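(* Assume the standing assumptions on $\mathcal U$, $\mathcal H$, $\mathcal R$ listed in the context, the solvability assumption (V) for the viscous problem and the convergence assumption (C). Then, for each $\ell \in H^{1}(0,T;Y^* ) \cap \mathfrak{L}(q_0,y_0)$, the rate-independent evolution $$-\partial_q \mathcal E(t,q(t)) \in \partial_2 \mathcal R (\mathcal H(q)(t),\dot{q}(t)) \ \text{ in } Y^* \quad \text{for a.a. } t\in(0,T), \qquad q(0)=q_0,$$ admits at least one solution $q \in H^1(0,T;Y)$.
   Context: Setting: $T>0$ is fixed, $X$ is a Banach space, $Y$ is a Hilbert space, $Y^*$ its dual with pairing $\langle\cdot,\cdot\rangle_Y$; $q_0\in Y$ is a fixed initial datum. Dots denote weak time derivatives. $\partial_2\mathcal R(\zeta,\eta)\subset Y^*$ denotes the convex subdifferential of $\mathcal R(\zeta,\cdot):Y\to[0,\infty]$ at $\eta$. Energy: given a load $\ell:[0,T]\to Y^*$, $\mathcal E(t,y):=\mathcal U(y)-\langle \ell(t),y\rangle_Y$, so $\partial_q\mathcal E(t,q)=\mathcal U'(q)-\ell(t)$. Here $\mathcal U\in C^2(Y)$, $\mathcal U:Y\to\mathbb R$, and there is $\alpha>0$ with $(1-\theta)\mathcal U(y_1)+\theta\,\mathcal U(y_2)\ge \mathcal U((1-\theta)y_1+\theta y_2)+\frac{\alpha}{2}\theta(1-\theta)\|y_2-y_1\|_Y^2$ for all $y_1,y_2\in Y$, $\theta\in[0,1]$. History operator: $\mathcal H:L^1(0,T;Y)\to W^{1,1}(0,T;X)$, $\mathcal H(y)(t):=\int_0^t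 B(t-s,y(s))\,ds+y_0$, where $y_0\in X$ is fixed and $B:[0,T]\times Y\to X$ satisfies: (i) for a.a. $t$, $B(t,\cdot):Y\to X$ is Lipschitz with constant $b(t)$, $b\in L^1(0,T)$, and $B(\cdot,0)\in L^1(0,T;X)$; (ii) for each $y\in Y$, $B(\cdot,y):[0,T]\to X$ is differentiable and $\partial_tB(\cdot,y)$ is measurable; (iii) for a.a. $t$, $\partial_tB(t,\cdot):Y\to X$ is Lipschitz with constant $\tilde b(t)$, $\tilde b\in L^1(0,T)$, and $\partial_tB(\cdot,0)\in L^1(0,T;X)$. Dissipation: $\mathcal R:X\times Y\to[0,\infty]$ satisfies: (1) for each $\zeta\in X$, $\mathcal R(\zeta,\cdot)$ is proper, convex, lower semicontinuous and positively homogeneous ($\mathcal R(\zeta,\gamma\eta)=\gamma\mathcal R(\zeta,\eta)$ for all $\gamma\ge0$, $\eta\in Y$); its domain is a fixed subset $\operatorname{dom}\mathcal R$ of $Y$ independent of $\zeta$; $t\mapsto\mathcal R(\zeta(t),\eta(t))$ is measurable whenever $\zeta:[0,T]\to X$ and $\eta:[0,T]\to\operatorname{dom}\mathcal R$ are measurable; (2) there is $L_{\mathcal R}\ge0$ with $\mathcal R(\zeta_1,\eta_2)-\mathcal R(\zeta_1,\eta_1)+\mathcal R(\zeta_2,\eta_1)-\mathcal R(\zeta_2,\eta_2)\le L_{\mathcal R}\|\zeta_1-\zeta_2\|_X\|\eta_1-\eta_2\|_Y$ for all $\zeta_1,\zeta_2\in X$, $\eta_1,\eta_2\in\operatorname{dom}\mathcal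 R$. Compatibility set: $\mathfrak L(q_0,y_0):=\{\ell\in C([0,T];Y^* ): -\mathcal U'(q_0)+\ell(0)\in\partial_2\mathcal R(y_0,0)\}$. Assumption (V): for $\epsilon>0$, let $\mathcal R_\epsilon(\zeta,\eta):=\mathcal R(\zeta,\eta)+\frac{\epsilon}{2}\|\eta\|_Y^2$. For all sufficiently small $\epsilon>0$ and every $\ell\in L^2(0,T;Y^* )$, the viscous problem $-\partial_q\mathcal E(t,q(t))\in\partial_2\mathcal R_\epsilon(\mathcal H(q)(t),\dot q(t))$ in $Y^*$ for a.a. $t\in(0,T)$, $q(0)=q_0$, has at least one solution $q\in H^1(0,T;Y)$. Assumption (C): $\operatorname{dom}\mathcal R\subset Y$ is closed, and whenever $y_m\rightharpoonup y$ weakly in $H^1(0,T;Y)$ with $\{y_m\}\subset\{y\in H^1(0,T;Y): y(0)=q_0,\ \dot y(t)\in\operatorname{dom}\mathcal R \text{ for a.a. } t\in(0,T)\}$, one has: (1) $\liminf_{m\to\infty}\int_0^T\mathcal R(\mathcal H(y_m)(t),\dot y_m(t))\,dt\ge\int_0^T\mathcal R(\mathcal H(y)(t),\dot y(t))\,dt$; (2) for each $v\in L^2(0,T;\operatorname{dom}\mathcal R)$ there is a sequence $\{v_m\}\subset L^2(0,T;\operatorname{dom}\mathcal R)$ with $v_m\rightharpoonup v$ in $L^2(0,T;Y)$ and $\limsup_{m\to\infty}\int_0^T\mathcal R(\mathcal H(y_m)(t),v_m(t))+\mathcal U'(y_m(t))(v_m(t))\,dt\le\int_0^T\mathcal R(\mathcal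 H(y)(t),v(t))+\mathcal U'(y(t))(v(t))\,dt$. *)

theory Defs
  imports "HOL-Analysis.Analysis"
begin

text \<open>
  The library's Bochner integral is restricted to second countable spaces. Since no separability is
  assumed here, strong measurability and the Bochner integral are defined for arbitrary normed
  spaces, following the library's construction via \<^const>\<open>Bochner_Integration.simple_bochner_integral\<close>.
\<close>

definition strongly_measurable ::
  "'a measure \<Rightarrow> ('a \<Rightarrow> 'b::real_normed_vector) \<Rightarrow> bool" where
  "strongly_measurable M f \<longleftrightarrow>
     (\<exists>s. (\<forall>n::nat. simple_function M (s n)) \<and> (AE x in M. (\<lambda>n. s n x) \<longlonglongrightarrow> f x))"

definition has_bochner ::
  "'a measure \<Rightarrow> ('a \<Rightarrow> 'b::real_normed_vector) \<Rightarrow> 'b \<Rightarrow> bool" where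
  "has_bochner M f I \<longleftrightarrow> strongly_measurable M f \<and>
     (\<exists>s. (\<forall>n::nat. Bochner_Integration.simple_bochner_integrable M (s n)) \<and>
          (\<lambda>n. \<integral>\<^sup>+x. ennreal (norm (f x - s n x)) \<partial>M) \<longlonglongrightarrow> 0 \<and>
          (\<lambda>n. Bochner_Integration.simple_bochner_integral M (s n)) \<longlonglongrightarrow> I)"

definition bochner :: "'a measure \<Rightarrow> ('a \<Rightarrow> 'b::real_normed_vector) \<Rightarrow> 'b" where
  "bochner M f = (THE I. has_bochner M f I)"

abbreviation leb :: "real \<Rightarrow> real measure" where
  "leb T \<equiv> lebesgue_on {0..T}"

text \<open>
  Elements of Bochner and Sobolev spaces on \<open>(0,T)\<close> are functions on \<^typ>\<open>real\<close> whose values outside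
  \<open>[0,T]\<close> are irrelevant; functions that agree almost everywhere are not identified.
\<close>

definition Lp :: "nat \<Rightarrow> real \<Rightarrow> (real \<Rightarrow> 'b::real_normed_vector) set" where
  "Lp p T = {f. strongly_measurable (leb T) f \<and> integrable (leb T) (\<lambda>t. norm (f t) ^ p)}"

definition L2_norm :: "real \<Rightarrow> (real \<Rightarrow> 'b::real_normed_vector) \<Rightarrow> real" where
  "L2_norm T f = sqrt (LINT t|leb T. (norm (f t))\<^sup>2)"

definition test_function :: "real \<Rightarrow> (real \<Rightarrow> real) \<Rightarrow> bool" where
  "test_function T \<phi> \<longleftrightarrow> (\<forall>n. (deriv ^^ n) \<phi> differentiable_on UNIV) \<and>
     (\<exists>a b. 0 < a \<and> b < T \<and> (\<forall>t. t \<notin> {a..b} \<longrightarrow> \<phi> t = 0))"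

definition has_weak_deriv ::
  "real \<Rightarrow> (real \<Rightarrow> 'b::real_normed_vector) \<Rightarrow> (real \<Rightarrow> 'b) \<Rightarrow> bool" where
  "has_weak_deriv T q g \<longleftrightarrow> q \<in> Lp 1 T \<and> g \<in> Lp 1 T \<and>
     (\<forall>\<phi>. test_function T \<phi> \<longrightarrow>
        bochner (leb T) (\<lambda>t. deriv \<phi> t *\<^sub>R q t) = - bochner (leb T) (\<lambda>t. \<phi> t *\<^sub>R g t))"

text \<open>A representative of the weak derivative, which is unique up to null sets.\<close>

definition wderiv :: "real \<Rightarrow> (real \<Rightarrow> 'b::real_normed_vector) \<Rightarrow> real \<Rightarrow> 'b" where
  "wderiv T q = (SOME g. has_weak_deriv T q g)"

text \<open>
  Elements of \<open>H\<^sup>1(0,T)\<close> are represented by their continuous representatives, so that point values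
  such as \<open>q 0\<close> are meaningful.
\<close>

definition H1 :: "real \<Rightarrow> (real \<Rightarrow> 'b::real_normed_vector) set" where
  "H1 T = {q. continuous_on {0..T} q \<and> q \<in> Lp 2 T \<and> (\<exists>g. g \<in> Lp 2 T \<and> has_weak_deriv T q g)}"

definition H1_norm :: "real \<Rightarrow> (real \<Rightarrow> 'b::real_normed_vector) \<Rightarrow> real" where
  "H1_norm T q = sqrt ((L2_norm T q)\<^sup>2 + (L2_norm T (wderiv T q))\<^sup>2)"

text \<open>
  Weak convergence in a space \<open>V\<close> of functions with (semi)norm \<open>p\<close>: convergence under every bounded
  linear functional. Such functionals do not distinguish functions at distance zero.
\<close>

definition bounded_functional ::
  "('a \<Rightarrow> 'b::real_vector) set \<Rightarrow> (('a \<Rightarrow> 'b) \<Rightarrow> real) \<Rightarrow> (('a \<Rightarrow> 'b) \<Rightarrow> real) \<Rightarrow> bool" where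
  "bounded_functional V p F \<longleftrightarrow>
     (\<forall>u\<in>V. \<forall>v\<in>V. F (\<lambda>t. u t + v t) = F u + F v) \<and>
     (\<forall>c. \<forall>u\<in>V. F (\<lambda>t. c *\<^sub>R u t) = c * F u) \<and>
     (\<exists>C. \<forall>u\<in>V. \<bar>F u\<bar> \<le> C * p u)"

definition weakly_converges ::
  "('a \<Rightarrow> 'b::real_vector) set \<Rightarrow> (('a \<Rightarrow> 'b) \<Rightarrow> real) \<Rightarrow> (nat \<Rightarrow> 'a \<Rightarrow> 'b) \<Rightarrow> ('a \<Rightarrow> 'b) \<Rightarrow> bool" where
  "weakly_converges V p f g \<longleftrightarrow> (\<forall>m. f m \<in> V) \<and> g \<in> V \<and>
     (\<forall>F. bounded_functional V p F \<longrightarrow> (\<lambda>m. F (f m)) \<longlonglongrightarrow> F g)"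

definition fderiv ::
  "('a::real_normed_vector \<Rightarrow> 'b::real_normed_vector) \<Rightarrow> 'a \<Rightarrow> 'a \<Rightarrow>\<^sub>L 'b" where
  "fderiv f x = Blinfun (frechet_derivative f (at x))"

definition C2_function :: "('a::real_normed_vector \<Rightarrow> 'b::real_normed_vector) \<Rightarrow> bool" where
  "C2_function f \<longleftrightarrow> (\<forall>x. f differentiable (at x)) \<and>
     (\<forall>x. fderiv f differentiable (at x)) \<and> continuous_on UNIV (fderiv (fderiv f))"

text \<open>The convex subdifferential, a subset of the dual; it is empty outside the domain of \<open>f\<close>.\<close>

definition subdiff ::
  "('y::real_normed_vector \<Rightarrow> ennreal) \<Rightarrow> 'y \<Rightarrow> ('y \<Rightarrow>\<^sub>L real) set" where
  "subdiff f \<eta> = {\<xi>. f \<eta> < \<infinity> \<and>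
     (\<forall>v. enn2ereal (f \<eta>) + ereal (blinfun_apply \<xi> (v - \<eta>)) \<le> enn2ereal (f v))}"

definition energy ::
  "('y::real_normed_vector \<Rightarrow> real) \<Rightarrow> (real \<Rightarrow> 'y \<Rightarrow>\<^sub>L real) \<Rightarrow> real \<Rightarrow> 'y \<Rightarrow> real" where
  "energy U l t y = U y - blinfun_apply (l t) y"

definition admissible_energy :: "('y::real_normed_vector \<Rightarrow> real) \<Rightarrow> bool" where
  "admissible_energy U \<longleftrightarrow> C2_function U \<and>
     (\<exists>\<alpha>>0. \<forall>y1 y2. \<forall>\<theta>\<in>{0..1}.
        (1 - \<theta>) * U y1 + \<theta> * U y2 \<ge>
          U ((1 - \<theta>) *\<^sub>R y1 + \<theta> *\<^sub>R y2) + \<alpha> / 2 * \<theta> * (1 - \<theta>) * (norm (y2 - y1))\<^sup>2)"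

definition history ::
  "(real \<Rightarrow> 'y \<Rightarrow> 'x::real_normed_vector) \<Rightarrow> 'x \<Rightarrow> (real \<Rightarrow> 'y) \<Rightarrow> real \<Rightarrow> 'x" where
  "history B y0 y t = bochner (leb t) (\<lambda>s. B (t - s) (y s)) + y0"

definition dtB ::
  "real \<Rightarrow> (real \<Rightarrow> 'y \<Rightarrow> 'x::real_normed_vector) \<Rightarrow> real \<Rightarrow> 'y \<Rightarrow> 'x" where
  "dtB T B t y = vector_derivative (\<lambda>s. B s y) (at t within {0..T})"

definition admissible_kernel ::
  "real \<Rightarrow> (real \<Rightarrow> 'y::real_normed_vector \<Rightarrow> 'x::real_normed_vector) \<Rightarrow> bool" where
  "admissible_kernel T B \<longleftrightarrow>
     (\<exists>b. integrable (leb T) b \<and> (AE t in leb T. (b t)-lipschitz_on UNIV (B t))) \<and>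
     (\<lambda>t. B t 0) \<in> Lp 1 T \<and>
     (\<forall>y. (\<lambda>t. B t y) differentiable_on {0..T} \<and>
          strongly_measurable (leb T) (\<lambda>t. dtB T B t y)) \<and>
     (\<exists>b. integrable (leb T) b \<and> (AE t in leb T. (b t)-lipschitz_on UNIV (dtB T B t))) \<and>
     (\<lambda>t. dtB T B t 0) \<in> Lp 1 T"

text \<open>The set \<open>D\<close> is the common domain of the functionals \<open>R \<zeta>\<close>.\<close>

definition admissible_dissipation ::
  "real \<Rightarrow> ('x::real_normed_vector \<Rightarrow> 'y::real_normed_vector \<Rightarrow> ennreal) \<Rightarrow> 'y set \<Rightarrow> bool" where
  "admissible_dissipation T R D \<longleftrightarrow>
     (\<forall>\<zeta>. (\<exists>\<eta>. R \<zeta> \<eta> < \<infinity>) \<and>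
          (\<forall>\<eta>1 \<eta>2. \<forall>\<theta>\<in>{0..1}. R \<zeta> ((1 - \<theta>) *\<^sub>R \<eta>1 + \<theta> *\<^sub>R \<eta>2)
               \<le> ennreal (1 - \<theta>) * R \<zeta> \<eta>1 + ennreal \<theta> * R \<zeta> \<eta>2) \<and>
          (\<forall>\<eta>. R \<zeta> \<eta> \<le> Liminf (at \<eta>) (R \<zeta>)) \<and>
          (\<forall>\<gamma>\<ge>0. \<forall>\<eta>. R \<zeta> (\<gamma> *\<^sub>R \<eta>) = ennreal \<gamma> * R \<zeta> \<eta>) \<and>
          {\<eta>. R \<zeta> \<eta> < \<infinity>} = D) \<and>
     (\<forall>\<zeta> \<eta>. strongly_measurable (leb T) \<zeta> \<longrightarrow> strongly_measurable (leb T) \<eta> \<longrightarrow>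
          (\<forall>t\<in>{0..T}. \<eta> t \<in> D) \<longrightarrow> (\<lambda>t. R (\<zeta> t) (\<eta> t)) \<in> borel_measurable (leb T)) \<and>
     (\<exists>L\<ge>0. \<forall>\<zeta>1 \<zeta>2. \<forall>\<eta>1\<in>D. \<forall>\<eta>2\<in>D.
          enn2real (R \<zeta>1 \<eta>2) - enn2real (R \<zeta>1 \<eta>1) + enn2real (R \<zeta>2 \<eta>1) - enn2real (R \<zeta>2 \<eta>2)
            \<le> L * norm (\<zeta>1 - \<zeta>2) * norm (\<eta>1 - \<eta>2))"

definition compatible_loads ::
  "real \<Rightarrow> ('y::real_normed_vector \<Rightarrow> real) \<Rightarrow> ('x \<Rightarrow> 'y \<Rightarrow> ennreal) \<Rightarrow> 'y \<Rightarrow> 'x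
     \<Rightarrow> (real \<Rightarrow> 'y \<Rightarrow>\<^sub>L real) set" where
  "compatible_loads T U R q0 y0 =
     {l. continuous_on {0..T} l \<and> - fderiv U q0 + l 0 \<in> subdiff (R y0) 0}"

definition evolution_solution ::
  "real \<Rightarrow> ('y::real_normed_vector \<Rightarrow> real) \<Rightarrow> (real \<Rightarrow> 'y \<Rightarrow> 'x::real_normed_vector) \<Rightarrow> 'x \<Rightarrow> 'y
     \<Rightarrow> ('x \<Rightarrow> 'y \<Rightarrow> ennreal) \<Rightarrow> (real \<Rightarrow> 'y \<Rightarrow>\<^sub>L real) \<Rightarrow> (real \<Rightarrow> 'y) \<Rightarrow> bool" where
  "evolution_solution T U B y0 q0 R l q \<longleftrightarrow> q \<in> H1 T \<and> q 0 = q0 \<and>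
     (AE t in leb T.
        - fderiv (energy U l t) (q t) \<in> subdiff (R (history B y0 q t)) (wderiv T q t))"

definition viscous_dissipation ::
  "real \<Rightarrow> ('x \<Rightarrow> 'y::real_normed_vector \<Rightarrow> ennreal) \<Rightarrow> 'x \<Rightarrow> 'y \<Rightarrow> ennreal" where
  "viscous_dissipation \<epsilon> R \<zeta> \<eta> = R \<zeta> \<eta> + ennreal (\<epsilon> / 2 * (norm \<eta>)\<^sup>2)"

definition viscous_solvability ::
  "real \<Rightarrow> ('y::real_normed_vector \<Rightarrow> real) \<Rightarrow> (real \<Rightarrow> 'y \<Rightarrow> 'x::real_normed_vector) \<Rightarrow> 'x \<Rightarrow> 'y
     \<Rightarrow> ('x \<Rightarrow> 'y \<Rightarrow> ennreal) \<Rightarrow> bool" where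
  "viscous_solvability T U B y0 q0 R \<longleftrightarrow>
     (\<exists>\<epsilon>0>0. \<forall>\<epsilon>. 0 < \<epsilon> \<and> \<epsilon> < \<epsilon>0 \<longrightarrow>
        (\<forall>l \<in> Lp 2 T. \<exists>q. evolution_solution T U B y0 q0 (viscous_dissipation \<epsilon> R) l q))"

text \<open>
  The integral of \<open>R(\<zeta>,v) + U'(y)(v)\<close>, where the first summand is nonnegative, possibly with infinite
  integral, and the second one is integrable for \<open>v \<in> L\<^sup>2\<close> and continuous \<open>y\<close>.
\<close>

definition dissipation_power ::
  "real \<Rightarrow> ('y::real_normed_vector \<Rightarrow> real) \<Rightarrow> (real \<Rightarrow> 'y \<Rightarrow> 'x::real_normed_vector) \<Rightarrow> 'x
     \<Rightarrow> ('x \<Rightarrow> 'y \<Rightarrow> ennreal) \<Rightarrow> (real \<Rightarrow> 'y) \<Rightarrow> (real \<Rightarrow> 'y) \<Rightarrow> ereal" where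
  "dissipation_power T U B y0 R y v =
     enn2ereal (\<integral>\<^sup>+t. R (history B y0 y t) (v t) \<partial>leb T) +
     ereal (LINT t|leb T. blinfun_apply (fderiv U (y t)) (v t))"

definition L2_in :: "real \<Rightarrow> 'y::real_normed_vector set \<Rightarrow> (real \<Rightarrow> 'y) set" where
  "L2_in T D = {v \<in> Lp 2 T. AE t in leb T. v t \<in> D}"

definition convergence_condition ::
  "real \<Rightarrow> ('y::real_normed_vector \<Rightarrow> real) \<Rightarrow> (real \<Rightarrow> 'y \<Rightarrow> 'x::real_normed_vector) \<Rightarrow> 'x \<Rightarrow> 'y
     \<Rightarrow> ('x \<Rightarrow> 'y \<Rightarrow> ennreal) \<Rightarrow> 'y set \<Rightarrow> bool" where
  "convergence_condition T U B y0 q0 R D \<longleftrightarrow> closed D \<and>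
     (\<forall>ym y. weakly_converges (H1 T) (H1_norm T) ym y \<and>
        (\<forall>m. ym m 0 = q0 \<and> (AE t in leb T. wderiv T (ym m) t \<in> D)) \<longrightarrow>
        liminf (\<lambda>m. \<integral>\<^sup>+t. R (history B y0 (ym m) t) (wderiv T (ym m) t) \<partial>leb T)
          \<ge> (\<integral>\<^sup>+t. R (history B y0 y t) (wderiv T y t) \<partial>leb T) \<and>
        (\<forall>v \<in> L2_in T D. \<exists>vm. (\<forall>m. vm m \<in> L2_in T D) \<and>
           weakly_converges (Lp 2 T) (L2_norm T) vm v \<and>
           limsup (\<lambda>m. dissipation_power T U B y0 R (ym m) (vm m))
             \<le> dissipation_power T U B y0 R y v))"

end

theory Submission
  imports Defs "HOL-Complex_Analysis.Great_Picard"
begin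

text \<open>
  The solution is the weak limit in \<open>H\<^sup>1\<close> of viscous solutions as the viscosity \<open>\<epsilon>\<close> vanishes. Since
  \<open>R(\<zeta>,\<cdot>)\<close> is positively homogeneous, the viscous inclusion at time \<open>t\<close>, tested against the one at
  time \<open>s\<close>, controls \<open>\<epsilon> \<langle>q'(t) - q'(s), q'(t)\<rangle> + \<langle>U'(q(t)) - U'(q(s)), q'(t)\<rangle>\<close> by the increments of the
  load and of the history. The two-sided version of this estimate makes \<open>q'\<close> continuous for fixed \<open>\<epsilon>\<close>,
  compatibility of the load gives \<open>q'(0) = 0\<close>, and uniform convexity of \<open>U\<close> with a Gronwall argument
  yields a bound on \<open>q'\<close> in \<open>L\<^sup>2\<close> that does not depend on \<open>\<epsilon>\<close>. In the limit, the recovery sequences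
  give the stability inequality \<open>\<langle>l - U'(q), v\<rangle> \<le> R(\<zeta>,v)\<close> and lower semicontinuity gives the energy
  inequality, that is the same inequality for \<open>v = q'\<close> reversed and integrated.
\<close>

subsection \<open>Strong measurability\<close>

text \<open>The inclusion holds only at almost every time and R is not smooth, so it is never
  differentiated in time. Two times are compared, and inequalities between increments are summed
  over fine partitions. This requires the rate q' at every time, which is the purpose of its
  continuity for fixed \<epsilon>. Its modulus of continuity depends on \<epsilon>, but it only
  controls errors that vanish with the mesh. The quantity \<epsilon>/2 |q'|^2 produced by the
  summation is zero at the start and has the right sign at the end, so \<epsilon> drops out of the
  bound. In the limit the product of U'(q) and q' is never treated directly. For stability it is
  already part of the recovery inequality; there remain the pairing with l and a term of order
  \<epsilon>, for which weakly convergent sequences must be known to be bounded. For the energy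
  inequality it equals U(q(T)) - U(q_0), bounded below by the tangent of U at the end point of the
  limit, which is weakly continuous. Since Y may be nonseparable, measurability rests on simple
  functions, and vector identities are proved by pairing with fixed vectors.\<close>

lemma complete_measure_lebesgue_on:
  assumes "S \<in> sets lebesgue"
  shows "complete_measure (lebesgue_on S)"
proof
  fix A B :: "'a set" assume "B \<subseteq> A" and A: "A \<in> null_sets (lebesgue_on S)"
  then have "A \<in> null_sets lebesgue" "A \<subseteq> S"
    using assms by (auto simp: null_sets_restrict_space)
  then have "B \<in> null_sets lebesgue" "B \<subseteq> S"
    using \<open>B \<subseteq> A\<close> completion.complete2 by auto
  then show "B \<in> sets (lebesgue_on S)"
    using assms by (auto simp: sets_restrict_space_iff)
qed

text \<open>Strong measurability is an almost everywhere condition, so values on a null set are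
  arbitrary. Preimages of two such functions differ by a subset of a null set, which is measurable
  by completeness; hence \<open>complete_measure\<close> is the standing condition below.\<close>

lemma measurable_cong_AE_complete:
  assumes "complete_measure M" and f: "f \<in> measurable M N" and ae: "AE x in M. f x = g x"
    and g: "\<And>x. x \<in> space M \<Longrightarrow> g x \<in> space N"
  shows "g \<in> measurable M N"
proof (rule measurableI)
  fix A assume A: "A \<in> sets N"
  show "g -` A \<inter> space M \<in> sets M"
  proof (rule complete_measure.in_sets_AE[OF assms(1)])
    show "f -` A \<inter> space M \<in> sets M" using f A by (rule measurable_sets)
    show "AE x in M. (x \<in> f -` A \<inter> space M) = (x \<in> g -` A \<inter> space M)"
      using ae by eventually_elim auto
  qed auto
qed (use g in auto)

lemma strongly_measurableI_simple: "simple_function M f \<Longrightarrow> strongly_measurable M f"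
  unfolding strongly_measurable_def by (intro exI[of _ "\<lambda>_. f"]) auto

lemma strongly_measurable_const: "strongly_measurable M (\<lambda>x. c)"
  by (rule strongly_measurableI_simple) simp

lemma strongly_measurable_cong_AE:
  assumes "strongly_measurable M f" "AE x in M. f x = g x"
  shows "strongly_measurable M g"
proof -
  obtain s where s: "\<forall>n::nat. simple_function M (s n)" "AE x in M. (\<lambda>n. s n x) \<longlonglongrightarrow> f x"
    using assms(1) by (auto simp: strongly_measurable_def)
  have "AE x in M. (\<lambda>n. s n x) \<longlonglongrightarrow> g x"
    using s(2) assms(2) by eventually_elim simp
  then show ?thesis using s(1) by (auto simp: strongly_measurable_def)
qed

text \<open>Simple functions stay simple under any map, and joint continuity of \<open>p\<close>
  carries the limit over. This avoids measurability of the pair, for which the product sigma-algebra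
  may be too small in nonseparable spaces.\<close>

lemma strongly_measurable_compose2:
  fixes p :: "'b::real_normed_vector \<Rightarrow> 'c::real_normed_vector \<Rightarrow> 'd::real_normed_vector"
  assumes "strongly_measurable M f" "strongly_measurable M g"
    and p: "continuous_on UNIV (\<lambda>z. p (fst z) (snd z))"
  shows "strongly_measurable M (\<lambda>x. p (f x) (g x))"
proof -
  obtain s where s: "\<forall>n::nat. simple_function M (s n)" "AE x in M. (\<lambda>n. s n x) \<longlonglongrightarrow> f x"
    using assms(1) by (auto simp: strongly_measurable_def)
  obtain r where r: "\<forall>n::nat. simple_function M (r n)" "AE x in M. (\<lambda>n. r n x) \<longlonglongrightarrow> g x"
    using assms(2) by (auto simp: strongly_measurable_def)
  have *: "(\<lambda>n. p (u n) (v n)) \<longlonglongrightarrow> p a b" if "u \<longlonglongrightarrow> a" "v \<longlonglongrightarrow> b" for u v a b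
    using continuous_on_tendsto_compose[OF p tendsto_Pair[OF that]] by simp
  have "AE x in M. (\<lambda>n. p (s n x) (r n x)) \<longlonglongrightarrow> p (f x) (g x)"
    using s(2) r(2) by eventually_elim (rule *)
  then show ?thesis unfolding strongly_measurable_def
    using s(1) r(1) by (intro exI[of _ "\<lambda>n x. p (s n x) (r n x)"]) (auto intro: simple_function_compose2)
qed

lemma strongly_measurable_compose:
  fixes h :: "'b::real_normed_vector \<Rightarrow> 'd::real_normed_vector"
  assumes "strongly_measurable M f" "continuous_on UNIV h"
  shows "strongly_measurable M (\<lambda>x. h (f x))"
  by (rule strongly_measurable_compose2[OF assms(1) assms(1), of "\<lambda>u v. h u"])
     (rule continuous_on_compose2[OF assms(2)], auto intro: continuous_intros)

lemma strongly_measurable_add: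
  "strongly_measurable M f \<Longrightarrow> strongly_measurable M g \<Longrightarrow> strongly_measurable M (\<lambda>x. f x + g x)"
  by (rule strongly_measurable_compose2) (auto intro!: continuous_intros)

lemma strongly_measurable_diff:
  "strongly_measurable M f \<Longrightarrow> strongly_measurable M g \<Longrightarrow> strongly_measurable M (\<lambda>x. f x - g x)"
  by (rule strongly_measurable_compose2) (auto intro!: continuous_intros)

lemma strongly_measurable_scaleR:
  "strongly_measurable M f \<Longrightarrow> strongly_measurable M g \<Longrightarrow> strongly_measurable M (\<lambda>x. f x *\<^sub>R g x)"
  by (rule strongly_measurable_compose2) (auto intro!: continuous_intros)

lemma strongly_measurable_inner:
  "strongly_measurable M f \<Longrightarrow> strongly_measurable M g \<Longrightarrow> strongly_measurable M (\<lambda>x. inner (f x) (g x))"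
  by (rule strongly_measurable_compose2) (auto intro!: continuous_intros)

lemma strongly_measurable_blinfun_apply:
  "strongly_measurable M f \<Longrightarrow> strongly_measurable M g \<Longrightarrow>
    strongly_measurable M (\<lambda>x. blinfun_apply (f x) (g x))"
  by (rule strongly_measurable_compose2) (auto intro!: continuous_intros)

lemma strongly_measurable_bounded_linear:
  "strongly_measurable M f \<Longrightarrow> bounded_linear h \<Longrightarrow> strongly_measurable M (\<lambda>x. h (f x))"
  by (rule strongly_measurable_compose) (auto intro: linear_continuous_on)

section \<open>Strong measurability versus Borel measurability: Pettis' criterion\<close>

lemma strongly_measurable_borel:
  fixes f :: "'a \<Rightarrow> 'b::real_normed_vector"
  assumes "complete_measure M" "strongly_measurable M f"
  shows "f \<in> borel_measurable M"
proof -
  obtain s where s: "\<forall>n::nat. simple_function M (s n)" and ae: "AE x in M. (\<lambda>n. s n x) \<longlonglongrightarrow> f x"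
    using assms(2) by (auto simp: strongly_measurable_def)
  \<comment> \<open>Setting everything to 0 on a null set that contains the points of divergence
    makes the convergence hold everywhere; completeness then restores \<open>f\<close>.\<close>
  from ae obtain N where N: "N \<in> null_sets M" "{x \<in> space M. \<not> (\<lambda>n. s n x) \<longlonglongrightarrow> f x} \<subseteq> N"
    by (auto elim!: AE_E simp: null_sets_def)
  define g where "g x = (if x \<in> N then 0 else f x)" for x
  have "g \<in> borel_measurable M"
  proof (rule borel_measurable_LIMSEQ_metric)
    show "(\<lambda>x. if x \<in> N then 0 else s i x) \<in> borel_measurable M" for i
      using s N(1) by (intro measurable_If_set) (auto intro: borel_measurable_simple_function)
    show "(\<lambda>i. if x \<in> N then 0 else s i x) \<longlonglongrightarrow> g x" if "x \<in> space M" for x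
      using N(2) that by (auto simp: g_def)
  qed
  moreover have "AE x in M. g x = f x"
    using AE_not_in[OF N(1)] by eventually_elim (simp add: g_def)
  ultimately show ?thesis
    by (rule measurable_cong_AE_complete[OF assms(1)]) simp
qed

text \<open>Half of Pettis' theorem: almost every value is a limit of values of the simple
  functions, which together are countably many.\<close>

lemma strongly_measurable_essentially_separable:
  fixes f :: "'a \<Rightarrow> 'b::real_normed_vector"
  assumes "strongly_measurable M f"
  obtains C where "countable C" "AE x in M. f x \<in> closure C"
proof -
  obtain s where s: "\<forall>n::nat. simple_function M (s n)" and ae: "AE x in M. (\<lambda>n. s n x) \<longlonglongrightarrow> f x"
    using assms by (auto simp: strongly_measurable_def)
  let ?C = "\<Union>n. s n ` space M"
  have "countable ?C"
    using s by (auto simp: simple_function_def intro: countable_finite)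
  moreover have "AE x in M. f x \<in> closure ?C"
    using ae AE_space
  proof eventually_elim
    case (elim x)
    then show ?case by (intro Lim_in_closed_set[OF closed_closure _ _ elim(1)])
        (auto intro!: always_eventually subsetD[OF closure_subset])
  qed
  ultimately show ?thesis by (rule that)
qed

text \<open>The simple functions pick the nearest among the first \<open>n\<close> points of a countable dense set.\<close>

lemma strongly_measurableI_separable:
  fixes f :: "'a \<Rightarrow> 'b::real_normed_vector"
  assumes meas: "\<And>c. (\<lambda>x. norm (f x - c)) \<in> borel_measurable M"
    and C: "countable C" "AE x in M. f x \<in> closure C"
  shows "strongly_measurable M f"
proof (cases "C = {}")
  case True
  then have "AE x in M. False" using C(2) by simp
  then have "AE x in M. (\<lambda>n. 0) \<longlonglongrightarrow> f x" by eventually_elim simp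
  then show ?thesis unfolding strongly_measurable_def by (intro exI[of _ "\<lambda>_ _. 0"]) auto
next
  case False
  define e where "e = from_nat_into C"
  have e: "range e = C" unfolding e_def using False C(1) by simp
  define best where "best n x j \<longleftrightarrow> j \<le> n \<and> (\<forall>i\<le>n. norm (f x - e j) \<le> norm (f x - e i))" for n x j
  define k where "k n x = (LEAST j. best n x j)" for n x
  have ex: "\<exists>j. best n x j" for n x
  proof -
    obtain j where "is_arg_min (\<lambda>i. norm (f x - e i)) (\<lambda>i. i \<le> n) j"
      using ex_is_arg_min_if_finite[of "{..n}" "\<lambda>i. norm (f x - e i)"] by auto
    then show ?thesis unfolding best_def is_arg_min_linorder by auto
  qed
  have k: "best n x (k n x)" for n x
    unfolding k_def using ex[of n x] by (rule LeastI_ex)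
  \<comment> \<open>Taking the least optimal index breaks ties, so each level set of
    \<open>k n\<close> is a measurable set minus finitely many measurable sets.\<close>
  have k_eq: "k n x = j \<longleftrightarrow> best n x j \<and> (\<forall>i<j. \<not> best n x i)" for n x j
  proof
    assume j: "k n x = j"
    have "\<not> best n x i" if "i < j" for i
      by (rule not_less_Least) (use that j in \<open>simp add: k_def\<close>)
    then show "best n x j \<and> (\<forall>i<j. \<not> best n x i)" using k[of n x] j by blast
  next
    assume "best n x j \<and> (\<forall>i<j. \<not> best n x i)"
    then show "k n x = j" unfolding k_def by (intro Least_equality) (auto simp: not_less[symmetric])
  qed
  have meas_best: "{x \<in> space M. best n x j} \<in> sets M" for n j
  proof -
    have "{x \<in> space M. best n x j} =
        (if j \<le> n then space M \<inter> (\<Inter>i\<in>{..n}. {x \<in> space M. norm (f x - e j) \<le> norm (f x - e i)}) else {})"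
      by (auto simp: best_def)
    moreover have "{x \<in> space M. norm (f x - e j) \<le> norm (f x - e i)} \<in> sets M" for i
      using meas by (intro borel_measurable_le)
    ultimately show ?thesis by auto
  qed
  have meas_k: "k n -` {j} \<inter> space M \<in> sets M" for n j
  proof -
    have "k n -` {j} \<inter> space M = {x \<in> space M. best n x j} - (\<Union>i<j. {x \<in> space M. best n x i})"
      using k_eq by auto
    then show ?thesis using meas_best by auto
  qed
  have sk: "simple_function M (k n)" for n
    unfolding simple_function_def
  proof
    have "k n ` space M \<subseteq> {..n}" using k[unfolded best_def] by auto
    then show "finite (k n ` space M)" by (rule finite_subset) simp
  qed (use meas_k in auto)
  have "AE x in M. (\<lambda>n. e (k n x)) \<longlonglongrightarrow> f x"
    using C(2)
  proof eventually_elim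
    case (elim x)
    show ?case
    proof (rule metric_LIMSEQ_I)
      fix r :: real assume "r > 0"
      then obtain y where y: "y \<in> C" "dist y (f x) < r"
        using elim by (auto simp: closure_approachable)
      then obtain i where "y = e i" using e by auto
      with k[of _ x] y(2) have "dist (e (k n x)) (f x) < r" if "n \<ge> i" for n
        using that unfolding best_def by (metis dist_commute dist_norm order_le_less_trans)
      then show "\<exists>i. \<forall>n\<ge>i. dist (e (k n x)) (f x) < r" by blast
    qed
  qed
  moreover have "simple_function M (\<lambda>x. e (k n x))" for n
    using sk by (rule simple_function_compose1)
  ultimately show ?thesis unfolding strongly_measurable_def
    by (intro exI[of _ "\<lambda>n x. e (k n x)"]) auto
qed

lemma strongly_measurable_norm_diff:
  assumes "complete_measure M" "strongly_measurable M f"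
  shows "(\<lambda>x. norm (f x - c)) \<in> borel_measurable M"
  by (rule strongly_measurable_borel[OF assms(1)], rule strongly_measurable_compose[OF assms(2)])
     (intro continuous_intros)

lemma strongly_measurable_norm:
  assumes "complete_measure M" "strongly_measurable M f"
  shows "(\<lambda>x. norm (f x)) \<in> borel_measurable M"
  using strongly_measurable_norm_diff[OF assms, of 0] by simp

lemma strongly_measurable_real:
  fixes f :: "'a \<Rightarrow> real"
  assumes "f \<in> borel_measurable M"
  shows "strongly_measurable M f"
proof -
  obtain C :: "real set" where C: "countable C" "closure C = UNIV"
    using that[of \<rat>] by (simp add: countable_rat Rats_closure_real)
  show ?thesis by (rule strongly_measurableI_separable[OF _ C(1)]) (use C assms in auto)
qed

text \<open>Pettis' criterion replaces a diagonal choice of simple functions: the union of the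
  countable sets belonging to the \<open>s n\<close> captures almost all values of \<open>f\<close>,
  and the distance to a point is a limit of measurable functions.\<close>

lemma strongly_measurable_LIMSEQ:
  fixes f :: "'a \<Rightarrow> 'b::real_normed_vector"
  assumes M: "complete_measure M" and s: "\<And>n. strongly_measurable M (s n)"
    and lim: "AE x in M. (\<lambda>n. s n x) \<longlonglongrightarrow> f x"
  shows "strongly_measurable M f"
proof -
  have "\<exists>C. countable C \<and> (AE x in M. s n x \<in> closure C)" for n
    using strongly_measurable_essentially_separable[OF s[of n]] by metis
  then obtain C where C: "\<And>n. countable (C n)" "\<And>n. AE x in M. s n x \<in> closure (C n)"
    by metis
  from lim obtain N where N: "N \<in> null_sets M" "{x \<in> space M. \<not> (\<lambda>n. s n x) \<longlonglongrightarrow> f x} \<subseteq> N"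
    by (auto elim!: AE_E simp: null_sets_def)
  show ?thesis
  proof (rule strongly_measurableI_separable)
    show "countable (\<Union>n. C n)" using C(1) by auto
    have "AE x in M. \<forall>n. s n x \<in> closure (C n)"
      using C(2) by (simp add: AE_all_countable)
    then show "AE x in M. f x \<in> closure (\<Union>n. C n)"
      using lim
    proof eventually_elim
      case (elim x)
      have "s n x \<in> closure (\<Union>n. C n)" for n
        using elim(1) closure_mono[of "C n" "\<Union>n. C n"] by auto
      then show ?case by (intro Lim_in_closed_set[OF closed_closure _ _ elim(2)]) auto
    qed
    fix c
    have "(\<lambda>x. if x \<in> N then 0 else norm (f x - c)) \<in> borel_measurable M"
    proof (rule borel_measurable_LIMSEQ_real)
      show "(\<lambda>x. if x \<in> N then 0 else norm (s i x - c)) \<in> borel_measurable M" for i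
        using strongly_measurable_norm_diff[OF M s] N(1) by (intro measurable_If_set) auto
      show "(\<lambda>i. if x \<in> N then 0 else norm (s i x - c)) \<longlonglongrightarrow> (if x \<in> N then 0 else norm (f x - c))"
        if "x \<in> space M" for x
        using N(2) that by (auto intro!: tendsto_intros)
    qed
    moreover have "AE x in M. (if x \<in> N then 0 else norm (f x - c)) = norm (f x - c)"
      using AE_not_in[OF N(1)] by eventually_elim simp
    ultimately show "(\<lambda>x. norm (f x - c)) \<in> borel_measurable M"
      by (rule measurable_cong_AE_complete[OF M]) auto
  qed
qed

text \<open>The values on a countable dense subset of \<open>S\<close> are dense in the image, so
  the separable criterion applies whatever the target space.\<close>

lemma strongly_measurable_continuous_on:
  fixes f :: "real \<Rightarrow> 'b::real_normed_vector"
  assumes f: "continuous_on S f" and S: "S \<in> sets lebesgue"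
  shows "strongly_measurable (lebesgue_on S) f"
proof -
  obtain C where C: "countable C" "C \<subseteq> S" "S \<subseteq> closure C"
    by (rule separable)
  show ?thesis
  proof (rule strongly_measurableI_separable)
    show "countable (f ` C)" using C(1) by auto
    have "f x \<in> closure (f ` C)" if "x \<in> S" for x
    proof -
      have "x \<in> closure C" using C(3) that by (rule subsetD)
      then obtain u where u: "\<forall>n. u n \<in> C" "u \<longlonglongrightarrow> x"
        unfolding closure_sequential by (elim exE conjE)
      then have "(\<lambda>n. f (u n)) \<longlonglongrightarrow> f x"
        using C(2) that u(1) by (intro continuous_on_tendsto_compose[OF f]) (auto intro!: always_eventually)
      moreover have "\<forall>n. f (u n) \<in> f ` C" using u(1) by simp
      ultimately show ?thesis
        unfolding closure_sequential by (intro exI[of _ "\<lambda>n. f (u n)"] conjI)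
    qed
    then show "AE x in lebesgue_on S. f x \<in> closure (f ` C)" by (intro AE_I2) simp
    show "(\<lambda>x. norm (f x - c)) \<in> borel_measurable (lebesgue_on S)" for c
      by (rule continuous_imp_measurable_on_sets_lebesgue[OF _ S]) (intro continuous_intros f)
  qed
qed

lemma strongly_measurable_restrict:
  assumes "strongly_measurable M f" "S \<inter> space M \<in> sets M"
  shows "strongly_measurable (restrict_space M S) f"
proof -
  obtain s where s: "\<forall>n::nat. simple_function M (s n)" and ae: "AE x in M. (\<lambda>n. s n x) \<longlonglongrightarrow> f x"
    using assms by (auto simp: strongly_measurable_def)
  have "simple_function (restrict_space M S) (s n)" for n
  proof -
    have "simple_function M (\<lambda>x. indicat_real S x *\<^sub>R s n x)"
    proof (rule simple_function_compose2[of M "indicat_real S" "s n" "(*\<^sub>R)"])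
      have "simple_function M (indicat_real (S \<inter> space M))"
        using assms(2) by simp
      then show "simple_function M (indicat_real S)"
        by (rule simple_function_cong[THEN iffD1, rotated]) (auto simp: indicator_def)
    qed (use s in auto)
    then show ?thesis by (subst simple_function_restrict_space[OF assms(2)])
  qed
  moreover have "AE x in restrict_space M S. (\<lambda>n. s n x) \<longlonglongrightarrow> f x"
    using ae by (subst AE_restrict_space_iff[OF assms(2)]) auto
  ultimately show ?thesis by (auto simp: strongly_measurable_def)
qed

text \<open>Together with restriction this moves functions between \<open>[0,T]\<close> and the
  whole line, on which the Hilbert space of square integrable functions is built.\<close>

lemma strongly_measurable_extend:
  fixes f :: "'a \<Rightarrow> 'b::real_normed_vector"
  assumes "strongly_measurable (restrict_space M S) f" "S \<inter> space M \<in> sets M"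
  shows "strongly_measurable M (\<lambda>x. indicat_real S x *\<^sub>R f x)"
proof -
  obtain s where s: "\<forall>n::nat. simple_function (restrict_space M S) (s n)"
    and ae: "AE x in restrict_space M S. (\<lambda>n. s n x) \<longlonglongrightarrow> f x"
    using assms by (auto simp: strongly_measurable_def)
  have "simple_function M (\<lambda>x. indicat_real S x *\<^sub>R s n x)" for n
    using s simple_function_restrict_space[OF assms(2)] by blast
  moreover have "AE x in M. (\<lambda>n. indicat_real S x *\<^sub>R s n x) \<longlonglongrightarrow> indicat_real S x *\<^sub>R f x"
    using ae[unfolded AE_restrict_space_iff[OF assms(2)]]
    by eventually_elim (auto simp: indicator_def intro: tendsto_intros)
  ultimately show ?thesis 
    by (auto simp: strongly_measurable_def intro!: exI[of _ "\<lambda>n x. indicat_real S x *\<^sub>R s n x"])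
qed

subsection \<open>The Bochner integral\<close>

text \<open>Triangle inequality through \<open>f\<close>. The same estimate yields uniqueness of the
  integral and the Cauchy property of its approximations.\<close>

lemma simple_bochner_integral_dist:
  fixes f :: "'a \<Rightarrow> 'b::real_normed_vector"
  assumes M: "complete_measure M" and f: "strongly_measurable M f"
    and s: "Bochner_Integration.simple_bochner_integrable M s"
    and t: "Bochner_Integration.simple_bochner_integrable M t"
  shows "ennreal (norm (Bochner_Integration.simple_bochner_integral M s
      - Bochner_Integration.simple_bochner_integral M t)) \<le>
    (\<integral>\<^sup>+ x. norm (f x - s x) \<partial>M) + (\<integral>\<^sup>+ x. norm (f x - t x) \<partial>M)"
    (is "ennreal (norm (?s - ?t)) \<le> ?S + ?T")
proof -
  have "strongly_measurable M s" "strongly_measurable M t"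
    using s t by (auto intro: strongly_measurableI_simple elim: simple_bochner_integrable.cases)
  then have meas: "(\<lambda>x. norm (f x - s x)) \<in> borel_measurable M" "(\<lambda>x. norm (f x - t x)) \<in> borel_measurable M"
    using f by (auto intro!: strongly_measurable_norm[OF M] strongly_measurable_diff)
  have "ennreal (norm (?s - ?t)) = norm (Bochner_Integration.simple_bochner_integral M (\<lambda>x. s x - t x))"
    using s t by (subst simple_bochner_integral_diff) auto
  also have "\<dots> \<le> Bochner_Integration.simple_bochner_integral M (\<lambda>x. norm (s x - t x))"
    using simple_bochner_integrable_compose2[of "(-)" M "s" "t"] s t
    by (auto intro!: simple_bochner_integral_norm_bound)
  also have "\<dots> = (\<integral>\<^sup>+x. norm (s x - t x) \<partial>M)"
    using simple_bochner_integrable_compose2[of "\<lambda>x y. norm (x - y)" M "s" "t"] s t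
    by (auto intro!: simple_bochner_integral_eq_nn_integral)
  also have "\<dots> \<le> (\<integral>\<^sup>+x. ennreal (norm (f x - s x)) + ennreal (norm (f x - t x)) \<partial>M)"
  proof (rule nn_integral_mono)
    fix x
    have "norm (s x - t x) \<le> norm (f x - s x) + norm (f x - t x)"
      by (metis dual_order.refl norm_diff_triangle_le norm_minus_commute)
    then show "ennreal (norm (s x - t x)) \<le> ennreal (norm (f x - s x)) + ennreal (norm (f x - t x))"
      by (metis ennreal_leI ennreal_plus norm_ge_zero)
  qed
  also have "\<dots> = ?S + ?T"
    using meas by (intro nn_integral_add) auto
  finally show ?thesis .
qed

lemma has_bochner_unique:
  assumes M: "complete_measure M" and "has_bochner M f I" "has_bochner M f J"
  shows "I = J"
proof -
  obtain s where f: "strongly_measurable M f" and s: "\<And>n::nat. Bochner_Integration.simple_bochner_integrable M (s n)"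
    "(\<lambda>n. \<integral>\<^sup>+x. ennreal (norm (f x - s n x)) \<partial>M) \<longlonglongrightarrow> 0"
    "(\<lambda>n. Bochner_Integration.simple_bochner_integral M (s n)) \<longlonglongrightarrow> I"
    using assms(2) by (auto simp: has_bochner_def)
  obtain t where t: "\<And>n::nat. Bochner_Integration.simple_bochner_integrable M (t n)"
    "(\<lambda>n. \<integral>\<^sup>+x. ennreal (norm (f x - t n x)) \<partial>M) \<longlonglongrightarrow> 0"
    "(\<lambda>n. Bochner_Integration.simple_bochner_integral M (t n)) \<longlonglongrightarrow> J"
    using assms(3) by (auto simp: has_bochner_def)
  let ?d = "\<lambda>n. ennreal (norm (Bochner_Integration.simple_bochner_integral M (s n)
      - Bochner_Integration.simple_bochner_integral M (t n)))"
  have "?d \<longlonglongrightarrow> ennreal (norm (I - J))"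
    by (intro tendsto_intros s t)
  moreover have "?d \<longlonglongrightarrow> 0"
  proof (rule tendsto_sandwich[OF _ _ tendsto_const])
    show "\<forall>\<^sub>F n in sequentially. ?d n \<le> (\<integral>\<^sup>+x. norm (f x - s n x) \<partial>M) + (\<integral>\<^sup>+x. norm (f x - t n x) \<partial>M)"
      by (intro always_eventually allI simple_bochner_integral_dist[OF M f] s t)
    show "(\<lambda>n. (\<integral>\<^sup>+x. norm (f x - s n x) \<partial>M) + (\<integral>\<^sup>+x. norm (f x - t n x) \<partial>M)) \<longlonglongrightarrow> 0"
      using tendsto_add[OF s(2) t(2)] by simp
  qed simp
  ultimately have "ennreal (norm (I - J)) = 0" by (rule LIMSEQ_unique)
  then show ?thesis by simp
qed

lemma bochner_eqI: "complete_measure M \<Longrightarrow> has_bochner M f I \<Longrightarrow> bochner M f = I"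
  unfolding bochner_def by (rule the_equality) (auto dest: has_bochner_unique)

lemma has_bochner_bochner:
  fixes f :: "'a \<Rightarrow> 'b::{real_normed_vector,complete_space}"
  assumes M: "complete_measure M" and f: "strongly_measurable M f"
    and int: "integrable M (\<lambda>x. norm (f x))"
  shows "has_bochner M f (bochner M f)"
proof -
  obtain s where s: "\<And>n::nat. simple_function M (s n)" "AE x in M. (\<lambda>n. s n x) \<longlonglongrightarrow> f x"
    using f by (auto simp: strongly_measurable_def)
  \<comment> \<open>Cutting the approximants off at twice the norm of \<open>f\<close> makes them
    dominated. Convergence survives: where \<open>f x = 0\<close> the cut gives 0, elsewhere the
    bound holds eventually. The errors are then dominated by \<open>3 * norm (f x)\<close>.\<close>
  define t where "t n x = (if norm (s n x) \<le> 2 * norm (f x) then s n x else 0)" for n x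
  have meas_norm: "(\<lambda>x. norm (f x)) \<in> borel_measurable M" "(\<lambda>x. norm (s n x)) \<in> borel_measurable M" for n
    using s by (auto intro!: strongly_measurable_norm[OF M] f strongly_measurableI_simple)
  have "{x \<in> space M. norm (s n x) \<le> 2 * norm (f x)} \<in> sets M" for n
    using meas_norm by (intro borel_measurable_le) auto
  then have t_simple: "simple_function M (t n)" for n
    unfolding t_def using s by (intro simple_function_If) auto
  have t_le: "norm (t n x) \<le> 2 * norm (f x)" for n x
    by (simp add: t_def)
  have t_int: "Bochner_Integration.simple_bochner_integrable M (t n)" for n
  proof (rule simple_bochner_integrableI_bounded[OF t_simple])
    have "(\<integral>\<^sup>+x. norm (t n x) \<partial>M) \<le> (\<integral>\<^sup>+x. ennreal (2 * norm (f x)) \<partial>M)"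
      using t_le by (intro nn_integral_mono ennreal_leI)
    also have "\<dots> < \<infinity>"
      using integrable_mult_right[OF int, of 2] by (subst nn_integral_eq_integral) auto
    finally show "(\<integral>\<^sup>+x. norm (t n x) \<partial>M) < \<infinity>" .
  qed
  have t_lim: "AE x in M. (\<lambda>n. norm (f x - t n x)) \<longlonglongrightarrow> 0"
    using s(2)
  proof eventually_elim
    case (elim x)
    have "(\<lambda>n. t n x) \<longlonglongrightarrow> f x"
    proof (cases "f x = 0")
      case True
      then have "t n x = 0" for n by (simp add: t_def)
      then show ?thesis using True by simp
    next
      case False
      then have "\<forall>\<^sub>F n in sequentially. norm (s n x) < 2 * norm (f x)"
        by (intro order_tendstoD[OF tendsto_norm[OF elim]]) simp
      then have "\<forall>\<^sub>F n in sequentially. s n x = t n x"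
        by eventually_elim (simp add: t_def)
      then show ?thesis using elim by (rule Lim_transform_eventually[rotated])
    qed
    then have "(\<lambda>n. norm (f x - t n x)) \<longlonglongrightarrow> norm (f x - f x)" by (intro tendsto_intros)
    then show ?case by simp
  qed
  have "(\<lambda>n. \<integral>\<^sup>+x. ennreal (norm (f x - t n x)) \<partial>M) \<longlonglongrightarrow> (\<integral>\<^sup>+x. 0 \<partial>M)"
  proof (rule nn_integral_dominated_convergence)
    show "(\<lambda>x. ennreal (norm (f x - t n x))) \<in> borel_measurable M" for n
      by (rule measurable_compose[OF strongly_measurable_norm[OF M strongly_measurable_diff[OF f
              strongly_measurableI_simple[OF t_simple]]] measurable_ennreal])
    show "(\<lambda>x. ennreal (3 * norm (f x))) \<in> borel_measurable M"
      using meas_norm by simp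
    show "AE x in M. ennreal (norm (f x - t n x)) \<le> ennreal (3 * norm (f x))" for n
    proof (intro AE_I2 ennreal_leI)
      show "norm (f x - t n x) \<le> 3 * norm (f x)" for x
        using norm_triangle_ineq4[of "f x" "t n x"] t_le[of n x] by simp
    qed
    show "(\<integral>\<^sup>+x. ennreal (3 * norm (f x)) \<partial>M) < \<infinity>"
      using integrable_mult_right[OF int, of 3] by (subst nn_integral_eq_integral) auto
    show "AE x in M. (\<lambda>n. ennreal (norm (f x - t n x))) \<longlonglongrightarrow> 0"
      using t_lim by eventually_elim (metis ennreal_0 tendsto_ennrealI)
  qed auto
  then have lim0: "(\<lambda>n. \<integral>\<^sup>+x. ennreal (norm (f x - t n x)) \<partial>M) \<longlonglongrightarrow> 0" by simp
  have "Cauchy (\<lambda>n. Bochner_Integration.simple_bochner_integral M (t n))"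
  proof (rule CauchyI)
    fix e :: real assume "e > 0"
    then have "\<forall>\<^sub>F n in sequentially. (\<integral>\<^sup>+x. ennreal (norm (f x - t n x)) \<partial>M) < ennreal (e/2)"
      by (intro order_tendstoD[OF lim0]) auto
    then obtain N where N: "\<And>n. n \<ge> N \<Longrightarrow> (\<integral>\<^sup>+x. ennreal (norm (f x - t n x)) \<partial>M) < ennreal (e/2)"
      by (auto simp: eventually_sequentially)
    have "norm (Bochner_Integration.simple_bochner_integral M (t m) -
        Bochner_Integration.simple_bochner_integral M (t n)) < e" if "m \<ge> N" "n \<ge> N" for m n
    proof -
      have "ennreal (norm (Bochner_Integration.simple_bochner_integral M (t m) -
        Bochner_Integration.simple_bochner_integral M (t n))) < ennreal (e/2) + ennreal (e/2)"
        using simple_bochner_integral_dist[OF M f t_int t_int, of m n] add_strict_mono[OF N N, OF that]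
        by (rule order_le_less_trans)
      also have "\<dots> = ennreal e" using \<open>e > 0\<close> by (subst ennreal_plus[symmetric]) auto
      finally show ?thesis by (simp add: ennreal_less_iff)
    qed
    then show "\<exists>N. \<forall>m\<ge>N. \<forall>n\<ge>N. norm (Bochner_Integration.simple_bochner_integral M (t m) -
        Bochner_Integration.simple_bochner_integral M (t n)) < e" by blast
  qed
  then obtain I where "(\<lambda>n. Bochner_Integration.simple_bochner_integral M (t n)) \<longlonglongrightarrow> I"
    by (auto simp: Cauchy_convergent_iff convergent_def)
  then have "has_bochner M f I"
    unfolding has_bochner_def using f t_int lim0 by blast
  then show ?thesis using bochner_eqI[OF M] by metis
qed

text \<open>Functionals turn Bochner integrals into Lebesgue integrals of real functions; vector
  identities are recovered later by varying the functional.\<close>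

lemma has_bochner_bounded_linear:
  fixes f :: "'a \<Rightarrow> 'b::real_normed_vector" and h :: "'b \<Rightarrow> real"
  assumes M: "complete_measure M" and f: "has_bochner M f I" and h: "bounded_linear h"
  shows "has_bochner_integral M (\<lambda>x. h (f x)) (h I)"
proof -
  obtain s where sm: "strongly_measurable M f" and s: "\<And>n::nat. Bochner_Integration.simple_bochner_integrable M (s n)"
    "(\<lambda>n. \<integral>\<^sup>+x. ennreal (norm (f x - s n x)) \<partial>M) \<longlonglongrightarrow> 0"
    "(\<lambda>n. Bochner_Integration.simple_bochner_integral M (s n)) \<longlonglongrightarrow> I"
    using f by (auto simp: has_bochner_def)
  interpret bounded_linear h by fact
  obtain K where K: "\<And>x. norm (h x) \<le> norm x * K" "K \<ge> 0" using nonneg_bounded by blast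
  have meas: "(\<lambda>x. norm (f x - s n x)) \<in> borel_measurable M" for n
    using s(1)[of n] by (intro strongly_measurable_norm[OF M strongly_measurable_diff[OF sm
            strongly_measurableI_simple]]) (auto elim: simple_bochner_integrable.cases)
  show ?thesis
  proof
    show "(\<lambda>x. h (f x)) \<in> borel_measurable M"
      by (intro strongly_measurable_borel[OF M] strongly_measurable_bounded_linear[OF sm] h)
    show "Bochner_Integration.simple_bochner_integrable M (\<lambda>x. h (s n x))" for n
      using simple_bochner_integrable_compose2[of "\<lambda>x y. h x", OF _ s(1) s(1)] by (simp add: zero)
    show "(\<lambda>n. \<integral>\<^sup>+x. ennreal (norm (h (f x) - h (s n x))) \<partial>M) \<longlonglongrightarrow> 0"
    proof (rule tendsto_sandwich[OF _ _ tendsto_const])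
      show "\<forall>\<^sub>F n in sequentially. (\<integral>\<^sup>+x. ennreal (norm (h (f x) - h (s n x))) \<partial>M) \<le>
          ennreal K * (\<integral>\<^sup>+x. ennreal (norm (f x - s n x)) \<partial>M)"
      proof (intro always_eventually allI)
        fix n
        have "(\<integral>\<^sup>+x. ennreal (norm (h (f x) - h (s n x))) \<partial>M) \<le> (\<integral>\<^sup>+x. ennreal K * ennreal (norm (f x - s n x)) \<partial>M)"
          using K by (intro nn_integral_mono)
            (auto simp: diff[symmetric] ennreal_mult[symmetric] mult.commute intro!: ennreal_leI)
        also have "\<dots> = ennreal K * (\<integral>\<^sup>+x. ennreal (norm (f x - s n x)) \<partial>M)"
          using meas by (intro nn_integral_cmult) auto
        finally show "(\<integral>\<^sup>+x. ennreal (norm (h (f x) - h (s n x))) \<partial>M) \<le>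
          ennreal K * (\<integral>\<^sup>+x. ennreal (norm (f x - s n x)) \<partial>M)" .
      qed
      show "(\<lambda>n. ennreal K * (\<integral>\<^sup>+x. ennreal (norm (f x - s n x)) \<partial>M)) \<longlonglongrightarrow> 0"
        using ennreal_tendsto_cmult[OF _ s(2), of "ennreal K"] by simp
    qed simp
    show "(\<lambda>n. Bochner_Integration.simple_bochner_integral M (\<lambda>x. h (s n x))) \<longlonglongrightarrow> h I"
      using tendsto[OF s(3)] simple_bochner_integral_linear[OF linear_axioms s(1)] by simp
  qed
qed

lemma
  fixes f :: "'a \<Rightarrow> 'b::{real_normed_vector,complete_space}" and h :: "'b \<Rightarrow> real"
  assumes "complete_measure M" "strongly_measurable M f" "integrable M (\<lambda>x. norm (f x))" "bounded_linear h"
  shows integrable_bounded_linear_bochner: "integrable M (\<lambda>x. h (f x))"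
    and bounded_linear_bochner: "h (bochner M f) = (LINT x|M. h (f x))"
  using has_bochner_bounded_linear[OF assms(1) has_bochner_bochner[OF assms(1-3)] assms(4)]
  by (auto simp: has_bochner_integral_iff)

lemma
  fixes f :: "'a \<Rightarrow> 'b::{real_inner,complete_space}"
  assumes "complete_measure M" "strongly_measurable M f" "integrable M (\<lambda>x. norm (f x))"
  shows integrable_inner_bochner: "integrable M (\<lambda>x. inner (f x) y)"
    and inner_bochner: "inner (bochner M f) y = (LINT x|M. inner (f x) y)"
  using integrable_bounded_linear_bochner[OF assms bounded_linear_inner_left]
    bounded_linear_bochner[OF assms bounded_linear_inner_left] by auto

text \<open>Pairing the integral with itself gives its squared norm, and Cauchy-Schwarz under the
  integral sign leaves one factor to cancel.\<close>

lemma norm_bochner_le: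
  fixes f :: "'a \<Rightarrow> 'b::{real_inner,complete_space}"
  assumes "complete_measure M" "strongly_measurable M f" "integrable M (\<lambda>x. norm (f x))"
  shows "norm (bochner M f) \<le> (LINT x|M. norm (f x))"
proof -
  let ?I = "bochner M f"
  have "norm ?I * norm ?I = (LINT x|M. inner (f x) ?I)"
    using inner_bochner[OF assms, of ?I] by (simp add: power2_norm_eq_inner[symmetric] power2_eq_square)
  also have "\<dots> \<le> (LINT x|M. norm (f x) * norm ?I)"
    using integrable_inner_bochner[OF assms] assms(3)
    by (intro integral_mono integrable_mult_left) (auto simp: norm_cauchy_schwarz)
  also have "\<dots> = (LINT x|M. norm (f x)) * norm ?I" by simp
  finally show ?thesis
    by (cases "norm ?I = 0") (auto simp: integral_nonneg_AE)
qed

section \<open>Agreement with the Henstock-Kurzweil integral\<close>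

lemma simple_has_integral:
  fixes s :: "real \<Rightarrow> 'b::banach"
  assumes s: "simple_function (lebesgue_on S) s" and S: "S \<in> lmeasurable"
  shows "(s has_integral Bochner_Integration.simple_bochner_integral (lebesgue_on S) s) S"
proof -
  define E where "E y = {x \<in> S. s x = y}" for y
  have Sl: "S \<in> sets lebesgue" using S by (simp add: fmeasurableD)
  have E: "E y \<in> lmeasurable" for y
  proof (rule fmeasurableI2[OF S])
    have "s -` {y} \<inter> space (lebesgue_on S) \<in> sets (lebesgue_on S)"
      using s by (rule simple_functionD)
    also have "s -` {y} \<inter> space (lebesgue_on S) = E y" by (auto simp: E_def)
    finally show "E y \<in> sets lebesgue" using Sl by (simp add: sets_restrict_space_iff)
  qed (auto simp: E_def)
  have "((\<lambda>x. indicat_real (E y) x *\<^sub>R y) has_integral measure (lebesgue_on S) (E y) *\<^sub>R y) S" for y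
  proof (rule has_integral_scaleR_left)
    have "measure (lebesgue_on S) (E y) = measure lebesgue (E y)"
      using Sl by (intro measure_restrict_space) (auto simp: E_def)
    moreover have "((\<lambda>x. if x \<in> S then indicat_real (E y) x else 0) has_integral measure lebesgue (E y)) UNIV"
      using E[of y, unfolded lmeasurable_iff_has_integral]
      by (rule has_integral_eq[rotated]) (auto simp: E_def)
    then have "(indicat_real (E y) has_integral measure lebesgue (E y)) S"
      by (simp only: has_integral_restrict_UNIV)
    ultimately show "(indicat_real (E y) has_integral measure (lebesgue_on S) (E y)) S"
      by simp
  qed
  then have "((\<lambda>x. \<Sum>y\<in>s ` S. indicat_real (E y) x *\<^sub>R y) has_integral
      (\<Sum>y\<in>s ` S. measure (lebesgue_on S) (E y) *\<^sub>R y)) S"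
    using s by (intro has_integral_sum) (auto simp: simple_function_def)
  moreover have "(\<Sum>y\<in>s ` S. indicat_real (E y) x *\<^sub>R y) = s x" if "x \<in> S" for x
  proof -
    have "(\<Sum>y\<in>s ` S. indicat_real (E y) x *\<^sub>R y) = (\<Sum>y\<in>s ` S. if y = s x then s x else 0)"
      using that by (intro sum.cong) (auto simp: E_def indicator_def)
    also have "\<dots> = s x" using s that by (subst sum.delta) (auto simp: simple_function_def)
    finally show ?thesis .
  qed
  ultimately have "(s has_integral (\<Sum>y\<in>s ` S. measure (lebesgue_on S) (E y) *\<^sub>R y)) S"
    by (simp cong: has_integral_cong)
  then show ?thesis
    unfolding simple_bochner_integral_def E_def by simp
qed

text \<open>Both integrals agree on simple functions, and both errors are bounded by the integral of
  \<open>norm (f x - s n x)\<close>. The agreement opens the rules for shift and reflection to the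
  history operator.\<close>

lemma has_bochner_eq_integral:
  fixes f :: "real \<Rightarrow> 'b::banach"
  assumes f: "has_bochner (lebesgue_on S) f I" and S: "S \<in> lmeasurable" and int: "f integrable_on S"
  shows "I = integral S f"
proof -
  let ?M = "lebesgue_on S"
  have Sl: "S \<in> sets lebesgue" using S by (simp add: fmeasurableD)
  note M = complete_measure_lebesgue_on[OF Sl]
  obtain s where sm: "strongly_measurable ?M f" and s: "\<And>n::nat. Bochner_Integration.simple_bochner_integrable ?M (s n)"
    and lim: "(\<lambda>n. \<integral>\<^sup>+x. ennreal (norm (f x - s n x)) \<partial>?M) \<longlonglongrightarrow> 0"
    "(\<lambda>n. Bochner_Integration.simple_bochner_integral ?M (s n)) \<longlonglongrightarrow> I"
    using f by (auto simp: has_bochner_def)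
  have s': "simple_function ?M (s n)" for n
    using s by (auto elim: simple_bochner_integrable.cases)
  let ?d = "\<lambda>n. norm (integral S f - Bochner_Integration.simple_bochner_integral ?M (s n))"
  have "\<forall>\<^sub>F n in sequentially. (\<integral>\<^sup>+x. ennreal (norm (f x - s n x)) \<partial>?M) < \<infinity>"
    using order_tendstoD(2)[OF lim(1), of \<infinity>] by simp
  then have ev: "\<forall>\<^sub>F n in sequentially. ennreal (?d n) \<le> (\<integral>\<^sup>+x. ennreal (norm (f x - s n x)) \<partial>?M)"
  proof eventually_elim
    case (elim n)
    have "(\<lambda>x. norm (f x - s n x)) \<in> borel_measurable ?M"
      by (rule strongly_measurable_norm[OF M strongly_measurable_diff[OF sm strongly_measurableI_simple[OF s']]])
    then have i: "integrable ?M (\<lambda>x. norm (f x - s n x))"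
      using elim by (intro integrableI_bounded) auto
    have hi: "((\<lambda>x. f x - s n x) has_integral (integral S f - Bochner_Integration.simple_bochner_integral ?M (s n))) S"
      by (intro has_integral_diff integrable_integral int simple_has_integral s' S)
    have "?d n \<le> integral S (\<lambda>x. norm (f x - s n x))"
      unfolding integral_unique[OF hi, symmetric]
      using hi integrable_on_lebesgue_on[OF i Sl] by (intro integral_norm_bound_integral) auto
    also have "\<dots> = (LINT x|?M. norm (f x - s n x))"
      by (rule lebesgue_integral_eq_integral[symmetric, OF i Sl])
    finally show ?case
      using i by (subst nn_integral_eq_integral) (auto intro: ennreal_leI)
  qed
  have "(\<lambda>n. ennreal (?d n)) \<longlonglongrightarrow> 0"
    by (rule tendsto_sandwich[OF _ ev tendsto_const lim(1)]) simp
  moreover have "(\<lambda>n. ennreal (?d n)) \<longlonglongrightarrow> ennreal (norm (integral S f - I))"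
    by (intro tendsto_intros lim)
  ultimately have "ennreal (norm (integral S f - I)) = 0" by (rule LIMSEQ_unique[rotated])
  then show ?thesis by simp
qed

lemma bochner_continuous_on:
  fixes f :: "real \<Rightarrow> 'b::banach"
  assumes "continuous_on {a..b} f"
  shows "bochner (lebesgue_on {a..b}) f = integral {a..b} f"
proof (rule has_bochner_eq_integral)
  have "continuous_on {a..b} (\<lambda>x. norm (f x))" using assms by (intro continuous_intros)
  then have "integrable (lebesgue_on {a..b}) (\<lambda>x. norm (f x))"
    by (rule continuous_imp_integrable_real)
  then show "has_bochner (lebesgue_on {a..b}) f (bochner (lebesgue_on {a..b}) f)"
    by (intro has_bochner_bochner complete_measure_lebesgue_on strongly_measurable_continuous_on assms) auto
qed (use assms in \<open>auto intro: integrable_continuous_interval\<close>)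

subsection \<open>Weak sequential compactness in Hilbert spaces\<close>

text \<open>Almost norm-minimal elements of the convex hulls of the tails are Cauchy by the parallelogram law.\<close>

lemma bounded_tails_common_point:
  fixes x :: "nat \<Rightarrow> 'h::{real_inner,complete_space}"
  assumes bd: "\<And>n. norm (x n) \<le> C"
  obtains y where "\<And>n. y \<in> closure (convex hull (x ` {n..}))"
proof -
  define K where "K n = convex hull (x ` {n..})" for n
  define d where "d n = (INF v\<in>K n. norm v)" for n
  have x_K: "x n \<in> K n" for n unfolding K_def by (rule hull_inc) simp
  have K_mono: "K m \<subseteq> K n" if "n \<le> m" for n m
    unfolding K_def using that by (intro hull_mono) auto
  have bdd: "bdd_below (norm ` K n)" for n by (rule bdd_belowI[of _ 0]) auto
  have d_le: "d n \<le> norm v" if "v \<in> K n" for n v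
    unfolding d_def using bdd that by (rule cINF_lower)
  have d0: "0 \<le> d n" for n unfolding d_def using x_K by (intro cINF_greatest) auto
  have "incseq d"
  proof (rule incseq_SucI)
    fix n
    have "K (Suc n) \<noteq> {}" "K (Suc n) \<subseteq> K n" using x_K[of "Suc n"] K_mono[of n "Suc n"] by auto
    then show "d n \<le> d (Suc n)" unfolding d_def by (intro cINF_superset_mono bdd) auto
  qed
  moreover have "d n \<le> C" for n using d_le[OF x_K] bd order_trans by blast
  ultimately obtain D where D: "d \<longlonglongrightarrow> D" using incseq_convergent[of d C] by metis
  have "\<exists>v\<in>K n. norm v < d n + 1 / Suc n" for n
    using cINF_less_iff[OF _ bdd, of n "d n + 1 / Suc n"] x_K unfolding d_def[symmetric] by auto
  then obtain y where y: "\<And>n. y n \<in> K n" "\<And>n. norm (y n) < d n + 1 / Suc n" by metis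
  have "Cauchy y"
  proof (rule CauchyI)
    fix e :: real assume "e > 0"
    define b where "b n = (d n + 1 / Suc n)\<^sup>2" for n
    have "(\<lambda>n. (d n + 1 / Suc n)\<^sup>2) \<longlonglongrightarrow> (D + 0)\<^sup>2"
      by (intro tendsto_intros D LIMSEQ_Suc[OF lim_1_over_n])
    then have "b \<longlonglongrightarrow> D\<^sup>2" by (simp add: b_def[abs_def])
    moreover have "(\<lambda>n. (d n)\<^sup>2) \<longlonglongrightarrow> D\<^sup>2" by (intro tendsto_intros D)
    \<comment> \<open>The share \<open>e^2/8\<close> is fitted to the parallelogram law:
      \<open>2 * (norm (y m))^2 + 2 * (norm (y n))^2\<close> is below
      \<open>4 * D^2 + e^2/2\<close>, and \<open>(2 * d N)^2\<close> is above
      \<open>4 * D^2 - e^2/2\<close>.\<close>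
    ultimately have "\<forall>\<^sub>F n in sequentially. b n < D\<^sup>2 + e\<^sup>2/8 \<and> (d n)\<^sup>2 > D\<^sup>2 - e\<^sup>2/8"
      using \<open>e > 0\<close> by (intro eventually_conj order_tendstoD) auto
    then obtain N where N: "\<And>n. n \<ge> N \<Longrightarrow> b n < D\<^sup>2 + e\<^sup>2/8" "\<And>n. n \<ge> N \<Longrightarrow> (d n)\<^sup>2 > D\<^sup>2 - e\<^sup>2/8"
      by (auto simp: eventually_sequentially)
    have *: "norm (y m - y n) < e" if "m \<ge> N" "n \<ge> N" for m n
    proof -
      have "y m \<in> K N" "y n \<in> K N" using K_mono that y(1) by blast+
      then have "(1/2) *\<^sub>R y m + (1/2) *\<^sub>R y n \<in> K N"
        unfolding K_def by (intro convexD convex_convex_hull) auto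
      from d_le[OF this] have "d N \<le> norm ((1/2) *\<^sub>R (y m + y n))" by (simp add: scaleR_add_right)
      then have "2 * d N \<le> norm (y m + y n)" by simp
      then have "(2 * d N)\<^sup>2 \<le> (norm (y m + y n))\<^sup>2" using d0 by (intro power_mono) auto
      moreover have "(norm (y m - y n))\<^sup>2 + (norm (y m + y n))\<^sup>2 = 2 * (norm (y m))\<^sup>2 + 2 * (norm (y n))\<^sup>2"
        by (simp add: power2_norm_eq_inner inner_add_left inner_add_right inner_diff_left inner_diff_right)
      moreover have "(norm (y m))\<^sup>2 \<le> b m" "(norm (y n))\<^sup>2 \<le> b n"
        unfolding b_def using y(2)[of m] y(2)[of n] by (auto intro!: power_mono)
      ultimately have "(norm (y m - y n))\<^sup>2 < e\<^sup>2"
        using N(1)[OF that(1)] N(1)[OF that(2)] N(2)[of N] by (simp add: power_mult_distrib)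
      then show ?thesis using \<open>e > 0\<close> by (simp add: power_less_imp_less_base)
    qed
    then show "\<exists>M. \<forall>m\<ge>M. \<forall>n\<ge>M. norm (y m - y n) < e" by blast
  qed
  then obtain z where z: "y \<longlonglongrightarrow> z" by (auto simp: Cauchy_convergent_iff convergent_def)
  have "z \<in> closure (K n)" for n
  proof (rule Lim_in_closed_set[OF closed_closure _ _ z])
    have "\<forall>m\<ge>n. y m \<in> closure (K n)"
      using K_mono y(1) closure_subset by blast
    then show "\<forall>\<^sub>F m in sequentially. y m \<in> closure (K n)" by (auto simp: eventually_sequentially)
  qed simp
  then show ?thesis using that unfolding K_def by blast
qed

lemma closure_hull_subset:
  fixes S :: "'h::real_normed_vector set"
  assumes "A \<subseteq> S" "convex S" "closed S"
  shows "closure (convex hull A) \<subseteq> S"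
  using assms by (meson closure_minimal hull_minimal)

text \<open>Preimages of closed balls under \<open>G\<close> are closed and convex, so they contain
  the closed hull of a tail as soon as they contain the tail.\<close>

lemma functional_tails_common_point:
  fixes x :: "nat \<Rightarrow> 'h::{real_inner,complete_space}"
  assumes y: "\<And>n. y \<in> closure (convex hull (x ` {n..}))"
    and G: "bounded_linear G" and lim: "(\<lambda>n. G (x n)) \<longlonglongrightarrow> (c::real)"
  shows "G y = c"
proof -
  have "dist c (G y) \<le> e" if "e > 0" for e
  proof -
    obtain N where N: "\<And>n. n \<ge> N \<Longrightarrow> dist (G (x n)) c < e"
      using metric_LIMSEQ_D[OF lim \<open>e > 0\<close>] by blast
    have "convex (G -` cball c e)"
      using G by (intro convex_linear_vimage convex_cball) (simp add: bounded_linear.linear)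
    moreover have "closed (G -` cball c e)"
      using G by (intro continuous_closed_vimage closed_cball) (simp add: linear_continuous_at)
    ultimately have "closure (convex hull (x ` {N..})) \<subseteq> G -` cball c e"
      using N by (intro closure_hull_subset) (force simp: dist_commute)+
    then show ?thesis using y[of N] by auto
  qed
  then have "dist c (G y) \<le> 0" by (rule field_le_epsilon) simp
  then show ?thesis by simp
qed

text \<open>Diagonal extraction is applied to the inner products with the members of the sequence,
  which are countably many conditions even in a nonseparable space. A point \<open>y\<close> common
  to all closed tail hulls is the limit: a subsequence along which \<open>G\<close> stays away from
  \<open>G y\<close> has such a point \<open>z\<close> too, and \<open>z - y\<close> is orthogonal
  to every \<open>x m\<close>, hence to the closed hull, which contains both \<open>z\<close> and
  \<open>y\<close>.\<close>

lemma weakly_convergent_subsequence: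
  fixes x :: "nat \<Rightarrow> 'h::{real_inner,complete_space}"
  assumes bd: "\<And>n. norm (x n) \<le> C"
  obtains r y where "strict_mono (r :: nat \<Rightarrow> nat)"
    "\<And>G :: 'h \<Rightarrow> real. bounded_linear G \<Longrightarrow> (\<lambda>n. G (x (r n))) \<longlonglongrightarrow> G y"
proof -
  have "norm (inner (x n) (x m)) \<le> C * C" for n m
  proof -
    have "0 \<le> C" using norm_ge_zero bd by (rule order_trans)
    then show ?thesis
      using Cauchy_Schwarz_ineq2[of "x n" "x m"] mult_mono[OF bd[of n] bd[of m]] by simp
  qed
  then have *: "norm (inner (x n) (x m)) \<le> C * C" for n m .
  obtain r where r: "strict_mono (r :: nat \<Rightarrow> nat)" "\<And>m. \<exists>l. (\<lambda>n. inner (x (r n)) (x m)) \<longlonglongrightarrow> l"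
    by (rule function_convergent_subsequence[of "UNIV::nat set" "\<lambda>n m. inner (x n) (x m)" "C * C"])
       (use * in auto)
  from r(2) obtain l where l: "\<And>m. (\<lambda>n. inner (x (r n)) (x m)) \<longlonglongrightarrow> l m" by metis
  obtain y where y: "\<And>n. y \<in> closure (convex hull ((\<lambda>n. x (r n)) ` {n..}))"
    using bounded_tails_common_point[of "\<lambda>n. x (r n)" C] bd by blast
  have "(\<lambda>n. G (x (r n))) \<longlonglongrightarrow> G y" if G: "bounded_linear G" for G :: "'h \<Rightarrow> real"
  proof (rule ccontr)
    assume "\<not> ?thesis"
    then obtain e where e: "e > 0" "\<not> (\<forall>\<^sub>F n in sequentially. dist (G (x (r n))) (G y) < e)"
      by (auto simp: tendsto_iff)
    then obtain s where s: "strict_mono (s :: nat \<Rightarrow> nat)" "\<And>n. \<not> dist (G (x (r (s n)))) (G y) < e"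
      using not_eventually_sequentiallyD by blast
    interpret bounded_linear G by fact
    obtain k where k: "\<And>v. norm (G v) \<le> norm v * k" "k \<ge> 0" using nonneg_bounded by blast
    have "norm (G (x n)) \<le> C * k" for n
      using k(1)[of "x n"] mult_right_mono[OF bd[of n] k(2)] by simp
    then have "bounded (range (\<lambda>n. G (x (r (s n)))))" by (auto simp: bounded_iff)
    then obtain c t where t: "strict_mono (t :: nat \<Rightarrow> nat)" "(\<lambda>n. G (x (r (s (t n))))) \<longlonglongrightarrow> c"
      using bounded_imp_convergent_subsequence[of "\<lambda>n. G (x (r (s n)))"] by (auto simp: o_def)
    obtain z where z: "\<And>n. z \<in> closure (convex hull ((\<lambda>n. x (r (s (t n)))) ` {n..}))"
      using bounded_tails_common_point[of "\<lambda>n. x (r (s (t n)))" C] bd by blast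
    have st: "strict_mono (\<lambda>n. s (t n))" using s(1) t(1) by (simp add: strict_mono_def)
    have "inner (z - y) (x m) = 0" for m
    proof -
      have "inner y (x m) = l m"
        by (rule functional_tails_common_point[OF y bounded_linear_inner_left l])
      moreover have "inner z (x m) = l m"
        using LIMSEQ_subseq_LIMSEQ[OF l st]
        by (intro functional_tails_common_point[OF z bounded_linear_inner_left]) (simp add: o_def)
      ultimately show ?thesis by (simp add: inner_diff_left)
    qed
    then have "closure (convex hull (range x)) \<subseteq> {v. inner (z - y) v = 0}"
      by (intro closure_hull_subset convex_hyperplane closed_hyperplane) auto
    moreover have "z \<in> closure (convex hull (range x))"
      using z[of 0] by (rule subsetD[OF closure_mono[OF hull_mono], rotated]) auto
    moreover have "y \<in> closure (convex hull (range x))"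
      using y[of 0] by (rule subsetD[OF closure_mono[OF hull_mono], rotated]) auto
    ultimately have "inner (z - y) z = 0" "inner (z - y) y = 0" by auto
    then have "inner (z - y) (z - y) = 0" by (simp add: inner_diff_right)
    then have "z = y" by simp
    moreover have "G z = c" by (rule functional_tails_common_point[OF z G t(2)])
    ultimately have "(\<lambda>n. dist (G (x (r (s (t n))))) (G y)) \<longlonglongrightarrow> 0"
      using t(2) tendsto_dist[OF t(2) tendsto_const[of "G y"]] by simp
    then have "\<forall>\<^sub>F n in sequentially. dist (G (x (r (s (t n))))) (G y) < e"
      using e(1) by (rule order_tendstoD)
    then show False using s(2) by simp
  qed
  then show ?thesis using that r(1) by blast
qed

section \<open>The uniform boundedness principle\<close>

text \<open>
  Sokal's proof of the uniform boundedness principle: the point \<open>z\<close> is the limit of steps of length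
  \<open>3\<^sup>-\<^sup>k\<close> in the direction of a rapidly growing subsequence, with the sign chosen so that no cancellation occurs.
\<close>

lemma weakly_bounded_imp_Bseq:
  fixes x :: "nat \<Rightarrow> 'h::{real_inner,complete_space}"
  assumes wb: "\<And>v. Bseq (\<lambda>n. inner (x n) v)"
  shows "Bseq x"
proof (rule ccontr)
  assume "\<not> Bseq x"
  then have unb: "\<exists>n. norm (x n) > K" for K
    by (metis BseqI' linorder_not_less)
  \<comment> \<open>Growth 4 beats the step ratio 3. All later steps together move \<open>z\<close>
    by at most \<open>3/2 * (1/3)^(k+1)\<close>, which is half of step \<open>k\<close>, so at least
    half of \<open>(1/3)^k * norm (u k)\<close>, a quantity above \<open>(4/3)^k\<close>, survives
    in the limit.\<close>
  have "\<exists>n. \<forall>k. norm (x (n k)) > 4 ^ k" by (intro choice allI unb)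
  then obtain n where n: "\<And>k. norm (x (n k)) > 4 ^ k" by blast
  define u where "u k = x (n k)" for k
  have u_gt: "norm (u k) > 4 ^ k" for k using n by (simp add: u_def)
  have u_pos: "norm (u k) > 0" for k
    using u_gt[of k] by (rule less_trans[rotated]) simp
  define w where "w k = sgn (u k)" for k
  define z where "z = rec_nat 0 (\<lambda>k v. v + ((if inner (u k) v \<ge> 0 then 1 else - 1) * (1/3)^k) *\<^sub>R w k)"
  have z_Suc: "z (Suc k) = z k + ((if inner (u k) (z k) \<ge> 0 then 1 else - 1) * (1/3)^k) *\<^sub>R w k" for k
    by (simp add: z_def)
  have w_norm: "norm (w k) = 1" for k using u_pos[of k] by (simp add: w_def norm_sgn)
  have uw: "inner (u k) (w k) = norm (u k)" for k
    using u_pos[of k] by (simp add: w_def sgn_div_norm power2_norm_eq_inner[symmetric] power2_eq_square)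
  have step: "norm (z (Suc k) - z k) \<le> (1/3)^k" for k
    by (simp add: z_Suc w_norm)
  have dist: "norm (z (k + m) - z k) \<le> 3/2 * ((1/3)^k - (1/3)^(k + m))" for k m
  proof (induction m)
    case (Suc m)
    have "norm (z (k + Suc m) - z k) \<le> norm (z (Suc (k + m)) - z (k + m)) + norm (z (k + m) - z k)"
      by (metis add_Suc_right norm_diff_triangle_le order_refl)
    also have "\<dots> \<le> (1/3)^(k + m) + 3/2 * ((1/3)^k - (1/3)^(k + m))"
      using step Suc by (intro add_mono) auto
    finally show ?case by (simp add: field_simps)
  qed simp
  have dist': "norm (z (k + m) - z k) \<le> 3/2 * (1/3)^k" for k m
  proof -
    have "3/2 * ((1/3::real)^k - (1/3)^(k + m)) \<le> 3/2 * (1/3)^k" by simp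
    then show ?thesis using dist[of k m] by (rule order_trans[rotated])
  qed
  have "Cauchy z"
  proof (rule CauchyI)
    fix e :: real assume "e > 0"
    have "(\<lambda>k. 3/2 * (1/3::real)^k) \<longlonglongrightarrow> 3/2 * 0"
      by (intro tendsto_intros LIMSEQ_power_zero) auto
    then have "\<forall>\<^sub>F k in sequentially. 3/2 * (1/3::real)^k < e"
      using \<open>e > 0\<close> by (intro order_tendstoD) auto
    then obtain M where M: "\<And>k. k \<ge> M \<Longrightarrow> 3/2 * (1/3::real)^k < e" by (auto simp: eventually_sequentially)
    have *: "norm (z j - z k) < e" if "k \<ge> M" "j \<ge> k" for k j
      using dist'[of k "j - k"] M[OF that(1)] that(2) by simp
    have "norm (z k - z j) < e" if "k \<ge> M" "j \<ge> M" for k j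
      using *[of k j] *[of j k] that by (cases "j \<ge> k") (auto simp: norm_minus_commute)
    then show "\<exists>M. \<forall>k\<ge>M. \<forall>j\<ge>M. norm (z k - z j) < e" by blast
  qed
  then obtain z' where z': "z \<longlonglongrightarrow> z'" by (auto simp: Cauchy_convergent_iff convergent_def)
  have dist_lim: "norm (z' - z k) \<le> 3/2 * (1/3)^k" for k
  proof (rule LIMSEQ_le_const2)
    show "(\<lambda>m. norm (z (m + k) - z k)) \<longlonglongrightarrow> norm (z' - z k)"
      by (intro tendsto_intros LIMSEQ_ignore_initial_segment z')
    show "\<exists>N. \<forall>m\<ge>N. norm (z (m + k) - z k) \<le> 3/2 * (1/3)^k"
      using dist'[of k] by (simp add: add.commute)
  qed
  have large: "(4/3)^k / 2 \<le> \<bar>inner (u k) z'\<bar>" for k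
  proof -
    have "p \<le> \<bar>c + (if c \<ge> 0 then 1 else - 1) * p\<bar>" if "p \<ge> 0" for c p :: real
      using that by auto
    from this[of "(1/3)^k * norm (u k)" "inner (u k) (z k)"]
    have "(1/3)^k * norm (u k) \<le> \<bar>inner (u k) (z (Suc k))\<bar>"
      by (simp add: z_Suc inner_add_right uw mult.assoc)
    moreover have "\<bar>inner (u k) (z' - z (Suc k))\<bar> \<le> (1/3)^k * norm (u k) / 2"
      using Cauchy_Schwarz_ineq2[of "u k" "z' - z (Suc k)"]
        mult_left_mono[OF dist_lim[of "Suc k"] norm_ge_zero[of "u k"]] by (simp add: mult.commute)
    moreover have "\<bar>inner (u k) (z (Suc k))\<bar> \<le> \<bar>inner (u k) z'\<bar> + \<bar>inner (u k) (z' - z (Suc k))\<bar>"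
      by (simp add: inner_diff_right)
    ultimately have "(1/3)^k * norm (u k) / 2 \<le> \<bar>inner (u k) z'\<bar>" by linarith
    moreover have "(1/3)^k * 4^k \<le> (1/3)^k * norm (u k)" using u_gt[of k] by (intro mult_left_mono) auto
    moreover have "(1/3)^k * 4^k = (4/3::real)^k" by (simp add: power_divide)
    ultimately show ?thesis by linarith
  qed
  obtain K where K: "\<And>k. norm (inner (x k) z') \<le> K" using wb[of z'] by (auto simp: Bseq_def)
  obtain k where "2 * K < (4/3::real)^k" using real_arch_pow[of "4/3" "2 * K"] by auto
  then show False using large[of k] K[of "n k"] by (simp add: u_def)
qed

subsection \<open>The Hilbert space of square integrable functions\<close>

text \<open>The measure is left arbitrary because two instances are used: the whole line, for the
  quotient type, and \<open>leb T\<close>, where the set is \<open>Lp 2 T\<close>.\<close>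

definition sqint :: "'a measure \<Rightarrow> ('a \<Rightarrow> 'b::real_normed_vector) set" where
  "sqint M = {f. strongly_measurable M f \<and> integrable M (\<lambda>x. (norm (f x))\<^sup>2)}"

lemma sqint_strongly_measurable: "f \<in> sqint M \<Longrightarrow> strongly_measurable M f"
  and sqint_integrable: "f \<in> sqint M \<Longrightarrow> integrable M (\<lambda>x. (norm (f x))\<^sup>2)"
  by (auto simp: sqint_def)

lemma sqint_zero: "(\<lambda>x. 0) \<in> sqint M"
  by (simp add: sqint_def strongly_measurable_const)

lemma sqint_cong_AE:
  assumes M: "complete_measure M" and f: "f \<in> sqint M" and eq: "AE x in M. f x = g x"
  shows "g \<in> sqint M"
proof -
  have g: "strongly_measurable M g"
    using sqint_strongly_measurable[OF f] eq by (rule strongly_measurable_cong_AE)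
  have "integrable M (\<lambda>x. (norm (g x))\<^sup>2)"
  proof (rule integrable_cong_AE_imp[OF sqint_integrable[OF f]])
    show "(\<lambda>x. (norm (g x))\<^sup>2) \<in> borel_measurable M"
      using strongly_measurable_norm[OF M g] by simp
    show "AE x in M. (norm (f x))\<^sup>2 = (norm (g x))\<^sup>2" using eq by eventually_elim simp
  qed
  with g show ?thesis by (simp add: sqint_def)
qed

lemma power2_norm_add_le: "(norm (a + b))\<^sup>2 \<le> 2 * (norm a)\<^sup>2 + 2 * (norm b)\<^sup>2"
proof -
  have "(norm (a + b))\<^sup>2 \<le> (norm a + norm b)\<^sup>2" by (intro power_mono norm_triangle_ineq) simp
  also have "\<dots> \<le> 2 * (norm a)\<^sup>2 + 2 * (norm b)\<^sup>2"
    using zero_le_power2[of "norm a - norm b"] by (simp add: power2_sum power2_diff)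
  finally show ?thesis .
qed

lemma sqint_add:
  assumes M: "complete_measure M" and f: "f \<in> sqint M" and g: "g \<in> sqint M"
  shows "(\<lambda>x. f x + g x) \<in> sqint M"
proof -
  have s: "strongly_measurable M (\<lambda>x. f x + g x)"
    using f g by (intro strongly_measurable_add sqint_strongly_measurable)
  have "integrable M (\<lambda>x. (norm (f x + g x))\<^sup>2)"
  proof (rule Bochner_Integration.integrable_bound)
    show "integrable M (\<lambda>x. 2 * (norm (f x))\<^sup>2 + 2 * (norm (g x))\<^sup>2)"
      using f g by (intro Bochner_Integration.integrable_add integrable_mult_right sqint_integrable)
    show "(\<lambda>x. (norm (f x + g x))\<^sup>2) \<in> borel_measurable M"
      using strongly_measurable_norm[OF M s] by simp
    show "AE x in M. norm ((norm (f x + g x))\<^sup>2) \<le> norm (2 * (norm (f x))\<^sup>2 + 2 * (norm (g x))\<^sup>2)"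
      using power2_norm_add_le[of "f _" "g _"] by (intro AE_I2) simp
  qed
  with s show ?thesis by (simp add: sqint_def)
qed

lemma sqint_scaleR:
  assumes "f \<in> sqint M"
  shows "(\<lambda>x. c *\<^sub>R f x) \<in> sqint M"
  using assms strongly_measurable_scaleR[OF strongly_measurable_const[of M c] sqint_strongly_measurable[OF assms]]
  by (auto simp: sqint_def power_mult_distrib)

lemma sqint_diff:
  assumes "complete_measure M" "f \<in> sqint M" "g \<in> sqint M"
  shows "(\<lambda>x. f x - g x) \<in> sqint M"
  using sqint_add[OF assms(1,2) sqint_scaleR[OF assms(3), of "-1"]] by simp

lemma sqint_uminus: "f \<in> sqint M \<Longrightarrow> (\<lambda>x. - f x) \<in> sqint M"
  using sqint_scaleR[of f M "-1"] by simp

lemma sqint_norm_mult_integrable: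
  fixes f :: "'a \<Rightarrow> 'b::real_normed_vector" and g :: "'a \<Rightarrow> 'c::real_normed_vector"
  assumes M: "complete_measure M" and f: "f \<in> sqint M" and g: "g \<in> sqint M"
  shows "integrable M (\<lambda>x. norm (f x) * norm (g x))"
proof (rule Bochner_Integration.integrable_bound)
  show "integrable M (\<lambda>x. (norm (f x))\<^sup>2 + (norm (g x))\<^sup>2)"
    using f g by (intro Bochner_Integration.integrable_add sqint_integrable)
  show "(\<lambda>x. norm (f x) * norm (g x)) \<in> borel_measurable M"
    using f g by (intro borel_measurable_times strongly_measurable_norm[OF M] sqint_strongly_measurable)
  have "a * b \<le> a\<^sup>2 + b\<^sup>2" if "a \<ge> 0" "b \<ge> 0" for a b :: real
    using sum_squares_bound[of a b] mult_nonneg_nonneg[OF that] by simp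
  then show "AE x in M. norm (norm (f x) * norm (g x)) \<le> norm ((norm (f x))\<^sup>2 + (norm (g x))\<^sup>2)"
    by (intro AE_I2) simp
qed

lemma sqint_pairing_integrable:
  fixes f :: "'a \<Rightarrow> 'b::real_normed_vector" and g :: "'a \<Rightarrow> 'c::real_normed_vector"
    and h :: "'b \<Rightarrow> 'c \<Rightarrow> real"
  assumes M: "complete_measure M" and f: "f \<in> sqint M" and g: "g \<in> sqint M"
    and h: "strongly_measurable M (\<lambda>x. h (f x) (g x))" "\<And>u v. \<bar>h u v\<bar> \<le> norm u * norm v"
  shows "integrable M (\<lambda>x. h (f x) (g x))"
  by (rule Bochner_Integration.integrable_bound[OF sqint_norm_mult_integrable[OF M f g]])
    (use h in \<open>auto intro: strongly_measurable_borel[OF M]\<close>)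

lemma sqint_inner_integrable:
  assumes M: "complete_measure M" and f: "f \<in> sqint M" and g: "g \<in> sqint M"
  shows "integrable M (\<lambda>x. inner (f x) (g x))"
  by (rule sqint_pairing_integrable[OF M f g])
    (use f g in \<open>auto intro: strongly_measurable_inner sqint_strongly_measurable Cauchy_Schwarz_ineq2\<close>)

lemma sqint_blinfun_integrable:
  fixes f :: "'a \<Rightarrow> 'b::real_normed_vector \<Rightarrow>\<^sub>L real" and g :: "'a \<Rightarrow> 'b"
  assumes M: "complete_measure M" and f: "f \<in> sqint M" and g: "g \<in> sqint M"
  shows "integrable M (\<lambda>x. blinfun_apply (f x) (g x))"
proof (rule sqint_pairing_integrable[OF M f g, of blinfun_apply])
  show "strongly_measurable M (\<lambda>x. blinfun_apply (f x) (g x))"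
    using f g by (intro strongly_measurable_blinfun_apply sqint_strongly_measurable)
  show "\<bar>blinfun_apply u v\<bar> \<le> norm u * norm v" for u :: "'b \<Rightarrow>\<^sub>L real" and v
    using norm_blinfun[of u v] by simp
qed

text \<open>With \<open>a\<close> the norm of the \<open>n\<close>-th increment, \<open>2a \<le> 2\<^sup>-\<^sup>n + 2\<^sup>n a\<^sup>2\<close> replaces Minkowski's inequality.\<close>

lemma sqint_rapid_AE_convergent:
  fixes f :: "nat \<Rightarrow> 'a \<Rightarrow> 'b::{real_normed_vector,complete_space}"
  assumes M: "complete_measure M" and f: "\<And>n. f n \<in> sqint M"
    and rapid: "\<And>n. (LINT x|M. (norm (f (Suc n) x - f n x))\<^sup>2) \<le> (1/4)^n"
  shows "AE x in M. convergent (\<lambda>n. f n x)"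
proof -
  define a where "a n x = norm (f (Suc n) x - f n x)" for n x
  have a_int: "integrable M (\<lambda>x. (a n x)\<^sup>2)" for n
    unfolding a_def by (intro sqint_integrable sqint_diff M f)
  have a_meas: "(\<lambda>x. ennreal (2^n * (a n x)\<^sup>2)) \<in> borel_measurable M" for n
    using a_int[of n] by simp
  \<comment> \<open>The weight \<open>2^n\<close> still leaves integrals of at most
    \<open>(1/2)^n\<close>, so the weighted squares are summable at almost every point.\<close>
  have "(\<integral>\<^sup>+x. (\<Sum>n. ennreal (2^n * (a n x)\<^sup>2)) \<partial>M) = (\<Sum>n. \<integral>\<^sup>+x. ennreal (2^n * (a n x)\<^sup>2) \<partial>M)"
    using a_meas by (intro nn_integral_suminf)
  also have "\<dots> \<le> (\<Sum>n. ennreal ((1/2)^n))"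
  proof (intro suminf_le)
    fix n
    have "(\<integral>\<^sup>+x. ennreal (2^n * (a n x)\<^sup>2) \<partial>M) = ennreal (LINT x|M. 2^n * (a n x)\<^sup>2)"
      using a_int by (intro nn_integral_eq_integral integrable_mult_right) auto
    also have "\<dots> \<le> ennreal (2^n * (1/4)^n)"
      using rapid[of n] by (intro ennreal_leI) (simp add: a_def)
    also have "2^n * (1/4)^n = (1/2::real)^n" by (simp add: power_mult_distrib[symmetric])
    finally show "(\<integral>\<^sup>+x. ennreal (2^n * (a n x)\<^sup>2) \<partial>M) \<le> ennreal ((1/2)^n)" .
  qed auto
  also have "\<dots> = ennreal (\<Sum>n. (1/2)^n)"
    by (intro suminf_ennreal2 summable_geometric) auto
  finally have "(\<integral>\<^sup>+x. (\<Sum>n. ennreal (2^n * (a n x)\<^sup>2)) \<partial>M) \<noteq> \<infinity>"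
    by (auto simp: top_unique)
  then have "AE x in M. (\<Sum>n. ennreal (2^n * (a n x)\<^sup>2)) \<noteq> \<infinity>"
    using a_meas by (intro nn_integral_PInf_AE) auto
  then show ?thesis
  proof eventually_elim
    case (elim x)
    have s1: "summable (\<lambda>n. 2^n * (a n x)\<^sup>2)"
      using elim by (intro summable_suminf_not_top) auto
    have "summable (\<lambda>n. a n x)"
    proof (rule summable_comparison_test[OF exI[of _ 0]], intro allI impI)
      show "summable (\<lambda>n. (1/2)^n + 2^n * (a n x)\<^sup>2)"
        by (intro summable_add s1 summable_geometric) auto
      fix n
      have "0 \<le> (1/2)^n * (1 - 2^n * a n x)\<^sup>2" by simp
      also have "\<dots> = (1/2)^n + 2^n * (a n x)\<^sup>2 - 2 * a n x"
        by (simp add: power2_eq_square algebra_simps power_one_over)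
      finally show "norm (a n x) \<le> (1/2)^n + 2^n * (a n x)\<^sup>2"
        using norm_ge_zero[of "f (Suc n) x - f n x"] unfolding a_def[symmetric] by simp
    qed
    then have "Cauchy (\<lambda>n. \<Sum>k<n. a k x)"
      by (simp add: summable_iff_convergent convergent_Cauchy)
    have le: "norm (f n x - f m x) \<le> norm ((\<Sum>k<n. a k x) - (\<Sum>k<m. a k x))" if "m \<le> n" for m n
      using that
    proof (induction n rule: dec_induct)
      case (step n)
      have "norm (f (Suc n) x - f m x) \<le> a n x + norm (f n x - f m x)"
        unfolding a_def by (metis norm_diff_triangle_le order_refl)
      also have "\<dots> \<le> a n x + norm ((\<Sum>k<n. a k x) - (\<Sum>k<m. a k x))" using step by simp
      also have "norm ((\<Sum>k<n. a k x) - (\<Sum>k<m. a k x)) = (\<Sum>k<n. a k x) - (\<Sum>k<m. a k x)"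
        using step by (simp add: a_def sum_mono2)
      also have "a n x + ((\<Sum>k<n. a k x) - (\<Sum>k<m. a k x)) \<le> norm ((\<Sum>k<Suc n. a k x) - (\<Sum>k<m. a k x))"
        by simp
      finally show ?case .
    qed simp
    have "Cauchy (\<lambda>n. f n x)"
    proof (rule CauchyI)
      fix e :: real assume "e > 0"
      then obtain N where N: "\<And>m n. m \<ge> N \<Longrightarrow> n \<ge> N \<Longrightarrow> norm ((\<Sum>k<m. a k x) - (\<Sum>k<n. a k x)) < e"
        using CauchyD[OF \<open>Cauchy (\<lambda>n. \<Sum>k<n. a k x)\<close>] by meson
      have "norm (f m x - f n x) < e" if "m \<ge> N" "n \<ge> N" for m n
        using le[of m n] le[of n m] N[of n m] N[of m n] that
        by (cases "m \<le> n") (auto simp: norm_minus_commute)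
      then show "\<exists>N. \<forall>m\<ge>N. \<forall>n\<ge>N. norm (f m x - f n x) < e" by blast
    qed
    then show ?case by (rule Cauchy_convergent)
  qed
qed

text \<open>The rapid decay provides a pointwise limit \<open>g\<close>. Fatou's lemma, applied to
  \<open>(norm (f k x - f n x))^2\<close> as \<open>k\<close> grows, carries the Cauchy bound over
  to \<open>g\<close>.\<close>

lemma sqint_complete:
  fixes f :: "nat \<Rightarrow> 'a \<Rightarrow> 'b::{real_normed_vector,complete_space}"
  assumes M: "complete_measure M" and f: "\<And>n. f n \<in> sqint M"
    and rapid: "\<And>n. (LINT x|M. (norm (f (Suc n) x - f n x))\<^sup>2) \<le> (1/4)^n"
    and Cauchy: "\<And>e. e > 0 \<Longrightarrow> \<exists>N. \<forall>n\<ge>N. \<forall>k\<ge>N. (LINT x|M. (norm (f k x - f n x))\<^sup>2) \<le> e"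
  obtains g where "g \<in> sqint M" "(\<lambda>n. LINT x|M. (norm (g x - f n x))\<^sup>2) \<longlonglongrightarrow> 0"
proof -
  define g where "g x = lim (\<lambda>n. f n x)" for x
  have lim: "AE x in M. (\<lambda>n. f n x) \<longlonglongrightarrow> g x"
    using sqint_rapid_AE_convergent[OF M f rapid]
    by eventually_elim (simp add: g_def convergent_LIMSEQ_iff)
  have gs: "strongly_measurable M g"
    using M sqint_strongly_measurable[OF f] lim by (rule strongly_measurable_LIMSEQ)
  have meas: "(\<lambda>x. (norm (g x - f n x))\<^sup>2) \<in> borel_measurable M" for n
    using strongly_measurable_norm[OF M strongly_measurable_diff[OF gs sqint_strongly_measurable[OF f[of n]]]]
    by simp
  have fatou: "\<exists>N. \<forall>n\<ge>N. (\<integral>\<^sup>+x. ennreal ((norm (g x - f n x))\<^sup>2) \<partial>M) \<le> ennreal e" if e: "e > 0" for e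
  proof -
    obtain N where N: "\<And>n k. n \<ge> N \<Longrightarrow> k \<ge> N \<Longrightarrow> (LINT x|M. (norm (f k x - f n x))\<^sup>2) \<le> e"
      using Cauchy[OF e] by blast
    have "(\<integral>\<^sup>+x. ennreal ((norm (g x - f n x))\<^sup>2) \<partial>M) \<le> ennreal e" if n: "n \<ge> N" for n
    proof -
      have "(\<integral>\<^sup>+x. ennreal ((norm (g x - f n x))\<^sup>2) \<partial>M) =
          (\<integral>\<^sup>+x. liminf (\<lambda>k. ennreal ((norm (f k x - f n x))\<^sup>2)) \<partial>M)"
      proof (rule nn_integral_cong_AE)
        show "AE x in M. ennreal ((norm (g x - f n x))\<^sup>2) = liminf (\<lambda>k. ennreal ((norm (f k x - f n x))\<^sup>2))"
          using lim
        proof eventually_elim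
          case (elim x)
          have "(\<lambda>k. ennreal ((norm (f k x - f n x))\<^sup>2)) \<longlonglongrightarrow> ennreal ((norm (g x - f n x))\<^sup>2)"
            by (intro tendsto_intros elim)
          then show ?case by (intro lim_imp_Liminf[symmetric]) auto
        qed
      qed
      also have "\<dots> \<le> liminf (\<lambda>k. \<integral>\<^sup>+x. ennreal ((norm (f k x - f n x))\<^sup>2) \<partial>M)"
      proof (rule nn_integral_liminf)
        fix k
        have "integrable M (\<lambda>x. (norm (f k x - f n x))\<^sup>2)" by (intro sqint_integrable sqint_diff M f)
        then show "(\<lambda>x. ennreal ((norm (f k x - f n x))\<^sup>2)) \<in> borel_measurable M" by simp
      qed
      also have "\<dots> \<le> ennreal e"
      proof (rule Liminf_le)
        have "(\<integral>\<^sup>+x. ennreal ((norm (f k x - f n x))\<^sup>2) \<partial>M) \<le> ennreal e" if "k \<ge> N" for k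
        proof -
          have "integrable M (\<lambda>x. (norm (f k x - f n x))\<^sup>2)" by (intro sqint_integrable sqint_diff M f)
          then show ?thesis
            using N[OF n that] by (subst nn_integral_eq_integral) (auto intro: ennreal_leI)
        qed
        then show "\<forall>\<^sub>F k in sequentially. (\<integral>\<^sup>+x. ennreal ((norm (f k x - f n x))\<^sup>2) \<partial>M) \<le> ennreal e"
          by (auto simp: eventually_sequentially)
      qed simp
      finally show ?thesis .
    qed
    then show ?thesis by blast
  qed
  obtain N where N: "(\<integral>\<^sup>+x. ennreal ((norm (g x - f N x))\<^sup>2) \<partial>M) \<le> ennreal 1"
    using fatou[of 1] by auto
  have "integrable M (\<lambda>x. (norm (g x - f N x))\<^sup>2)"
    using meas N by (intro integrableI_bounded) (auto simp: top_unique less_top[symmetric])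
  then have "(\<lambda>x. g x - f N x) \<in> sqint M"
    using strongly_measurable_diff[OF gs sqint_strongly_measurable[OF f]] by (simp add: sqint_def)
  from sqint_add[OF M this f[of N]] have g: "g \<in> sqint M" by simp
  have "(\<lambda>n. LINT x|M. (norm (g x - f n x))\<^sup>2) \<longlonglongrightarrow> 0"
  proof (rule metric_LIMSEQ_I)
    fix e :: real assume "e > 0"
    then obtain N where N: "\<And>n. n \<ge> N \<Longrightarrow> (\<integral>\<^sup>+x. ennreal ((norm (g x - f n x))\<^sup>2) \<partial>M) \<le> ennreal (e/2)"
      using fatou[of "e/2"] by auto
    have "dist (LINT x|M. (norm (g x - f n x))\<^sup>2) 0 < e" if "n \<ge> N" for n
    proof -
      have "integrable M (\<lambda>x. (norm (g x - f n x))\<^sup>2)" by (intro sqint_integrable sqint_diff M f g)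
      then have "ennreal (LINT x|M. (norm (g x - f n x))\<^sup>2) \<le> ennreal (e/2)"
        using N[OF that] by (subst (asm) nn_integral_eq_integral) auto
      then have "(LINT x|M. (norm (g x - f n x))\<^sup>2) \<le> e/2" using \<open>e > 0\<close> by (simp add: ennreal_le_iff)
      then show ?thesis using \<open>e > 0\<close> by (simp add: dist_real_def integral_nonneg_AE)
    qed
    then show "\<exists>N. \<forall>n\<ge>N. dist (LINT x|M. (norm (g x - f n x))\<^sup>2) 0 < e" by blast
  qed
  with g show ?thesis by (rule that)
qed

section \<open>The quotient by null sets and its Hilbert space structure\<close>

lemma complete_measure_lebesgue: "complete_measure lebesgue"
  by (rule completion.complete_measure_axioms)

text \<open>
  The underlying measure space is the whole line because a type cannot depend on \<open>T\<close>; functions on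
  \<open>[0,T]\<close> are extended by zero.
\<close>

quotient_type (overloaded) 'a bochner_L2 = "real \<Rightarrow> 'a::{real_inner,complete_space}" / partial:
  "\<lambda>f g. f \<in> sqint lebesgue \<and> g \<in> sqint lebesgue \<and> (AE t in lebesgue. f t = g t)"
proof (rule part_equivpI)
  show "\<exists>f::real \<Rightarrow> 'a. f \<in> sqint lebesgue \<and> f \<in> sqint lebesgue \<and> (AE t in lebesgue. f t = f t)"
    using sqint_zero by (intro exI[of _ "\<lambda>_. 0"]) auto
qed (auto intro!: sympI transpI elim: AE_mp)

lemma sqint_integral_eq_0_iff:
  assumes M: "complete_measure M" and f: "f \<in> sqint M"
  shows "(LINT x|M. inner (f x) (f x)) = 0 \<longleftrightarrow> (AE x in M. f x = 0)"
  by (subst integral_nonneg_eq_0_iff_AE) (use sqint_inner_integrable[OF M f f] in auto)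

instantiation bochner_L2 :: ("{real_inner,complete_space}") real_inner
begin

lift_definition zero_bochner_L2 :: "'a bochner_L2" is "\<lambda>t. 0"
  by (simp add: sqint_zero)

lift_definition plus_bochner_L2 :: "'a bochner_L2 \<Rightarrow> 'a bochner_L2 \<Rightarrow> 'a bochner_L2" is "\<lambda>f g t. f t + g t"
  by (auto intro: sqint_add complete_measure_lebesgue)

lift_definition minus_bochner_L2 :: "'a bochner_L2 \<Rightarrow> 'a bochner_L2 \<Rightarrow> 'a bochner_L2" is "\<lambda>f g t. f t - g t"
  by (auto intro: sqint_diff complete_measure_lebesgue)

lift_definition uminus_bochner_L2 :: "'a bochner_L2 \<Rightarrow> 'a bochner_L2" is "\<lambda>f t. - f t"
  by (auto intro: sqint_uminus)

lift_definition scaleR_bochner_L2 :: "real \<Rightarrow> 'a bochner_L2 \<Rightarrow> 'a bochner_L2" is "\<lambda>c f t. c *\<^sub>R f t"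
  by (auto intro: sqint_scaleR)

lift_definition inner_bochner_L2 :: "'a bochner_L2 \<Rightarrow> 'a bochner_L2 \<Rightarrow> real" is
  "\<lambda>f g. LINT t|lebesgue. inner (f t) (g t)"
proof -
  fix f f' g g' :: "real \<Rightarrow> 'a"
  assume f: "f \<in> sqint lebesgue \<and> f' \<in> sqint lebesgue \<and> (AE t in lebesgue. f t = f' t)"
    and g: "g \<in> sqint lebesgue \<and> g' \<in> sqint lebesgue \<and> (AE t in lebesgue. g t = g' t)"
  show "(LINT t|lebesgue. inner (f t) (g t)) = (LINT t|lebesgue. inner (f' t) (g' t))"
  proof (rule integral_cong_AE)
    show "(\<lambda>t. inner (f t) (g t)) \<in> borel_measurable lebesgue" "(\<lambda>t. inner (f' t) (g' t)) \<in> borel_measurable lebesgue"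
      using f g by (auto intro: borel_measurable_integrable sqint_inner_integrable complete_measure_lebesgue)
    show "AE t in lebesgue. inner (f t) (g t) = inner (f' t) (g' t)"
      using f g by auto
  qed
qed

definition norm_bochner_L2 :: "'a bochner_L2 \<Rightarrow> real" where
  "norm_bochner_L2 x = sqrt (inner x x)"

definition sgn_bochner_L2 :: "'a bochner_L2 \<Rightarrow> 'a bochner_L2" where
  "sgn_bochner_L2 x = inverse (norm x) *\<^sub>R x"

definition dist_bochner_L2 :: "'a bochner_L2 \<Rightarrow> 'a bochner_L2 \<Rightarrow> real" where
  "dist_bochner_L2 x y = norm (x - y)"

definition uniformity_bochner_L2 :: "('a bochner_L2 \<times> 'a bochner_L2) filter" where
  "uniformity_bochner_L2 = (INF e\<in>{0 <..}. principal {(x, y). dist x y < e})"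

definition open_bochner_L2 :: "'a bochner_L2 set \<Rightarrow> bool" where
  "open_bochner_L2 S \<longleftrightarrow> (\<forall>x\<in>S. \<forall>\<^sub>F (x', y) in uniformity. x' = x \<longrightarrow> y \<in> S)"

instance
proof
  fix x y z :: "'a bochner_L2" and a b :: real
  show "x + y + z = x + (y + z)"
    by transfer (auto intro!: sqint_add complete_measure_lebesgue simp: add.assoc)
  show "x + y = y + x"
    by transfer (auto intro!: sqint_add complete_measure_lebesgue simp: add.commute)
  show "0 + x = x" by transfer auto
  show "- x + x = 0"
    by transfer (auto intro!: sqint_add sqint_uminus complete_measure_lebesgue simp: sqint_zero)
  show "x - y = x + - y"
    by transfer (auto intro!: sqint_add sqint_diff sqint_uminus complete_measure_lebesgue)
  show "a *\<^sub>R (x + y) = a *\<^sub>R x + a *\<^sub>R y"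
    by transfer (auto intro!: sqint_add sqint_scaleR complete_measure_lebesgue simp: scaleR_add_right)
  show "(a + b) *\<^sub>R x = a *\<^sub>R x + b *\<^sub>R x"
    by transfer (auto intro!: sqint_add sqint_scaleR complete_measure_lebesgue simp: scaleR_add_left)
  show "a *\<^sub>R b *\<^sub>R x = (a * b) *\<^sub>R x"
    by transfer (auto intro!: sqint_scaleR complete_measure_lebesgue)
  show "1 *\<^sub>R x = x" by transfer auto
  show "dist x y = norm (x - y)" by (rule dist_bochner_L2_def)
  show "sgn x = inverse (norm x) *\<^sub>R x" by (rule sgn_bochner_L2_def)
  show "(uniformity :: ('a bochner_L2 \<times> 'a bochner_L2) filter) = (INF e\<in>{0 <..}. principal {(x, y). dist x y < e})"
    by (rule uniformity_bochner_L2_def)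
  show "open S = (\<forall>x\<in>S. \<forall>\<^sub>F (x', y) in uniformity. x' = x \<longrightarrow> y \<in> S)" for S :: "'a bochner_L2 set"
    by (rule open_bochner_L2_def)
  show "inner x y = inner y x" by transfer (simp add: inner_commute)
  show "inner (x + y) z = inner x z + inner y z"
    by transfer (auto simp: inner_add_left intro!: Bochner_Integration.integral_add
        sqint_inner_integrable complete_measure_lebesgue)
  show "inner (a *\<^sub>R x) y = a * inner x y" by transfer simp
  show "0 \<le> inner x x" by transfer (simp add: integral_nonneg_AE)
  show "(inner x x = 0) = (x = 0)"
    by transfer (auto simp: sqint_zero sqint_integral_eq_0_iff complete_measure_lebesgue)
  show "norm x = sqrt (inner x x)" by (rule norm_bochner_L2_def)
qed

end

lemma rep_bochner_L2_sqint: "rep_bochner_L2 x \<in> sqint lebesgue"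
  using Quotient3_rep_reflp[OF Quotient3_bochner_L2, of x] by simp

lemma abs_rep_bochner_L2: "abs_bochner_L2 (rep_bochner_L2 x) = x"
  by (rule Quotient3_abs_rep[OF Quotient3_bochner_L2])

lemma rep_abs_bochner_L2:
  assumes "f \<in> sqint lebesgue"
  shows "AE t in lebesgue. rep_bochner_L2 (abs_bochner_L2 f) t = f t"
  using rep_abs_rsp_left[OF Quotient3_bochner_L2, of f f] assms by simp

lemma inner_abs_bochner_L2:
  assumes "f \<in> sqint lebesgue" "g \<in> sqint lebesgue"
  shows "inner (abs_bochner_L2 f) (abs_bochner_L2 g) = (LINT t|lebesgue. inner (f t) (g t))"
  using assms by (simp add: inner_bochner_L2.abs_eq)

lemma inner_bochner_L2_rep:
  "inner x y = (LINT t|lebesgue. inner (rep_bochner_L2 x t) (rep_bochner_L2 y t))"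
  using inner_abs_bochner_L2[OF rep_bochner_L2_sqint[of x] rep_bochner_L2_sqint[of y]]
  by (simp add: abs_rep_bochner_L2)

lemma minus_abs_bochner_L2:
  assumes "f \<in> sqint lebesgue" "g \<in> sqint lebesgue"
  shows "abs_bochner_L2 f - abs_bochner_L2 g = abs_bochner_L2 (\<lambda>t. f t - g t)"
  using assms by (simp add: minus_bochner_L2.abs_eq)

lemma norm_abs_bochner_L2:
  assumes "f \<in> sqint lebesgue"
  shows "(norm (abs_bochner_L2 f))\<^sup>2 = (LINT t|lebesgue. (norm (f t))\<^sup>2)"
  using inner_abs_bochner_L2[OF assms assms] by (simp add: power2_norm_eq_inner)

lemma dist_bochner_L2_rep:
  "(dist x y)\<^sup>2 = (LINT t|lebesgue. (norm (rep_bochner_L2 x t - rep_bochner_L2 y t))\<^sup>2)"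
proof -
  have "x - y = abs_bochner_L2 (\<lambda>t. rep_bochner_L2 x t - rep_bochner_L2 y t)"
    using minus_abs_bochner_L2[OF rep_bochner_L2_sqint rep_bochner_L2_sqint, of x y]
    by (simp add: abs_rep_bochner_L2)
  then show ?thesis
    by (simp add: dist_norm norm_abs_bochner_L2 sqint_diff rep_bochner_L2_sqint complete_measure_lebesgue)
qed

lemma rep_add_bochner_L2:
  "AE t in lebesgue. rep_bochner_L2 (x + y) t = rep_bochner_L2 x t + rep_bochner_L2 y t"
proof -
  have "x + y = abs_bochner_L2 (\<lambda>t. rep_bochner_L2 x t + rep_bochner_L2 y t)"
    using plus_bochner_L2.abs_eq[of "rep_bochner_L2 x" "rep_bochner_L2 y"]
    by (simp add: rep_bochner_L2_sqint abs_rep_bochner_L2)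
  then show ?thesis
    by (simp add: rep_abs_bochner_L2 sqint_add rep_bochner_L2_sqint complete_measure_lebesgue)
qed

lemma rep_scaleR_bochner_L2:
  "AE t in lebesgue. rep_bochner_L2 (c *\<^sub>R x) t = c *\<^sub>R rep_bochner_L2 x t"
proof -
  have "c *\<^sub>R x = abs_bochner_L2 (\<lambda>t. c *\<^sub>R rep_bochner_L2 x t)"
    using scaleR_bochner_L2.abs_eq[of "rep_bochner_L2 x" c]
    by (simp add: rep_bochner_L2_sqint abs_rep_bochner_L2)
  then show ?thesis
    by (simp add: rep_abs_bochner_L2 sqint_scaleR rep_bochner_L2_sqint)
qed

text \<open>A Cauchy sequence is thinned out until consecutive distances are at most
  \<open>(1/2)^k\<close>; squaring gives the \<open>(1/4)^k\<close> of
  \<open>sqint_complete\<close>. Convergence of the subsequence suffices.\<close>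

instance bochner_L2 :: ("{real_inner,complete_space}") complete_space
proof
  fix X :: "nat \<Rightarrow> 'a bochner_L2" assume X: "Cauchy X"
  have "\<exists>N. \<forall>m\<ge>N. \<forall>n\<ge>N. dist (X m) (X n) < (1/2)^k" for k
    using metric_CauchyD[OF X, of "(1/2)^k"] by simp
  then obtain N where N: "\<And>k m n. m \<ge> N k \<Longrightarrow> n \<ge> N k \<Longrightarrow> dist (X m) (X n) < (1/2)^k"
    by metis
  define r where "r = rec_nat (N 0) (\<lambda>k m. max (Suc m) (N (Suc k)))"
  have "r k < r (Suc k)" for k by (simp add: r_def)
  then have r: "strict_mono r" by (rule strict_monoI_Suc)
  have rN: "N k \<le> r k" for k by (cases k) (simp_all add: r_def)
  define f where "f k = rep_bochner_L2 (X (r k))" for k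
  have dist_f: "(LINT t|lebesgue. (norm (f k t - f m t))\<^sup>2) = (dist (X (r k)) (X (r m)))\<^sup>2" for k m
    by (simp add: f_def dist_bochner_L2_rep)
  obtain g where g: "g \<in> sqint lebesgue" "(\<lambda>n. LINT t|lebesgue. (norm (g t - f n t))\<^sup>2) \<longlonglongrightarrow> 0"
  proof (rule sqint_complete[OF complete_measure_lebesgue, of f])
    show "f n \<in> sqint lebesgue" for n by (simp add: f_def rep_bochner_L2_sqint)
    show "(LINT t|lebesgue. (norm (f (Suc n) t - f n t))\<^sup>2) \<le> (1/4)^n" for n
    proof -
      have "N n \<le> r (Suc n)" using rN[of n] strict_monoD[OF r, of n "Suc n"] by simp
      then have "(dist (X (r (Suc n))) (X (r n)))\<^sup>2 \<le> ((1/2)^n)\<^sup>2"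
        using N[of n "r (Suc n)" "r n"] rN[of n] by (intro power_mono) auto
      then show ?thesis by (simp add: dist_f power_mult[symmetric] mult.commute[of n] power_mult[of _ 2] power_one_over)
    qed
    show "\<exists>N. \<forall>n\<ge>N. \<forall>k\<ge>N. (LINT t|lebesgue. (norm (f k t - f n t))\<^sup>2) \<le> e" if "e > 0" for e
    proof -
      obtain K where K: "\<And>m n. m \<ge> K \<Longrightarrow> n \<ge> K \<Longrightarrow> dist (X m) (X n) < sqrt e"
        using metric_CauchyD[OF X, of "sqrt e"] \<open>e > 0\<close> by auto
      have "(LINT t|lebesgue. (norm (f k t - f n t))\<^sup>2) \<le> e" if "n \<ge> K" "k \<ge> K" for n k
      proof -
        have "r n \<ge> K" "r k \<ge> K" using that seq_suble[OF r] order_trans by blast+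
        then have "(dist (X (r k)) (X (r n)))\<^sup>2 \<le> (sqrt e)\<^sup>2"
          using K[of "r k" "r n"] by (intro power_mono) auto
        then show ?thesis using \<open>e > 0\<close> by (simp add: dist_f)
      qed
      then show ?thesis by blast
    qed
  qed
  have "(\<lambda>n. (dist (X (r n)) (abs_bochner_L2 g))\<^sup>2) \<longlonglongrightarrow> 0"
  proof -
    have "(dist (X (r n)) (abs_bochner_L2 g))\<^sup>2 = (LINT t|lebesgue. (norm (g t - f n t))\<^sup>2)" for n
    proof -
      have "abs_bochner_L2 g - X (r n) = abs_bochner_L2 (\<lambda>t. g t - f n t)"
        using minus_abs_bochner_L2[OF g(1) rep_bochner_L2_sqint, of "X (r n)"]
        by (simp add: abs_rep_bochner_L2 f_def)
      then show ?thesis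
        by (subst dist_commute) (simp add: dist_norm norm_abs_bochner_L2 sqint_diff g(1) f_def
            rep_bochner_L2_sqint complete_measure_lebesgue)
    qed
    then show ?thesis using g(2) by simp
  qed
  then have "(\<lambda>n. sqrt ((dist (X (r n)) (abs_bochner_L2 g))\<^sup>2)) \<longlonglongrightarrow> sqrt 0" by (intro tendsto_intros)
  then have "(X \<circ> r) \<longlonglongrightarrow> abs_bochner_L2 g"
    by (subst tendsto_dist_iff) (simp add: o_def)
  then show "convergent X"
    using X r by (metis Cauchy_converges_subseq convergentI)
qed

subsection \<open>Functions of one real variable\<close>

text \<open>
  This stands in for the fundamental theorem of calculus for absolutely continuous functions: product
  rule, chain rule and energy inequality only need increments that are controlled up to \<open>\<delta>\<close> times the
  increment of a fixed function.
\<close>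

lemma local_increase_imp_le:
  fixes \<Phi> G :: "real \<Rightarrow> real"
  assumes "a \<le> b"
    and loc: "\<And>\<delta>. \<delta> > 0 \<Longrightarrow> \<exists>\<eta>>0. \<forall>s t. a \<le> s \<longrightarrow> s \<le> t \<longrightarrow> t \<le> b \<longrightarrow> t - s < \<eta> \<longrightarrow>
      \<Phi> s - \<Phi> t \<le> \<delta> * (G t - G s)"
  shows "\<Phi> a \<le> \<Phi> b"
proof -
  have *: "\<Phi> a - \<Phi> b \<le> \<delta> * (G b - G a)" if "\<delta> > 0" for \<delta>
  proof -
    obtain \<eta> where \<eta>: "\<eta> > 0" "\<And>s t. a \<le> s \<Longrightarrow> s \<le> t \<Longrightarrow> t \<le> b \<Longrightarrow> t - s < \<eta> \<Longrightarrow>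
        \<Phi> s - \<Phi> t \<le> \<delta> * (G t - G s)"
      using loc[OF \<open>\<delta> > 0\<close>] by blast
    \<comment> \<open>An equidistant partition with step below \<open>\<eta>\<close>, over which the
      local inequality telescopes on both sides.\<close>
    obtain n :: nat where n: "n > (b - a) / \<eta>" using reals_Archimedean2 by blast
    then have n0: "0 < real n" using \<open>a \<le> b\<close> \<eta>(1) by (smt (verit) divide_nonneg_pos)
    define h where "h = (b - a) / n"
    have h: "0 \<le> h" "h < \<eta>" "a + n * h = b"
      using n0 n \<open>a \<le> b\<close> \<eta>(1) by (auto simp: h_def field_simps)
    have "\<Phi> a - \<Phi> (a + k * h) \<le> \<delta> * (G (a + k * h) - G a)" if "k \<le> n" for k :: nat
      using that
    proof (induction k)
      case (Suc k)
      have "real (Suc k) * h \<le> n * h" using Suc.prems h(1) by (intro mult_right_mono) auto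
      then have "\<Phi> (a + k * h) - \<Phi> (a + Suc k * h) \<le> \<delta> * (G (a + Suc k * h) - G (a + k * h))"
        using h by (intro \<eta>(2)) (auto simp: algebra_simps)
      moreover have "\<Phi> a - \<Phi> (a + k * h) \<le> \<delta> * (G (a + k * h) - G a)" using Suc by simp
      ultimately show ?case by (simp add: algebra_simps)
    qed simp
    from this[of n] show ?thesis using h by simp
  qed
  \<comment> \<open>The sign of the total increment of \<open>G\<close> is unknown. If it is
    positive, \<delta> is sent to 0; otherwise the value 1 for \<delta> already gives the
    claim.\<close>
  show ?thesis
  proof (cases "G b - G a > 0")
    case True
    have "\<Phi> a \<le> \<Phi> b + e" if "e > 0" for e
      using *[of "e / (G b - G a)"] True that by simp
    then show ?thesis by (rule field_le_epsilon)
  next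
    case False
    then show ?thesis using *[of 1] by simp
  qed
qed

lemma local_constant_imp_eq:
  fixes \<Phi> G :: "real \<Rightarrow> real"
  assumes "a \<le> b"
    and loc: "\<And>\<delta>. \<delta> > 0 \<Longrightarrow> \<exists>\<eta>>0. \<forall>s t. a \<le> s \<longrightarrow> s \<le> t \<longrightarrow> t \<le> b \<longrightarrow> t - s < \<eta> \<longrightarrow>
      \<bar>\<Phi> t - \<Phi> s\<bar> \<le> \<delta> * (G t - G s)"
  shows "\<Phi> a = \<Phi> b"
proof -
  have "c * \<Phi> a \<le> c * \<Phi> b" if c: "\<bar>c\<bar> = 1" for c
  proof (rule local_increase_imp_le[OF assms(1)])
    fix \<delta> :: real assume "\<delta> > 0"
    from loc[OF this] obtain \<eta> where \<eta>: "\<eta> > 0" "\<forall>s t. a \<le> s \<longrightarrow> s \<le> t \<longrightarrow> t \<le> b \<longrightarrow> t - s < \<eta> \<longrightarrow>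
      \<bar>\<Phi> t - \<Phi> s\<bar> \<le> \<delta> * (G t - G s)" by blast
    have "c * \<Phi> s - c * \<Phi> t \<le> \<bar>\<Phi> t - \<Phi> s\<bar>" for s t
    proof -
      have "c = 1 \<or> c = - 1" using c by (simp add: abs_if split: if_splits)
      then show ?thesis by auto
    qed
    then show "\<exists>\<eta>>0. \<forall>s t. a \<le> s \<longrightarrow> s \<le> t \<longrightarrow> t \<le> b \<longrightarrow> t - s < \<eta> \<longrightarrow>
      c * \<Phi> s - c * \<Phi> t \<le> \<delta> * (G t - G s)"
      using \<eta> order_trans by blast
  qed
  from this[of 1] this[of "-1"] show ?thesis by simp
qed

lemma leb_integrable_on:
  fixes g :: "real \<Rightarrow> real"
  assumes g: "integrable (leb T) g" and "0 \<le> s" "t \<le> T"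
  shows "g integrable_on {s..t}"
proof -
  have "g integrable_on {0..T}" by (rule integrable_on_lebesgue_on[OF g]) simp
  then show ?thesis by (rule integrable_on_subinterval) (use assms in auto)
qed

lemma leb_integral:
  fixes g :: "real \<Rightarrow> real"
  assumes "integrable (leb T) g"
  shows "(LINT t|leb T. g t) = integral {0..T} g"
  by (rule lebesgue_integral_eq_integral[OF assms]) simp

lemma complete_measure_leb: "complete_measure (leb T)"
  by (rule complete_measure_lebesgue_on) simp

lemma continuous_leb_measurable:
  fixes c :: "real \<Rightarrow> real"
  shows "continuous_on {0..T} c \<Longrightarrow> c \<in> borel_measurable (leb T)"
  by (rule continuous_imp_measurable_on_sets_lebesgue) auto

lemma integrable_continuous_mult:
  fixes c g :: "real \<Rightarrow> real"
  assumes c: "continuous_on {0..T} c" and g: "integrable (leb T) g"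
  shows "integrable (leb T) (\<lambda>x. c x * g x)"
proof -
  have "bounded (c ` {0..T})"
    by (intro compact_imp_bounded compact_continuous_image c) simp
  then obtain K where "\<forall>y\<in>c ` {0..T}. norm y \<le> K" unfolding bounded_iff by blast
  then have K: "\<And>x. x \<in> {0..T} \<Longrightarrow> \<bar>c x\<bar> \<le> K" by simp
  show ?thesis
  proof (rule Bochner_Integration.integrable_bound)
    show "integrable (leb T) (\<lambda>x. K * \<bar>g x\<bar>)" using g by simp
    show "(\<lambda>x. c x * g x) \<in> borel_measurable (leb T)"
      using continuous_leb_measurable[OF c] g by simp
    show "AE x in leb T. norm (c x * g x) \<le> norm (K * \<bar>g x\<bar>)"
    proof (rule AE_I2)
      fix x assume "x \<in> space (leb T)"
      then have "\<bar>c x\<bar> \<le> K" using K by simp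
      then show "norm (c x * g x) \<le> norm (K * \<bar>g x\<bar>)"
        by (simp add: abs_mult mult_right_mono)
    qed
  qed
qed

lemma integral_interval_diff:
  fixes g :: "real \<Rightarrow> real"
  assumes "g integrable_on {a..t}" "a \<le> s" "s \<le> t"
  shows "integral {a..t} g - integral {a..s} g = integral {s..t} g"
  using Henstock_Kurzweil_Integration.integral_combine[OF assms(2,3,1)] by simp

lemma uniformly_continuous_interval:
  fixes f :: "real \<Rightarrow> 'a::metric_space"
  assumes "continuous_on {a..b} f" "e > 0"
  obtains d where "d > 0" "\<And>x y. x \<in> {a..b} \<Longrightarrow> y \<in> {a..b} \<Longrightarrow> \<bar>x - y\<bar> < d \<Longrightarrow> dist (f x) (f y) < e"
proof -
  have "uniformly_continuous_on {a..b} f"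
    by (rule compact_uniformly_continuous[OF assms(1)]) simp
  then obtain d where "d > 0" "\<And>x y. x \<in> {a..b} \<Longrightarrow> y \<in> {a..b} \<Longrightarrow> dist y x < d \<Longrightarrow> dist (f y) (f x) < e"
    using assms(2) unfolding uniformly_continuous_on_def by metis
  then show ?thesis using that[of d] by (simp add: dist_real_def)
qed

lemma continuous_primitive:
  fixes g :: "real \<Rightarrow> real"
  assumes "integrable (leb T) g"
  shows "continuous_on {0..T} (\<lambda>t. integral {0..t} g)"
  using leb_integrable_on[OF assms, of 0 T] by (intro indefinite_integral_continuous_1) simp

text \<open>Since \<open>g\<close> is merely integrable, its primitive \<open>G\<close> need not be
  differentiable everywhere. On a short interval, replacing the factors \<open>\<phi>\<close> and
  \<open>G\<close> by end point values costs \<delta> times the integral of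
  \<open>\<bar>g x\<bar> + \<bar>\<phi>' x\<bar>\<close>, by uniform continuity of both.\<close>

lemma integration_by_parts_primitive:
  fixes g \<phi> \<phi>' :: "real \<Rightarrow> real"
  assumes T: "0 \<le> T" and g: "integrable (leb T) g"
    and \<phi>: "\<And>x. x \<in> {0..T} \<Longrightarrow> (\<phi> has_real_derivative \<phi>' x) (at x within {0..T})"
    and \<phi>': "continuous_on {0..T} \<phi>'"
  shows "\<phi> T * integral {0..T} g =
    integral {0..T} (\<lambda>x. \<phi>' x * integral {0..x} g) + integral {0..T} (\<lambda>x. \<phi> x * g x)"
proof -
  define G where "G t = integral {0..t} g" for t
  have G: "continuous_on {0..T} G" unfolding G_def by (rule continuous_primitive[OF g])
  have \<phi>c: "continuous_on {0..T} \<phi>" by (rule DERIV_continuous_on[OF \<phi>])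
  have i1: "integrable (leb T) (\<lambda>x. \<phi>' x * G x)"
    by (intro continuous_imp_integrable_real continuous_intros \<phi>' G)
  have i2: "integrable (leb T) (\<lambda>x. \<phi> x * g x)" by (rule integrable_continuous_mult[OF \<phi>c g])
  have i3: "integrable (leb T) (\<lambda>x. \<bar>g x\<bar> + \<bar>\<phi>' x\<bar>)"
  proof (rule Bochner_Integration.integrable_add)
    show "integrable (leb T) (\<lambda>x. \<bar>\<phi>' x\<bar>)" by (intro continuous_imp_integrable_real continuous_intros \<phi>')
  qed (use g in simp)
  define \<Phi> where "\<Phi> t = \<phi> t * G t - integral {0..t} (\<lambda>x. \<phi>' x * G x) - integral {0..t} (\<lambda>x. \<phi> x * g x)" for t
  have "\<Phi> 0 = \<Phi> T"
  proof (rule local_constant_imp_eq[OF T, of _ "\<lambda>t. integral {0..t} (\<lambda>x. \<bar>g x\<bar> + \<bar>\<phi>' x\<bar>)"])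
    fix \<delta> :: real assume \<delta>: "\<delta> > 0"
    obtain d1 where d1: "d1 > 0" "\<And>x y. x \<in> {0..T} \<Longrightarrow> y \<in> {0..T} \<Longrightarrow> \<bar>x - y\<bar> < d1 \<Longrightarrow> dist (\<phi> x) (\<phi> y) < \<delta>"
      using uniformly_continuous_interval[OF \<phi>c \<delta>] by metis
    obtain d2 where d2: "d2 > 0" "\<And>x y. x \<in> {0..T} \<Longrightarrow> y \<in> {0..T} \<Longrightarrow> \<bar>x - y\<bar> < d2 \<Longrightarrow> dist (G x) (G y) < \<delta>"
      using uniformly_continuous_interval[OF G \<delta>] by metis
    have "\<bar>\<Phi> t - \<Phi> s\<bar> \<le> \<delta> * (integral {0..t} (\<lambda>x. \<bar>g x\<bar> + \<bar>\<phi>' x\<bar>) - integral {0..s} (\<lambda>x. \<bar>g x\<bar> + \<bar>\<phi>' x\<bar>))"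
      if st: "0 \<le> s" "s \<le> t" "t \<le> T" "t - s < min d1 d2" for s t
    proof -
      note io = leb_integrable_on[OF _ \<open>0 \<le> s\<close> \<open>t \<le> T\<close>] and io0 = leb_integrable_on[OF _ order_refl \<open>t \<le> T\<close>]
      note df = integral_interval_diff[OF io0 \<open>0 \<le> s\<close> \<open>s \<le> t\<close>]
      have d\<phi>: "((\<lambda>x. \<phi>' x) has_integral (\<phi> t - \<phi> s)) {s..t}"
        using st by (intro fundamental_theorem_of_calculus)
          (auto intro!: DERIV_subset[OF \<phi>] simp: has_real_derivative_iff_has_vector_derivative[symmetric])
      have dG: "G t - G s = integral {s..t} g" unfolding G_def by (rule df[OF g])
      have "\<Phi> t - \<Phi> s = \<phi> t * (G t - G s) + (\<phi> t - \<phi> s) * G s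
          - integral {s..t} (\<lambda>x. \<phi>' x * G x) - integral {s..t} (\<lambda>x. \<phi> x * g x)"
        using df[OF i1] df[OF i2] by (simp add: \<Phi>_def algebra_simps)
      also have "\<phi> t * (G t - G s) = integral {s..t} (\<lambda>x. \<phi> t * g x)"
        unfolding dG by simp
      also have "(\<phi> t - \<phi> s) * G s = integral {s..t} (\<lambda>x. \<phi>' x * G s)"
        using integral_unique[OF d\<phi>] by simp
      also have "integral {s..t} (\<lambda>x. \<phi> t * g x) + integral {s..t} (\<lambda>x. \<phi>' x * G s)
          - integral {s..t} (\<lambda>x. \<phi>' x * G x) - integral {s..t} (\<lambda>x. \<phi> x * g x) =
          integral {s..t} (\<lambda>x. (\<phi> t * g x + \<phi>' x * G s) - \<phi>' x * G x - \<phi> x * g x)"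
        using io[OF i1] io[OF i2] io[OF g] has_integral_integrable[OF d\<phi>]
        by (intro integral_unique[symmetric] has_integral_diff has_integral_add integrable_integral)
          (auto intro: integrable_on_mult_right integrable_on_mult_left)
      finally have eq: "\<Phi> t - \<Phi> s = integral {s..t} (\<lambda>x. (\<phi> t * g x + \<phi>' x * G s) - \<phi>' x * G x - \<phi> x * g x)" .
      have "norm (\<Phi> t - \<Phi> s) \<le> integral {s..t} (\<lambda>x. \<delta> * (\<bar>g x\<bar> + \<bar>\<phi>' x\<bar>))"
        unfolding eq
      proof (rule integral_norm_bound_integral)
        show "(\<lambda>x. (\<phi> t * g x + \<phi>' x * G s) - \<phi>' x * G x - \<phi> x * g x) integrable_on {s..t}"
          using io[OF i1] io[OF i2] io[OF g] has_integral_integrable[OF d\<phi>]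
          by (intro integrable_diff integrable_add) (auto intro: integrable_on_mult_right integrable_on_mult_left)
        show "(\<lambda>x. \<delta> * (\<bar>g x\<bar> + \<bar>\<phi>' x\<bar>)) integrable_on {s..t}"
          using io[OF i3] by (rule integrable_on_mult_right)
        fix x assume x: "x \<in> {s..t}"
        have "\<bar>\<phi> t - \<phi> x\<bar> \<le> \<delta>" "\<bar>G s - G x\<bar> \<le> \<delta>"
          using d1(2)[of t x] d2(2)[of s x] x st by (auto simp: dist_real_def)
        then have "\<bar>(\<phi> t - \<phi> x) * g x\<bar> \<le> \<delta> * \<bar>g x\<bar>" "\<bar>(G s - G x) * \<phi>' x\<bar> \<le> \<delta> * \<bar>\<phi>' x\<bar>"
          by (auto simp: abs_mult intro!: mult_right_mono)
        then show "norm ((\<phi> t * g x + \<phi>' x * G s) - \<phi>' x * G x - \<phi> x * g x) \<le> \<delta> * (\<bar>g x\<bar> + \<bar>\<phi>' x\<bar>)"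
          by (simp add: algebra_simps)
      qed
      then show ?thesis using df[OF i3] by simp
    qed
    then show "\<exists>\<eta>>0. \<forall>s t. 0 \<le> s \<longrightarrow> s \<le> t \<longrightarrow> t \<le> T \<longrightarrow> t - s < \<eta> \<longrightarrow> \<bar>\<Phi> t - \<Phi> s\<bar> \<le>
        \<delta> * (integral {0..t} (\<lambda>x. \<bar>g x\<bar> + \<bar>\<phi>' x\<bar>) - integral {0..s} (\<lambda>x. \<bar>g x\<bar> + \<bar>\<phi>' x\<bar>))"
      using d1(1) d2(1) by (intro exI[of _ "min d1 d2"]) auto
  qed
  then show ?thesis by (simp add: \<Phi>_def G_def)
qed

subsection \<open>Test functions\<close>

text \<open>The regularity half of \<open>test_function\<close>, separated from the support
  condition.\<close>

definition smooth :: "(real \<Rightarrow> real) \<Rightarrow> bool" where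
  "smooth f \<longleftrightarrow> (\<forall>n. (deriv ^^ n) f differentiable_on UNIV)"

text \<open>Membership in a class closed under \<open>deriv\<close> replaces a formula for the n-th
  derivative. Products, affine substitutions and the flat exponential each get a class of their
  own.\<close>

lemma smooth_coinduct:
  assumes "f \<in> F" "\<And>f. f \<in> F \<Longrightarrow> f differentiable_on UNIV \<and> deriv f \<in> F"
  shows "smooth f"
proof -
  have "(deriv ^^ n) f \<in> F" for n
    by (induction n) (use assms in auto)
  then show ?thesis using assms(2) by (auto simp: smooth_def)
qed

lemma smooth_deriv: "smooth f \<Longrightarrow> smooth (deriv f)"
  unfolding smooth_def by (metis funpow_Suc_right comp_apply)

lemma smooth_DERIV: "smooth f \<Longrightarrow> (f has_real_derivative deriv f x) (at x)"
proof -
  assume "smooth f"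
  then have "f differentiable_on UNIV" unfolding smooth_def by (metis funpow_0)
  then show ?thesis
    by (simp add: differentiable_on_def field_differentiable_def real_differentiable_def DERIV_deriv_iff_real_differentiable)
qed

lemma smooth_continuous: "smooth f \<Longrightarrow> continuous_on S f"
  using smooth_DERIV by (meson DERIV_isCont continuous_at_imp_continuous_on)

lemma smooth_const: "smooth (\<lambda>x. c)"
  by (rule smooth_coinduct[of _ "range (\<lambda>c x. c)"]) auto

lemma smooth_family:
  assumes "f \<in> F" "\<And>f. f \<in> F \<Longrightarrow> \<exists>f'\<in>F. \<forall>x. (f has_real_derivative f' x) (at x)"
  shows "smooth f"
proof (rule smooth_coinduct[OF assms(1)])
  fix f assume "f \<in> F"
  then obtain f' where f': "f' \<in> F" "\<And>x. (f has_real_derivative f' x) (at x)"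
    using assms(2) by blast
  then have "deriv f = f'" by (auto intro: DERIV_imp_deriv)
  then show "f differentiable_on UNIV \<and> deriv f \<in> F"
    using f' by (auto simp: differentiable_on_def real_differentiable_def)
qed

text \<open>Leibniz' rule without binomial sums: finite sums of products are closed under
  differentiation. A sum of two smooth functions is the case with both second factors equal to
  1.\<close>

inductive_set smooth_products :: "(real \<Rightarrow> real) set" where
  mult: "smooth f \<Longrightarrow> smooth g \<Longrightarrow> (\<lambda>x. f x * g x) \<in> smooth_products"
| add: "u \<in> smooth_products \<Longrightarrow> v \<in> smooth_products \<Longrightarrow> (\<lambda>x. u x + v x) \<in> smooth_products"

lemma smooth_productsD: "u \<in> smooth_products \<Longrightarrow> smooth u"
proof (rule smooth_family)
  fix u assume "u \<in> smooth_products"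
  then show "\<exists>u'\<in>smooth_products. \<forall>x. (u has_real_derivative u' x) (at x)"
  proof induction
    case (mult f g)
    have "(\<lambda>x. deriv f x * g x + deriv g x * f x) \<in> smooth_products"
      using mult by (intro smooth_products.intros smooth_deriv)
    then show ?case
      using mult by (intro bexI) (auto intro!: DERIV_mult smooth_DERIV)
  next
    case (add u v)
    then obtain u' v' where "u' \<in> smooth_products" "\<forall>x. (u has_real_derivative u' x) (at x)"
      "v' \<in> smooth_products" "\<forall>x. (v has_real_derivative v' x) (at x)" by blast
    then show ?case
      by (intro bexI[of _ "\<lambda>x. u' x + v' x"]) (auto intro!: DERIV_add smooth_products.intros)
  qed
qed

lemma smooth_mult: "smooth f \<Longrightarrow> smooth g \<Longrightarrow> smooth (\<lambda>x. f x * g x)"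
  by (rule smooth_productsD[OF smooth_products.mult])

lemma smooth_add: "smooth f \<Longrightarrow> smooth g \<Longrightarrow> smooth (\<lambda>x. f x + g x)"
  using smooth_productsD[OF smooth_products.add[OF smooth_products.mult smooth_products.mult]]
    smooth_const[of 1] by (metis (no_types, lifting) ext mult.right_neutral)

text \<open>In the class used here the factor \<open>k\<close> absorbs the powers of
  \<open>b\<close> that the chain rule produces.\<close>

lemma smooth_affine:
  assumes "smooth f"
  shows "smooth (\<lambda>x. f (a + b * x))"
proof (rule smooth_family)
  show "(\<lambda>x. f (a + b * x)) \<in> {\<lambda>x. k * g (a + b * x) | k g. smooth g}"
    using assms by (auto intro!: exI[of _ 1] exI[of _ f])
  fix h assume "h \<in> {\<lambda>x. k * g (a + b * x) | k g. smooth g}"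
  then obtain k g where h: "h = (\<lambda>x. k * g (a + b * x))" "smooth g" by auto
  have "(h has_real_derivative (k * b) * deriv g (a + b * x)) (at x)" for x
    unfolding h(1) by (rule derivative_eq_intros DERIV_chain2[OF smooth_DERIV[OF h(2)]] refl)+ simp
  moreover have "(\<lambda>x. (k * b) * deriv g (a + b * x)) \<in> {\<lambda>x. k * g (a + b * x) | k g. smooth g}"
    using smooth_deriv[OF h(2)] by blast
  ultimately show "\<exists>f'\<in>{\<lambda>x. k * g (a + b * x) | k g. smooth g}. \<forall>x. (h has_real_derivative f' x) (at x)"
    by (intro bexI[rotated]) auto
qed

section \<open>Bump functions\<close>

lemma poly_exp_tendsto_0: "((\<lambda>y. poly Q y * exp (- y)) \<longlongrightarrow> (0::real)) at_top"
proof -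
  have "((\<lambda>y. \<Sum>i\<le>degree Q. coeff Q i * (y ^ i / exp y)) \<longlongrightarrow> (\<Sum>i\<le>degree Q. coeff Q i * 0)) at_top"
    by (intro tendsto_intros tendsto_power_div_exp_0)
  then show ?thesis
    by (simp add: poly_altdef sum_distrib_right sum_divide_distrib exp_minus field_simps)
qed

text \<open>The functions \<open>poly P (1/x) * exp (- (1/x))\<close>, continued by 0, are closed
  under differentiation. At 0 the right difference quotient is
  \<open>y * poly P y * exp (- y)\<close> with \<open>y = 1/h\<close>, which tends to 0.\<close>

lemma smooth_exp_inverse: "smooth (\<lambda>x. if x > 0 then exp (- (1 / x)) else 0)"
proof (rule smooth_family)
  define f where "f P x = (if x > 0 then poly P (1 / x) * exp (- (1 / x)) else (0::real))" for P x
  show "(\<lambda>x. if x > 0 then exp (- (1 / x)) else 0) \<in> range f"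
    by (rule range_eqI[of _ _ "[:1:]"]) (auto simp: f_def)
  fix h assume "h \<in> range f"
  then obtain P where h: "h = f P" by auto
  \<comment> \<open>With \<open>y = 1/x\<close> the inner derivative is \<open>- y^2\<close>, so the
    new polynomial factor is \<open>y^2 * (P - P')(y)\<close>; each \<open>pCons 0\<close>
    multiplies by \<open>y\<close>.\<close>
  define Q where "Q = pCons 0 (pCons 0 (P - pderiv P))"
  have "(f P has_real_derivative f Q x) (at x)" for x
  proof -
    consider "x > 0" | "x < 0" | "x = 0" by linarith
    then show ?thesis
    proof cases
      case 1
      have "((\<lambda>x. poly P (1 / x) * exp (- (1 / x))) has_real_derivative f Q x) (at x)"
        using 1 by (auto intro!: derivative_eq_intros DERIV_chain2[OF poly_DERIV]
            simp: f_def Q_def field_simps power2_eq_square)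
      then show ?thesis
        by (rule has_field_derivative_transform_within_open[of _ _ _ "{0<..}"]) (use 1 in \<open>auto simp: f_def\<close>)
    next
      case 2
      have "((\<lambda>x. 0) has_real_derivative f Q x) (at x)" using 2 by (simp add: f_def)
      then show ?thesis
        by (rule has_field_derivative_transform_within_open[of _ _ _ "{..<0}"]) (use 2 in \<open>auto simp: f_def\<close>)
    next
      case 3
      have "((\<lambda>h. f P h / h) \<longlongrightarrow> 0) (at_left 0)"
        by (rule Lim_transform_eventually[OF tendsto_const]) (auto simp: f_def eventually_at_filter)
      moreover have "((\<lambda>h. f P h / h) \<longlongrightarrow> 0) (at_right 0)"
      proof (rule Lim_transform_eventually)
        show "((\<lambda>h. poly (pCons 0 P) (inverse h) * exp (- inverse h)) \<longlongrightarrow> 0) (at_right 0)"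
          by (rule filterlim_compose[OF poly_exp_tendsto_0 filterlim_inverse_at_top_right])
        show "\<forall>\<^sub>F h in at_right 0. poly (pCons 0 P) (inverse h) * exp (- inverse h) = f P h / h"
          by (auto simp: eventually_at_right_less f_def field_simps eventually_at_filter)
      qed
      ultimately have "((\<lambda>h. f P h / h) \<longlongrightarrow> 0) (at 0)" by (rule filterlim_split_at)
      then show ?thesis unfolding 3 DERIV_def by (simp add: f_def)
    qed
  qed
  then show "\<exists>f'\<in>range f. \<forall>x. (h has_real_derivative f' x) (at x)" unfolding h by blast
qed

lemma smooth_bump:
  fixes s h :: real
  assumes "h > 0"
  obtains \<beta> where "smooth \<beta>" "\<And>x. \<beta> x \<ge> 0" "\<And>x. x \<notin> {s<..<s + h} \<Longrightarrow> \<beta> x = 0"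
    "\<And>x. x \<in> {s<..<s + h} \<Longrightarrow> \<beta> x > 0"
proof -
  define \<psi> :: "real \<Rightarrow> real" where "\<psi> x = (if x > 0 then exp (- (1 / x)) else 0)" for x
  have \<psi>: "smooth \<psi>" using smooth_exp_inverse by (simp add: \<psi>_def[abs_def])
  have "smooth (\<lambda>x. \<psi> (- s + 1 * x) * \<psi> ((s + h) + (- 1) * x))"
    by (intro smooth_mult smooth_affine \<psi>)
  then show ?thesis
    by (rule that) (auto simp: \<psi>_def)
qed

text \<open>Integrals against normalized bumps recover point values of a continuous function; this
  links weak formulations, which only see integrals, to values at single times.\<close>

lemma bump_average_approx:
  fixes u \<beta> :: "real \<Rightarrow> real"
  assumes u: "continuous_on {0..T} u" and \<beta>: "continuous_on {0..T} \<beta>" "\<And>x. \<beta> x \<ge> 0"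
    and c: "integral {0..T} \<beta> = c" "c > 0"
    and near: "\<And>x. x \<in> {0..T} \<Longrightarrow> \<beta> x \<noteq> 0 \<Longrightarrow> \<bar>u x - v\<bar> \<le> e"
  shows "\<bar>integral {0..T} (\<lambda>x. \<beta> x / c * u x) - v\<bar> \<le> e"
proof -
  have i: "\<beta> integrable_on {0..T}" "(\<lambda>x. \<beta> x * u x) integrable_on {0..T}"
    by (intro integrable_continuous_interval continuous_intros u \<beta>)+
  have "norm (integral {0..T} (\<lambda>x. \<beta> x * u x - \<beta> x * v)) \<le> integral {0..T} (\<lambda>x. \<beta> x * e)"
  proof (rule integral_norm_bound_integral)
    fix x assume x: "x \<in> {0..T}"
    have "\<beta> x * \<bar>u x - v\<bar> \<le> \<beta> x * e" using near[OF x] \<beta>(2)[of x] by (cases "\<beta> x = 0") auto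
    then show "norm (\<beta> x * u x - \<beta> x * v) \<le> \<beta> x * e"
      using \<beta>(2)[of x] by (simp add: abs_mult right_diff_distrib[symmetric])
  qed (intro integrable_continuous_interval continuous_intros u \<beta>)+
  also have "integral {0..T} (\<lambda>x. \<beta> x * u x - \<beta> x * v) = integral {0..T} (\<lambda>x. \<beta> x * u x) - c * v"
    using i c(1) by (subst Henstock_Kurzweil_Integration.integral_diff) (auto intro: integrable_on_mult_left)
  finally have *: "\<bar>integral {0..T} (\<lambda>x. \<beta> x * u x) - c * v\<bar> \<le> c * e"
    using c(1) by simp
  define A where "A = integral {0..T} (\<lambda>x. \<beta> x * u x)"
  have "(\<lambda>x. \<beta> x / c * u x) = (\<lambda>x. (1 / c) * (\<beta> x * u x))" by auto
  then have "integral {0..T} (\<lambda>x. \<beta> x / c * u x) = (1 / c) * A"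
    unfolding A_def by (simp only: integral_mult_right)
  then have "integral {0..T} (\<lambda>x. \<beta> x / c * u x) - v = (A - c * v) / c"
    using c(2) by (simp add: diff_divide_distrib)
  then show ?thesis
    using *[folded A_def] c(2) by (simp add: divide_le_eq mult.commute)
qed

text \<open>Zero total mass makes the primitive return to 0 to the right of the support of
  \<open>\<beta>\<close>, which gives compact support inside \<open>(0,T)\<close>.\<close>

lemma test_functionI_primitive:
  assumes \<beta>: "smooth \<beta>" and zero: "\<And>x. x \<notin> {s..t} \<Longrightarrow> \<beta> x = 0" and st: "0 < s" "s \<le> t" "t < T"
    and int: "integral {0..T} \<beta> = 0"
  obtains \<phi> where "test_function T \<phi>" "deriv \<phi> = \<beta>"
proof -
  \<comment> \<open>For negative \<open>x\<close> the interval \<open>{0..x}\<close> is empty and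
    the value is 0, in accordance with \<open>\<beta>\<close> vanishing to the left of
    \<open>s > 0\<close>.\<close>
  define \<phi> where "\<phi> x = integral {0..x} \<beta>" for x
  have \<phi>0: "\<phi> x = 0" if "x \<le> s" for x
  proof -
    have "integral {0..x} \<beta> = integral {0..x} (\<lambda>x. 0)"
    proof (rule integral_spike[of "{s}"])
      show "\<And>y. y \<in> {0..x} - {s} \<Longrightarrow> 0 = \<beta> y" using zero that by auto
    qed auto
    then show ?thesis by (simp add: \<phi>_def)
  qed
  have D: "(\<phi> has_real_derivative \<beta> x) (at x)" for x
  proof (cases "x < s")
    case True
    have "((\<lambda>x. 0) has_real_derivative \<beta> x) (at x)" using zero[of x] True by simp
    then show ?thesis
      by (rule has_field_derivative_transform_within_open[of _ _ _ "{..<s}"]) (use True \<phi>0 in auto)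
  next
    case False
    then have x: "x > 0" using st by simp
    have "(\<phi> has_real_derivative \<beta> x) (at x within {0..x+1})"
      unfolding \<phi>_def by (rule integral_has_real_derivative) (use smooth_continuous[OF \<beta>] x in auto)
    moreover have "at x within {0..x+1} = at x"
      by (rule at_within_interior) (use x in simp)
    ultimately show ?thesis by simp
  qed
  then have d: "deriv \<phi> = \<beta>" by (auto intro: DERIV_imp_deriv)
  have "(deriv ^^ n) \<phi> differentiable_on UNIV" for n
  proof (cases n)
    case 0
    then show ?thesis using D by (auto simp: differentiable_on_def real_differentiable_def)
  next
    case (Suc m)
    then show ?thesis using \<beta> by (simp add: smooth_def d funpow_Suc_right del: funpow.simps)
  qed
  moreover have "\<phi> x = 0" if "x \<notin> {s..t}" for x
  proof (cases "x \<le> s")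
    case False
    then have x: "x > t" using that by auto
    have i: "\<beta> integrable_on {0..max x T}" by (intro integrable_continuous_interval smooth_continuous \<beta>)
    have tail: "integral {t..y} \<beta> = 0" for y
    proof -
      have "integral {t..y} \<beta> = integral {t..y} (\<lambda>x. 0)"
      proof (rule integral_spike[of "{t}"])
        show "\<And>z. z \<in> {t..y} - {t} \<Longrightarrow> 0 = \<beta> z" using zero by auto
      qed auto
      then show ?thesis by simp
    qed
    have "integral {0..y} \<beta> = integral {0..t} \<beta>" if "t \<le> y" for y
    proof -
      have "\<beta> integrable_on {0..y}" by (intro integrable_continuous_interval smooth_continuous \<beta>)
      from integral_interval_diff[OF this, of t] tail[of y] that st show ?thesis by simp
    qed
    from this[of T] this[of x] show ?thesis using int x st by (simp add: \<phi>_def)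
  qed (rule \<phi>0)
  ultimately have "test_function T \<phi>"
    unfolding test_function_def using st by (intro conjI allI exI[of _ s] exI[of _ t]) auto
  with d show ?thesis by (rule that[rotated])
qed

text \<open>Testing with a difference of two normalized bumps shows that \<open>u\<close> has equal values at any two points.\<close>

lemma du_Bois_Reymond:
  fixes u :: "real \<Rightarrow> real"
  assumes T: "T > 0" and u: "continuous_on {0..T} u"
    and test: "\<And>\<phi>. test_function T \<phi> \<Longrightarrow> integral {0..T} (\<lambda>x. deriv \<phi> x * u x) = 0"
    and x: "x \<in> {0..T}"
  shows "u x = u 0"
proof -
  have open_case: "u s = u t" if st: "0 < s" "s < t" "t < T" for s t
  proof -
    have "\<bar>u s - u t\<bar> \<le> e" if e: "e > 0" for e
    proof -
      obtain d where d: "d > 0" "\<And>x y. x \<in> {0..T} \<Longrightarrow> y \<in> {0..T} \<Longrightarrow> \<bar>x - y\<bar> < d \<Longrightarrow> dist (u x) (u y) < e/2"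
        using uniformly_continuous_interval[OF u, of "e/2"] e by (metis half_gt_zero)
      \<comment> \<open>One width serves both bumps: below \<open>d\<close>, so that
        \<open>u\<close> varies by less than \<open>e/2\<close> on each support, and small enough
        for the right bump to end before \<open>T\<close>.\<close>
      define h where "h = min (d/2) ((T - t)/2)"
      have h: "0 < h" "h < d" "t + h < T" using d(1) st by (auto simp: h_def min_def field_simps)
      have bump: "\<exists>\<beta> c. smooth \<beta> \<and> (\<forall>x. x \<notin> {r..r + h} \<longrightarrow> \<beta> x = 0) \<and> integral {0..T} \<beta> = c \<and> c > 0 \<and>
          \<bar>integral {0..T} (\<lambda>x. \<beta> x / c * u x) - u r\<bar> \<le> e/2" if r: "0 < r" "r \<le> t" for r
      proof -
        obtain \<beta> where \<beta>: "smooth \<beta>" "\<And>x. \<beta> x \<ge> 0" "\<And>x. x \<notin> {r<..<r + h} \<Longrightarrow> \<beta> x = 0"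
          "\<And>x. x \<in> {r<..<r + h} \<Longrightarrow> \<beta> x > 0"
          by (rule smooth_bump[OF h(1)]) blast
        have "integral {0..T} \<beta> > 0"
        proof (rule ccontr)
          assume "\<not> ?thesis"
          moreover have "integral {0..T} \<beta> \<ge> 0"
            using \<beta>(2) by (intro Henstock_Kurzweil_Integration.integral_nonneg
                integrable_continuous_interval smooth_continuous \<beta>(1))
          ultimately have "integral {0..T} \<beta> = 0" by simp
          then have "\<forall>x\<in>{0..T}. \<beta> x = 0"
            using T \<beta>(2) smooth_continuous[OF \<beta>(1)] by (subst (asm) integral_eq_0_iff) auto
          moreover have "r + h/2 \<in> {0..T}" "\<beta> (r + h/2) > 0" using \<beta>(4)[of "r + h/2"] h r by auto
          ultimately show False by force
        qed
        moreover have "\<bar>integral {0..T} (\<lambda>x. \<beta> x / integral {0..T} \<beta> * u x) - u r\<bar> \<le> e/2"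
        proof (rule bump_average_approx[OF u smooth_continuous[OF \<beta>(1)] \<beta>(2) refl calculation])
          fix x assume "x \<in> {0..T}" "\<beta> x \<noteq> 0"
          moreover then have "x \<in> {r<..<r + h}" using \<beta>(3) by blast
          ultimately have "dist (u x) (u r) < e/2" using h r st by (intro d(2)) auto
          then show "\<bar>u x - u r\<bar> \<le> e/2" by (simp add: dist_real_def)
        qed
        ultimately show ?thesis using \<beta>
          by (intro exI[of _ \<beta>] exI[of _ "integral {0..T} \<beta>"]) auto
      qed
      obtain \<beta> c where \<beta>: "smooth \<beta>" "\<And>x. x \<notin> {s..s + h} \<Longrightarrow> \<beta> x = 0" "integral {0..T} \<beta> = c" "c > 0"
          "\<bar>integral {0..T} (\<lambda>x. \<beta> x / c * u x) - u s\<bar> \<le> e/2"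
        using bump[of s] st by auto
      obtain \<gamma> b where \<gamma>: "smooth \<gamma>" "\<And>x. x \<notin> {t..t + h} \<Longrightarrow> \<gamma> x = 0" "integral {0..T} \<gamma> = b" "b > 0"
          "\<bar>integral {0..T} (\<lambda>x. \<gamma> x / b * u x) - u t\<bar> \<le> e/2"
        using bump[of t] st by auto
      note ic = integrable_continuous_interval
      have sm: "smooth (\<lambda>x. 1/c * \<beta> x + (-1/b) * \<gamma> x)"
        by (intro smooth_add smooth_mult smooth_const \<beta> \<gamma>)
      have int0: "integral {0..T} (\<lambda>x. 1/c * \<beta> x + (-1/b) * \<gamma> x) = 0"
      proof -
        have "integral {0..T} (\<lambda>x. 1/c * \<beta> x + (-1/b) * \<gamma> x) =
            integral {0..T} (\<lambda>x. 1/c * \<beta> x) + integral {0..T} (\<lambda>x. (-1/b) * \<gamma> x)"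
          by (intro Henstock_Kurzweil_Integration.integral_add ic smooth_continuous smooth_mult smooth_const \<beta> \<gamma>)
        also have "\<dots> = 1/c * c + (-1/b) * b"
          unfolding integral_mult_right \<beta>(3) \<gamma>(3) by simp
        also have "\<dots> = 0" using \<beta>(4) \<gamma>(4) by simp
        finally show ?thesis .
      qed
      obtain \<phi> where \<phi>: "test_function T \<phi>" "deriv \<phi> = (\<lambda>x. 1/c * \<beta> x + (-1/b) * \<gamma> x)"
        by (rule test_functionI_primitive[OF sm _ _ _ _ int0, of s "t + h"]) (use st h \<beta>(2) \<gamma>(2) in auto)
      have "0 = integral {0..T} (\<lambda>x. \<beta> x / c * u x - \<gamma> x / b * u x)"
        using test[OF \<phi>(1)] unfolding \<phi>(2) by (simp add: algebra_simps)
      also have "\<dots> = integral {0..T} (\<lambda>x. \<beta> x / c * u x) - integral {0..T} (\<lambda>x. \<gamma> x / b * u x)"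
        using \<beta>(4) \<gamma>(4)
        by (intro Henstock_Kurzweil_Integration.integral_diff ic continuous_intros u smooth_continuous \<beta>(1) \<gamma>(1)) auto
      finally have "integral {0..T} (\<lambda>x. \<beta> x / c * u x) = integral {0..T} (\<lambda>x. \<gamma> x / b * u x)"
        by (simp only: eq_iff_diff_eq_0[symmetric])
      moreover have "\<bar>y - z\<bar> \<le> e" if "v = w" "\<bar>v - y\<bar> \<le> e/2" "\<bar>w - z\<bar> \<le> e/2" for v w y z :: real
        using that by linarith
      ultimately show ?thesis using \<beta>(5) \<gamma>(5) by blast
    qed
    then have "\<bar>u s - u t\<bar> \<le> 0" by (rule field_le_epsilon) simp
    then show ?thesis by simp
  qed
  have half: "u y = u (T/2)" if "y \<in> {0<..<T}" for y
  proof (cases y "T/2" rule: linorder_cases)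
    case less
    then show ?thesis using that by (intro open_case) auto
  next
    case greater
    then show ?thesis using that T by (intro open_case[symmetric]) auto
  qed (rule arg_cong)
  have "u y = u (T/2)" if "y \<in> {0..T}" for y
  proof (rule continuous_constant_on_closure[of "{0<..<T}" u, OF _ half])
    show "continuous_on (closure {0<..<T}) u" "y \<in> closure {0<..<T}" using u T that by simp_all
  qed
  from this[of x] this[of 0] show ?thesis using x T by simp
qed

subsection \<open>Sobolev functions\<close>

text \<open>Vanishing primitives first give a vanishing integral of \<open>c x * h x\<close> for
  continuous \<open>c\<close>, by freezing \<open>c\<close> on short intervals. Continuous
  \<open>c\<close> that tend almost everywhere to the bounded function
  \<open>h / (1 + \<bar>h\<bar>)\<close> then show that the nonnegative function
  \<open>h^2 / (1 + \<bar>h\<bar>)\<close> has integral 0.\<close>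

lemma integral_zero_imp_AE_zero:
  fixes h :: "real \<Rightarrow> real"
  assumes T: "0 \<le> T" and h: "integrable (leb T) h"
    and zero: "\<And>t. t \<in> {0..T} \<Longrightarrow> integral {0..t} h = 0"
  shows "AE x in leb T. h x = 0"
proof -
  have ch: "integral {0..T} (\<lambda>x. c x * h x) = 0" if c: "continuous_on {0..T} c" for c
  proof -
    have i1: "integrable (leb T) (\<lambda>x. c x * h x)" by (rule integrable_continuous_mult[OF c h])
    have i2: "integrable (leb T) (\<lambda>x. \<bar>h x\<bar>)" using h by simp
    have "integral {0..0} (\<lambda>x. c x * h x) = integral {0..T} (\<lambda>x. c x * h x)"
    proof (rule local_constant_imp_eq[OF T, of "\<lambda>t. integral {0..t} (\<lambda>x. c x * h x)" "\<lambda>t. integral {0..t} (\<lambda>x. \<bar>h x\<bar>)"])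
      fix \<delta> :: real assume \<delta>: "\<delta> > 0"
      obtain d where d: "d > 0" "\<And>x y. x \<in> {0..T} \<Longrightarrow> y \<in> {0..T} \<Longrightarrow> \<bar>x - y\<bar> < d \<Longrightarrow> dist (c x) (c y) < \<delta>"
        using uniformly_continuous_interval[OF c \<delta>] by metis
      have "\<bar>integral {0..t} (\<lambda>x. c x * h x) - integral {0..s} (\<lambda>x. c x * h x)\<bar> \<le>
          \<delta> * (integral {0..t} (\<lambda>x. \<bar>h x\<bar>) - integral {0..s} (\<lambda>x. \<bar>h x\<bar>))"
        if st: "0 \<le> s" "s \<le> t" "t \<le> T" "t - s < d" for s t
      proof -
        note io = leb_integrable_on[OF _ \<open>0 \<le> s\<close> \<open>t \<le> T\<close>] and io0 = leb_integrable_on[OF _ order_refl \<open>t \<le> T\<close>]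
        note df = integral_interval_diff[OF io0 \<open>0 \<le> s\<close> \<open>s \<le> t\<close>]
        have "integral {s..t} h = 0" using df[OF h] zero[of s] zero[of t] st by simp
        then have "integral {s..t} (\<lambda>x. c s * h x) = 0" by simp
        then have "integral {s..t} (\<lambda>x. c x * h x) = integral {s..t} (\<lambda>x. c x * h x - c s * h x)"
          using io[OF i1] io[OF h]
          by (subst Henstock_Kurzweil_Integration.integral_diff) (auto intro: integrable_on_mult_right)
        moreover have "norm (integral {s..t} (\<lambda>x. c x * h x - c s * h x)) \<le> integral {s..t} (\<lambda>x. \<delta> * \<bar>h x\<bar>)"
        proof (rule integral_norm_bound_integral)
          show "(\<lambda>x. c x * h x - c s * h x) integrable_on {s..t}"
            using io[OF i1] io[OF h] by (intro integrable_diff integrable_on_mult_right)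
          show "(\<lambda>x. \<delta> * \<bar>h x\<bar>) integrable_on {s..t}"
            using io[OF i2] by (rule integrable_on_mult_right)
          fix x assume x: "x \<in> {s..t}"
          then have "\<bar>c x - c s\<bar> \<le> \<delta>" using d(2)[of x s] st by (auto simp: dist_real_def)
          then show "norm (c x * h x - c s * h x) \<le> \<delta> * \<bar>h x\<bar>"
            by (simp add: left_diff_distrib[symmetric] abs_mult mult_right_mono)
        qed
        ultimately show ?thesis using df[OF i1] df[OF i2] by simp
      qed
      then show "\<exists>\<eta>>0. \<forall>s t. 0 \<le> s \<longrightarrow> s \<le> t \<longrightarrow> t \<le> T \<longrightarrow> t - s < \<eta> \<longrightarrow>
          \<bar>integral {0..t} (\<lambda>x. c x * h x) - integral {0..s} (\<lambda>x. c x * h x)\<bar> \<le>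
          \<delta> * (integral {0..t} (\<lambda>x. \<bar>h x\<bar>) - integral {0..s} (\<lambda>x. \<bar>h x\<bar>))"
        using d(1) by blast
    qed
    then show ?thesis by simp
  qed
  have "h measurable_on {0..T}"
    using h by (subst measurable_on_iff_borel_measurable) auto
  then obtain N c where N: "negligible N" and c: "\<And>n::nat. continuous_on UNIV (c n)"
    "\<And>x. x \<notin> N \<Longrightarrow> (\<lambda>n. c n x) \<longlonglongrightarrow> (if x \<in> {0..T} then h x else 0)"
    unfolding measurable_on_def by blast
  define k :: "real \<Rightarrow> real" where "k y = y / (1 + \<bar>y\<bar>)" for y
  have nz: "1 + \<bar>y\<bar> \<noteq> 0" for y :: real using abs_ge_zero[of y] by linarith
  have k_cont: "continuous_on S k" for S
    unfolding k_def using nz by (intro continuous_intros) auto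
  have k_le: "\<bar>k y\<bar> \<le> 1" for y by (simp add: k_def divide_le_eq)
  have "AE x in lebesgue. x \<notin> N"
    using N by (simp add: negligible_iff_null_sets AE_not_in)
  then have ae: "AE x in leb T. x \<notin> N"
    by (subst AE_restrict_space_iff) auto
  have "(\<lambda>n. LINT x|leb T. k (c n x) * h x) \<longlonglongrightarrow> (LINT x|leb T. k (h x) * h x)"
  proof (rule integral_dominated_convergence)
    have kc: "continuous_on {0..T} (\<lambda>x. k (c n x))" for n
      by (rule continuous_on_compose2[OF k_cont[of UNIV]]) (use c(1) in \<open>auto intro: continuous_on_subset\<close>)
    show "(\<lambda>x. k (c n x) * h x) \<in> borel_measurable (leb T)" for n
      using integrable_continuous_mult[OF kc h] by simp
    show "(\<lambda>x. k (h x) * h x) \<in> borel_measurable (leb T)"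
      using h borel_measurable_continuous_onI[OF k_cont] by (intro borel_measurable_times measurable_compose[of h _ _ k]) auto
    show "integrable (leb T) (\<lambda>x. \<bar>h x\<bar>)" using h by simp
    show "AE x in leb T. (\<lambda>n. k (c n x) * h x) \<longlonglongrightarrow> k (h x) * h x"
      using ae AE_space
    proof eventually_elim
      case (elim x)
      have "(\<lambda>n. c n x) \<longlonglongrightarrow> h x" using c(2)[OF elim(1)] elim(2) by simp
      then show ?case
        by (intro tendsto_intros continuous_on_tendsto_compose[OF k_cont[of UNIV]]) auto
    qed
    show "AE x in leb T. norm (k (c n x) * h x) \<le> \<bar>h x\<bar>" for n
      using k_le by (intro AE_I2) (simp add: abs_mult mult_left_le_one_le)
  qed
  moreover have "(LINT x|leb T. k (c n x) * h x) = 0" for n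
  proof -
    have kc: "continuous_on {0..T} (\<lambda>x. k (c n x))"
      by (rule continuous_on_compose2[OF k_cont[of UNIV]]) (use c(1) in \<open>auto intro: continuous_on_subset\<close>)
    show ?thesis using ch[OF kc] leb_integral[OF integrable_continuous_mult[OF kc h]] by simp
  qed
  ultimately have "(\<lambda>n. 0) \<longlonglongrightarrow> (LINT x|leb T. k (h x) * h x)" by simp
  then have "(LINT x|leb T. k (h x) * h x) = 0" by (simp add: LIMSEQ_const_iff)
  moreover have "integrable (leb T) (\<lambda>x. k (h x) * h x)"
  proof (rule Bochner_Integration.integrable_bound[OF h])
    show "(\<lambda>x. k (h x) * h x) \<in> borel_measurable (leb T)"
      using h borel_measurable_continuous_onI[OF k_cont] by (intro borel_measurable_times measurable_compose[of h _ _ k]) auto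
    show "AE x in leb T. norm (k (h x) * h x) \<le> norm (h x)"
      using k_le by (intro AE_I2) (simp add: abs_mult mult_left_le_one_le)
  qed
  moreover have kh: "k (h x) * h x \<ge> 0" for x by (simp add: k_def)
  ultimately have "AE x in leb T. k (h x) * h x = 0"
    by (subst (asm) integral_nonneg_eq_0_iff_AE) auto
  then show ?thesis by eventually_elim (use nz in \<open>auto simp: k_def\<close>)
qed

lemma Lp1_iff: "f \<in> Lp (Suc 0) T \<longleftrightarrow> strongly_measurable (leb T) f \<and> integrable (leb T) (\<lambda>t. norm (f t))"
  by (simp add: Lp_def)

lemma Lp2_eq_sqint: "Lp 2 T = sqint (leb T)"
  by (simp add: Lp_def sqint_def)

lemma leb_emeasure_finite: "emeasure (leb T) (space (leb T)) \<noteq> \<infinity>"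
  by (cases "0 \<le> T") (simp_all add: emeasure_restrict_space)

lemma Lp2_imp_Lp1:
  assumes "f \<in> Lp 2 T"
  shows "f \<in> Lp 1 T"
proof -
  interpret finite_measure "leb T" by (rule finite_measureI) (rule leb_emeasure_finite)
  have f: "strongly_measurable (leb T) f" "integrable (leb T) (\<lambda>t. (norm (f t))\<^sup>2)"
    using assms by (auto simp: Lp_def)
  have "integrable (leb T) (\<lambda>t. norm (f t))"
  proof (rule Bochner_Integration.integrable_bound)
    show "integrable (leb T) (\<lambda>t. 1 + (norm (f t))\<^sup>2)" using f(2) by simp
    show "(\<lambda>t. norm (f t)) \<in> borel_measurable (leb T)"
      by (rule strongly_measurable_norm[OF complete_measure_leb f(1)])
    have "a \<le> 1 + a\<^sup>2" for a :: real
      using zero_le_power2[of "a - 1/2"] unfolding power2_eq_square by (simp add: algebra_simps)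
    then show "AE t in leb T. norm (norm (f t)) \<le> norm (1 + (norm (f t))\<^sup>2)"
      by (intro AE_I2) simp
  qed
  with f show ?thesis by (simp add: Lp1_iff)
qed

lemma Lp1_scaleR_continuous:
  assumes c: "continuous_on {0..T} (c :: real \<Rightarrow> real)" and g: "g \<in> Lp 1 T"
  shows "(\<lambda>t. c t *\<^sub>R g t) \<in> Lp 1 T"
proof -
  have "integrable (leb T) (\<lambda>t. \<bar>c t\<bar> * norm (g t))"
    using g by (intro integrable_continuous_mult continuous_intros c) (simp add: Lp1_iff)
  moreover have "strongly_measurable (leb T) (\<lambda>t. c t *\<^sub>R g t)"
    by (rule strongly_measurable_scaleR[OF strongly_measurable_continuous_on[OF c]]) (use g in \<open>auto simp: Lp1_iff\<close>)
  ultimately show ?thesis by (simp add: Lp1_iff)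
qed

lemma
  fixes f :: "real \<Rightarrow> 'b::{real_normed_vector,complete_space}" and h :: "'b \<Rightarrow> real"
  assumes "f \<in> Lp 1 T" "bounded_linear h"
  shows Lp1_functional_integrable: "integrable (leb T) (\<lambda>t. h (f t))"
    and Lp1_functional_bochner: "h (bochner (leb T) f) = (LINT t|leb T. h (f t))"
  using assms by (auto simp: Lp1_iff intro: integrable_bounded_linear_bochner bounded_linear_bochner complete_measure_leb)

lemma test_function_smooth: "test_function T \<phi> \<Longrightarrow> smooth \<phi>"
  by (simp add: test_function_def smooth_def)

lemma test_function_boundary:
  assumes "test_function T \<phi>"
  shows "\<phi> 0 = 0" "\<phi> T = 0"
  using assms by (auto simp: test_function_def)

lemma test_function_by_parts:
  fixes g :: "real \<Rightarrow> real"
  assumes T: "0 \<le> T" and \<phi>: "test_function T \<phi>" and g: "integrable (leb T) g"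
  shows "integral {0..T} (\<lambda>x. deriv \<phi> x * integral {0..x} g) = - integral {0..T} (\<lambda>x. \<phi> x * g x)"
proof -
  note sm = test_function_smooth[OF \<phi>]
  have "\<phi> T * integral {0..T} g =
    integral {0..T} (\<lambda>x. deriv \<phi> x * integral {0..x} g) + integral {0..T} (\<lambda>x. \<phi> x * g x)"
    by (rule integration_by_parts_primitive[OF T g])
      (auto intro: has_field_derivative_at_within smooth_DERIV[OF sm] smooth_continuous smooth_deriv[OF sm])
  then show ?thesis using test_function_boundary[OF \<phi>] by simp
qed

text \<open>After applying \<open>h\<close>, the weak formulation and integration by parts show that
  \<open>h (q x)\<close> minus the primitive of \<open>h (g x)\<close> is orthogonal to all
  derivatives of test functions; the lemma of du Bois-Reymond makes it constant.\<close>

lemma weak_deriv_functional: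
  fixes q :: "real \<Rightarrow> 'b::{real_normed_vector,complete_space}" and h :: "'b \<Rightarrow> real"
  assumes T: "T > 0" and q: "continuous_on {0..T} q" "has_weak_deriv T q g" and h: "bounded_linear h"
    and t: "t \<in> {0..T}"
  shows "h (q t) - h (q 0) = integral {0..t} (\<lambda>x. h (g x))"
proof -
  interpret h: bounded_linear h by fact
  have L: "q \<in> Lp 1 T" "g \<in> Lp 1 T" using q(2) by (auto simp: has_weak_deriv_def)
  note hg = Lp1_functional_integrable[OF L(2) h]
  let ?H = "\<lambda>x. integral {0..x} (\<lambda>x. h (g x))"
  have hq: "continuous_on {0..T} (\<lambda>x. h (q x))" by (rule h.continuous_on[OF q(1)])
  have Hc: "continuous_on {0..T} ?H" by (rule continuous_primitive[OF hg])
  have "h (q t) - ?H t = h (q 0) - ?H 0"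
  proof (rule du_Bois_Reymond[OF T _ _ t])
    show "continuous_on {0..T} (\<lambda>x. h (q x) - ?H x)" by (intro continuous_intros hq Hc)
    fix \<phi> assume \<phi>: "test_function T \<phi>"
    note sm = test_function_smooth[OF \<phi>]
    have c: "continuous_on {0..T} \<phi>" "continuous_on {0..T} (deriv \<phi>)"
      by (intro smooth_continuous smooth_deriv sm)+
    have "integral {0..T} (\<lambda>x. deriv \<phi> x * h (q x)) = h (bochner (leb T) (\<lambda>x. deriv \<phi> x *\<^sub>R q x))"
      using Lp1_functional_bochner[OF Lp1_scaleR_continuous[OF c(2) L(1)] h]
        leb_integral[OF Lp1_functional_integrable[OF Lp1_scaleR_continuous[OF c(2) L(1)] h]]
      by (simp add: h.scaleR)
    also have "\<dots> = - h (bochner (leb T) (\<lambda>x. \<phi> x *\<^sub>R g x))"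
      using q(2) \<phi> by (simp add: has_weak_deriv_def h.neg)
    also have "\<dots> = - integral {0..T} (\<lambda>x. \<phi> x * h (g x))"
      using Lp1_functional_bochner[OF Lp1_scaleR_continuous[OF c(1) L(2)] h]
        leb_integral[OF Lp1_functional_integrable[OF Lp1_scaleR_continuous[OF c(1) L(2)] h]]
      by (simp add: h.scaleR)
    also have "\<dots> = integral {0..T} (\<lambda>x. deriv \<phi> x * ?H x)"
      using test_function_by_parts[OF _ \<phi> hg] T by simp
    finally have "integral {0..T} (\<lambda>x. deriv \<phi> x * h (q x)) - integral {0..T} (\<lambda>x. deriv \<phi> x * ?H x) = 0"
      by simp
    also have "integral {0..T} (\<lambda>x. deriv \<phi> x * h (q x)) - integral {0..T} (\<lambda>x. deriv \<phi> x * ?H x) =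
        integral {0..T} (\<lambda>x. deriv \<phi> x * h (q x) - deriv \<phi> x * ?H x)"
      by (intro Henstock_Kurzweil_Integration.integral_diff[symmetric] integrable_continuous_interval
          continuous_intros c hq Hc)
    finally show "integral {0..T} (\<lambda>x. deriv \<phi> x * (h (q x) - ?H x)) = 0"
      by (simp add: right_diff_distrib)
  qed
  then show ?thesis by simp
qed

lemma inner_ext:
  fixes a b :: "'b::real_inner"
  assumes "\<And>y. inner a y = inner b y"
  shows "a = b"
proof -
  have "inner (a - b) (a - b) = 0" using assms[of "a - b"] by (simp add: inner_diff_left)
  then show ?thesis by simp
qed

text \<open>Converse of \<open>weak_deriv_functional\<close>. With both directions Sobolev functions
  can be handled through scalar primitives in place of test functions.\<close>

lemma has_weak_derivI:
  fixes q :: "real \<Rightarrow> 'b::{real_inner,complete_space}"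
  assumes T: "T > 0" and q: "continuous_on {0..T} q" and g: "g \<in> Lp 1 T"
    and eq: "\<And>t y. t \<in> {0..T} \<Longrightarrow> inner (q t) y - inner (q 0) y = integral {0..t} (\<lambda>x. inner (g x) y)"
  shows "has_weak_deriv T q g"
proof -
  have qL: "q \<in> Lp 1 T"
    using q by (auto simp: Lp1_iff intro!: strongly_measurable_continuous_on continuous_imp_integrable_real continuous_intros)
  have "bochner (leb T) (\<lambda>t. deriv \<phi> t *\<^sub>R q t) = - bochner (leb T) (\<lambda>t. \<phi> t *\<^sub>R g t)"
    if \<phi>: "test_function T \<phi>" for \<phi>
  proof (rule inner_ext)
    fix y :: 'b
    note h = bounded_linear_inner_left[of y]
    note sm = test_function_smooth[OF \<phi>]
    have c: "continuous_on {0..T} \<phi>" "continuous_on {0..T} (deriv \<phi>)"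
      by (intro smooth_continuous smooth_deriv sm)+
    note hg = Lp1_functional_integrable[OF g h]
    let ?H = "\<lambda>x. integral {0..x} (\<lambda>x. inner (g x) y)"
    have Hc: "continuous_on {0..T} ?H" by (rule continuous_primitive[OF hg])
    have "(deriv \<phi> has_integral \<phi> T - \<phi> 0) {0..T}"
      using T by (intro fundamental_theorem_of_calculus)
        (auto simp: has_real_derivative_iff_has_vector_derivative[symmetric] intro: has_field_derivative_at_within smooth_DERIV[OF sm])
    then have i0: "integral {0..T} (deriv \<phi>) = 0"
      using test_function_boundary[OF \<phi>] by (simp add: integral_unique)
    have "inner (bochner (leb T) (\<lambda>t. deriv \<phi> t *\<^sub>R q t)) y = integral {0..T} (\<lambda>x. deriv \<phi> x * inner (q x) y)"
      using Lp1_functional_bochner[OF Lp1_scaleR_continuous[OF c(2) qL] h]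
        leb_integral[OF Lp1_functional_integrable[OF Lp1_scaleR_continuous[OF c(2) qL] h]] by simp
    also have "\<dots> = integral {0..T} (\<lambda>x. deriv \<phi> x * inner (q 0) y + deriv \<phi> x * ?H x)"
    proof (rule Henstock_Kurzweil_Integration.integral_cong)
      fix x assume "x \<in> {0..T}"
      then have "inner (q x) y = inner (q 0) y + ?H x" using eq[of x y] by linarith
      then show "deriv \<phi> x * inner (q x) y = deriv \<phi> x * inner (q 0) y + deriv \<phi> x * ?H x"
        by (simp only: distrib_left)
    qed
    also have "\<dots> = integral {0..T} (\<lambda>x. deriv \<phi> x * inner (q 0) y) + integral {0..T} (\<lambda>x. deriv \<phi> x * ?H x)"
      by (intro Henstock_Kurzweil_Integration.integral_add integrable_continuous_interval continuous_intros c Hc)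
    also have "\<dots> = - integral {0..T} (\<lambda>x. \<phi> x * inner (g x) y)"
      using test_function_by_parts[OF _ \<phi> hg] T i0 by simp
    also have "\<dots> = inner (- bochner (leb T) (\<lambda>t. \<phi> t *\<^sub>R g t)) y"
      using Lp1_functional_bochner[OF Lp1_scaleR_continuous[OF c(1) g] h]
        leb_integral[OF Lp1_functional_integrable[OF Lp1_scaleR_continuous[OF c(1) g] h]] by simp
    finally show "inner (bochner (leb T) (\<lambda>t. deriv \<phi> t *\<^sub>R q t)) y = inner (- bochner (leb T) (\<lambda>t. \<phi> t *\<^sub>R g t)) y" .
  qed
  with qL g show ?thesis by (simp add: has_weak_deriv_def)
qed

text \<open>The exceptional null set for a direction \<open>c\<close> depends on \<open>c\<close>.
  Essential separability of the difference leaves countably many directions, and since their closure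
  contains \<open>f t - g t\<close>, this vector is orthogonal to itself.\<close>

lemma weak_deriv_unique:
  fixes q :: "real \<Rightarrow> 'b::{real_inner,complete_space}"
  assumes T: "T > 0" and q: "continuous_on {0..T} q" "has_weak_deriv T q f" "has_weak_deriv T q g"
  shows "AE t in leb T. f t = g t"
proof -
  have L: "f \<in> Lp 1 T" "g \<in> Lp 1 T" using q(2,3) by (auto simp: has_weak_deriv_def)
  have sm: "strongly_measurable (leb T) (\<lambda>t. f t - g t)"
    using L by (intro strongly_measurable_diff) (auto simp: Lp1_iff)
  obtain C where C: "countable C" "AE t in leb T. f t - g t \<in> closure C"
    using strongly_measurable_essentially_separable[OF sm] by blast
  have "AE t in leb T. inner (f t - g t) c = 0" for c
  proof (rule integral_zero_imp_AE_zero)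
    note i = Lp1_functional_integrable[OF L(1) bounded_linear_inner_left[of c]]
      Lp1_functional_integrable[OF L(2) bounded_linear_inner_left[of c]]
    show "integrable (leb T) (\<lambda>t. inner (f t - g t) c)"
      using i by (simp add: inner_diff_left)
    fix t assume t: "t \<in> {0..T}"
    then have "integral {0..t} (\<lambda>x. inner (f x) c) = integral {0..t} (\<lambda>x. inner (g x) c)"
      using weak_deriv_functional[OF T q(1,2) bounded_linear_inner_left[of c] t]
        weak_deriv_functional[OF T q(1,3) bounded_linear_inner_left[of c] t] by simp
    then show "integral {0..t} (\<lambda>x. inner (f x - g x) c) = 0"
      using t leb_integrable_on[OF i(1), of 0 t] leb_integrable_on[OF i(2), of 0 t]
      by (simp add: inner_diff_left Henstock_Kurzweil_Integration.integral_diff)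
  qed (use T in simp)
  then have "AE t in leb T. \<forall>c\<in>C. inner (f t - g t) c = 0"
    using C(1) by (subst AE_ball_countable) auto
  then show ?thesis using C(2)
  proof eventually_elim
    case (elim t)
    have "closure C \<subseteq> {y. inner (f t - g t) y = 0}"
      using elim(1) by (intro closure_minimal closed_hyperplane) auto
    then have "inner (f t - g t) (f t - g t) = 0" using elim(2) by auto
    then show ?case by simp
  qed
qed

text \<open>The increment is paired with itself, and one factor of its norm cancels.\<close>

lemma weak_deriv_norm_diff:
  fixes q :: "real \<Rightarrow> 'b::{real_inner,complete_space}"
  assumes T: "T > 0" and q: "continuous_on {0..T} q" "has_weak_deriv T q g" and st: "0 \<le> s" "s \<le> t" "t \<le> T"
  shows "norm (q t - q s) \<le> integral {s..t} (\<lambda>x. norm (g x))"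
proof -
  let ?d = "q t - q s"
  have L: "g \<in> Lp 1 T" using q(2) by (auto simp: has_weak_deriv_def)
  note h = bounded_linear_inner_left[of ?d]
  note i = Lp1_functional_integrable[OF L h]
  have n: "integrable (leb T) (\<lambda>x. norm (g x))" using L by (simp add: Lp1_iff)
  have "inner ?d ?d = integral {s..t} (\<lambda>x. inner (g x) ?d)"
    using weak_deriv_functional[OF T q h, of t] weak_deriv_functional[OF T q h, of s] st
      integral_interval_diff[OF leb_integrable_on[OF i], of 0 t s] by (simp add: inner_diff_left)
  also have "\<dots> \<le> integral {s..t} (\<lambda>x. norm (g x) * norm ?d)"
    using leb_integrable_on[OF i, of s t] leb_integrable_on[OF n, of s t] st
    by (intro integral_le integrable_on_mult_left) (auto simp: norm_cauchy_schwarz)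
  also have "\<dots> = integral {s..t} (\<lambda>x. norm (g x)) * norm ?d" by simp
  finally have "norm ?d * norm ?d \<le> integral {s..t} (\<lambda>x. norm (g x)) * norm ?d"
    by (simp add: power2_norm_eq_inner[symmetric] power2_eq_square)
  moreover have "integral {s..t} (\<lambda>x. norm (g x)) \<ge> 0"
    using leb_integrable_on[OF n, of s t] st by (intro Henstock_Kurzweil_Integration.integral_nonneg) auto
  ultimately show ?thesis by (cases "norm ?d = 0") auto
qed

text \<open>For functionals there is no inner product to pair with, so the increment is evaluated at
  every \<open>y\<close> and the operator norm is read off.\<close>

lemma weak_deriv_norm_diff_dual:
  fixes l :: "real \<Rightarrow> 'b::real_normed_vector \<Rightarrow>\<^sub>L real"
  assumes T: "T > 0" and l: "continuous_on {0..T} l" "has_weak_deriv T l g" and st: "0 \<le> s" "s \<le> t" "t \<le> T"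
  shows "norm (l t - l s) \<le> integral {s..t} (\<lambda>x. norm (g x))"
proof (rule norm_blinfun_bound)
  have L: "g \<in> Lp 1 T" using l(2) by (auto simp: has_weak_deriv_def)
  have n: "integrable (leb T) (\<lambda>x. norm (g x))" using L by (simp add: Lp1_iff)
  show "integral {s..t} (\<lambda>x. norm (g x)) \<ge> 0"
    using leb_integrable_on[OF n, of s t] st by (intro Henstock_Kurzweil_Integration.integral_nonneg) auto
  fix y :: 'b
  have h: "bounded_linear (\<lambda>\<xi>::'b \<Rightarrow>\<^sub>L real. blinfun_apply \<xi> y)" by (rule bounded_linear_intros)+
  note i = Lp1_functional_integrable[OF L h]
  have "blinfun_apply (l t - l s) y = integral {s..t} (\<lambda>x. blinfun_apply (g x) y)"
    using weak_deriv_functional[OF T l h, of t] weak_deriv_functional[OF T l h, of s] st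
      integral_interval_diff[OF leb_integrable_on[OF i], of 0 t s] by (simp add: blinfun.diff_left)
  moreover have "norm (integral {s..t} (\<lambda>x. blinfun_apply (g x) y)) \<le> integral {s..t} (\<lambda>x. norm (g x) * norm y)"
    using leb_integrable_on[OF i, of s t] leb_integrable_on[OF n, of s t] st
    by (intro integral_norm_bound_integral integrable_on_mult_left norm_blinfun) auto
  ultimately show "norm (blinfun_apply (l t - l s) y) \<le> integral {s..t} (\<lambda>x. norm (g x)) * norm y"
    by simp
qed

text \<open>Discriminant argument for the quadratic in \<open>c\<close> that results from
  integrating \<open>(norm (f x) - c * norm (g x))^2\<close>.\<close>

lemma sqint_Cauchy_Schwarz:
  fixes f :: "'a \<Rightarrow> 'b::real_normed_vector" and g :: "'a \<Rightarrow> 'c::real_normed_vector"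
  assumes M: "complete_measure M" and f: "f \<in> sqint M" and g: "g \<in> sqint M"
  shows "(LINT x|M. norm (f x) * norm (g x)) \<le> sqrt (LINT x|M. (norm (f x))\<^sup>2) * sqrt (LINT x|M. (norm (g x))\<^sup>2)"
proof -
  define a b m where "a = (LINT x|M. (norm (f x))\<^sup>2)" and "b = (LINT x|M. (norm (g x))\<^sup>2)"
    and "m = (LINT x|M. norm (f x) * norm (g x))"
  note i = sqint_integrable[OF f] sqint_integrable[OF g] sqint_norm_mult_integrable[OF M f g]
  have *: "0 \<le> a - 2 * c * m + c\<^sup>2 * b" for c
  proof -
    have "0 \<le> (LINT x|M. (norm (f x) - c * norm (g x))\<^sup>2)" by (intro integral_nonneg_AE) auto
    also have "\<dots> = (LINT x|M. ((norm (f x))\<^sup>2 - (2 * c) * (norm (f x) * norm (g x))) + c\<^sup>2 * (norm (g x))\<^sup>2)"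
      by (intro Bochner_Integration.integral_cong) (auto simp: power2_eq_square algebra_simps)
    also have "\<dots> = a - 2 * c * m + c\<^sup>2 * b"
      using i by (simp add: a_def b_def m_def)
    finally show ?thesis .
  qed
  have b: "0 \<le> b" unfolding b_def by (intro integral_nonneg_AE) auto
  have a: "0 \<le> a" using *[of 0] by simp
  have m: "0 \<le> m" unfolding m_def by (intro integral_nonneg_AE) auto
  have "m\<^sup>2 \<le> a * b"
  proof (cases "b = 0")
    case True
    have "m = 0"
    proof (rule ccontr)
      assume "m \<noteq> 0"
      \<comment> \<open>With \<open>b = 0\<close> the quadratic degenerates to
        \<open>a - 2 * c * m\<close>, and this \<open>c\<close> gives it the value -1.\<close>
      then show False using *[of "(a + 1) / (2 * m)"] True by (simp add: field_simps)
    qed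
    then show ?thesis using a b by simp
  next
    case False
    then have "b > 0" using b by simp
    have "0 \<le> b * (a - 2 * (m/b) * m + (m/b)\<^sup>2 * b)" using *[of "m/b"] b by (intro mult_nonneg_nonneg)
    also have "\<dots> = a * b - m\<^sup>2" using \<open>b > 0\<close> by (simp add: field_simps power2_eq_square)
    finally show ?thesis by simp
  qed
  then have "sqrt (m\<^sup>2) \<le> sqrt (a * b)" by (rule real_sqrt_le_mono)
  then show ?thesis using m by (simp add: real_sqrt_mult a_def b_def m_def)
qed

section \<open>Passage between \<open>[0,T]\<close> and the whole line\<close>

lemma sqint_restrict:
  assumes "f \<in> sqint lebesgue"
  shows "f \<in> sqint (leb T)" "(LINT t|leb T. (norm (f t))\<^sup>2) \<le> (LINT t|lebesgue. (norm (f t))\<^sup>2)"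
proof -
  note i = sqint_integrable[OF assms]
  have set: "{0..T} \<inter> space lebesgue \<in> sets lebesgue" by simp
  have i2: "integrable lebesgue (\<lambda>t. indicat_real {0..T} t *\<^sub>R (norm (f t))\<^sup>2)"
    using i by (intro integrable_mult_indicator) auto
  have "integrable (leb T) (\<lambda>t. (norm (f t))\<^sup>2)"
    using i2 by (simp add: integrable_restrict_space)
  moreover have "strongly_measurable (leb T) f"
    by (rule strongly_measurable_restrict[OF sqint_strongly_measurable[OF assms] set])
  ultimately show "f \<in> sqint (leb T)" by (simp add: sqint_def)
  have "(LINT t|leb T. (norm (f t))\<^sup>2) = (LINT t|lebesgue. indicat_real {0..T} t *\<^sub>R (norm (f t))\<^sup>2)"
    by (rule integral_restrict_space) simp
  also have "\<dots> \<le> (LINT t|lebesgue. (norm (f t))\<^sup>2)"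
    using i i2 by (intro integral_mono) (auto simp: indicator_def)
  finally show "(LINT t|leb T. (norm (f t))\<^sup>2) \<le> (LINT t|lebesgue. (norm (f t))\<^sup>2)" .
qed

definition zero_ext :: "real \<Rightarrow> (real \<Rightarrow> 'b::real_normed_vector) \<Rightarrow> real \<Rightarrow> 'b" where
  "zero_ext T f t = indicat_real {0..T} t *\<^sub>R f t"

lemma sqint_zero_ext:
  assumes "f \<in> sqint (leb T)"
  shows "zero_ext T f \<in> sqint lebesgue"
proof -
  have set: "{0..T} \<inter> space lebesgue \<in> sets lebesgue" by simp
  have "strongly_measurable lebesgue (zero_ext T f)"
    unfolding zero_ext_def[abs_def]
    by (rule strongly_measurable_extend[OF sqint_strongly_measurable[OF assms] set])
  moreover have "integrable lebesgue (\<lambda>t. (norm (zero_ext T f t))\<^sup>2)"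
  proof -
    have "integrable lebesgue (\<lambda>t. indicat_real {0..T} t *\<^sub>R (norm (f t))\<^sup>2)"
      using sqint_integrable[OF assms] by (simp add: integrable_restrict_space)
    moreover have "(norm (zero_ext T f t))\<^sup>2 = indicat_real {0..T} t *\<^sub>R (norm (f t))\<^sup>2" for t
      by (simp add: zero_ext_def indicator_def)
    ultimately show ?thesis by simp
  qed
  ultimately show ?thesis by (simp add: sqint_def)
qed

lemma integral_zero_ext:
  fixes h :: "'b::real_normed_vector \<Rightarrow> real \<Rightarrow> real"
  assumes "\<And>t. h 0 t = 0"
  shows "(LINT t|lebesgue. h (zero_ext T f t) t) = (LINT t|leb T. h (f t) t)"
proof -
  have "(LINT t|leb T. h (f t) t) = (LINT t|lebesgue. indicat_real {0..T} t *\<^sub>R h (f t) t)"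
    by (rule integral_restrict_space) simp
  also have "(\<lambda>t. indicat_real {0..T} t *\<^sub>R h (f t) t) = (\<lambda>t. h (zero_ext T f t) t)"
    using assms by (auto simp: zero_ext_def indicator_def)
  finally show ?thesis by simp
qed

lemma AE_leb_lebesgue: "AE t in lebesgue. P t \<Longrightarrow> AE t in leb T. P t"
  by (subst AE_restrict_space_iff) auto

section \<open>Representatives and functionals on H^1\<close>

lemma H1_weak_deriv: "q \<in> H1 T \<Longrightarrow> has_weak_deriv T q (wderiv T q)"
  unfolding wderiv_def H1_def by (rule someI_ex[of "has_weak_deriv T q"]) auto

lemma H1_continuous: "q \<in> H1 T \<Longrightarrow> continuous_on {0..T} q"
  by (simp add: H1_def)

lemma wderiv_AE_eq:
  fixes q :: "real \<Rightarrow> 'b::{real_inner,complete_space}"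
  assumes "T > 0" "continuous_on {0..T} q" "has_weak_deriv T q g"
  shows "AE t in leb T. wderiv T q t = g t"
proof -
  have "has_weak_deriv T q (wderiv T q)" unfolding wderiv_def by (rule someI[of "has_weak_deriv T q", OF assms(3)])
  then show ?thesis using assms weak_deriv_unique by blast
qed

lemma wderiv_sqint:
  fixes q :: "real \<Rightarrow> 'b::{real_inner,complete_space}"
  assumes "T > 0" "q \<in> H1 T"
  shows "wderiv T q \<in> sqint (leb T)"
proof -
  obtain g where g: "g \<in> sqint (leb T)" "has_weak_deriv T q g"
    using assms(2) by (auto simp: H1_def Lp2_eq_sqint)
  have "AE t in leb T. g t = wderiv T q t"
    using wderiv_AE_eq[OF assms(1) H1_continuous[OF assms(2)] g(2)] by auto
  then show ?thesis by (rule sqint_cong_AE[OF complete_measure_leb g(1)])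
qed

lemma H1I:
  fixes q :: "real \<Rightarrow> 'b::{real_inner,complete_space}"
  assumes T: "T > 0" and q: "continuous_on {0..T} q" and g: "g \<in> sqint (leb T)"
    and eq: "\<And>t y. t \<in> {0..T} \<Longrightarrow> inner (q t) y - inner (q 0) y = integral {0..t} (\<lambda>x. inner (g x) y)"
  shows "q \<in> H1 T" "has_weak_deriv T q g" "AE t in leb T. wderiv T q t = g t"
proof -
  show w: "has_weak_deriv T q g"
    using T q Lp2_imp_Lp1 g eq by (intro has_weak_derivI) (auto simp: Lp2_eq_sqint)
  have "q \<in> Lp 2 T"
    using q by (auto simp: Lp_def intro!: strongly_measurable_continuous_on continuous_imp_integrable_real continuous_intros)
  then show "q \<in> H1 T" using q w g by (auto simp: H1_def Lp2_eq_sqint)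
  show "AE t in leb T. wderiv T q t = g t" by (rule wderiv_AE_eq[OF T q w])
qed

lemma L2_norm_cong_AE:
  assumes M: "f \<in> sqint (leb T)" and "AE t in leb T. f t = g t"
  shows "L2_norm T f = L2_norm T g"
proof -
  have "g \<in> sqint (leb T)" by (rule sqint_cong_AE[OF complete_measure_leb assms])
  then show ?thesis
    unfolding L2_norm_def using assms
    by (intro arg_cong[where f = sqrt] integral_cong_AE borel_measurable_integrable sqint_integrable) auto
qed

lemma L2_norm_nonneg: "0 \<le> L2_norm T f"
  by (simp add: L2_norm_def integral_nonneg_AE)

lemma L2_norm_power2: "(L2_norm T f)\<^sup>2 = (LINT t|leb T. (norm (f t))\<^sup>2)"
  by (simp add: L2_norm_def integral_nonneg_AE)

lemma L2_norm_le_H1_norm: "L2_norm T q \<le> H1_norm T q" "L2_norm T (wderiv T q) \<le> H1_norm T q"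
  by (auto simp: H1_norm_def intro!: real_le_rsqrt)

lemma H1_scaleR:
  fixes q :: "real \<Rightarrow> 'b::{real_inner,complete_space}"
  assumes T: "T > 0" and q: "q \<in> H1 T"
  shows "(\<lambda>t. c *\<^sub>R q t) \<in> H1 T"
proof (rule H1I(1)[OF T])
  show "continuous_on {0..T} (\<lambda>t. c *\<^sub>R q t)" by (intro continuous_intros H1_continuous q)
  show "(\<lambda>t. c *\<^sub>R wderiv T q t) \<in> sqint (leb T)" by (intro sqint_scaleR wderiv_sqint T q)
  fix t y assume "t \<in> {0..T}"
  from weak_deriv_functional[OF T H1_continuous[OF q] H1_weak_deriv[OF q] bounded_linear_inner_left[of y] this]
  have "c * (inner (q t) y - inner (q 0) y) = c * integral {0..t} (\<lambda>x. inner (wderiv T q x) y)" by simp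
  then show "inner (c *\<^sub>R q t) y - inner (c *\<^sub>R q 0) y = integral {0..t} (\<lambda>x. inner (c *\<^sub>R wderiv T q x) y)"
    by (simp add: right_diff_distrib)
qed

text \<open>Functions that agree on \<open>[0,T]\<close> differ by a function of
  \<open>H1_norm\<close> 0, on which a bounded functional vanishes. This allows a function to be
  exchanged for its form as constant plus primitive, which may differ outside
  \<open>[0,T]\<close>.\<close>

lemma bounded_functional_cong:
  fixes u v :: "real \<Rightarrow> 'b::{real_inner,complete_space}"
  assumes T: "T > 0" and F: "bounded_functional (H1 T) (H1_norm T) F"
    and u: "u \<in> H1 T" and v: "v \<in> H1 T" and eq: "\<And>t. t \<in> {0..T} \<Longrightarrow> u t = v t"
  shows "F u = F v"
proof -
  define w where "w t = u t + (- 1) *\<^sub>R v t" for t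
  have w0: "w t = 0" if "t \<in> {0..T}" for t using eq[OF that] by (simp add: w_def)
  have "continuous_on {0..T} w" unfolding w_def by (intro continuous_intros H1_continuous u v)
  then have w: "w \<in> H1 T" "AE t in leb T. wderiv T w t = 0"
    using H1I[OF T _ sqint_zero, of w] w0 T by (auto simp: sqint_zero)
  have "(LINT t|leb T. (norm (w t))\<^sup>2) = (LINT t|leb T. 0)"
    using w0 by (intro Bochner_Integration.integral_cong) auto
  then have "L2_norm T w = 0" by (simp add: L2_norm_def)
  moreover have "L2_norm T (wderiv T w) = L2_norm T (\<lambda>_. 0 :: 'b)"
    by (rule L2_norm_cong_AE[OF wderiv_sqint[OF T w(1)] w(2)])
  ultimately have "H1_norm T w = 0" by (simp add: H1_norm_def L2_norm_def)
  moreover obtain C where "\<And>u. u \<in> H1 T \<Longrightarrow> \<bar>F u\<bar> \<le> C * H1_norm T u"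
    using F unfolding bounded_functional_def by blast
  ultimately have "F w = 0" using w(1) by force
  moreover have "F w = F u + F (\<lambda>t. (- 1) *\<^sub>R v t)"
  proof -
    have "F (\<lambda>t. u t + v t) = F u + F v" if "u \<in> H1 T" "v \<in> H1 T" for u v
      using F that unfolding bounded_functional_def by blast
    then show ?thesis unfolding w_def[abs_def] using u H1_scaleR[OF T v, of "-1"] by blast
  qed
  moreover have "F (\<lambda>t. (- 1) *\<^sub>R v t) = - 1 * F v"
    using F v unfolding bounded_functional_def by blast
  ultimately show ?thesis by simp
qed

text \<open>The indicator keeps the measure \<open>leb T\<close> the same for all \<open>t\<close>.
  Every real \<open>t\<close> gets a value in this way, so linearity holds as an identity between
  functions on the whole line.\<close>

definition primitive :: "real \<Rightarrow> (real \<Rightarrow> 'b::real_normed_vector) \<Rightarrow> real \<Rightarrow> 'b" where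
  "primitive T g t = bochner (leb T) (\<lambda>s. indicat_real {0..t} s *\<^sub>R g s)"

lemma Lp1_indicator:
  assumes "g \<in> Lp 1 T"
  shows "(\<lambda>s. indicat_real {0..t} s *\<^sub>R g s) \<in> Lp 1 T"
proof -
  have g: "strongly_measurable (leb T) g" "integrable (leb T) (\<lambda>t. norm (g t))"
    using assms by (auto simp: Lp1_iff)
  have meas: "indicat_real {0..t} \<in> borel_measurable (leb T)"
    by (intro measurable_restrict_space1 borel_measurable_indicator) simp
  have "integrable (leb T) (\<lambda>s. indicat_real {0..t} s * norm (g s))"
  proof (rule Bochner_Integration.integrable_bound[OF g(2)])
    show "(\<lambda>s. indicat_real {0..t} s * norm (g s)) \<in> borel_measurable (leb T)"
      by (rule borel_measurable_times[OF meas borel_measurable_integrable[OF g(2)]])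
  qed (auto simp: indicator_def)
  then show ?thesis
    using strongly_measurable_scaleR[OF strongly_measurable_real[OF meas] g(1)] by (simp add: Lp1_iff)
qed

lemma inner_primitive_LINT:
  fixes g :: "real \<Rightarrow> 'b::{real_inner,complete_space}"
  assumes "g \<in> Lp 1 T"
  shows "integrable (leb T) (\<lambda>s. indicat_real {0..t} s * inner (g s) y)"
    "inner (primitive T g t) y = (LINT s|leb T. indicat_real {0..t} s * inner (g s) y)"
  using Lp1_functional_integrable[OF Lp1_indicator[OF assms] bounded_linear_inner_left[of y]]
    Lp1_functional_bochner[OF Lp1_indicator[OF assms] bounded_linear_inner_left[of y]]
  by (simp_all add: primitive_def)

lemma inner_primitive:
  fixes g :: "real \<Rightarrow> 'b::{real_inner,complete_space}"
  assumes g: "g \<in> Lp 1 T" and t: "t \<in> {0..T}"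
  shows "inner (primitive T g t) y = integral {0..t} (\<lambda>s. inner (g s) y)"
proof -
  have "inner (primitive T g t) y = integral {0..T} (\<lambda>s. indicat_real {0..t} s * inner (g s) y)"
    using inner_primitive_LINT[OF g] leb_integral by metis
  also have "(\<lambda>s. indicat_real {0..t} s * inner (g s) y) = (\<lambda>s. if s \<in> {0..t} then inner (g s) y else 0)"
    by (auto simp: indicator_def)
  also have "integral {0..T} \<dots> = integral {0..t} (\<lambda>s. inner (g s) y)"
    using t by (subst integral_restrict_Int) (simp add: min_absorb2)
  finally show ?thesis .
qed

lemma primitive_add:
  fixes f g :: "real \<Rightarrow> 'b::{real_inner,complete_space}"
  assumes "f \<in> Lp 1 T" "g \<in> Lp 1 T" "(\<lambda>t. f t + g t) \<in> Lp 1 T"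
  shows "primitive T (\<lambda>t. f t + g t) t = primitive T f t + primitive T g t"
  by (rule inner_ext) (use assms in \<open>simp add: inner_primitive_LINT inner_add_left distrib_left\<close>)

lemma primitive_scaleR:
  fixes f :: "real \<Rightarrow> 'b::{real_inner,complete_space}"
  assumes "f \<in> Lp 1 T" "(\<lambda>t. c *\<^sub>R f t) \<in> Lp 1 T"
  shows "primitive T (\<lambda>t. c *\<^sub>R f t) t = c *\<^sub>R primitive T f t"
proof (rule inner_ext)
  fix y
  have "(\<lambda>s. indicat_real {0..t} s * inner (c *\<^sub>R f s) y) = (\<lambda>s. c * (indicat_real {0..t} s * inner (f s) y))"
    by auto
  then show "inner (primitive T (\<lambda>t. c *\<^sub>R f t) t) y = inner (c *\<^sub>R primitive T f t) y"
    using assms by (simp add: inner_primitive_LINT)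
qed

lemma primitive_cong_AE:
  fixes f g :: "real \<Rightarrow> 'b::{real_inner,complete_space}"
  assumes "f \<in> Lp 1 T" "g \<in> Lp 1 T" "AE t in leb T. f t = g t"
  shows "primitive T f t = primitive T g t"
proof (rule inner_ext)
  fix y
  have "(LINT s|leb T. indicat_real {0..t} s * inner (f s) y) = (LINT s|leb T. indicat_real {0..t} s * inner (g s) y)"
    using inner_primitive_LINT(1)[OF assms(1)] inner_primitive_LINT(1)[OF assms(2)] assms(3)
    by (intro integral_cong_AE borel_measurable_integrable) auto
  then show "inner (primitive T f t) y = inner (primitive T g t) y"
    using assms by (simp add: inner_primitive_LINT)
qed

text \<open>Increments of the primitive are bounded by those of the primitive of
  \<open>norm (g x)\<close>, which gives continuity; the weak derivative then follows from the
  scalar identities.\<close>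

lemma primitive_H1:
  fixes g :: "real \<Rightarrow> 'b::{real_inner,complete_space}"
  assumes T: "T > 0" and g: "g \<in> sqint (leb T)"
  shows "(\<lambda>t. a + primitive T g t) \<in> H1 T" "AE t in leb T. wderiv T (\<lambda>t. a + primitive T g t) t = g t"
    "primitive T g 0 = 0"
proof -
  have g1: "g \<in> Lp 1 T" using g Lp2_imp_Lp1 by (simp add: Lp2_eq_sqint)
  have n: "integrable (leb T) (\<lambda>x. norm (g x))" using g1 by (simp add: Lp1_iff)
  show p0: "primitive T g 0 = 0"
    by (rule inner_ext) (use T in \<open>simp add: inner_primitive[OF g1]\<close>)
  have diff: "norm (primitive T g t - primitive T g s) \<le> integral {0..t} (\<lambda>x. norm (g x)) - integral {0..s} (\<lambda>x. norm (g x))"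
    if st: "0 \<le> s" "s \<le> t" "t \<le> T" for s t
  proof -
    let ?d = "primitive T g t - primitive T g s"
    note i = Lp1_functional_integrable[OF g1 bounded_linear_inner_left[of ?d]]
    have "inner ?d ?d = integral {s..t} (\<lambda>x. inner (g x) ?d)"
      using inner_primitive[OF g1, of t ?d] inner_primitive[OF g1, of s ?d] st
        integral_interval_diff[OF leb_integrable_on[OF i], of 0 t s] by (simp add: inner_diff_left)
    also have "\<dots> \<le> integral {s..t} (\<lambda>x. norm (g x) * norm ?d)"
      using leb_integrable_on[OF i, of s t] leb_integrable_on[OF n, of s t] st
      by (intro integral_le integrable_on_mult_left) (auto simp: norm_cauchy_schwarz)
    also have "\<dots> = integral {s..t} (\<lambda>x. norm (g x)) * norm ?d" by simp
    finally have "norm ?d * norm ?d \<le> integral {s..t} (\<lambda>x. norm (g x)) * norm ?d"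
      by (simp add: power2_norm_eq_inner[symmetric] power2_eq_square)
    moreover have "integral {s..t} (\<lambda>x. norm (g x)) \<ge> 0"
      using leb_integrable_on[OF n, of s t] st by (intro Henstock_Kurzweil_Integration.integral_nonneg) auto
    ultimately have "norm ?d \<le> integral {s..t} (\<lambda>x. norm (g x))" by (cases "norm ?d = 0") auto
    then show ?thesis
      using integral_interval_diff[OF leb_integrable_on[OF n], of 0 t s] st by simp
  qed
  have cont: "continuous_on {0..T} (primitive T g)"
    unfolding continuous_on_iff
  proof (intro ballI allI impI)
    fix s e :: real assume s: "s \<in> {0..T}" and e: "e > 0"
    obtain d where d: "d > 0" "\<And>x y. x \<in> {0..T} \<Longrightarrow> y \<in> {0..T} \<Longrightarrow> \<bar>x - y\<bar> < d \<Longrightarrow>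
        dist (integral {0..x} (\<lambda>x. norm (g x))) (integral {0..y} (\<lambda>x. norm (g x))) < e"
      using uniformly_continuous_interval[OF continuous_primitive[OF n] e] by metis
    have "dist (primitive T g t) (primitive T g s) < e" if t: "t \<in> {0..T}" "dist t s < d" for t
    proof -
      have "dist (primitive T g t) (primitive T g s) \<le> dist (integral {0..t} (\<lambda>x. norm (g x))) (integral {0..s} (\<lambda>x. norm (g x)))"
        using diff[of s t] diff[of t s] s t by (cases "s \<le> t") (auto simp: dist_norm norm_minus_commute)
      also have "\<dots> < e" using d(2)[of t s] s t by (simp add: dist_real_def)
      finally show ?thesis .
    qed
    then show "\<exists>d>0. \<forall>t\<in>{0..T}. dist t s < d \<longrightarrow> dist (primitive T g t) (primitive T g s) < e"
      using d(1) by blast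
  qed
  have c: "continuous_on {0..T} (\<lambda>t. a + primitive T g t)" by (intro continuous_intros cont)
  have "inner (a + primitive T g t) y - inner (a + primitive T g 0) y = integral {0..t} (\<lambda>x. inner (g x) y)"
    if "t \<in> {0..T}" for t y
    using inner_primitive[OF g1 that, of y] p0 by (simp add: inner_add_left)
  from H1I[OF T c g this]
  show "(\<lambda>t. a + primitive T g t) \<in> H1 T" "AE t in leb T. wderiv T (\<lambda>t. a + primitive T g t) t = g t" by auto
qed

text \<open>Cauchy-Schwarz against the constant 1, whose norm in L^2 of the interval is
  \<open>sqrt T\<close>.\<close>

lemma primitive_norm_le:
  fixes g :: "real \<Rightarrow> 'b::{real_inner,complete_space}"
  assumes T: "T > 0" and g: "g \<in> sqint (leb T)" and t: "t \<in> {0..T}"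
  shows "norm (primitive T g t) \<le> sqrt T * L2_norm T g"
proof -
  have g1: "g \<in> Lp 1 T" using g Lp2_imp_Lp1 by (simp add: Lp2_eq_sqint)
  have n: "integrable (leb T) (\<lambda>x. norm (g x))" using g1 by (simp add: Lp1_iff)
  have Lp: "strongly_measurable (leb T) (\<lambda>s. indicat_real {0..t} s *\<^sub>R g s)"
    "integrable (leb T) (\<lambda>s. norm (indicat_real {0..t} s *\<^sub>R g s))"
    using Lp1_indicator[OF g1] by (auto simp: Lp1_iff simp del: norm_scaleR)
  have one: "(\<lambda>x. 1::real) \<in> sqint (leb T)"
    using leb_emeasure_finite[of T] by (simp add: sqint_def strongly_measurable_const less_top)
  have "norm (primitive T g t) \<le> (LINT s|leb T. norm (indicat_real {0..t} s *\<^sub>R g s))"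
    unfolding primitive_def by (rule norm_bochner_le[OF complete_measure_leb Lp])
  also have "\<dots> \<le> (LINT s|leb T. norm (1::real) * norm (g s))"
    using Lp(2) n by (intro integral_mono) (auto simp: indicator_def)
  also have "\<dots> \<le> sqrt (LINT x|leb T. (norm (1::real))\<^sup>2) * sqrt (LINT x|leb T. (norm (g x))\<^sup>2)"
    by (rule sqint_Cauchy_Schwarz[OF complete_measure_leb one g])
  also have "(LINT x|leb T. (norm (1::real))\<^sup>2) = T"
    using T by (simp add: measure_restrict_space)
  finally show ?thesis by (simp add: L2_norm_def)
qed

text \<open>The squared pointwise bound \<open>T * (L2_norm T g)^2\<close>, integrated over
  \<open>[0,T]\<close>, contributes \<open>T^2\<close>; the derivative \<open>g\<close> contributes
  1.\<close>

lemma H1_norm_primitive_le: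
  fixes g :: "real \<Rightarrow> 'b::{real_inner,complete_space}"
  assumes T: "T > 0" and g: "g \<in> sqint (leb T)"
  shows "H1_norm T (primitive T g) \<le> sqrt (T\<^sup>2 + 1) * L2_norm T g"
proof -
  have p: "primitive T g \<in> H1 T" "AE t in leb T. wderiv T (primitive T g) t = g t"
    using primitive_H1(1,2)[OF T g, of 0] by auto
  have "(L2_norm T (primitive T g))\<^sup>2 \<le> (LINT t|leb T. T * (L2_norm T g)\<^sup>2)"
    unfolding L2_norm_power2[of _ "primitive T g"]
  proof (rule integral_mono)
    show "integrable (leb T) (\<lambda>t. (norm (primitive T g t))\<^sup>2)"
      by (intro continuous_imp_integrable_real continuous_intros H1_continuous p)
    show "integrable (leb T) (\<lambda>t. T * (L2_norm T g)\<^sup>2)"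
      by (intro continuous_imp_integrable_real continuous_intros)
    fix t assume "t \<in> space (leb T)"
    then have "(norm (primitive T g t))\<^sup>2 \<le> (sqrt T * L2_norm T g)\<^sup>2"
      using primitive_norm_le[OF T g, of t] by (intro power_mono) auto
    then show "(norm (primitive T g t))\<^sup>2 \<le> T * (L2_norm T g)\<^sup>2"
      using T by (simp add: power_mult_distrib)
  qed
  also have "\<dots> = T\<^sup>2 * (L2_norm T g)\<^sup>2"
    using T by (simp add: measure_restrict_space power2_eq_square)
  finally have "(L2_norm T (primitive T g))\<^sup>2 \<le> T\<^sup>2 * (L2_norm T g)\<^sup>2" .
  moreover have "L2_norm T (wderiv T (primitive T g)) = L2_norm T g"
    by (rule L2_norm_cong_AE[OF wderiv_sqint[OF T p(1)] p(2)])
  ultimately have "H1_norm T (primitive T g) \<le> sqrt ((T\<^sup>2 + 1) * (L2_norm T g)\<^sup>2)"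
    unfolding H1_norm_def by (intro real_sqrt_le_mono) (simp add: algebra_simps)
  then show ?thesis using L2_norm_nonneg[of T g] by (simp add: real_sqrt_mult)
qed

lemma H1_eq_primitive:
  fixes q :: "real \<Rightarrow> 'b::{real_inner,complete_space}"
  assumes T: "T > 0" and q: "q \<in> H1 T" and t: "t \<in> {0..T}"
  shows "q t = q 0 + primitive T (wderiv T q) t"
proof (rule inner_ext)
  fix y
  have "wderiv T q \<in> Lp 1 T" using wderiv_sqint[OF T q] Lp2_imp_Lp1 by (simp add: Lp2_eq_sqint)
  from inner_primitive[OF this t, of y]
  show "inner (q t) y = inner (q 0 + primitive T (wderiv T q) t) y"
    using weak_deriv_functional[OF T H1_continuous[OF q] H1_weak_deriv[OF q] bounded_linear_inner_left[of y] t]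
    by (simp add: inner_add_left)
qed

text \<open>Compactness is taken from L^2: the derivatives have a weakly convergent subsequence in
  \<open>bochner_L2\<close>. The map \<open>J\<close>, which integrates a class, is bounded and
  linear into H^1, so every bounded functional on H^1 composed with \<open>J\<close> is one on
  \<open>bochner_L2\<close>. The common initial value \<open>a\<close> enters only through the fixed
  function \<open>const\<close>.\<close>

lemma H1_weakly_convergent_subsequence:
  fixes q :: "nat \<Rightarrow> real \<Rightarrow> 'b::{real_inner,complete_space}"
  assumes T: "T > 0" and q: "\<And>m. q m \<in> H1 T" "\<And>m. q m 0 = a"
    and bd: "\<And>m. L2_norm T (wderiv T (q m)) \<le> C"
  obtains r u where "strict_mono (r :: nat \<Rightarrow> nat)" "u \<in> H1 T" "u 0 = a"
    "weakly_converges (H1 T) (H1_norm T) (\<lambda>m. q (r m)) u"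
proof -
  define g where "g m = wderiv T (q m)" for m
  have g: "g m \<in> sqint (leb T)" for m unfolding g_def by (rule wderiv_sqint[OF T q(1)])
  define x where "x m = abs_bochner_L2 (zero_ext T (g m))" for m
  have "norm (x m) \<le> C" for m
  proof -
    have "(norm (x m))\<^sup>2 = (L2_norm T (g m))\<^sup>2"
      unfolding x_def using integral_zero_ext[of "\<lambda>y t. (norm y)\<^sup>2" T "g m"]
      by (simp add: norm_abs_bochner_L2 sqint_zero_ext g L2_norm_power2)
    then have "norm (x m) = L2_norm T (g m)" by (rule power2_eq_imp_eq) (auto simp: L2_norm_nonneg)
    then show ?thesis using bd by (simp add: g_def)
  qed
  then obtain r y where r: "strict_mono (r :: nat \<Rightarrow> nat)"
    and y: "\<And>G :: 'b bochner_L2 \<Rightarrow> real. bounded_linear G \<Longrightarrow> (\<lambda>n. G (x (r n))) \<longlonglongrightarrow> G y"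
    by (rule weakly_convergent_subsequence[of x C]) auto
  define J where "J z = primitive T (rep_bochner_L2 z)" for z :: "'b bochner_L2"
  have rep: "rep_bochner_L2 z \<in> sqint (leb T)" for z :: "'b bochner_L2"
    by (rule sqint_restrict(1)[OF rep_bochner_L2_sqint])
  have L1: "f \<in> sqint (leb T) \<Longrightarrow> f \<in> Lp 1 T" for f :: "real \<Rightarrow> 'b"
    using Lp2_imp_Lp1 by (simp add: Lp2_eq_sqint)
  have J_H1: "J z \<in> H1 T" for z unfolding J_def using primitive_H1(1)[OF T rep, of 0] by simp
  \<comment> \<open>Representatives of classes add only almost everywhere, but their primitives add
    at every \<open>t\<close>; \<open>bounded_functional\<close> requires such exact
    identities.\<close>
  have J_add: "J (z + z') = (\<lambda>t. J z t + J z' t)" for z z'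
  proof
    fix t
    have "primitive T (rep_bochner_L2 (z + z')) t = primitive T (\<lambda>t. rep_bochner_L2 z t + rep_bochner_L2 z' t) t"
      by (intro primitive_cong_AE L1 rep sqint_add complete_measure_leb AE_leb_lebesgue rep_add_bochner_L2)
    also have "\<dots> = J z t + J z' t"
      unfolding J_def by (intro primitive_add L1 rep sqint_add complete_measure_leb)
    finally show "J (z + z') t = J z t + J z' t" unfolding J_def .
  qed
  have J_scaleR: "J (c *\<^sub>R z) = (\<lambda>t. c *\<^sub>R J z t)" for c z
  proof
    fix t
    have "primitive T (rep_bochner_L2 (c *\<^sub>R z)) t = primitive T (\<lambda>t. c *\<^sub>R rep_bochner_L2 z t) t"
      by (intro primitive_cong_AE L1 rep sqint_scaleR AE_leb_lebesgue rep_scaleR_bochner_L2)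
    also have "\<dots> = c *\<^sub>R J z t"
      unfolding J_def by (intro primitive_scaleR L1 rep sqint_scaleR)
    finally show "J (c *\<^sub>R z) t = c *\<^sub>R J z t" unfolding J_def .
  qed
  have J_norm: "H1_norm T (J z) \<le> sqrt (T\<^sup>2 + 1) * norm z" for z
  proof -
    have "(L2_norm T (rep_bochner_L2 z))\<^sup>2 \<le> (norm z)\<^sup>2"
      using sqint_restrict(2)[OF rep_bochner_L2_sqint[of z], of T]
      by (simp add: L2_norm_power2 power2_norm_eq_inner[of z] inner_bochner_L2_rep power2_norm_eq_inner)
    then have "L2_norm T (rep_bochner_L2 z) \<le> norm z" by (rule power2_le_imp_le) simp
    then have "sqrt (T\<^sup>2 + 1) * L2_norm T (rep_bochner_L2 z) \<le> sqrt (T\<^sup>2 + 1) * norm z"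
      by (intro mult_left_mono) auto
    then show ?thesis
      unfolding J_def using H1_norm_primitive_le[OF T rep[of z]] by linarith
  qed
  define const where "const t = a" for t :: real
  have const: "const \<in> H1 T" unfolding const_def[abs_def]
    by (rule H1I(1)[OF T, of _ "\<lambda>_. 0"]) (auto simp: sqint_zero)
  define u where "u t = const t + J y t" for t
  have u: "u \<in> H1 T" "u 0 = a"
    using primitive_H1(1)[OF T rep[of y], of a] primitive_H1(3)[OF T rep[of y]] by (auto simp: u_def[abs_def] J_def const_def)
  have x_u: "const t + J (x m) t = q m t" if t: "t \<in> {0..T}" for m t
  proof -
    have "AE t in lebesgue. rep_bochner_L2 (x m) t = zero_ext T (g m) t"
      unfolding x_def by (intro rep_abs_bochner_L2 sqint_zero_ext g)
    from AE_leb_lebesgue[OF this] have "AE t in leb T. rep_bochner_L2 (x m) t = g m t"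
      using AE_space by eventually_elim (simp add: zero_ext_def)
    then have "J (x m) t = primitive T (g m) t"
      unfolding J_def by (intro primitive_cong_AE L1 rep g)
    then show ?thesis
      using H1_eq_primitive[OF T q(1) t, of m] q(2) by (simp add: const_def g_def)
  qed
  have "(\<lambda>m. F (q (r m))) \<longlonglongrightarrow> F u" if F: "bounded_functional (H1 T) (H1_norm T) F" for F
  proof -
    obtain C where C: "\<And>u. u \<in> H1 T \<Longrightarrow> \<bar>F u\<bar> \<le> C * H1_norm T u"
      using F unfolding bounded_functional_def by blast
    have F_add: "F (\<lambda>t. u t + v t) = F u + F v" if "u \<in> H1 T" "v \<in> H1 T" for u v
      using F that unfolding bounded_functional_def by blast
    have F_scale: "F (\<lambda>t. c *\<^sub>R u t) = c * F u" if "u \<in> H1 T" for u c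
      using F that unfolding bounded_functional_def by blast
    have "bounded_linear (\<lambda>z. F (J z))"
    proof (rule bounded_linear_intro)
      show "F (J (z + z')) = F (J z) + F (J z')" for z z'
        unfolding J_add by (intro F_add J_H1)
      show "F (J (c *\<^sub>R z)) = c *\<^sub>R F (J z)" for c z
        unfolding J_scaleR using F_scale[OF J_H1] by simp
      show "norm (F (J z)) \<le> norm z * (\<bar>C\<bar> * sqrt (T\<^sup>2 + 1))" for z
      proof -
        have "0 \<le> H1_norm T (J z)" using L2_norm_le_H1_norm(1) L2_norm_nonneg order_trans by blast
        then have "C * H1_norm T (J z) \<le> \<bar>C\<bar> * H1_norm T (J z)" by (intro mult_right_mono) auto
        also have "\<dots> \<le> \<bar>C\<bar> * (sqrt (T\<^sup>2 + 1) * norm z)" by (intro mult_left_mono J_norm) auto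
        finally show ?thesis using C[OF J_H1[of z]] by (simp add: mult_ac)
      qed
    qed
    then have "(\<lambda>m. F const + F (J (x (r m)))) \<longlonglongrightarrow> F const + F (J y)"
      by (intro tendsto_intros y)
    moreover have "F const + F (J y) = F u"
      unfolding u_def using F_add[OF const J_H1] by simp
    moreover have "F const + F (J (x m)) = F (q m)" for m
    proof -
      have "F const + F (J (x m)) = F (\<lambda>t. const t + J (x m) t)"
        using F_add[OF const J_H1] by simp
      also have "\<dots> = F (q m)"
      proof (rule bounded_functional_cong[OF T F _ q(1) x_u])
        show "(\<lambda>t. const t + J (x m) t) \<in> H1 T"
          unfolding const_def J_def by (rule primitive_H1(1)[OF T rep])
      qed
      finally show ?thesis .
    qed
    ultimately show ?thesis by simp
  qed
  then have "weakly_converges (H1 T) (H1_norm T) (\<lambda>m. q (r m)) u"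
    unfolding weakly_converges_def using q(1) u(1) by blast
  with r u show ?thesis by (rule that)
qed

text \<open>Pairing with a fixed class is a bounded functional on \<open>Lp 2 T\<close>, so the zero
  extensions form a weakly bounded sequence in the complete space \<open>bochner_L2\<close>, to
  which uniform boundedness applies.\<close>

lemma L2_weakly_converges_bounded:
  fixes v :: "nat \<Rightarrow> real \<Rightarrow> 'b::{real_inner,complete_space}"
  assumes "weakly_converges (Lp 2 T) (L2_norm T) v w"
  obtains K where "\<And>m. L2_norm T (v m) \<le> K"
proof -
  have v: "v m \<in> sqint (leb T)" for m
    using assms by (simp add: weakly_converges_def Lp2_eq_sqint)
  define x where "x m = abs_bochner_L2 (zero_ext T (v m))" for m
  have "Bseq (\<lambda>m. inner (x m) z)" for z
  proof -
    define F where "F f = (LINT t|leb T. inner (f t) (rep_bochner_L2 z t))" for f :: "real \<Rightarrow> 'b"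
    have rep: "rep_bochner_L2 z \<in> sqint (leb T)" by (rule sqint_restrict(1)[OF rep_bochner_L2_sqint])
    note i = sqint_inner_integrable[OF complete_measure_leb _ rep]
    have "bounded_functional (Lp 2 T) (L2_norm T) F"
      unfolding bounded_functional_def Lp2_eq_sqint
    proof (intro conjI ballI allI exI)
      show "F (\<lambda>t. f t + g t) = F f + F g" if "f \<in> sqint (leb T)" "g \<in> sqint (leb T)" for f g
        using i[OF that(1)] i[OF that(2)] by (simp add: F_def inner_add_left)
      show "F (\<lambda>t. c *\<^sub>R f t) = c * F f" for c f by (simp add: F_def)
      show "\<bar>F f\<bar> \<le> L2_norm T (rep_bochner_L2 z) * L2_norm T f" if f: "f \<in> sqint (leb T)" for f
      proof -
        have "\<bar>F f\<bar> \<le> (LINT t|leb T. \<bar>inner (f t) (rep_bochner_L2 z t)\<bar>)"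
          unfolding F_def by (rule integral_abs_bound)
        also have "\<dots> \<le> (LINT t|leb T. norm (f t) * norm (rep_bochner_L2 z t))"
          using i[OF f] sqint_norm_mult_integrable[OF complete_measure_leb f rep]
          by (intro integral_mono integrable_abs) (auto simp: Cauchy_Schwarz_ineq2)
        also have "\<dots> \<le> L2_norm T f * L2_norm T (rep_bochner_L2 z)"
          unfolding L2_norm_def by (rule sqint_Cauchy_Schwarz[OF complete_measure_leb f rep])
        finally show ?thesis by (simp add: mult.commute)
      qed
    qed
    then have "(\<lambda>m. F (v m)) \<longlonglongrightarrow> F w" using assms unfolding weakly_converges_def by blast
    moreover have "inner (x m) z = F (v m)" for m
    proof -
      have "inner (x m) z = (LINT t|lebesgue. inner (zero_ext T (v m) t) (rep_bochner_L2 z t))"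
        using inner_abs_bochner_L2[OF sqint_zero_ext[OF v[of m]] rep_bochner_L2_sqint[of z]]
        by (simp add: x_def abs_rep_bochner_L2)
      also have "\<dots> = F (v m)" unfolding F_def by (rule integral_zero_ext) simp
      finally show ?thesis .
    qed
    ultimately show ?thesis by (simp add: convergent_imp_Bseq[OF convergentI])
  qed
  then have "Bseq x" by (rule weakly_bounded_imp_Bseq)
  then obtain K where K: "\<And>m. norm (x m) \<le> K" by (auto simp: Bseq_def)
  have "L2_norm T (v m) \<le> K" for m
  proof -
    have "(norm (x m))\<^sup>2 = (L2_norm T (v m))\<^sup>2"
      unfolding x_def using integral_zero_ext[of "\<lambda>y t. (norm y)\<^sup>2" T "v m"]
      by (simp add: norm_abs_bochner_L2 sqint_zero_ext v L2_norm_power2)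
    then have "norm (x m) = L2_norm T (v m)" by (rule power2_eq_imp_eq) (auto simp: L2_norm_nonneg)
    then show ?thesis using K[of m] by simp
  qed
  then show ?thesis by (rule that)
qed

subsection \<open>The energy\<close>

lemma fderiv_works:
  assumes "f differentiable (at x)"
  shows "(f has_derivative blinfun_apply (fderiv f x)) (at x)"
proof -
  have *: "(f has_derivative frechet_derivative f (at x)) (at x)"
    using assms by (simp add: frechet_derivative_works)
  then show ?thesis
    unfolding fderiv_def using has_derivative_bounded_linear[OF *] by (simp add: bounded_linear_Blinfun_apply)
qed

lemma fderiv_eqI:
  assumes "(f has_derivative blinfun_apply L) (at x)"
  shows "fderiv f x = L"
  unfolding fderiv_def frechet_derivative_at[OF assms, symmetric] by (rule blinfun_apply_inverse)

lemma fderiv_energy: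
  assumes "U differentiable (at y)"
  shows "fderiv (energy U l t) y = fderiv U y - l t"
proof (rule fderiv_eqI)
  have "((\<lambda>y. U y - blinfun_apply (l t) y) has_derivative (\<lambda>v. blinfun_apply (fderiv U y) v - blinfun_apply (l t) v)) (at y)"
    by (intro has_derivative_diff fderiv_works assms bounded_linear_imp_has_derivative blinfun.bounded_linear_right)
  then show "(energy U l t has_derivative blinfun_apply (fderiv U y - l t)) (at y)"
    by (simp add: energy_def[abs_def] minus_blinfun.rep_eq)
qed

lemma C2_function_continuous_fderiv: "C2_function U \<Longrightarrow> continuous_on S (fderiv U)"
  unfolding C2_function_def
  by (meson continuous_at_imp_continuous_on differentiable_imp_continuous_within)

lemma C2_function_differentiable: "C2_function U \<Longrightarrow> U differentiable (at x)"
  by (simp add: C2_function_def)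

text \<open>The convexity inequality on the segment is divided by \<open>\<theta>\<close>, which
  then tends to 0 from the right.\<close>

lemma strongly_convex_first_order:
  fixes U :: "'y::real_normed_vector \<Rightarrow> real"
  assumes diff: "U differentiable (at y1)"
    and conv: "\<forall>\<theta>\<in>{0..1}. (1 - \<theta>) * U y1 + \<theta> * U y2 \<ge>
          U ((1 - \<theta>) *\<^sub>R y1 + \<theta> *\<^sub>R y2) + \<alpha> / 2 * \<theta> * (1 - \<theta>) * (norm (y2 - y1))\<^sup>2"
  shows "U y1 + blinfun_apply (fderiv U y1) (y2 - y1) + \<alpha> / 2 * (norm (y2 - y1))\<^sup>2 \<le> U y2"
proof -
  define d where "d = y2 - y1"
  have "((\<lambda>\<theta>. y1 + \<theta> *\<^sub>R d) has_derivative (\<lambda>\<theta>. \<theta> *\<^sub>R d)) (at 0)"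
    by (auto intro!: derivative_eq_intros)
  moreover have "(U has_derivative blinfun_apply (fderiv U y1)) (at (y1 + 0 *\<^sub>R d))"
    using fderiv_works[OF diff] by simp
  ultimately have "((\<lambda>\<theta>. U (y1 + \<theta> *\<^sub>R d)) has_derivative (\<lambda>\<theta>. blinfun_apply (fderiv U y1) (\<theta> *\<^sub>R d))) (at 0)"
    by (rule has_derivative_compose)
  then have "((\<lambda>\<theta>. U (y1 + \<theta> *\<^sub>R d)) has_real_derivative blinfun_apply (fderiv U y1) d) (at 0)"
    by (simp add: has_field_derivative_def blinfun.scaleR_right mult.commute[of _ "blinfun_apply _ d"])
  then have "((\<lambda>\<theta>. (U (y1 + \<theta> *\<^sub>R d) - U y1) / \<theta>) \<longlongrightarrow> blinfun_apply (fderiv U y1) d) (at 0)"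
    by (simp add: DERIV_def)
  then have lim: "((\<lambda>\<theta>. (U (y1 + \<theta> *\<^sub>R d) - U y1) / \<theta>) \<longlongrightarrow> blinfun_apply (fderiv U y1) d) (at_right 0)"
    by (rule filterlim_mono[OF _ order_refl at_le]) auto
  have lim2: "((\<lambda>\<theta>. U y2 - U y1 - \<alpha> / 2 * (1 - \<theta>) * (norm d)\<^sup>2) \<longlongrightarrow> U y2 - U y1 - \<alpha> / 2 * (1 - 0) * (norm d)\<^sup>2) (at_right 0)"
    by (intro tendsto_intros)
  have "\<forall>\<^sub>F \<theta> in at_right 0. (U (y1 + \<theta> *\<^sub>R d) - U y1) / \<theta> \<le> U y2 - U y1 - \<alpha> / 2 * (1 - \<theta>) * (norm d)\<^sup>2"
  proof (rule eventually_at_rightI[of 0 1])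
    fix \<theta> :: real assume \<theta>: "\<theta> \<in> {0<..<1}"
    have "(1 - \<theta>) *\<^sub>R y1 + \<theta> *\<^sub>R y2 = y1 + \<theta> *\<^sub>R d" by (simp add: d_def algebra_simps)
    with conv \<theta> have "U (y1 + \<theta> *\<^sub>R d) + \<alpha> / 2 * \<theta> * (1 - \<theta>) * (norm d)\<^sup>2 \<le> (1 - \<theta>) * U y1 + \<theta> * U y2"
      by (auto simp: d_def dest!: bspec[of _ _ \<theta>])
    then have "U (y1 + \<theta> *\<^sub>R d) - U y1 \<le> (U y2 - U y1 - \<alpha> / 2 * (1 - \<theta>) * (norm d)\<^sup>2) * \<theta>"
      by (simp add: algebra_simps)
    then show "(U (y1 + \<theta> *\<^sub>R d) - U y1) / \<theta> \<le> U y2 - U y1 - \<alpha> / 2 * (1 - \<theta>) * (norm d)\<^sup>2"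
      using \<theta> by (simp add: divide_le_eq)
  qed simp
  from tendsto_le[OF _ lim2 lim this] show ?thesis by (simp add: d_def)
qed

text \<open>Bounded sets of the state space need not be compact, but the chords of one continuous
  trajectory are the image of the compact set \<open>{0..1} \<times> {0..T} \<times> {0..T}\<close>.
  Uniform control of the derivatives of \<open>U\<close> is obtained only there.\<close>

lemma segment_uniformly_continuous:
  fixes q :: "real \<Rightarrow> 'y::real_normed_vector" and f :: "'y \<Rightarrow> 'z::metric_space"
  assumes q: "continuous_on {0..T} q" and f: "continuous_on UNIV f" and e: "e > 0"
  obtains d where "d > 0" "\<And>s t \<theta>. s \<in> {0..T} \<Longrightarrow> t \<in> {0..T} \<Longrightarrow> \<theta> \<in> {0..1} \<Longrightarrow> \<bar>t - s\<bar> < d \<Longrightarrow>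
    dist (f (q s + \<theta> *\<^sub>R (q t - q s))) (f (q s)) < e"
proof -
  define S :: "(real \<times> real \<times> real) set" where "S = {0..1} \<times> {0..T} \<times> {0..T}"
  define \<Psi> where "\<Psi> z = f (q (fst (snd z)) + fst z *\<^sub>R (q (snd (snd z)) - q (fst (snd z))))" for z :: "real \<times> real \<times> real"
  have "continuous_on S (\<lambda>z. q (fst (snd z)) + fst z *\<^sub>R (q (snd (snd z)) - q (fst (snd z))))"
    by (intro continuous_intros continuous_on_compose2[OF q]) (auto simp: S_def)
  then have "continuous_on S \<Psi>"
    unfolding \<Psi>_def by (intro continuous_on_compose2[OF f]) auto
  then have "uniformly_continuous_on S \<Psi>"
    by (rule compact_uniformly_continuous) (auto simp: S_def intro: compact_Times)
  then obtain d where d: "d > 0" "\<And>z z'. z \<in> S \<Longrightarrow> z' \<in> S \<Longrightarrow> dist z' z < d \<Longrightarrow> dist (\<Psi> z') (\<Psi> z) < e"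
    using e unfolding uniformly_continuous_on_def by metis
  show ?thesis
  proof (rule that[OF d(1)])
    fix s t \<theta> :: real assume "s \<in> {0..T}" "t \<in> {0..T}" "\<theta> \<in> {0..1}" "\<bar>t - s\<bar> < d"
    \<comment> \<open>The two parameters compared are \<open>(\<theta>, s, t)\<close> and
      \<open>(\<theta>, s, s)\<close>; for the latter the chord collapses to
      \<open>q s\<close>.\<close>
    then show "dist (f (q s + \<theta> *\<^sub>R (q t - q s))) (f (q s)) < e"
      using d(2)[of "(\<theta>, s, s)" "(\<theta>, s, t)"] by (simp add: S_def \<Psi>_def dist_Pair_Pair dist_real_def)
  qed
qed

lemma segment_bounded:
  fixes q :: "real \<Rightarrow> 'y::real_normed_vector" and f :: "'y \<Rightarrow> 'z::real_normed_vector"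
  assumes q: "continuous_on {0..T} q" and f: "continuous_on UNIV f"
  obtains K where "K \<ge> 0" "\<And>s t \<theta>. s \<in> {0..T} \<Longrightarrow> t \<in> {0..T} \<Longrightarrow> \<theta> \<in> {0..1} \<Longrightarrow>
    norm (f (q s + \<theta> *\<^sub>R (q t - q s))) \<le> K"
proof -
  define S :: "(real \<times> real \<times> real) set" where "S = {0..1} \<times> {0..T} \<times> {0..T}"
  define \<Psi> where "\<Psi> z = f (q (fst (snd z)) + fst z *\<^sub>R (q (snd (snd z)) - q (fst (snd z))))" for z :: "real \<times> real \<times> real"
  have "continuous_on S (\<lambda>z. q (fst (snd z)) + fst z *\<^sub>R (q (snd (snd z)) - q (fst (snd z))))"
    by (intro continuous_intros continuous_on_compose2[OF q]) (auto simp: S_def)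
  then have "continuous_on S \<Psi>"
    unfolding \<Psi>_def by (intro continuous_on_compose2[OF f]) auto
  then have "bounded (\<Psi> ` S)"
    by (intro compact_imp_bounded compact_continuous_image) (auto simp: S_def intro: compact_Times)
  then obtain K where K: "K > 0" "\<forall>y\<in>\<Psi> ` S. norm y \<le> K" unfolding bounded_pos by blast
  show ?thesis
  proof (rule that[of K])
    fix s t \<theta> :: real assume "s \<in> {0..T}" "t \<in> {0..T}" "\<theta> \<in> {0..1}"
    then have "(\<theta>, s, t) \<in> S" by (simp add: S_def)
    then have "norm (\<Psi> (\<theta>, s, t)) \<le> K" using K(2) by blast
    then show "norm (f (q s + \<theta> *\<^sub>R (q t - q s))) \<le> K" by (simp add: \<Psi>_def)
  qed (use K in simp)
qed

lemma onorm_blinfun_le: "onorm (blinfun_apply L) \<le> norm L"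
  by (simp add: norm_blinfun.rep_eq)

text \<open>Mean value inequality on chords, where the second derivative is bounded by compactness.
  The constant depends on the trajectory, which is harmless because it only enters error terms that
  vanish with the mesh.\<close>

lemma C2_function_fderiv_lipschitz_along:
  fixes q :: "real \<Rightarrow> 'y::real_normed_vector" and U :: "'y \<Rightarrow> real"
  assumes U: "C2_function U" and q: "continuous_on {0..T} q"
  obtains K where "K \<ge> 0" "\<And>s t. s \<in> {0..T} \<Longrightarrow> t \<in> {0..T} \<Longrightarrow>
    norm (fderiv U (q t) - fderiv U (q s)) \<le> K * norm (q t - q s)"
proof -
  have c: "continuous_on UNIV (fderiv (fderiv U))" and d: "\<And>x. fderiv U differentiable (at x)"
    using U by (auto simp: C2_function_def)
  obtain K where K: "K \<ge> 0" "\<And>s t \<theta>. s \<in> {0..T} \<Longrightarrow> t \<in> {0..T} \<Longrightarrow> \<theta> \<in> {0..1} \<Longrightarrow>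
    norm (fderiv (fderiv U) (q s + \<theta> *\<^sub>R (q t - q s))) \<le> K"
    using segment_bounded[OF q c] by metis
  have "norm (fderiv U (q t) - fderiv U (q s)) \<le> K * norm (q t - q s)" if st: "s \<in> {0..T}" "t \<in> {0..T}" for s t
  proof (rule differentiable_bound)
    show "convex (closed_segment (q s) (q t))" by (rule convex_closed_segment)
    fix x assume "x \<in> closed_segment (q s) (q t)"
    then obtain \<theta> where \<theta>: "\<theta> \<in> {0..1}" "x = q s + \<theta> *\<^sub>R (q t - q s)"
      by (auto simp: closed_segment_def algebra_simps)
    show "(fderiv U has_derivative blinfun_apply (fderiv (fderiv U) x)) (at x within closed_segment (q s) (q t))"
      by (rule has_derivative_at_withinI[OF fderiv_works[OF d]])
    show "onorm (blinfun_apply (fderiv (fderiv U) x)) \<le> K"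
      using onorm_blinfun_le K(2)[OF st \<theta>(1)] \<theta>(2) order_trans by blast
  qed auto
  with K(1) show ?thesis by (rule that)
qed

text \<open>On a short interval \<open>U\<close> is linearized at \<open>q s\<close>. The remainder
  and the freezing of \<open>fderiv U (q r)\<close> at \<open>r = s\<close> under the integral each
  cost \<delta> times the integral of \<open>norm (g r)\<close>, hence the factor 2 in the
  comparison function.\<close>

lemma
  fixes q :: "real \<Rightarrow> 'y::{real_inner,complete_space}" and U :: "'y \<Rightarrow> real"
  assumes T: "T > 0" and U: "C2_function U" and q: "continuous_on {0..T} q" "has_weak_deriv T q g"
  shows chain_rule_integrable: "integrable (leb T) (\<lambda>s. blinfun_apply (fderiv U (q s)) (g s))"
    and chain_rule: "U (q T) - U (q 0) = integral {0..T} (\<lambda>s. blinfun_apply (fderiv U (q s)) (g s))"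
proof -
  have L: "g \<in> Lp 1 T" using q(2) by (auto simp: has_weak_deriv_def)
  have n: "integrable (leb T) (\<lambda>x. norm (g x))" using L by (simp add: Lp1_iff)
  have DU: "continuous_on {0..T} (\<lambda>s. fderiv U (q s))"
    by (rule continuous_on_compose2[OF C2_function_continuous_fderiv[OF U, of UNIV] q(1)]) simp
  show i: "integrable (leb T) (\<lambda>s. blinfun_apply (fderiv U (q s)) (g s))"
  proof (rule Bochner_Integration.integrable_bound)
    show "integrable (leb T) (\<lambda>s. norm (fderiv U (q s)) * norm (g s))"
      by (intro integrable_continuous_mult continuous_intros DU n)
    show "(\<lambda>s. blinfun_apply (fderiv U (q s)) (g s)) \<in> borel_measurable (leb T)"
      by (intro strongly_measurable_borel[OF complete_measure_leb] strongly_measurable_blinfun_apply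
          strongly_measurable_continuous_on[OF DU]) (use L in \<open>auto simp: Lp1_iff\<close>)
    show "AE s in leb T. norm (blinfun_apply (fderiv U (q s)) (g s)) \<le> norm (norm (fderiv U (q s)) * norm (g s))"
    proof (rule AE_I2)
      show "norm (blinfun_apply (fderiv U (q s)) (g s)) \<le> norm (norm (fderiv U (q s)) * norm (g s))" for s
        using norm_blinfun[of "fderiv U (q s)" "g s"] by simp
    qed
  qed
  define \<Phi> where "\<Phi> t = U (q t) - integral {0..t} (\<lambda>s. blinfun_apply (fderiv U (q s)) (g s))" for t
  have "\<Phi> 0 = \<Phi> T"
  proof (rule local_constant_imp_eq[of 0 T _ "\<lambda>t. 2 * integral {0..t} (\<lambda>s. norm (g s))"])
    fix \<delta> :: real assume \<delta>: "\<delta> > 0"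
    obtain d where d: "d > 0" "\<And>s t \<theta>. s \<in> {0..T} \<Longrightarrow> t \<in> {0..T} \<Longrightarrow> \<theta> \<in> {0..1} \<Longrightarrow> \<bar>t - s\<bar> < d \<Longrightarrow>
      dist (fderiv U (q s + \<theta> *\<^sub>R (q t - q s))) (fderiv U (q s)) < \<delta>"
      using segment_uniformly_continuous[OF q(1) C2_function_continuous_fderiv[OF U] \<delta>] by metis
    have "\<bar>\<Phi> t - \<Phi> s\<bar> \<le> \<delta> * (2 * integral {0..t} (\<lambda>s. norm (g s)) - 2 * integral {0..s} (\<lambda>s. norm (g s)))"
      if st: "0 \<le> s" "s \<le> t" "t \<le> T" "t - s < d" for s t
    proof -
      note io = leb_integrable_on[OF _ \<open>0 \<le> s\<close> \<open>t \<le> T\<close>] and io0 = leb_integrable_on[OF _ order_refl \<open>t \<le> T\<close>]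
      note df = integral_interval_diff[OF io0 \<open>0 \<le> s\<close> \<open>s \<le> t\<close>]
      let ?D = "\<lambda>r. fderiv U (q r)"
      have h: "bounded_linear (blinfun_apply (?D s))" by (rule blinfun.bounded_linear_right)
      note ih = Lp1_functional_integrable[OF L h]
      have "?D s (q t - q s) = integral {s..t} (\<lambda>r. ?D s (g r))"
        using weak_deriv_functional[OF T q h, of t] weak_deriv_functional[OF T q h, of s] st df[OF ih]
        by (simp add: blinfun.diff_right)
      moreover have "norm (U (q t) - U (q s) - blinfun_apply (?D s) (q t - q s)) \<le> norm (q t - q s) * \<delta>"
      proof (rule differentiable_bound_linearization[where S = "closed_segment (q s) (q t)"])
        fix \<theta> :: real assume "\<theta> \<in> {0..1}"
        then show "q s + \<theta> *\<^sub>R (q t - q s) \<in> closed_segment (q s) (q t)"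
          by (auto simp: in_segment algebra_simps intro!: exI[of _ \<theta>])
      next
        fix x assume "x \<in> closed_segment (q s) (q t)"
        then obtain \<theta> where \<theta>: "\<theta> \<in> {0..1}" "x = q s + \<theta> *\<^sub>R (q t - q s)"
          by (auto simp: closed_segment_def algebra_simps)
        show "(U has_derivative blinfun_apply (fderiv U x)) (at x within closed_segment (q s) (q t))"
          by (rule has_derivative_at_withinI[OF fderiv_works[OF C2_function_differentiable[OF U]]])
        have "norm (fderiv U x - ?D s) \<le> \<delta>"
          using d(2)[of s t \<theta>] \<theta> st by (simp add: dist_norm)
        then show "onorm (blinfun_apply (fderiv U x) - blinfun_apply (?D s)) \<le> \<delta>"
          by (simp add: norm_blinfun.rep_eq minus_blinfun.rep_eq fun_diff_def)
      qed auto
      moreover have "norm (q t - q s) * \<delta> \<le> integral {s..t} (\<lambda>r. norm (g r)) * \<delta>"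
        using weak_deriv_norm_diff[OF T q st(1-3)] \<delta> by (intro mult_right_mono) auto
      moreover have "norm (integral {s..t} (\<lambda>r. ?D r (g r) - ?D s (g r))) \<le> integral {s..t} (\<lambda>r. \<delta> * norm (g r))"
      proof (rule integral_norm_bound_integral)
        show "(\<lambda>r. ?D r (g r) - ?D s (g r)) integrable_on {s..t}"
          by (intro integrable_diff io i ih)
        show "(\<lambda>r. \<delta> * norm (g r)) integrable_on {s..t}" by (intro integrable_on_mult_right io n)
        fix r assume r: "r \<in> {s..t}"
        have "norm (?D r - ?D s) \<le> \<delta>"
          using d(2)[of s r 1] r st by (simp add: dist_norm)
        then have "norm (?D r - ?D s) * norm (g r) \<le> \<delta> * norm (g r)" by (rule mult_right_mono) simp
        then show "norm (?D r (g r) - ?D s (g r)) \<le> \<delta> * norm (g r)"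
          using norm_blinfun[of "?D r - ?D s" "g r"] by (simp add: blinfun.diff_left)
      qed
      moreover have "integral {s..t} (\<lambda>r. ?D r (g r) - ?D s (g r)) = integral {s..t} (\<lambda>r. ?D r (g r)) - integral {s..t} (\<lambda>r. ?D s (g r))"
        by (intro Henstock_Kurzweil_Integration.integral_diff io i ih)
      ultimately show ?thesis
        using df[OF i] df[OF n] by (simp add: \<Phi>_def algebra_simps)
    qed
    then show "\<exists>\<eta>>0. \<forall>s t. 0 \<le> s \<longrightarrow> s \<le> t \<longrightarrow> t \<le> T \<longrightarrow> t - s < \<eta> \<longrightarrow> \<bar>\<Phi> t - \<Phi> s\<bar> \<le>
        \<delta> * (2 * integral {0..t} (\<lambda>s. norm (g s)) - 2 * integral {0..s} (\<lambda>s. norm (g s)))"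
      using d(1) by blast
  qed (use T in simp)
  then show "U (q T) - U (q 0) = integral {0..T} (\<lambda>s. blinfun_apply (fderiv U (q s)) (g s))"
    by (simp add: \<Phi>_def)
qed

subsection \<open>The history operator\<close>

lemma AE_leb_ex:
  assumes "T > 0" "AE t in leb T. P t"
  obtains t where "t \<in> {0..T}" "P t"
proof -
  have "\<not> (AE t in leb T. False)"
  proof
    assume "AE t in leb T. False"
    then have "(LINT t|leb T. 1::real) = (LINT t|leb T. 0)" by (intro integral_cong_AE) auto
    then show False using assms(1) by (simp add: measure_restrict_space)
  qed
  moreover have "AE t in leb T. False" if "\<And>t. t \<in> {0..T} \<Longrightarrow> \<not> P t"
    using assms(2) AE_space by eventually_elim (use that in auto)
  ultimately show ?thesis using that by blast
qed

text \<open>The Lipschitz constants of \<open>B t\<close> are given almost everywhere and are merely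
  integrable in time. Starting from one good time \<open>t0\<close> and integrating the Lipschitz
  bound of the time derivative gives the constant \<open>b t0 + M\<close> at every time.\<close>

lemma admissible_kernel_lipschitz:
  fixes B :: "real \<Rightarrow> 'y::real_normed_vector \<Rightarrow> 'x::banach"
  assumes T: "T > 0" and B: "admissible_kernel T B"
  obtains \<Lambda> where "\<And>t. t \<in> {0..T} \<Longrightarrow> \<Lambda>-lipschitz_on UNIV (B t)" "\<And>y. continuous_on {0..T} (\<lambda>t. B t y)"
proof -
  obtain b b' where b: "AE t in leb T. (b t)-lipschitz_on UNIV (B t)"
    and b': "integrable (leb T) b'" "AE t in leb T. (b' t)-lipschitz_on UNIV (dtB T B t)"
    and d: "\<And>y. (\<lambda>t. B t y) differentiable_on {0..T}"
    using B unfolding admissible_kernel_def by blast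
  obtain t0 where t0: "t0 \<in> {0..T}" "(b t0)-lipschitz_on UNIV (B t0)"
    using AE_leb_ex[OF T b] by blast
  have deriv: "((\<lambda>t. B t y) has_vector_derivative dtB T B t y) (at t within {0..T})" if "t \<in> {0..T}" for t y
    unfolding dtB_def using d[of y] that by (simp add: differentiable_on_def vector_derivative_works)
  have "{t \<in> space (leb T). \<not> (b' t)-lipschitz_on UNIV (dtB T B t)} \<in> null_sets (leb T)"
    using b'(2) by (subst (asm) complete_measure.AE_iff_null_sets[OF complete_measure_leb])
  then have neg: "negligible {t \<in> {0..T}. \<not> (b' t)-lipschitz_on UNIV (dtB T B t)}"
    by (simp add: null_sets_restrict_space negligible_iff_null_sets)
  define N where "N = {t \<in> {0..T}. \<not> (b' t)-lipschitz_on UNIV (dtB T B t)}"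
  have lip: "norm (dtB T B t y - dtB T B t z) \<le> b' t * norm (y - z)" "b' t \<ge> 0" if "t \<in> {0..T} - N" for t y z
  proof -
    have *: "(b' t)-lipschitz_on UNIV (dtB T B t)" using that by (auto simp: N_def)
    show "norm (dtB T B t y - dtB T B t z) \<le> b' t * norm (y - z)"
      using lipschitz_onD[OF *, of y z] by (simp add: dist_norm)
    show "b' t \<ge> 0" using * by (rule lipschitz_on_nonneg)
  qed
  have i: "integrable (leb T) (\<lambda>t. \<bar>b' t\<bar>)" using b'(1) by simp
  define M where "M = integral {0..T} (\<lambda>t. \<bar>b' t\<bar>)"
  have M: "M \<ge> 0" unfolding M_def using leb_integrable_on[OF i, of 0 T] by (intro Henstock_Kurzweil_Integration.integral_nonneg) auto
  have bound: "norm ((B t y - B t z) - (B s y - B s z)) \<le> M * norm (y - z)"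
    if st: "0 \<le> s" "s \<le> t" "t \<le> T" for s t y z
  proof -
    define f where "f r = dtB T B r y - dtB T B r z" for r
    have f: "(f has_integral ((B t y - B t z) - (B s y - B s z))) {s..t}"
      unfolding f_def
    proof (rule fundamental_theorem_of_calculus[OF st(2)])
      fix r assume "r \<in> {s..t}"
      then have r: "r \<in> {0..T}" using st by auto
      show "((\<lambda>r. B r y - B r z) has_vector_derivative dtB T B r y - dtB T B r z) (at r within {s..t})"
        by (intro has_vector_derivative_diff has_vector_derivative_within_subset[OF deriv[OF r]]) (use st in auto)
    qed
    have gi: "(\<lambda>r. \<bar>b' r\<bar> * norm (y - z)) integrable_on {s..t}"
      using leb_integrable_on[OF i st(1,3)] by (rule integrable_on_mult_left)
    \<comment> \<open>The bound on an integral asks for domination at every point. On the null set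
      \<open>N\<close> the integrand dominates itself, and the integral of \<open>G\<close> does not
      see \<open>N\<close>.\<close>
    define G where "G r = (if r \<in> N then norm (f r) else \<bar>b' r\<bar> * norm (y - z))" for r
    have "(G has_integral integral {s..t} (\<lambda>r. \<bar>b' r\<bar> * norm (y - z))) {s..t}"
      by (rule has_integral_spike[OF neg[folded N_def] _ integrable_integral[OF gi]]) (auto simp: G_def)
    then have "norm (integral {s..t} f) \<le> integral {s..t} (\<lambda>r. \<bar>b' r\<bar> * norm (y - z))"
      using integral_norm_bound_integral[OF has_integral_integrable[OF f], of G] lip st
      by (fastforce simp: G_def f_def has_integral_iff)
    also have "\<dots> = integral {s..t} (\<lambda>r. \<bar>b' r\<bar>) * norm (y - z)" by simp
    also have "\<dots> \<le> M * norm (y - z)"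
      unfolding M_def using leb_integrable_on[OF i st(1,3)] leb_integrable_on[OF i, of 0 T] st
      by (intro mult_right_mono integral_subset_le) auto
    finally show ?thesis using integral_unique[OF f] by simp
  qed
  have "(b t0 + M)-lipschitz_on UNIV (B t)" if t: "t \<in> {0..T}" for t
  proof (rule lipschitz_onI)
    show "0 \<le> b t0 + M" using lipschitz_on_nonneg[OF t0(2)] M by simp
    fix y z
    have "norm ((B t y - B t z) - (B t0 y - B t0 z)) \<le> M * norm (y - z)"
      using bound[of t t0 y z] bound[of t0 t y z] t t0(1) norm_minus_commute[of "B t y - B t z" "B t0 y - B t0 z"]
      by (cases "t \<le> t0") auto
    moreover have "norm (B t0 y - B t0 z) \<le> b t0 * norm (y - z)"
      using lipschitz_onD[OF t0(2), of y z] by (simp add: dist_norm)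
    moreover have "norm (B t y - B t z) \<le> norm ((B t y - B t z) - (B t0 y - B t0 z)) + norm (B t0 y - B t0 z)"
      by (metis diff_add_cancel norm_triangle_ineq)
    ultimately show "dist (B t y) (B t z) \<le> (b t0 + M) * dist y z"
      by (simp add: dist_norm distrib_right)
  qed
  then show ?thesis using that differentiable_imp_continuous_on[OF d] by blast
qed

text \<open>The variation of the state is absorbed by the uniform Lipschitz constant, which leaves
  continuity in time at the fixed state \<open>q a\<close>.\<close>

lemma kernel_continuous_on:
  fixes B :: "real \<Rightarrow> 'y::real_normed_vector \<Rightarrow> 'x::real_normed_vector" and S :: "real set"
  assumes lip: "\<And>t. t \<in> {0..T} \<Longrightarrow> \<Lambda>-lipschitz_on UNIV (B t)"
    and cont: "\<And>y. continuous_on {0..T} (\<lambda>t. B t y)"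
    and \<tau>: "continuous_on S \<tau>" "\<tau> ` S \<subseteq> {0..T}" and q: "continuous_on S q"
  shows "continuous_on S (\<lambda>s. B (\<tau> s) (q s))"
proof (rule continuous_on_sequentiallyI)
  fix u a assume u: "\<forall>n. u n \<in> S" "a \<in> S" "u \<longlonglongrightarrow> a"
  have t: "\<tau> (u n) \<in> {0..T}" "\<tau> a \<in> {0..T}" for n using \<tau>(2) u by blast+
  have lim: "(\<lambda>n. \<tau> (u n)) \<longlonglongrightarrow> \<tau> a" "(\<lambda>n. q (u n)) \<longlonglongrightarrow> q a"
    using u by (auto intro!: continuous_on_tendsto_compose[OF \<tau>(1)] continuous_on_tendsto_compose[OF q])
  have "(\<lambda>n. B (\<tau> (u n)) (q a)) \<longlonglongrightarrow> B (\<tau> a) (q a)"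
    using t lim(1) by (intro continuous_on_tendsto_compose[OF cont]) auto
  moreover have "(\<lambda>n. B (\<tau> (u n)) (q (u n)) - B (\<tau> (u n)) (q a)) \<longlonglongrightarrow> 0"
  proof (rule Lim_null_comparison)
    show "\<forall>\<^sub>F n in sequentially. norm (B (\<tau> (u n)) (q (u n)) - B (\<tau> (u n)) (q a)) \<le> \<Lambda> * dist (q (u n)) (q a)"
      using lipschitz_onD[OF lip[OF t(1)]] by (intro always_eventually) (auto simp: dist_norm)
    have "(\<lambda>n. \<Lambda> * dist (q (u n)) (q a)) \<longlonglongrightarrow> \<Lambda> * dist (q a) (q a)" by (intro tendsto_intros lim)
    then show "(\<lambda>n. \<Lambda> * dist (q (u n)) (q a)) \<longlonglongrightarrow> 0" by simp
  qed
  ultimately show "(\<lambda>n. B (\<tau> (u n)) (q (u n))) \<longlonglongrightarrow> B (\<tau> a) (q a)"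
    using tendsto_add by fastforce
qed

text \<open>
  Reflecting the convolution moves the time increment from the kernel to \<open>q\<close>, so that no derivative of
  \<open>B\<close> enters the estimate.
\<close>

lemma history_lipschitz:
  fixes B :: "real \<Rightarrow> 'y::real_normed_vector \<Rightarrow> 'x::banach" and q :: "real \<Rightarrow> 'y"
  assumes lip: "\<And>t. t \<in> {0..T} \<Longrightarrow> \<Lambda>-lipschitz_on UNIV (B t)"
    and cont: "\<And>y. continuous_on {0..T} (\<lambda>t. B t y)"
    and c0: "\<And>t. t \<in> {0..T} \<Longrightarrow> norm (B t 0) \<le> c0"
    and q: "continuous_on {0..T} q"
    and W: "continuous_on {0..T} W" "W 0 = 0"
    and qW: "\<And>s t. 0 \<le> s \<Longrightarrow> s \<le> t \<Longrightarrow> t \<le> T \<Longrightarrow> norm (q t - q s) \<le> W t - W s"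
    and st: "0 \<le> s" "s \<le> t" "t \<le> T"
  shows "norm (history B y0 q t - history B y0 q s) \<le> (t - s) * ((c0 + \<Lambda> * norm (q 0)) + 2 * \<Lambda> * W t)"
proof -
  have \<Lambda>: "\<Lambda> \<ge> 0" using lipschitz_on_nonneg[OF lip[of 0]] st by simp
  have mono: "W a \<le> W b" if "0 \<le> a" "a \<le> b" "b \<le> T" for a b
    using qW[OF that] norm_ge_zero[of "q b - q a"] by linarith
  have Bq: "continuous_on {0..r} (\<lambda>\<sigma>. B \<sigma> (q (r - \<sigma>)))" "continuous_on {0..r} (\<lambda>s. B (r - s) (q s))"
    if r: "0 \<le> r" "r \<le> T" for r
    using r by (auto intro!: kernel_continuous_on[OF lip cont] continuous_intros continuous_on_compose2[OF q]
        continuous_on_subset[OF q])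
  have hist: "history B y0 q r = integral {0..r} (\<lambda>\<sigma>. B \<sigma> (q (r - \<sigma>))) + y0" if r: "0 \<le> r" "r \<le> T" for r
  proof -
    have "bochner (leb r) (\<lambda>s. B (r - s) (q s)) = integral {0..r} (\<lambda>s. B (r - s) (q s))"
      by (rule bochner_continuous_on[OF Bq(2)[OF r]])
    also have "\<dots> = integral {- r..0} (\<lambda>s. B (r - (s + r)) (q (s + r)))"
      using integral_shift_Icc_real[of "- r" 0 "\<lambda>s. B (r - s) (q s)" r] by (simp add: o_def add.commute)
    also have "\<dots> = integral {0..r} (\<lambda>\<sigma>. B \<sigma> (q (r - \<sigma>)))"
      using Henstock_Kurzweil_Integration.integral_reflect_real[of r 0 "\<lambda>\<sigma>. B \<sigma> (q (r - \<sigma>))"]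
      by (simp add: add.commute)
    finally show ?thesis by (simp add: history_def)
  qed
  have Blin: "norm (B \<sigma> y - B \<sigma> z) \<le> \<Lambda> * norm (y - z)" if "\<sigma> \<in> {0..T}" for \<sigma> y z
    using lipschitz_onD[OF lip[OF that], of y z] by (simp add: dist_norm)
  let ?f = "\<lambda>\<sigma>. B \<sigma> (q (t - \<sigma>))" and ?g = "\<lambda>\<sigma>. B \<sigma> (q (s - \<sigma>))"
  have fi: "?f integrable_on {0..t}" "?g integrable_on {0..s}" "?f integrable_on {0..s}" "?f integrable_on {s..t}"
    using Bq(1)[of t] Bq(1)[of s] st by (auto intro!: integrable_continuous_interval intro: continuous_on_subset)
  have Wi: "W integrable_on {a..b}" if "0 \<le> a" "b \<le> T" for a b
    using that by (intro integrable_continuous_interval continuous_on_subset[OF W(1)]) auto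
  have Wr: "((\<lambda>\<sigma>. W (r - \<sigma>)) has_integral integral {r - s..r} W) {0..s}" if r: "s \<le> r" "r \<le> T" for r
  proof -
    have ci: "continuous_on {0..s} (\<lambda>\<sigma>. W (r - \<sigma>))"
      using r by (intro continuous_intros continuous_on_compose2[OF W(1)]) auto
    have "integral {r - s..r} W = integral {- s..0} (\<lambda>x. W (x + r))"
      using integral_shift_Icc_real[of "- s" 0 W r] by (simp add: o_def add.commute)
    also have "\<dots> = integral {0..s} (\<lambda>\<sigma>. W (r - \<sigma>))"
      using Henstock_Kurzweil_Integration.integral_reflect_real[of s 0 "\<lambda>\<sigma>. W (r - \<sigma>)"] by (simp add: add.commute)
    finally show ?thesis using integrable_integral[OF integrable_continuous_interval[OF ci]] by simp
  qed
  have "history B y0 q t - history B y0 q s = integral {0..t} ?f - integral {0..s} ?g"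
    using hist[of t] hist[of s] st by simp
  also have "integral {0..t} ?f = integral {0..s} ?f + integral {s..t} ?f"
    using Henstock_Kurzweil_Integration.integral_combine[OF st(1,2) fi(1)] by simp
  finally have "history B y0 q t - history B y0 q s = integral {0..s} (\<lambda>\<sigma>. ?f \<sigma> - ?g \<sigma>) + integral {s..t} ?f"
    using fi by (simp add: Henstock_Kurzweil_Integration.integral_diff)
  moreover have "norm (integral {0..s} (\<lambda>\<sigma>. ?f \<sigma> - ?g \<sigma>)) \<le> (t - s) * (\<Lambda> * W t)"
  proof -
    have "norm (integral {0..s} (\<lambda>\<sigma>. ?f \<sigma> - ?g \<sigma>)) \<le> integral {0..s} (\<lambda>\<sigma>. \<Lambda> * (W (t - \<sigma>) - W (s - \<sigma>)))"
    proof (rule integral_norm_bound_integral)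
      show "(\<lambda>\<sigma>. ?f \<sigma> - ?g \<sigma>) integrable_on {0..s}" by (intro integrable_diff fi)
      show "(\<lambda>\<sigma>. \<Lambda> * (W (t - \<sigma>) - W (s - \<sigma>))) integrable_on {0..s}"
        using Wr[of t] Wr[of s] st by (intro integrable_on_mult_right integrable_diff) (auto simp: has_integral_iff)
      fix \<sigma> assume "\<sigma> \<in> {0..s}"
      then show "norm (?f \<sigma> - ?g \<sigma>) \<le> \<Lambda> * (W (t - \<sigma>) - W (s - \<sigma>))"
        using Blin[of \<sigma> "q (t - \<sigma>)" "q (s - \<sigma>)"] mult_left_mono[OF qW[of "s - \<sigma>" "t - \<sigma>"] \<Lambda>] st by auto
    qed
    also have "\<dots> = \<Lambda> * (integral {t - s..t} W - integral {0..s} W)"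
      using Wr[of t] Wr[of s] st by (simp add: has_integral_iff Henstock_Kurzweil_Integration.integral_diff)
    \<comment> \<open>The overlap of the two intervals cancels. Both remaining intervals have length
      \<open>t - s\<close>, which is the source of that factor.\<close>
    also have "integral {t - s..t} W - integral {0..s} W = integral {s..t} W - integral {0..t - s} W"
      using Henstock_Kurzweil_Integration.integral_combine[of 0 "t - s" t W]
        Henstock_Kurzweil_Integration.integral_combine[of 0 s t W] Wi[of 0 t] st by simp
    also have "\<Lambda> * (integral {s..t} W - integral {0..t - s} W) \<le> \<Lambda> * ((t - s) * W t)"
    proof (rule mult_left_mono[OF _ \<Lambda>])
      have "0 \<le> integral {0..t - s} W"
        using mono[of 0] W(2) st Wi[of 0 "t - s"] by (intro Henstock_Kurzweil_Integration.integral_nonneg) auto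
      moreover have "integral {s..t} W \<le> integral {s..t} (\<lambda>_. W t)"
        using mono st Wi[of s t] by (intro integral_le) auto
      ultimately show "integral {s..t} W - integral {0..t - s} W \<le> (t - s) * W t" using st by simp
    qed
    finally show ?thesis by (simp add: mult_ac)
  qed
  moreover have "norm (integral {s..t} ?f) \<le> (t - s) * ((c0 + \<Lambda> * norm (q 0)) + \<Lambda> * W t)"
  proof -
    have "norm (integral {s..t} ?f) \<le> integral {s..t} (\<lambda>_. (c0 + \<Lambda> * norm (q 0)) + \<Lambda> * W t)"
    proof (rule integral_norm_bound_integral[OF fi(4)])
      fix \<sigma> assume \<sigma>: "\<sigma> \<in> {s..t}"
      have "norm (?f \<sigma>) \<le> norm (?f \<sigma> - B \<sigma> 0) + norm (B \<sigma> 0)" by (metis diff_add_cancel norm_triangle_ineq)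
      moreover have "norm (?f \<sigma> - B \<sigma> 0) \<le> \<Lambda> * norm (q (t - \<sigma>))"
        using Blin[of \<sigma> "q (t - \<sigma>)" 0] \<sigma> st by simp
      moreover have "norm (q (t - \<sigma>)) \<le> norm (q 0) + W t"
      proof -
        have "norm (q (t - \<sigma>)) \<le> norm (q (t - \<sigma>) - q 0) + norm (q 0)" by (metis diff_add_cancel norm_triangle_ineq)
        then show ?thesis using qW[of 0 "t - \<sigma>"] mono[of "t - \<sigma>" t] W(2) \<sigma> st by auto
      qed
      then have "\<Lambda> * norm (q (t - \<sigma>)) \<le> \<Lambda> * (norm (q 0) + W t)" using \<Lambda> by (rule mult_left_mono)
      ultimately show "norm (?f \<sigma>) \<le> (c0 + \<Lambda> * norm (q 0)) + \<Lambda> * W t"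
        using c0[of \<sigma>] \<sigma> st by (simp add: distrib_left)
    qed auto
    then show ?thesis using st by simp
  qed
  moreover have "(t - s) * (\<Lambda> * W t) + (t - s) * ((c0 + \<Lambda> * norm (q 0)) + \<Lambda> * W t) =
      (t - s) * ((c0 + \<Lambda> * norm (q 0)) + 2 * \<Lambda> * W t)" by (simp add: algebra_simps)
  ultimately show ?thesis
    using norm_triangle_ineq[of "integral {0..s} (\<lambda>\<sigma>. ?f \<sigma> - ?g \<sigma>)" "integral {s..t} ?f"] by simp
qed

lemma history_0:
  assumes "T > 0" "\<And>t. t \<in> {0..T} \<Longrightarrow> \<Lambda>-lipschitz_on UNIV (B t)"
  shows "history B y0 q 0 = (y0 :: 'x::banach)"
  using bochner_continuous_on[of 0 0 "\<lambda>s. B (0 - s) (q s)"] by (simp add: history_def)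

subsection \<open>Estimates for viscous solutions\<close>

lemma bochner_cong_AE:
  fixes f g :: "'a \<Rightarrow> 'b::real_normed_vector"
  assumes "AE x in M. f x = g x"
  shows "bochner M f = bochner M g"
proof -
  have "AE x in M. g x = f x" using assms by eventually_elim simp
  then have "strongly_measurable M f \<longleftrightarrow> strongly_measurable M g"
    using assms strongly_measurable_cong_AE by blast
  moreover have "(\<integral>\<^sup>+x. ennreal (norm (f x - s x)) \<partial>M) = (\<integral>\<^sup>+x. ennreal (norm (g x - s x)) \<partial>M)" for s
    using assms by (intro nn_integral_cong_AE) auto
  ultimately have "has_bochner M f = has_bochner M g"
    by (intro ext) (simp add: has_bochner_def)
  then show ?thesis by (simp add: bochner_def)
qed

lemma has_weak_deriv_cong_AE:
  fixes q :: "real \<Rightarrow> 'b::real_normed_vector"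
  assumes "has_weak_deriv T q f" "AE t in leb T. f t = g t"
  shows "has_weak_deriv T q g"
proof -
  have f: "strongly_measurable (leb T) f" "integrable (leb T) (\<lambda>t. norm (f t))"
    using assms(1) by (auto simp: has_weak_deriv_def Lp1_iff)
  have g: "strongly_measurable (leb T) g" by (rule strongly_measurable_cong_AE[OF f(1) assms(2)])
  have "integrable (leb T) (\<lambda>t. norm (g t))"
    using assms(2) by (intro integrable_cong_AE_imp[OF f(2)] strongly_measurable_norm[OF complete_measure_leb g]) auto
  with g have "g \<in> Lp 1 T" by (simp add: Lp1_iff)
  moreover have "bochner (leb T) (\<lambda>t. \<phi> t *\<^sub>R f t) = bochner (leb T) (\<lambda>t. \<phi> t *\<^sub>R g t)" for \<phi>
    using assms(2) by (intro bochner_cong_AE) auto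
  ultimately show ?thesis using assms(1) by (simp add: has_weak_deriv_def)
qed

text \<open>A set of full measure meets every open subinterval. Relations between continuous
  functions known at almost every time thereby extend to all times.\<close>

lemma AE_leb_dense:
  assumes T: "T > 0" and ae: "AE t in leb T. t \<in> S" and S: "S \<subseteq> {0..T}"
  shows "closure S = {0..T}"
proof
  show "closure S \<subseteq> {0..T}" using S by (intro closure_minimal) auto
  have "AE t in lebesgue. t \<in> {0..T} \<longrightarrow> t \<in> S"
    using ae by (subst (asm) AE_restrict_space_iff) auto
  then have ae': "AE t in lebesgue. t \<in> {0<..<T} \<longrightarrow> t \<in> closure S"
    by eventually_elim (use closure_subset[of S] in auto)
  have "{0<..<T} \<subseteq> closure S"
    using mem_closed_if_AE_lebesgue_open[OF open_greaterThanLessThan closed_closure ae'] by blast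
  then have "closure {0<..<T} \<subseteq> closure S" by (intro closure_minimal closed_closure)
  then show "{0..T} \<subseteq> closure S" using T by simp
qed

text \<open>The constants hidden in the admissibility hypotheses are fixed here;
  \<open>\<Lambda>\<close> is the bound uniform in time supplied by
  \<open>admissible_kernel_lipschitz\<close>.\<close>

locale rate_independent =
  fixes T :: real
    and q0 :: "'y::{real_inner, complete_space}"
    and y0 :: "'x::banach"
    and U :: "'y \<Rightarrow> real"
    and B :: "real \<Rightarrow> 'y \<Rightarrow> 'x"
    and R :: "'x \<Rightarrow> 'y \<Rightarrow> ennreal"
    and D :: "'y set"
    and l :: "real \<Rightarrow> 'y \<Rightarrow>\<^sub>L real"
    and \<alpha> \<Lambda> L :: real
  assumes T: "T > 0"
    and U: "C2_function U"
    and \<alpha>: "\<alpha> > 0"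
    and convex_U: "\<And>y1 y2. \<forall>\<theta>\<in>{0..1}. (1 - \<theta>) * U y1 + \<theta> * U y2 \<ge>
          U ((1 - \<theta>) *\<^sub>R y1 + \<theta> *\<^sub>R y2) + \<alpha> / 2 * \<theta> * (1 - \<theta>) * (norm (y2 - y1))\<^sup>2"
    and B_lip: "\<And>t. t \<in> {0..T} \<Longrightarrow> \<Lambda>-lipschitz_on UNIV (B t)"
    and B_cont: "\<And>y. continuous_on {0..T} (\<lambda>t. B t y)"
    and R_dissipation: "admissible_dissipation T R D"
    and L: "L \<ge> 0"
    and R_lip: "\<And>\<zeta>1 \<zeta>2 \<eta>1 \<eta>2. \<eta>1 \<in> D \<Longrightarrow> \<eta>2 \<in> D \<Longrightarrow>
          enn2real (R \<zeta>1 \<eta>2) - enn2real (R \<zeta>1 \<eta>1) + enn2real (R \<zeta>2 \<eta>1) - enn2real (R \<zeta>2 \<eta>2)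
            \<le> L * norm (\<zeta>1 - \<zeta>2) * norm (\<eta>1 - \<eta>2)"
    and l_H1: "l \<in> H1 T"
    and l_compatible: "l \<in> compatible_loads T U R q0 y0"
begin

text \<open>Meaningful on \<open>D\<close> only: \<open>enn2real\<close> sends infinity to 0, so
  membership in \<open>D\<close> accompanies every use of \<open>r\<close>.\<close>

abbreviation r :: "'x \<Rightarrow> 'y \<Rightarrow> real" where "r \<zeta> \<eta> \<equiv> enn2real (R \<zeta> \<eta>)"

lemma D_iff: "\<eta> \<in> D \<longleftrightarrow> R \<zeta> \<eta> < \<infinity>"
proof -
  have "{\<eta>. R \<zeta> \<eta> < \<infinity>} = D" using R_dissipation unfolding admissible_dissipation_def by blast
  then show ?thesis by blast
qed

lemma R_eq: "\<eta> \<in> D \<Longrightarrow> R \<zeta> \<eta> = ennreal (r \<zeta> \<eta>)"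
  using D_iff[of \<eta> \<zeta>] by (simp add: less_top)

lemma R_scale: "c \<ge> 0 \<Longrightarrow> R \<zeta> (c *\<^sub>R \<eta>) = ennreal c * R \<zeta> \<eta>"
  using R_dissipation unfolding admissible_dissipation_def by blast

lemma R_zero: "R \<zeta> 0 = 0"
  using R_scale[of 0 \<zeta> 0] by simp

lemma D_zero: "0 \<in> D"
  using D_iff[of 0] R_zero by simp

lemma D_scale: "c \<ge> 0 \<Longrightarrow> \<eta> \<in> D \<Longrightarrow> c *\<^sub>R \<eta> \<in> D"
  using D_iff[of \<eta>] D_iff[of "c *\<^sub>R \<eta>"] R_scale by (metis ennreal_less_top ennreal_mult_less_top infinity_ennreal_def)

lemma r_scale: "c \<ge> 0 \<Longrightarrow> r \<zeta> (c *\<^sub>R \<eta>) = c * r \<zeta> \<eta>"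
  by (simp add: R_scale enn2real_mult)

lemma
  assumes "\<eta>1 \<in> D" "\<eta>2 \<in> D" "\<theta> \<in> {0..1}"
  shows D_convex: "(1 - \<theta>) *\<^sub>R \<eta>1 + \<theta> *\<^sub>R \<eta>2 \<in> D"
    and r_convex: "r \<zeta> ((1 - \<theta>) *\<^sub>R \<eta>1 + \<theta> *\<^sub>R \<eta>2) \<le> (1 - \<theta>) * r \<zeta> \<eta>1 + \<theta> * r \<zeta> \<eta>2"
proof -
  have le: "R \<zeta> ((1 - \<theta>) *\<^sub>R \<eta>1 + \<theta> *\<^sub>R \<eta>2) \<le> ennreal ((1 - \<theta>) * r \<zeta> \<eta>1 + \<theta> * r \<zeta> \<eta>2)" for \<zeta>
  proof -
    have "R \<zeta> ((1 - \<theta>) *\<^sub>R \<eta>1 + \<theta> *\<^sub>R \<eta>2) \<le> ennreal (1 - \<theta>) * R \<zeta> \<eta>1 + ennreal \<theta> * R \<zeta> \<eta>2"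
      using R_dissipation assms(3) unfolding admissible_dissipation_def by blast
    also have "\<dots> = ennreal (1 - \<theta>) * ennreal (r \<zeta> \<eta>1) + ennreal \<theta> * ennreal (r \<zeta> \<eta>2)"
      using R_eq[OF assms(1)] R_eq[OF assms(2)] by simp
    also have "\<dots> = ennreal ((1 - \<theta>) * r \<zeta> \<eta>1 + \<theta> * r \<zeta> \<eta>2)"
      using assms(3) by (simp add: ennreal_mult ennreal_plus)
    finally show ?thesis .
  qed
  then show "(1 - \<theta>) *\<^sub>R \<eta>1 + \<theta> *\<^sub>R \<eta>2 \<in> D"
    using D_iff by (metis ennreal_less_top infinity_ennreal_def order_le_less_trans)
  show "r \<zeta> ((1 - \<theta>) *\<^sub>R \<eta>1 + \<theta> *\<^sub>R \<eta>2) \<le> (1 - \<theta>) * r \<zeta> \<eta>1 + \<theta> * r \<zeta> \<eta>2"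
    using le[of \<zeta>] assms(3) by (intro enn2real_leI) auto
qed

text \<open>The four-point condition with second rate 0, where \<open>R\<close> vanishes.\<close>

lemma r_le_of_history: "\<eta> \<in> D \<Longrightarrow> r \<zeta>2 \<eta> - r \<zeta>1 \<eta> \<le> L * norm (\<zeta>1 - \<zeta>2) * norm \<eta>"
  using R_lip[OF _ D_zero, of \<eta> \<zeta>1 \<zeta>2] by (simp add: R_zero)

lemma enn2ereal_finite: "x < \<infinity> \<Longrightarrow> enn2ereal x = ereal (enn2real x)"
  by (cases x) (auto simp: enn2ereal_ennreal)

text \<open>
  The subdifferential sum rule for the quadratic perturbation, combined with the fact that elements
  of the subdifferential of a positively homogeneous functional are exact on the point and bounded
  by the functional everywhere.
\<close>

lemma viscous_subdiff:
  assumes \<epsilon>: "\<epsilon> > 0" and \<xi>: "\<xi> \<in> subdiff (viscous_dissipation \<epsilon> R \<zeta>) \<eta>"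
  shows "\<eta> \<in> D" "blinfun_apply \<xi> \<eta> - \<epsilon> * inner \<eta> \<eta> = r \<zeta> \<eta>"
    "\<And>v. v \<in> D \<Longrightarrow> blinfun_apply \<xi> v - \<epsilon> * inner \<eta> v \<le> r \<zeta> v"
proof -
  have fin: "viscous_dissipation \<epsilon> R \<zeta> \<eta> < \<infinity>"
    and ineq: "\<And>v. enn2ereal (viscous_dissipation \<epsilon> R \<zeta> \<eta>) + ereal (blinfun_apply \<xi> (v - \<eta>))
      \<le> enn2ereal (viscous_dissipation \<epsilon> R \<zeta> v)"
    using \<xi> by (auto simp: subdiff_def)
  have "R \<zeta> \<eta> < \<infinity>" using fin by (simp add: viscous_dissipation_def less_top[symmetric])
  then show \<eta>: "\<eta> \<in> D" using D_iff by blast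
  have visc: "enn2ereal (viscous_dissipation \<epsilon> R \<zeta> v) = ereal (r \<zeta> v + \<epsilon> / 2 * (norm v)\<^sup>2)" if "v \<in> D" for v
  proof -
    have "viscous_dissipation \<epsilon> R \<zeta> v = ennreal (r \<zeta> v) + ennreal (\<epsilon> / 2 * (norm v)\<^sup>2)"
      unfolding viscous_dissipation_def using R_eq[OF that, of \<zeta>] by (rule arg_cong)
    also have "\<dots> = ennreal (r \<zeta> v + \<epsilon> / 2 * (norm v)\<^sup>2)"
      using \<epsilon> by (intro ennreal_plus[symmetric]) auto
    finally show ?thesis using \<epsilon> by (simp only:) (rule enn2ereal_ennreal, simp)
  qed
  have ineq': "r \<zeta> \<eta> + \<epsilon> / 2 * (norm \<eta>)\<^sup>2 + blinfun_apply \<xi> (v - \<eta>) \<le> r \<zeta> v + \<epsilon> / 2 * (norm v)\<^sup>2" if v: "v \<in> D" for v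
    using ineq[of v] by (simp add: visc[OF v] visc[OF \<eta>])
  have sub: "blinfun_apply \<xi> (v - \<eta>) - \<epsilon> * inner \<eta> (v - \<eta>) \<le> r \<zeta> v - r \<zeta> \<eta>" if v: "v \<in> D" for v
  proof (rule field_le_epsilon)
    fix e :: real assume e: "e > 0"
    define d where "d = v - \<eta>"
    \<comment> \<open>Moving only the fraction \<open>\<theta>\<close> towards \<open>v\<close>
      leaves a quadratic remainder of order \<open>\<theta>^2\<close>. This choice keeps it below
      \<open>e\<close> after division by \<open>\<theta>\<close>; the summand 1 protects against a
      zero denominator when \<open>v = \<eta>\<close>.\<close>
    define \<theta> where "\<theta> = min 1 (e / (\<epsilon> / 2 * (norm d)\<^sup>2 + 1))"
    have den: "\<epsilon> / 2 * (norm d)\<^sup>2 + 1 > 0" using \<epsilon> by (simp add: add_nonneg_pos)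
    have \<theta>: "0 < \<theta>" "\<theta> \<le> 1" using e den by (auto simp: \<theta>_def)
    have "\<theta> * (\<epsilon> / 2 * (norm d)\<^sup>2) \<le> \<theta> * (\<epsilon> / 2 * (norm d)\<^sup>2 + 1)" using \<theta> by simp
    also have "\<dots> \<le> e / (\<epsilon> / 2 * (norm d)\<^sup>2 + 1) * (\<epsilon> / 2 * (norm d)\<^sup>2 + 1)"
      using den by (intro mult_right_mono) (auto simp: \<theta>_def)
    also have "\<dots> = e" using den by simp
    finally have small: "\<theta> * (\<epsilon> / 2 * (norm d)\<^sup>2) \<le> e" .
    have eq: "(1 - \<theta>) *\<^sub>R \<eta> + \<theta> *\<^sub>R v = \<eta> + \<theta> *\<^sub>R d" by (simp add: d_def algebra_simps)
    have "\<eta> + \<theta> *\<^sub>R d \<in> D" "r \<zeta> (\<eta> + \<theta> *\<^sub>R d) \<le> (1 - \<theta>) * r \<zeta> \<eta> + \<theta> * r \<zeta> v"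
      using D_convex[OF \<eta> v, of \<theta>] r_convex[OF \<eta> v, of \<theta> \<zeta>] \<theta> by (auto simp: eq)
    with ineq'[of "\<eta> + \<theta> *\<^sub>R d"] have
      "r \<zeta> \<eta> + \<epsilon> / 2 * (norm \<eta>)\<^sup>2 + \<theta> * blinfun_apply \<xi> d \<le> (1 - \<theta>) * r \<zeta> \<eta> + \<theta> * r \<zeta> v + \<epsilon> / 2 * (norm (\<eta> + \<theta> *\<^sub>R d))\<^sup>2"
      by (simp add: blinfun.scaleR_right)
    moreover have "(norm (\<eta> + \<theta> *\<^sub>R d))\<^sup>2 = (norm \<eta>)\<^sup>2 + 2 * \<theta> * inner \<eta> d + \<theta>\<^sup>2 * (norm d)\<^sup>2"
    proof -
      have "inner (\<eta> + \<theta> *\<^sub>R d) (\<eta> + \<theta> *\<^sub>R d) =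
          inner \<eta> \<eta> + \<theta> * inner \<eta> d + \<theta> * inner d \<eta> + \<theta> * (\<theta> * inner d d)"
        by (simp add: inner_add_left inner_add_right distrib_left)
      then show ?thesis
        by (simp only: power2_norm_eq_inner inner_commute[of d \<eta>] power2_eq_square[of \<theta>] mult.assoc)
    qed
    ultimately have "\<theta> * (blinfun_apply \<xi> d - \<epsilon> * inner \<eta> d) \<le> \<theta> * (r \<zeta> v - r \<zeta> \<eta> + \<theta> * (\<epsilon> / 2 * (norm d)\<^sup>2))"
      by (simp add: algebra_simps power2_eq_square add_divide_distrib)
    then have "blinfun_apply \<xi> d - \<epsilon> * inner \<eta> d \<le> r \<zeta> v - r \<zeta> \<eta> + \<theta> * (\<epsilon> / 2 * (norm d)\<^sup>2)"
      using \<theta>(1) by simp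
    then show "blinfun_apply \<xi> (v - \<eta>) - \<epsilon> * inner \<eta> (v - \<eta>) \<le> r \<zeta> v - r \<zeta> \<eta> + e"
      using small by (simp add: d_def)
  qed
  \<comment> \<open>The test vectors 0 and \<open>2 *\<^sub>R \<eta>\<close>, with homogeneity, turn
    the inequality into an identity at \<open>\<eta>\<close>.\<close>
  have "blinfun_apply \<xi> \<eta> - \<epsilon> * inner \<eta> \<eta> \<ge> r \<zeta> \<eta>"
    using sub[OF D_zero] by (simp add: R_zero blinfun.minus_right)
  moreover have "blinfun_apply \<xi> \<eta> - \<epsilon> * inner \<eta> \<eta> \<le> r \<zeta> \<eta>"
    using sub[OF D_scale[of 2, OF _ \<eta>]] r_scale[of 2 \<zeta> \<eta>] by (simp add: scaleR_2)
  ultimately show eq: "blinfun_apply \<xi> \<eta> - \<epsilon> * inner \<eta> \<eta> = r \<zeta> \<eta>" by simp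
  show "blinfun_apply \<xi> v - \<epsilon> * inner \<eta> v \<le> r \<zeta> v" if "v \<in> D" for v
    using sub[OF that] eq by (simp add: blinfun.diff_right inner_diff_right algebra_simps)
qed

lemma compatible_bound: "v \<in> D \<Longrightarrow> blinfun_apply (l 0 - fderiv U q0) v \<le> r y0 v"
proof -
  assume v: "v \<in> D"
  have "enn2ereal (R y0 0) + ereal (blinfun_apply (- fderiv U q0 + l 0) (v - 0)) \<le> enn2ereal (R y0 v)"
    using l_compatible by (simp add: compatible_loads_def subdiff_def)
  moreover have "enn2ereal (R y0 v) = ereal (r y0 v)" using v D_iff enn2ereal_finite by blast
  ultimately show ?thesis by (simp add: R_zero zero_ennreal.rep_eq)
qed

text \<open>The negative energy gradient at time \<open>t\<close> along \<open>q\<close>, by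
  \<open>fderiv_energy\<close>.\<close>

definition force :: "(real \<Rightarrow> 'y) \<Rightarrow> real \<Rightarrow> 'y \<Rightarrow>\<^sub>L real" where
  "force q t = l t - fderiv U (q t)"

abbreviation hist :: "(real \<Rightarrow> 'y) \<Rightarrow> real \<Rightarrow> 'x" where
  "hist q \<equiv> history B y0 q"

lemma l_continuous: "continuous_on {0..T} l"
  using l_compatible by (simp add: compatible_loads_def)

lemma fderiv_U_continuous: "continuous_on S (\<lambda>t. q t) \<Longrightarrow> continuous_on S (\<lambda>t. fderiv U (q t))"
  by (rule continuous_on_compose2[OF C2_function_continuous_fderiv[OF U, of UNIV]]) auto

lemma force_continuous: "continuous_on {0..T} q \<Longrightarrow> continuous_on {0..T} (force q)"
  unfolding force_def[abs_def] by (intro continuous_intros l_continuous fderiv_U_continuous)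

lemma B_zero_bound: obtains c0 where "c0 \<ge> 0" "\<And>t. t \<in> {0..T} \<Longrightarrow> norm (B t 0) \<le> c0"
proof -
  have "bounded ((\<lambda>t. B t 0) ` {0..T})"
    by (intro compact_imp_bounded compact_continuous_image B_cont) simp
  then obtain c where "c > 0" "\<forall>x\<in>(\<lambda>t. B t 0) ` {0..T}. norm x \<le> c" unfolding bounded_pos by blast
  then show ?thesis by (intro that[of c]) auto
qed

lemma hist_0: "hist q 0 = y0"
  by (rule history_0[OF T B_lip])

lemma history_increment:
  assumes c0: "\<And>t. t \<in> {0..T} \<Longrightarrow> norm (B t 0) \<le> c0"
    and q: "continuous_on {0..T} q" "has_weak_deriv T q g" and st: "0 \<le> s" "s \<le> t" "t \<le> T"
  shows "norm (hist q t - hist q s) \<le>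
    (t - s) * ((c0 + \<Lambda> * norm (q 0)) + 2 * \<Lambda> * integral {0..t} (\<lambda>x. norm (g x)))"
proof (rule history_lipschitz[OF B_lip B_cont c0 q(1) _ _ _ st])
  have n: "integrable (leb T) (\<lambda>x. norm (g x))" using q(2) by (simp add: has_weak_deriv_def Lp1_iff)
  show "continuous_on {0..T} (\<lambda>t. integral {0..t} (\<lambda>x. norm (g x)))" by (rule continuous_primitive[OF n])
  show "norm (q t - q s) \<le> integral {0..t} (\<lambda>x. norm (g x)) - integral {0..s} (\<lambda>x. norm (g x))"
    if "0 \<le> s" "s \<le> t" "t \<le> T" for s t
    using weak_deriv_norm_diff[OF T q that] integral_interval_diff[OF leb_integrable_on[OF n], of 0 t s] that by simp
qed auto

lemma hist_continuous:
  assumes q: "continuous_on {0..T} q" "has_weak_deriv T q g"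
  shows "continuous_on {0..T} (hist q)"
proof -
  obtain c0 where c0: "c0 \<ge> 0" "\<And>t. t \<in> {0..T} \<Longrightarrow> norm (B t 0) \<le> c0" using B_zero_bound by blast
  have n: "integrable (leb T) (\<lambda>x. norm (g x))" using q(2) by (simp add: has_weak_deriv_def Lp1_iff)
  have \<Lambda>: "\<Lambda> \<ge> 0" using lipschitz_on_nonneg[OF B_lip[of 0]] T by simp
  define K where "K = (c0 + \<Lambda> * norm (q 0)) + 2 * \<Lambda> * integral {0..T} (\<lambda>x. norm (g x))"
  have "0 \<le> integral {0..T} (\<lambda>x. norm (g x))"
    using leb_integrable_on[OF n, of 0 T] by (intro Henstock_Kurzweil_Integration.integral_nonneg) auto
  then have K: "K \<ge> 0" using c0(1) \<Lambda> by (simp add: K_def)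
  have *: "norm (hist q t - hist q s) \<le> (t - s) * K" if st: "0 \<le> s" "s \<le> t" "t \<le> T" for s t
  proof -
    have "integral {0..t} (\<lambda>x. norm (g x)) \<le> integral {0..T} (\<lambda>x. norm (g x))"
      using leb_integrable_on[OF n, of 0 t] leb_integrable_on[OF n, of 0 T] st by (intro integral_subset_le) auto
    then have "(c0 + \<Lambda> * norm (q 0)) + 2 * \<Lambda> * integral {0..t} (\<lambda>x. norm (g x)) \<le> K"
      unfolding K_def using \<Lambda> by (intro add_left_mono mult_left_mono) auto
    then have "(t - s) * ((c0 + \<Lambda> * norm (q 0)) + 2 * \<Lambda> * integral {0..t} (\<lambda>x. norm (g x))) \<le> (t - s) * K"
      using st by (intro mult_left_mono) auto
    then show ?thesis using history_increment[OF c0(2) q st] by linarith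
  qed
  have "K-lipschitz_on {0..T} (hist q)"
  proof (rule lipschitz_onI[OF _ K])
    fix s t assume "s \<in> {0..T}" "t \<in> {0..T}"
    then show "dist (hist q s) (hist q t) \<le> K * dist s t"
      using *[of s t] *[of t s] by (cases "s \<le> t") (auto simp: dist_norm norm_minus_commute mult.commute)
  qed
  then show ?thesis by (rule lipschitz_on_continuous_on)
qed

end

text \<open>The auxiliary function \<open>m\<close> is nonincreasing: its derivative has the sign of
  \<open>F t - (a + b * integral {0..t} F)\<close>, which the hypothesis makes nonpositive.\<close>

lemma Gronwall_integral:
  fixes F :: "real \<Rightarrow> real"
  assumes T: "0 \<le> T" and F: "continuous_on {0..T} F" and b: "b \<ge> 0"
    and le: "\<And>t. t \<in> {0..T} \<Longrightarrow> F t \<le> a + b * integral {0..t} F"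
  shows "F T \<le> a * exp (b * T)"
proof -
  define m where "m t = (a + b * integral {0..t} F) * exp (- (b * t))" for t
  have "((\<lambda>t. b * (F t - (a + b * integral {0..t} F)) * exp (- (b * t))) has_integral (m T - m 0)) {0..T}"
  proof (rule fundamental_theorem_of_calculus[OF T])
    fix t assume t: "t \<in> {0..T}"
    have "((\<lambda>t. integral {0..t} F) has_real_derivative F t) (at t within {0..T})"
      by (rule integral_has_real_derivative[OF F t])
    then have "(m has_real_derivative b * (F t - (a + b * integral {0..t} F)) * exp (- (b * t))) (at t within {0..T})"
      unfolding m_def by (auto intro!: derivative_eq_intros simp: algebra_simps)
    then show "(m has_vector_derivative b * (F t - (a + b * integral {0..t} F)) * exp (- (b * t))) (at t within {0..T})"
      by (simp add: has_real_derivative_iff_has_vector_derivative)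
  qed
  moreover have "b * (F t - (a + b * integral {0..t} F)) * exp (- (b * t)) \<le> 0" if "t \<in> {0..T}" for t
    using le[OF that] b by (intro mult_nonpos_nonneg mult_nonneg_nonpos) auto
  ultimately have "m T - m 0 \<le> 0" using has_integral_le has_integral_0 by blast
  then have "(a + b * integral {0..T} F) * exp (- (b * T)) \<le> a" by (simp add: m_def)
  then have "(a + b * integral {0..T} F) * exp (- (b * T)) * exp (b * T) \<le> a * exp (b * T)"
    by (rule mult_right_mono) simp
  then have "a + b * integral {0..T} F \<le> a * exp (b * T)" by (simp add: mult.assoc exp_minus_inverse mult_exp_exp)
  then show ?thesis using le[of T] T by simp
qed

text \<open>The variance of \<open>w\<close> about its mean \<open>c\<close> is nonnegative.\<close>

lemma integral_power2_le:
  fixes w :: "real \<Rightarrow> real"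
  assumes w: "continuous_on {0..t} w" and t: "0 \<le> t"
  shows "(integral {0..t} w)\<^sup>2 \<le> t * integral {0..t} (\<lambda>s. (w s)\<^sup>2)"
proof (cases "t = 0")
  case False
  then have t: "t > 0" using t by simp
  define c where "c = integral {0..t} w / t"
  have ic: "f integrable_on {0..t}" if "continuous_on {0..t} f" for f :: "real \<Rightarrow> real"
    using that by (rule integrable_continuous_interval)
  have "0 \<le> integral {0..t} (\<lambda>s. (w s - c)\<^sup>2)"
    by (intro Henstock_Kurzweil_Integration.integral_nonneg ic continuous_intros w) auto
  also have "\<dots> = integral {0..t} (\<lambda>s. ((w s)\<^sup>2 - (2 * c) * w s) + c\<^sup>2)"
    by (intro Henstock_Kurzweil_Integration.integral_cong) (simp add: power2_diff)
  also have "\<dots> = integral {0..t} (\<lambda>s. (w s)\<^sup>2 - (2 * c) * w s) + integral {0..t} (\<lambda>s. c\<^sup>2)"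
    by (intro Henstock_Kurzweil_Integration.integral_add ic continuous_intros w)
  also have "integral {0..t} (\<lambda>s. (w s)\<^sup>2 - (2 * c) * w s) = integral {0..t} (\<lambda>s. (w s)\<^sup>2) - integral {0..t} (\<lambda>s. (2 * c) * w s)"
    by (intro Henstock_Kurzweil_Integration.integral_diff ic continuous_intros w)
  finally have "0 \<le> integral {0..t} (\<lambda>s. (w s)\<^sup>2) - 2 * c * integral {0..t} w + t * c\<^sup>2" using t by simp
  then have "0 \<le> t * (integral {0..t} (\<lambda>s. (w s)\<^sup>2) - 2 * c * integral {0..t} w + t * c\<^sup>2)"
    using t by simp
  also have "\<dots> = t * integral {0..t} (\<lambda>s. (w s)\<^sup>2) - (integral {0..t} w)\<^sup>2"
    using t by (simp add: c_def field_simps power2_eq_square)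
  finally show ?thesis by simp
qed simp

section \<open>Comparison of the viscous inclusion at two times\<close>

context rate_independent
begin

text \<open>Sum of the first-order inequalities at both points, each of which contributes
  \<open>\<alpha> / 2\<close>.\<close>

lemma fderiv_monotone:
  "blinfun_apply (fderiv U y2 - fderiv U y1) (y2 - y1) \<ge> \<alpha> * (norm (y2 - y1))\<^sup>2"
  using strongly_convex_first_order[OF C2_function_differentiable[OF U] convex_U, of y1 y2]
    strongly_convex_first_order[OF C2_function_differentiable[OF U] convex_U, of y2 y1]
  by (simp add: norm_minus_commute blinfun.diff_left blinfun.diff_right algebra_simps)

text \<open>A set of times in place of an almost everywhere statement, so that two times can be
  compared. The conditions are the form of the inclusion given by
  \<open>viscous_subdiff\<close>.\<close>

definition good_times :: "real \<Rightarrow> (real \<Rightarrow> 'y) \<Rightarrow> real set" where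
  "good_times \<epsilon> q = {t \<in> {0..T}. wderiv T q t \<in> D \<and>
     force q t (wderiv T q t) - \<epsilon> * inner (wderiv T q t) (wderiv T q t) = r (hist q t) (wderiv T q t) \<and>
     (\<forall>v\<in>D. force q t v - \<epsilon> * inner (wderiv T q t) v \<le> r (hist q t) v)}"

lemma AE_good_times:
  assumes \<epsilon>: "\<epsilon> > 0" and q: "evolution_solution T U B y0 q0 (viscous_dissipation \<epsilon> R) l q"
  shows "AE t in leb T. t \<in> good_times \<epsilon> q"
proof -
  have "AE t in leb T. - fderiv (energy U l t) (q t) \<in> subdiff (viscous_dissipation \<epsilon> R (hist q t)) (wderiv T q t)"
    using q by (simp add: evolution_solution_def)
  then show ?thesis using AE_space
  proof eventually_elim
    case (elim t)
    have "- fderiv (energy U l t) (q t) = force q t"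
      by (simp add: fderiv_energy[OF C2_function_differentiable[OF U]] force_def)
    then show ?case
      using viscous_subdiff[OF \<epsilon>, of "force q t" "hist q t" "wderiv T q t"] elim
      by (auto simp: good_times_def)
  qed
qed

text \<open>The rate at each time serves as test vector at the other. The four values of
  \<open>R\<close> combine to exactly the left side of \<open>R_lip\<close>, and the quadratic terms
  combine to \<open>\<epsilon>\<close> times the squared norm of the difference.\<close>

lemma good_times_two_sided:
  assumes \<epsilon>: "\<epsilon> > 0" and s: "s \<in> good_times \<epsilon> q" and t: "t \<in> good_times \<epsilon> q"
  shows "\<epsilon> * norm (wderiv T q t - wderiv T q s) \<le> norm (force q t - force q s) + L * norm (hist q t - hist q s)"
proof -
  let ?v = "wderiv T q"
  let ?d = "?v t - ?v s"
  have D: "?v s \<in> D" "?v t \<in> D" using s t by (auto simp: good_times_def)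
  have "force q t (?v t) - \<epsilon> * inner (?v t) (?v t) = r (hist q t) (?v t)"
    "force q s (?v s) - \<epsilon> * inner (?v s) (?v s) = r (hist q s) (?v s)"
    "force q t (?v s) - \<epsilon> * inner (?v t) (?v s) \<le> r (hist q t) (?v s)"
    "force q s (?v t) - \<epsilon> * inner (?v s) (?v t) \<le> r (hist q s) (?v t)"
    using s t D by (auto simp: good_times_def)
  moreover have "r (hist q t) (?v s) - r (hist q t) (?v t) + r (hist q s) (?v t) - r (hist q s) (?v s)
      \<le> L * norm (hist q t - hist q s) * norm (?v t - ?v s)"
    by (rule R_lip[OF D(2,1)])
  moreover have "inner ?d ?d = inner (?v t) (?v t) - inner (?v t) (?v s) - inner (?v s) (?v t) + inner (?v s) (?v s)"
    by (simp add: inner_diff_left inner_diff_right)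
  then have "\<epsilon> * inner ?d ?d = \<epsilon> * inner (?v t) (?v t) - \<epsilon> * inner (?v t) (?v s) - \<epsilon> * inner (?v s) (?v t) + \<epsilon> * inner (?v s) (?v s)"
    by (simp add: algebra_simps)
  ultimately have "\<epsilon> * inner ?d ?d \<le> blinfun_apply (force q t - force q s) ?d + L * norm (hist q t - hist q s) * norm ?d"
    by (simp add: blinfun.diff_left blinfun.diff_right)
  also have "blinfun_apply (force q t - force q s) ?d \<le> norm (force q t - force q s) * norm ?d"
    using norm_blinfun[of "force q t - force q s" ?d] by simp
  finally have "(\<epsilon> * norm ?d) * norm ?d \<le> (norm (force q t - force q s) + L * norm (hist q t - hist q s)) * norm ?d"
    by (simp add: power2_norm_eq_inner[symmetric] power2_eq_square algebra_simps)
  then show ?thesis using L by (cases "norm ?d = 0") auto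
qed

text \<open>Only the rate at \<open>t\<close> is used as test vector, so the force increment stays
  paired with the rate itself. In this form convexity of \<open>U\<close> can produce a bound
  independent of \<open>\<epsilon>\<close>.\<close>

lemma good_times_one_sided:
  assumes s: "s \<in> good_times \<epsilon> q" and t: "t \<in> good_times \<epsilon> q"
  shows "\<epsilon> * inner (wderiv T q t - wderiv T q s) (wderiv T q t) \<le>
    blinfun_apply (force q t - force q s) (wderiv T q t) + L * norm (hist q t - hist q s) * norm (wderiv T q t)"
proof -
  let ?v = "wderiv T q"
  have "force q t (?v t) - \<epsilon> * inner (?v t) (?v t) = r (hist q t) (?v t)"
    "force q s (?v t) - \<epsilon> * inner (?v s) (?v t) \<le> r (hist q s) (?v t)" and D: "?v t \<in> D"
    using s t by (auto simp: good_times_def)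
  moreover have "r (hist q s) (?v t) - r (hist q t) (?v t) \<le> L * norm (hist q t - hist q s) * norm (?v t)"
    by (rule r_le_of_history[OF D])
  ultimately show ?thesis by (simp add: blinfun.diff_left inner_diff_left right_diff_distrib)
qed

text \<open>Compatibility of the load acts as the inclusion at time 0 with rate 0, although 0 need
  not be a good time.\<close>

lemma good_times_initial:
  assumes q0: "q 0 = q0" and t: "t \<in> good_times \<epsilon> q"
  shows "\<epsilon> * norm (wderiv T q t) \<le> norm (force q t - force q 0) + L * norm (hist q t - hist q 0)"
proof -
  let ?v = "wderiv T q t"
  have "force q t ?v - \<epsilon> * inner ?v ?v = r (hist q t) ?v" and D: "?v \<in> D"
    using t by (auto simp: good_times_def)
  moreover have "force q 0 ?v \<le> r (hist q 0) ?v"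
    using compatible_bound[OF D] by (simp add: force_def q0 hist_0)
  moreover have "r (hist q 0) ?v - r (hist q t) ?v \<le> L * norm (hist q t - hist q 0) * norm ?v"
    by (rule r_le_of_history[OF D])
  ultimately have "\<epsilon> * inner ?v ?v \<le> blinfun_apply (force q t - force q 0) ?v + L * norm (hist q t - hist q 0) * norm ?v"
    by (simp add: blinfun.diff_left)
  also have "blinfun_apply (force q t - force q 0) ?v \<le> norm (force q t - force q 0) * norm ?v"
    using norm_blinfun[of "force q t - force q 0" ?v] by simp
  finally have "(\<epsilon> * norm ?v) * norm ?v \<le> (norm (force q t - force q 0) + L * norm (hist q t - hist q 0)) * norm ?v"
    by (simp add: power2_norm_eq_inner[symmetric] power2_eq_square algebra_simps)
  then show ?thesis using L by (cases "norm ?v = 0") auto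
qed

text \<open>On the dense set of good times the rate is uniformly continuous, hence it extends
  continuously to \<open>[0,T]\<close>. The initial and the one-sided estimate are closed conditions
  and pass to the extension; for pairs of times the dense set is the product.\<close>

lemma viscous_C1:
  assumes \<epsilon>: "\<epsilon> > 0" and q: "evolution_solution T U B y0 q0 (viscous_dissipation \<epsilon> R) l q"
  obtains p where "continuous_on {0..T} p" "AE t in leb T. wderiv T q t = p t" "p 0 = 0"
    "\<And>s t. s \<in> {0..T} \<Longrightarrow> t \<in> {0..T} \<Longrightarrow> \<epsilon> * inner (p t - p s) (p t) \<le>
      blinfun_apply (force q t - force q s) (p t) + L * norm (hist q t - hist q s) * norm (p t)"
proof -
  have qH: "q \<in> H1 T" "q 0 = q0" using q by (auto simp: evolution_solution_def)
  note qc = H1_continuous[OF qH(1)] and qw = H1_weak_deriv[OF qH(1)]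
  note hc = hist_continuous[OF qc qw] and fc = force_continuous[OF qc]
  let ?S = "good_times \<epsilon> q" and ?v = "wderiv T q"
  note ae = AE_good_times[OF \<epsilon> q]
  have cl: "closure ?S = {0..T}" by (rule AE_leb_dense[OF T ae]) (auto simp: good_times_def)
  have "uniformly_continuous_on ?S ?v"
    unfolding uniformly_continuous_on_def
  proof (intro allI impI)
    fix e :: real assume e: "e > 0"
    \<comment> \<open>\<open>L + 1\<close> in place of \<open>L\<close> covers the case
      \<open>L = 0\<close>.\<close>
    have e': "\<epsilon> * e / 2 > 0" "\<epsilon> * e / (2 * (L + 1)) > 0" using e \<epsilon> L by auto
    obtain d1 where d1: "d1 > 0" "\<And>x y. x \<in> {0..T} \<Longrightarrow> y \<in> {0..T} \<Longrightarrow> \<bar>x - y\<bar> < d1 \<Longrightarrow> dist (force q x) (force q y) < \<epsilon> * e / 2"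
      using uniformly_continuous_interval[OF fc e'(1)] by metis
    obtain d2 where d2: "d2 > 0" "\<And>x y. x \<in> {0..T} \<Longrightarrow> y \<in> {0..T} \<Longrightarrow> \<bar>x - y\<bar> < d2 \<Longrightarrow> dist (hist q x) (hist q y) < \<epsilon> * e / (2 * (L + 1))"
      using uniformly_continuous_interval[OF hc e'(2)] by metis
    have "dist (?v t) (?v s) < e" if st: "s \<in> ?S" "t \<in> ?S" "dist t s < min d1 d2" for s t
    proof -
      have T': "s \<in> {0..T}" "t \<in> {0..T}" using st by (auto simp: good_times_def)
      have "L * norm (hist q t - hist q s) \<le> L * (\<epsilon> * e / (2 * (L + 1)))"
        using d2(2)[OF T'(2,1)] st(3) L by (intro mult_left_mono) (auto simp: dist_norm)
      also have "\<dots> \<le> (L + 1) * (\<epsilon> * e / (2 * (L + 1)))"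
        using e'(2) by (intro mult_right_mono) auto
      also have "\<dots> = \<epsilon> * e / 2" using L by (simp add: field_simps)
      finally have "\<epsilon> * norm (?v t - ?v s) < \<epsilon> * e"
        using good_times_two_sided[OF \<epsilon> st(1,2)] d1(2)[OF T'(2,1)] st(3) by (simp add: dist_norm)
      then show ?thesis using \<epsilon> by (simp add: dist_norm)
    qed
    then show "\<exists>d>0. \<forall>x\<in>?S. \<forall>x'\<in>?S. dist x' x < d \<longrightarrow> dist (?v x') (?v x) < e"
      using d1(1) d2(1) by (intro exI[of _ "min d1 d2"]) auto
  qed
  then obtain p where p: "uniformly_continuous_on (closure ?S) p" "\<And>t. t \<in> ?S \<Longrightarrow> ?v t = p t"
    by (rule uniformly_continuous_on_extension_on_closure) blast
  have pc: "continuous_on {0..T} p"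
    using uniformly_continuous_imp_continuous[OF p(1)] by (simp add: cl)
  have "\<epsilon> * norm (p 0) - norm (force q 0 - force q 0) - L * norm (hist q 0 - hist q 0) \<le> 0"
  proof (rule continuous_le_on_closure[of ?S "\<lambda>t. \<epsilon> * norm (p t) - norm (force q t - force q 0) - L * norm (hist q t - hist q 0)"])
    show "continuous_on (closure ?S) (\<lambda>t. \<epsilon> * norm (p t) - norm (force q t - force q 0) - L * norm (hist q t - hist q 0))"
      unfolding cl by (intro continuous_intros pc fc hc)
    show "0 \<in> closure ?S" using T by (simp add: cl)
    show "\<epsilon> * norm (p t) - norm (force q t - force q 0) - L * norm (hist q t - hist q 0) \<le> 0" if "t \<in> ?S" for t
      using good_times_initial[OF qH(2) that] p(2)[OF that] by simp
  qed
  then have "\<epsilon> * norm (p 0) \<le> 0" by simp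
  then have p0: "p 0 = 0" using \<epsilon> by (simp add: mult_le_0_iff)
  define Z where "Z z = \<epsilon> * inner (p (snd z) - p (fst z)) (p (snd z)) -
      blinfun_apply (force q (snd z) - force q (fst z)) (p (snd z))
      - L * norm (hist q (snd z) - hist q (fst z)) * norm (p (snd z))" for z
  have Z: "Z (s, t) \<le> 0" if "s \<in> {0..T}" "t \<in> {0..T}" for s t
  proof (rule continuous_le_on_closure[of "?S \<times> ?S" Z])
    show "continuous_on (closure (?S \<times> ?S)) Z"
      unfolding Z_def closure_Times cl
      by (intro continuous_intros continuous_on_compose2[OF pc] continuous_on_compose2[OF fc]
          continuous_on_compose2[OF hc]) auto
    show "(s, t) \<in> closure (?S \<times> ?S)" using that by (simp add: closure_Times cl)
    show "Z z \<le> 0" if "z \<in> ?S \<times> ?S" for z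
      using good_times_one_sided[of "fst z" \<epsilon> q "snd z"] p(2)[of "fst z"] p(2)[of "snd z"] that
      by (auto simp: Z_def)
  qed
  show ?thesis
  proof (rule that[OF pc _ p0])
    show "AE t in leb T. ?v t = p t" using ae by eventually_elim (rule p(2))
    show "\<epsilon> * inner (p t - p s) (p t) \<le>
      blinfun_apply (force q t - force q s) (p t) + L * norm (hist q t - hist q s) * norm (p t)"
      if "s \<in> {0..T}" "t \<in> {0..T}" for s t
      using Z[OF that] by (simp add: Z_def)
  qed
qed

end

section \<open>Energy inequality and bound independent of the viscosity\<close>

context rate_independent
begin

text \<open>The error is paired with itself, as in \<open>weak_deriv_norm_diff\<close>.\<close>

lemma increment_linear_approx:
  fixes q p :: "real \<Rightarrow> 'y"
  assumes q: "continuous_on {0..T} q" "has_weak_deriv T q p" and st: "0 \<le> s" "s \<le> t" "t \<le> T"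
    and near: "\<And>x. x \<in> {s..t} \<Longrightarrow> norm (p x - v) \<le> \<delta>"
  shows "norm (q t - q s - (t - s) *\<^sub>R v) \<le> (t - s) * \<delta>"
proof -
  define d where "d = q t - q s - (t - s) *\<^sub>R v"
  have L1: "p \<in> Lp 1 T" using q(2) by (simp add: has_weak_deriv_def)
  note h = bounded_linear_inner_left[of d]
  note i = Lp1_functional_integrable[OF L1 h]
  have "inner (q t - q s) d = integral {s..t} (\<lambda>x. inner (p x) d)"
    using weak_deriv_functional[OF T q h, of t] weak_deriv_functional[OF T q h, of s] st
      integral_interval_diff[OF leb_integrable_on[OF i], of 0 t s] by (simp add: inner_diff_left)
  then have "inner d d = integral {s..t} (\<lambda>x. inner (p x) d) - integral {s..t} (\<lambda>x. inner v d)"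
    using st by (simp add: d_def inner_diff_left)
  also have "\<dots> = integral {s..t} (\<lambda>x. inner (p x) d - inner v d)"
    using leb_integrable_on[OF i, of s t] st by (intro Henstock_Kurzweil_Integration.integral_diff[symmetric]) auto
  also have "\<dots> \<le> integral {s..t} (\<lambda>x. \<delta> * norm d)"
  proof (rule integral_le)
    show "(\<lambda>x. inner (p x) d - inner v d) integrable_on {s..t}"
      using leb_integrable_on[OF i, of s t] st by (intro integrable_diff) auto
    fix x assume "x \<in> {s..t}"
    then have "norm (p x - v) * norm d \<le> \<delta> * norm d" using near by (intro mult_right_mono) auto
    then show "inner (p x) d - inner v d \<le> \<delta> * norm d"
      using norm_cauchy_schwarz[of "p x - v" d] by (simp add: inner_diff_left)
  qed auto
  also have "\<dots> = ((t - s) * \<delta>) * norm d" using st by simp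
  finally have le: "norm d * norm d \<le> ((t - s) * \<delta>) * norm d"
    by (simp add: power2_norm_eq_inner[symmetric] power2_eq_square)
  have "0 \<le> \<delta>" using order_trans[OF norm_ge_zero near[of s]] st by simp
  then have "norm d \<le> (t - s) * \<delta>"
    using le st by (cases "norm d = 0") auto
  then show ?thesis by (simp add: d_def)
qed

text \<open>Monotonicity of the gradient concerns the increment of \<open>q\<close>, while the
  energy estimate pairs with \<open>p t\<close>. The increment is
  \<open>(t - s) *\<^sub>R p t\<close> up to an error of norm at most
  \<open>(t - s) * \<delta>\<close>; the exchange costs \<open>2 * \<alpha> * M * \<delta>\<close>
  in the square and \<open>K * M * \<delta>\<close> in the pairing.\<close>

lemma fderiv_increment_lower_bound:
  fixes q p :: "real \<Rightarrow> 'y"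
  assumes q: "continuous_on {0..T} q" "has_weak_deriv T q p" and st: "0 \<le> s" "s \<le> t" "t \<le> T"
    and near: "\<And>x. x \<in> {s..t} \<Longrightarrow> norm (p x - p t) \<le> \<delta>"
    and M: "\<And>x. x \<in> {0..T} \<Longrightarrow> norm (p x) \<le> M"
    and K: "K \<ge> 0" "norm (fderiv U (q t) - fderiv U (q s)) \<le> K * norm (q t - q s)"
  shows "(t - s) * (\<alpha> * (norm (p t))\<^sup>2 - (2 * \<alpha> + K) * M * \<delta>) \<le> blinfun_apply (fderiv U (q t) - fderiv U (q s)) (p t)"
proof (cases "s = t")
  case False
  then have pos: "t - s > 0" using st by simp
  have L1: "p \<in> Lp 1 T" using q(2) by (simp add: has_weak_deriv_def)
  have \<delta>: "0 \<le> \<delta>" using near[of t] st by simp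
  let ?a = "q t - q s" and ?w = "norm (p t)" and ?DU = "fderiv U (q t) - fderiv U (q s)"
  have wM: "?w \<le> M" using M[of t] st by simp
  define e where "e = ?a - (t - s) *\<^sub>R p t"
  have e: "norm e \<le> (t - s) * \<delta>"
    unfolding e_def by (rule increment_linear_approx[OF q st near])
  have aM: "norm ?a \<le> (t - s) * M"
  proof -
    have "norm ?a \<le> integral {s..t} (\<lambda>x. norm (p x))" by (rule weak_deriv_norm_diff[OF T q st])
    also have "\<dots> \<le> integral {s..t} (\<lambda>x. M)"
      using leb_integrable_on[of T "\<lambda>x. norm (p x)" s t] L1 M st by (intro integral_le) (auto simp: Lp1_iff)
    finally show ?thesis using st by simp
  qed
  \<comment> \<open>The lower bound \<open>?w - \<delta>\<close> may be squared only if it is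
    nonnegative; otherwise the left side is nonpositive anyway.\<close>
  have sq: "(t - s)\<^sup>2 * (?w\<^sup>2 - 2 * \<delta> * ?w) \<le> (norm ?a)\<^sup>2"
  proof (cases "?w \<ge> \<delta>")
    case True
    have "(t - s) *\<^sub>R p t = ?a - e" by (simp add: e_def)
    then have "norm ((t - s) *\<^sub>R p t) \<le> norm ?a + norm e" using norm_triangle_ineq4[of ?a e] by simp
    then have "(t - s) * ?w \<le> norm ?a + (t - s) * \<delta>" using e pos by simp
    then have "(t - s) * (?w - \<delta>) \<le> norm ?a" by (simp add: algebra_simps)
    then have "((t - s) * (?w - \<delta>))\<^sup>2 \<le> (norm ?a)\<^sup>2"
      using True pos by (intro power_mono mult_nonneg_nonneg) auto
    moreover have "(t - s)\<^sup>2 * (?w\<^sup>2 - 2 * \<delta> * ?w) \<le> ((t - s) * (?w - \<delta>))\<^sup>2"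
      unfolding power_mult_distrib by (intro mult_left_mono zero_le_power2) (simp add: power2_diff)
    ultimately show ?thesis by linarith
  next
    case False
    then have "?w * (?w - 2 * \<delta>) \<le> 0" using \<delta> by (intro mult_nonneg_nonpos) auto
    then have "(t - s)\<^sup>2 * (?w\<^sup>2 - 2 * \<delta> * ?w) \<le> 0"
      by (intro mult_nonneg_nonpos zero_le_power2) (simp add: power2_eq_square algebra_simps)
    then show ?thesis using zero_le_power2[of "norm ?a"] by linarith
  qed
  have "blinfun_apply ?DU e \<le> norm ?DU * norm e" using norm_blinfun[of ?DU e] by simp
  also have "\<dots> \<le> (K * norm ?a) * ((t - s) * \<delta>)" using K e by (intro mult_mono) auto
  also have "\<dots> \<le> (K * ((t - s) * M)) * ((t - s) * \<delta>)"
    using K(1) aM \<delta> pos by (intro mult_right_mono mult_left_mono) auto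
  also have "\<dots> = (t - s)\<^sup>2 * (K * M * \<delta>)" by (simp add: power2_eq_square)
  finally have DUe: "blinfun_apply ?DU e \<le> (t - s)\<^sup>2 * (K * M * \<delta>)" .
  have "\<alpha> * ((t - s)\<^sup>2 * (?w\<^sup>2 - 2 * \<delta> * ?w)) \<le> \<alpha> * (norm ?a)\<^sup>2"
    using sq \<alpha> by (intro mult_left_mono) auto
  also have "\<dots> \<le> blinfun_apply ?DU ?a" by (rule fderiv_monotone)
  also have "\<dots> = (t - s) * blinfun_apply ?DU (p t) + blinfun_apply ?DU e"
    by (simp add: e_def blinfun.diff_right blinfun.scaleR_right)
  finally have main: "\<alpha> * ((t - s)\<^sup>2 * (?w\<^sup>2 - 2 * \<delta> * ?w)) - (t - s)\<^sup>2 * (K * M * \<delta>) \<le> (t - s) * blinfun_apply ?DU (p t)"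
    using DUe by linarith
  have "\<delta> * ?w \<le> \<delta> * M" using \<delta> wM by (rule mult_left_mono[rotated])
  then have "\<alpha> * (\<delta> * ?w) \<le> \<alpha> * (\<delta> * M)" using \<alpha> by (intro mult_left_mono[of "\<delta> * ?w"]) auto
  then have "\<alpha> * ?w\<^sup>2 - (2 * \<alpha> + K) * M * \<delta> \<le> \<alpha> * (?w\<^sup>2 - 2 * \<delta> * ?w) - K * M * \<delta>"
    by (simp add: algebra_simps)
  then have "(t - s)\<^sup>2 * (\<alpha> * ?w\<^sup>2 - (2 * \<alpha> + K) * M * \<delta>) \<le> (t - s)\<^sup>2 * (\<alpha> * (?w\<^sup>2 - 2 * \<delta> * ?w) - K * M * \<delta>)"
    by (rule mult_left_mono) simp
  also have "\<dots> = \<alpha> * ((t - s)\<^sup>2 * (?w\<^sup>2 - 2 * \<delta> * ?w)) - (t - s)\<^sup>2 * (K * M * \<delta>)"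
    by (simp add: algebra_simps)
  finally have "(t - s) * ((t - s) * (\<alpha> * ?w\<^sup>2 - (2 * \<alpha> + K) * M * \<delta>)) \<le> (t - s) * blinfun_apply ?DU (p t)"
    using main by (simp add: power2_eq_square mult.assoc)
  then show ?thesis using pos by simp
qed simp

text \<open>The one-sided estimate bounds each increment of \<open>\<epsilon> / 2 * (w t)^2\<close>
  by load and history terms minus the convexity gain, up to \<delta> times a comparison increment,
  which makes \<open>\<Phi>\<close> nondecreasing. The quadratic term vanishes at 0 by
  \<open>p 0 = 0\<close> and is dropped at the end.\<close>

lemma viscous_energy_inequality:
  assumes \<epsilon>: "\<epsilon> > 0" and sol: "evolution_solution T U B y0 q0 (viscous_dissipation \<epsilon> R) l q"
    and c0: "\<And>t. t \<in> {0..T} \<Longrightarrow> norm (B t 0) \<le> c0"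
    and gl: "has_weak_deriv T l gl"
  obtains p where "continuous_on {0..T} p" "AE t in leb T. wderiv T q t = p t"
    "\<And>\<tau>. \<tau> \<in> {0..T} \<Longrightarrow> 0 \<le> integral {0..\<tau>} (\<lambda>x. norm (p x) * norm (gl x)) +
      integral {0..\<tau>} (\<lambda>x. L * ((c0 + \<Lambda> * norm q0) + 2 * \<Lambda> * integral {0..x} (\<lambda>x. norm (p x))) * norm (p x)
        - \<alpha> * (norm (p x))\<^sup>2)"
proof -
  have qH: "q \<in> H1 T" "q 0 = q0" using sol by (auto simp: evolution_solution_def)
  obtain p where p: "continuous_on {0..T} p" "AE t in leb T. wderiv T q t = p t" "p 0 = 0"
    "\<And>s t. s \<in> {0..T} \<Longrightarrow> t \<in> {0..T} \<Longrightarrow> \<epsilon> * inner (p t - p s) (p t) \<le>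
      blinfun_apply (force q t - force q s) (p t) + L * norm (hist q t - hist q s) * norm (p t)"
    using viscous_C1[OF \<epsilon> sol] by blast
  note q = H1_continuous[OF qH(1)] has_weak_deriv_cong_AE[OF H1_weak_deriv[OF qH(1)] p(2)]
  define w \<gamma> where "w x = norm (p x)" and "\<gamma> x = norm (gl x)" for x
  define W where "W t = integral {0..t} w" for t
  define k where "k x = L * ((c0 + \<Lambda> * norm q0) + 2 * \<Lambda> * W x) * w x - \<alpha> * (w x)\<^sup>2" for x
  have wc: "continuous_on {0..T} w" unfolding w_def by (intro continuous_intros p)
  have wi: "integrable (leb T) w" by (rule continuous_imp_integrable_real[OF wc])
  have Wc: "continuous_on {0..T} W" unfolding W_def[abs_def] by (rule continuous_primitive[OF wi])
  have kc: "continuous_on {0..T} k" unfolding k_def by (intro continuous_intros Wc wc)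
  have ki: "integrable (leb T) k" by (rule continuous_imp_integrable_real[OF kc])
  have \<gamma>i: "integrable (leb T) \<gamma>" using gl by (simp add: has_weak_deriv_def Lp1_iff \<gamma>_def[abs_def])
  have w\<gamma>i: "integrable (leb T) (\<lambda>x. w x * \<gamma> x)" by (rule integrable_continuous_mult[OF wc \<gamma>i])
  have lc: "continuous_on {0..T} l" by (rule l_continuous)
  obtain M where M: "\<And>x. x \<in> {0..T} \<Longrightarrow> norm (p x) \<le> M"
  proof -
    have "bounded (p ` {0..T})" by (intro compact_imp_bounded compact_continuous_image p) simp
    then obtain M where "\<forall>x\<in>p ` {0..T}. norm x \<le> M" unfolding bounded_iff by blast
    then show ?thesis by (intro that[of M]) auto
  qed
  have M0: "M \<ge> 0" using order_trans[OF norm_ge_zero M[of 0]] T by simp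
  obtain K where K: "K \<ge> 0" "\<And>s t. s \<in> {0..T} \<Longrightarrow> t \<in> {0..T} \<Longrightarrow>
    norm (fderiv U (q t) - fderiv U (q s)) \<le> K * norm (q t - q s)"
    using C2_function_fderiv_lipschitz_along[OF U q(1)] by metis
  define \<Phi> where "\<Phi> t = integral {0..t} (\<lambda>x. w x * \<gamma> x) + integral {0..t} k - \<epsilon> / 2 * (w t)\<^sup>2" for t
  \<comment> \<open>Coefficient of all errors of size \<open>\<delta> * (t - s)\<close>: 1 from
    freezing \<open>k\<close> at \<open>t\<close>, the rest from
    \<open>fderiv_increment_lower_bound\<close>. The load error is measured by the integral of
    \<open>\<gamma>\<close> instead.\<close>
  define C where "C = 1 + (2 * \<alpha> + K) * M"
  have main: "\<Phi> 0 \<le> \<Phi> \<tau>" if \<tau>: "\<tau> \<in> {0..T}" for \<tau>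
  proof (rule local_increase_imp_le[of 0 \<tau> \<Phi> "\<lambda>t. integral {0..t} \<gamma> + C * t"])
    fix \<delta> :: real assume \<delta>: "\<delta> > 0"
    obtain d1 where d1: "d1 > 0" "\<And>x y. x \<in> {0..T} \<Longrightarrow> y \<in> {0..T} \<Longrightarrow> \<bar>x - y\<bar> < d1 \<Longrightarrow> dist (p x) (p y) < \<delta>"
      using uniformly_continuous_interval[OF p(1) \<delta>] by metis
    obtain d2 where d2: "d2 > 0" "\<And>x y. x \<in> {0..T} \<Longrightarrow> y \<in> {0..T} \<Longrightarrow> \<bar>x - y\<bar> < d2 \<Longrightarrow> dist (k x) (k y) < \<delta>"
      using uniformly_continuous_interval[OF kc \<delta>] by metis
    have "\<Phi> s - \<Phi> t \<le> \<delta> * ((integral {0..t} \<gamma> + C * t) - (integral {0..s} \<gamma> + C * s))"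
      if st: "0 \<le> s" "s \<le> t" "t \<le> \<tau>" "t - s < min d1 d2" for s t
    proof -
      have tT: "t \<le> T" using st \<tau> by simp
      have mem: "s \<in> {0..T}" "t \<in> {0..T}" using st tT by auto
      note io = leb_integrable_on[OF _ \<open>0 \<le> s\<close> tT] and io0 = leb_integrable_on[OF _ order_refl tT]
      note df = integral_interval_diff[OF io0 \<open>0 \<le> s\<close> \<open>s \<le> t\<close>]
      have near: "norm (p x - p t) \<le> \<delta>" if "x \<in> {s..t}" for x
        using d1(2)[of x t] that st tT by (auto simp: dist_norm)
      have DU: "(t - s) * (\<alpha> * (w t)\<^sup>2 - (2 * \<alpha> + K) * M * \<delta>) \<le> blinfun_apply (fderiv U (q t) - fderiv U (q s)) (p t)"
        unfolding w_def by (rule fderiv_increment_lower_bound[OF q st(1,2) tT near M K(1) K(2)[OF mem]])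
      have ll: "blinfun_apply (l t - l s) (p t) \<le> integral {s..t} \<gamma> * w t"
      proof -
        have "blinfun_apply (l t - l s) (p t) \<le> norm (l t - l s) * norm (p t)"
          using norm_blinfun[of "l t - l s" "p t"] by simp
        also have "\<dots> \<le> integral {s..t} \<gamma> * norm (p t)"
          unfolding \<gamma>_def by (intro mult_right_mono weak_deriv_norm_diff_dual[OF T lc gl st(1,2) tT]) auto
        finally show ?thesis by (simp add: w_def)
      qed
      have hh: "L * norm (hist q t - hist q s) * norm (p t) \<le> L * ((t - s) * ((c0 + \<Lambda> * norm q0) + 2 * \<Lambda> * W t)) * w t"
        using history_increment[OF c0 q st(1,2) tT] L qH(2)
        unfolding w_def W_def by (intro mult_right_mono mult_left_mono) auto
      \<comment> \<open>Convexity of half the squared norm; what is dropped is half the squared norm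
        of \<open>p t - p s\<close>, times \<open>\<epsilon>\<close>.\<close>
      have ps: "\<epsilon> / 2 * ((w t)\<^sup>2 - (w s)\<^sup>2) \<le> \<epsilon> * inner (p t - p s) (p t)"
      proof -
        have "0 \<le> inner (p t - p s) (p t - p s)" by simp
        then have "((w t)\<^sup>2 - (w s)\<^sup>2) / 2 \<le> inner (p t - p s) (p t)"
          by (simp add: w_def power2_norm_eq_inner inner_diff_left inner_diff_right inner_commute[of "p s" "p t"])
        then have "\<epsilon> * (((w t)\<^sup>2 - (w s)\<^sup>2) / 2) \<le> \<epsilon> * inner (p t - p s) (p t)"
          using \<epsilon> by (intro mult_left_mono) auto
        then show ?thesis by simp
      qed
      have "\<epsilon> / 2 * ((w t)\<^sup>2 - (w s)\<^sup>2) \<le> blinfun_apply (l t - l s) (p t)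
          - blinfun_apply (fderiv U (q t) - fderiv U (q s)) (p t) + L * norm (hist q t - hist q s) * norm (p t)"
        using ps p(4)[OF mem] by (simp add: force_def blinfun.diff_left)
      then have 1: "\<epsilon> / 2 * ((w t)\<^sup>2 - (w s)\<^sup>2) \<le> integral {s..t} \<gamma> * w t + (t - s) * k t + (t - s) * ((2 * \<alpha> + K) * M * \<delta>)"
        using DU ll hh by (simp add: k_def algebra_simps)
      have 2: "integral {s..t} \<gamma> * w t - integral {s..t} (\<lambda>x. w x * \<gamma> x) \<le> \<delta> * integral {s..t} \<gamma>"
      proof -
        have "integral {s..t} \<gamma> * w t - integral {s..t} (\<lambda>x. w x * \<gamma> x) = integral {s..t} (\<lambda>x. \<gamma> x * w t) - integral {s..t} (\<lambda>x. w x * \<gamma> x)"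
          by simp
        also have "\<dots> = integral {s..t} (\<lambda>x. \<gamma> x * w t - w x * \<gamma> x)"
          by (intro Henstock_Kurzweil_Integration.integral_diff[symmetric] io integrable_on_mult_left \<gamma>i w\<gamma>i)
        also have "\<dots> \<le> integral {s..t} (\<lambda>x. \<delta> * \<gamma> x)"
        proof (rule integral_le)
          show "(\<lambda>x. \<gamma> x * w t - w x * \<gamma> x) integrable_on {s..t}"
            by (intro integrable_diff io integrable_on_mult_left \<gamma>i w\<gamma>i)
          show "(\<lambda>x. \<delta> * \<gamma> x) integrable_on {s..t}" by (intro io integrable_on_mult_right \<gamma>i)
          fix x assume "x \<in> {s..t}"
          then have "w t - w x \<le> \<delta>" using near[of x] norm_triangle_ineq2[of "p t" "p x"]
            by (simp add: w_def norm_minus_commute)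
          then have "(w t - w x) * \<gamma> x \<le> \<delta> * \<gamma> x" by (rule mult_right_mono) (simp add: \<gamma>_def)
          then show "\<gamma> x * w t - w x * \<gamma> x \<le> \<delta> * \<gamma> x" by (simp add: algebra_simps)
        qed
        finally show ?thesis by simp
      qed
      have 3: "(t - s) * k t - integral {s..t} k \<le> \<delta> * (t - s)"
      proof -
        have "(t - s) * k t - integral {s..t} k = integral {s..t} (\<lambda>x. k t) - integral {s..t} k"
          using st by simp
        also have "\<dots> = integral {s..t} (\<lambda>x. k t - k x)"
          by (intro Henstock_Kurzweil_Integration.integral_diff[symmetric] io ki) auto
        also have "\<dots> \<le> integral {s..t} (\<lambda>x. \<delta>)"
        proof (rule integral_le)
          show "(\<lambda>x. k t - k x) integrable_on {s..t}" by (intro integrable_diff io ki) auto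
          fix x assume "x \<in> {s..t}"
          then show "k t - k x \<le> \<delta>" using d2(2)[of t x] st tT by (auto simp: dist_real_def)
        qed auto
        finally show ?thesis using st by (simp add: mult.commute)
      qed
      have "\<Phi> s - \<Phi> t = \<epsilon> / 2 * ((w t)\<^sup>2 - (w s)\<^sup>2) - integral {s..t} (\<lambda>x. w x * \<gamma> x) - integral {s..t} k"
        using df[OF w\<gamma>i] df[OF ki] by (simp add: \<Phi>_def algebra_simps)
      also have "\<dots> \<le> \<delta> * integral {s..t} \<gamma> + \<delta> * (t - s) + (t - s) * ((2 * \<alpha> + K) * M * \<delta>)"
        using 1 2 3 by linarith
      also have "\<dots> = \<delta> * ((integral {0..t} \<gamma> + C * t) - (integral {0..s} \<gamma> + C * s))"
        using df[OF \<gamma>i] by (simp add: C_def algebra_simps)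
      finally show ?thesis .
    qed
    then show "\<exists>\<eta>>0. \<forall>s t. 0 \<le> s \<longrightarrow> s \<le> t \<longrightarrow> t \<le> \<tau> \<longrightarrow> t - s < \<eta> \<longrightarrow>
        \<Phi> s - \<Phi> t \<le> \<delta> * ((integral {0..t} \<gamma> + C * t) - (integral {0..s} \<gamma> + C * s))"
      using d1(1) d2(1) by (intro exI[of _ "min d1 d2"]) auto
  qed (use \<tau> in auto)
  show ?thesis
  proof (rule that[OF p(1,2)])
    fix \<tau> assume "\<tau> \<in> {0..T}"
    from main[OF this] have "0 \<le> integral {0..\<tau>} (\<lambda>x. w x * \<gamma> x) + integral {0..\<tau>} k - \<epsilon> / 2 * (w \<tau>)\<^sup>2"
      using p(3) by (simp add: \<Phi>_def w_def)
    moreover have "0 \<le> \<epsilon> / 2 * (w \<tau>)\<^sup>2" using \<epsilon> by simp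
    ultimately have "0 \<le> integral {0..\<tau>} (\<lambda>x. w x * \<gamma> x) + integral {0..\<tau>} k" by linarith
    then show "0 \<le> integral {0..\<tau>} (\<lambda>x. norm (p x) * norm (gl x)) +
      integral {0..\<tau>} (\<lambda>x. L * ((c0 + \<Lambda> * norm q0) + 2 * \<Lambda> * integral {0..x} (\<lambda>x. norm (p x))) * norm (p x)
        - \<alpha> * (norm (p x))\<^sup>2)"
      by (simp add: w_def[abs_def] \<gamma>_def[abs_def] k_def[abs_def] W_def)
  qed
qed

text \<open>Young's inequality absorbs the terms linear in the rate into the convexity term. The
  history feeds back the primitive \<open>W\<close> of the rate, whose square is at most
  \<open>T * F x\<close>, so Gronwall's inequality for \<open>F\<close> closes the estimate. The
  constants are defined before \<open>\<epsilon>\<close> and \<open>q\<close> are chosen.\<close>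

lemma viscous_estimate:
  obtains C where "\<And>\<epsilon> q. \<epsilon> > 0 \<Longrightarrow> evolution_solution T U B y0 q0 (viscous_dissipation \<epsilon> R) l q \<Longrightarrow>
    L2_norm T (wderiv T q) \<le> C"
proof -
  obtain c0 where c0: "c0 \<ge> 0" "\<And>t. t \<in> {0..T} \<Longrightarrow> norm (B t 0) \<le> c0" using B_zero_bound by blast
  obtain gl where gl: "gl \<in> Lp 2 T" "has_weak_deriv T l gl" using l_H1 by (auto simp: H1_def)
  define \<gamma> where "\<gamma> x = norm (gl x)" for x
  have \<gamma>2: "integrable (leb T) (\<lambda>x. (\<gamma> x)\<^sup>2)" and \<gamma>i: "integrable (leb T) \<gamma>"
    using gl Lp2_imp_Lp1[OF gl(1)] by (auto simp: Lp_def \<gamma>_def[abs_def])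
  define K0 c where "K0 = L * (c0 + \<Lambda> * norm q0)" and "c = 2 * L * \<Lambda>"
  define G where "G x = 2 * (\<gamma> x)\<^sup>2 + 2 * K0\<^sup>2" for x
  have G0: "G x \<ge> 0" for x by (simp add: G_def)
  have Gi: "integrable (leb T) G"
    unfolding G_def
    by (intro Bochner_Integration.integrable_add integrable_mult_right[OF \<gamma>2]
        continuous_imp_integrable_real[OF continuous_on_const])
  \<comment> \<open>From \<open>\<alpha>/2 * F \<tau> \<le> (1/\<alpha>) * integral {0..T} G + (c^2
    * T/\<alpha>) * integral {0..\<tau>} F\<close>, multiplied by \<open>2/\<alpha>\<close>.\<close>
  define a b where "a = 2 / \<alpha>\<^sup>2 * integral {0..T} G" and "b = 2 / \<alpha>\<^sup>2 * (c\<^sup>2 * T)"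
  have b0: "b \<ge> 0" using T by (simp add: b_def)
  have "L2_norm T (wderiv T q) \<le> sqrt (a * exp (b * T))"
    if \<epsilon>: "\<epsilon> > 0" and sol: "evolution_solution T U B y0 q0 (viscous_dissipation \<epsilon> R) l q" for \<epsilon> q
  proof -
    obtain p where p: "continuous_on {0..T} p" "AE t in leb T. wderiv T q t = p t"
      "\<And>\<tau>. \<tau> \<in> {0..T} \<Longrightarrow> 0 \<le> integral {0..\<tau>} (\<lambda>x. norm (p x) * norm (gl x)) +
      integral {0..\<tau>} (\<lambda>x. L * ((c0 + \<Lambda> * norm q0) + 2 * \<Lambda> * integral {0..x} (\<lambda>x. norm (p x))) * norm (p x)
        - \<alpha> * (norm (p x))\<^sup>2)"
      using viscous_energy_inequality[OF \<epsilon> sol c0(2) gl(2)] by blast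
    define w where "w x = norm (p x)" for x
    define W where "W t = integral {0..t} w" for t
    define F where "F t = integral {0..t} (\<lambda>x. (w x)\<^sup>2)" for t
    have wc: "continuous_on {0..T} w" unfolding w_def by (intro continuous_intros p)
    have w2: "integrable (leb T) (\<lambda>x. (w x)\<^sup>2)" by (intro continuous_imp_integrable_real continuous_intros wc)
    have Wc: "continuous_on {0..T} W"
      unfolding W_def[abs_def] by (rule continuous_primitive[OF continuous_imp_integrable_real[OF wc]])
    have Fc: "continuous_on {0..T} F" unfolding F_def[abs_def] by (rule continuous_primitive[OF w2])
    have W_le: "(W x)\<^sup>2 \<le> T * F x" if x: "x \<in> {0..T}" for x
    proof -
      have "(W x)\<^sup>2 \<le> x * F x"
        unfolding W_def F_def using x by (intro integral_power2_le continuous_on_subset[OF wc]) auto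
      also have "\<dots> \<le> T * F x"
        using x leb_integrable_on[OF w2, of 0 x] unfolding F_def
        by (intro mult_right_mono Henstock_Kurzweil_Integration.integral_nonneg) auto
      finally show ?thesis .
    qed
    have F_le: "F \<tau> \<le> a + b * integral {0..\<tau>} F" if \<tau>: "\<tau> \<in> {0..T}" for \<tau>
    proof -
      have \<tau>': "0 \<le> \<tau>" "\<tau> \<le> T" using \<tau> by auto
      note io = leb_integrable_on[OF _ order_refl \<tau>'(2)]
      define k where "k x = (K0 + c * W x) * w x - \<alpha> * (w x)\<^sup>2" for x
      have ki: "integrable (leb T) k"
        unfolding k_def by (intro continuous_imp_integrable_real continuous_intros Wc wc)
      have w\<gamma>i: "integrable (leb T) (\<lambda>x. w x * \<gamma> x)" by (rule integrable_continuous_mult[OF wc \<gamma>i])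
      have Fi: "integrable (leb T) F" by (rule continuous_imp_integrable_real[OF Fc])
      have "0 \<le> integral {0..\<tau>} (\<lambda>x. w x * \<gamma> x) + integral {0..\<tau>} k"
        using p(3)[OF \<tau>] by (simp add: w_def[abs_def] \<gamma>_def[abs_def] k_def[abs_def] W_def K0_def c_def algebra_simps)
      also have "\<dots> = integral {0..\<tau>} (\<lambda>x. w x * \<gamma> x + k x)"
        by (intro Henstock_Kurzweil_Integration.integral_add[symmetric] io w\<gamma>i ki)
      also have "\<dots> \<le> integral {0..\<tau>} (\<lambda>x. (1 / \<alpha>) * G x + (c\<^sup>2 * T / \<alpha>) * F x - (\<alpha> / 2) * (w x)\<^sup>2)"
      proof (rule integral_le)
        show "(\<lambda>x. w x * \<gamma> x + k x) integrable_on {0..\<tau>}" by (intro integrable_add io w\<gamma>i ki)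
        show "(\<lambda>x. (1 / \<alpha>) * G x + (c\<^sup>2 * T / \<alpha>) * F x - (\<alpha> / 2) * (w x)\<^sup>2) integrable_on {0..\<tau>}"
          by (intro integrable_add integrable_diff integrable_on_mult_right io Gi Fi w2)
        fix x assume "x \<in> {0..\<tau>}"
        then have x: "x \<in> {0..T}" using \<tau>' by auto
        define g where "g = \<gamma> x + K0 + c * W x"
        \<comment> \<open>Young's inequality
          \<open>g * w \<le> g^2 / (2 * \<alpha>) + \<alpha>/2 * w^2\<close> in multiplied form; the
          weight uses up half of the convexity term and leaves the other half.\<close>
        have "0 \<le> (g - \<alpha> * w x)\<^sup>2" by simp
        then have "2 * \<alpha> * (g * w x) \<le> g\<^sup>2 + \<alpha>\<^sup>2 * (w x)\<^sup>2"
          by (simp add: power2_diff power_mult_distrib algebra_simps)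
        moreover have "g\<^sup>2 \<le> 2 * G x + 2 * (c\<^sup>2 * (T * F x))"
        proof -
          have "g\<^sup>2 \<le> 2 * (\<gamma> x + K0)\<^sup>2 + 2 * (c * W x)\<^sup>2"
            unfolding g_def using power2_norm_add_le[of "\<gamma> x + K0" "c * W x"] by (simp only: real_norm_def power2_abs)
          moreover have "(\<gamma> x + K0)\<^sup>2 \<le> G x"
            unfolding G_def using power2_norm_add_le[of "\<gamma> x" K0] by (simp only: real_norm_def power2_abs)
          moreover have "(c * W x)\<^sup>2 \<le> c\<^sup>2 * (T * F x)"
            unfolding power_mult_distrib using W_le[OF x] by (intro mult_left_mono) auto
          ultimately show ?thesis by linarith
        qed
        ultimately have "2 * \<alpha> * (g * w x) \<le> 2 * G x + 2 * (c\<^sup>2 * (T * F x)) + \<alpha>\<^sup>2 * (w x)\<^sup>2" by linarith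
        then have "g * w x \<le> (2 * G x + 2 * (c\<^sup>2 * (T * F x)) + \<alpha>\<^sup>2 * (w x)\<^sup>2) / (2 * \<alpha>)"
          using \<alpha> by (simp add: pos_le_divide_eq mult.commute)
        also have "\<dots> = (1 / \<alpha>) * G x + (c\<^sup>2 * T / \<alpha>) * F x + (\<alpha> / 2) * (w x)\<^sup>2"
          using \<alpha> by (simp add: field_simps power2_eq_square)
        finally show "w x * \<gamma> x + k x \<le> (1 / \<alpha>) * G x + (c\<^sup>2 * T / \<alpha>) * F x - (\<alpha> / 2) * (w x)\<^sup>2"
          by (simp add: k_def g_def algebra_simps)
      qed
      also have "\<dots> = (1 / \<alpha>) * integral {0..\<tau>} G + (c\<^sup>2 * T / \<alpha>) * integral {0..\<tau>} F - (\<alpha> / 2) * F \<tau>"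
        using io[OF Gi] io[OF Fi] io[OF w2] unfolding F_def[of \<tau>]
        by (intro integral_unique has_integral_diff has_integral_add has_integral_mult_right integrable_integral)
      finally have "(\<alpha> / 2) * F \<tau> \<le> (1 / \<alpha>) * integral {0..\<tau>} G + (c\<^sup>2 * T / \<alpha>) * integral {0..\<tau>} F" by simp
      also have "\<dots> \<le> (1 / \<alpha>) * integral {0..T} G + (c\<^sup>2 * T / \<alpha>) * integral {0..\<tau>} F"
        using \<alpha> \<tau>' G0 leb_integrable_on[OF Gi, of 0 \<tau>] leb_integrable_on[OF Gi, of 0 T]
        by (intro add_right_mono mult_left_mono integral_subset_le) auto
      finally have "F \<tau> \<le> ((1 / \<alpha>) * integral {0..T} G + (c\<^sup>2 * T / \<alpha>) * integral {0..\<tau>} F) * (2 / \<alpha>)"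
        using \<alpha> by (simp add: field_simps)
      then show ?thesis using \<alpha> by (simp add: a_def b_def field_simps power2_eq_square)
    qed
    have "(L2_norm T (wderiv T q))\<^sup>2 = F T"
    proof -
      have "(L2_norm T (wderiv T q))\<^sup>2 = (LINT t|leb T. (w t)\<^sup>2)"
      proof -
        have "wderiv T q \<in> sqint (leb T)" by (rule wderiv_sqint[OF T]) (use sol in \<open>simp add: evolution_solution_def\<close>)
        from L2_norm_cong_AE[OF this p(2)] show ?thesis by (simp add: L2_norm_power2 w_def)
      qed
      also have "\<dots> = F T" unfolding F_def by (rule leb_integral[OF w2])
      finally show ?thesis .
    qed
    also have "F T \<le> a * exp (b * T)"
      using T by (intro Gronwall_integral Fc b0 F_le) auto
    finally show ?thesis by (rule real_le_rsqrt)
  qed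
  then show ?thesis by (rule that)
qed

end

subsection \<open>The vanishing viscosity limit\<close>

text \<open>\<open>ennreal\<close> sends negative reals to 0, so the right side integrates the
  positive part of \<open>h\<close>.\<close>

lemma ereal_integral_le_nn_integral:
  fixes h :: "'a \<Rightarrow> real"
  assumes "integrable M h"
  shows "ereal (LINT x|M. h x) \<le> enn2ereal (\<integral>\<^sup>+x. ennreal (h x) \<partial>M)"
proof -
  have i: "integrable M (\<lambda>x. max 0 (h x))" using assms by (intro integrable_max) auto
  have "(\<integral>\<^sup>+x. ennreal (h x) \<partial>M) = (\<integral>\<^sup>+x. ennreal (max 0 (h x)) \<partial>M)"
    by (intro nn_integral_cong) (auto simp: max_def ennreal_neg)
  also have "\<dots> = ennreal (LINT x|M. max 0 (h x))" using i by (intro nn_integral_eq_integral) auto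
  finally have "enn2ereal (\<integral>\<^sup>+x. ennreal (h x) \<partial>M) = ereal (LINT x|M. max 0 (h x))"
    by (simp add: enn2ereal_ennreal integral_nonneg_AE)
  moreover have "(LINT x|M. h x) \<le> (LINT x|M. max 0 (h x))"
    using assms i by (intro integral_mono) auto
  ultimately show ?thesis by simp
qed

lemma sqint_continuous:
  fixes f :: "real \<Rightarrow> 'b::real_normed_vector"
  assumes "continuous_on {0..T} f"
  shows "f \<in> sqint (leb T)"
  using assms by (auto simp: sqint_def intro!: strongly_measurable_continuous_on continuous_imp_integrable_real continuous_intros)

lemma H1_wderiv_add:
  fixes u v :: "real \<Rightarrow> 'b::{real_inner,complete_space}"
  assumes T: "T > 0" and u: "u \<in> H1 T" and v: "v \<in> H1 T"
  shows "AE t in leb T. wderiv T (\<lambda>t. u t + v t) t = wderiv T u t + wderiv T v t"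
proof (rule H1I(3)[OF T])
  show "continuous_on {0..T} (\<lambda>t. u t + v t)" by (intro continuous_intros H1_continuous u v)
  show "(\<lambda>t. wderiv T u t + wderiv T v t) \<in> sqint (leb T)"
    by (intro sqint_add complete_measure_leb wderiv_sqint T u v)
  fix t y assume t: "t \<in> {0..T}"
  note h = bounded_linear_inner_left[of y]
  have "wderiv T u \<in> Lp 1 T" "wderiv T v \<in> Lp 1 T"
    using Lp2_imp_Lp1 wderiv_sqint[OF T u] wderiv_sqint[OF T v] by (auto simp: Lp2_eq_sqint)
  then have i: "(\<lambda>x. inner (wderiv T u x) y) integrable_on {0..t}" "(\<lambda>x. inner (wderiv T v x) y) integrable_on {0..t}"
    using t by (auto intro!: leb_integrable_on[where T = T] Lp1_functional_integrable[OF _ h])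
  show "inner (u t + v t) y - inner (u 0 + v 0) y = integral {0..t} (\<lambda>x. inner (wderiv T u x + wderiv T v x) y)"
    using weak_deriv_functional[OF T H1_continuous[OF u] H1_weak_deriv[OF u] h t]
      weak_deriv_functional[OF T H1_continuous[OF v] H1_weak_deriv[OF v] h t]
    by (simp add: inner_add_left Henstock_Kurzweil_Integration.integral_add[OF i])
qed

lemma H1_wderiv_scaleR:
  fixes u :: "real \<Rightarrow> 'b::{real_inner,complete_space}"
  assumes T: "T > 0" and u: "u \<in> H1 T"
  shows "AE t in leb T. wderiv T (\<lambda>t. c *\<^sub>R u t) t = c *\<^sub>R wderiv T u t"
proof (rule H1I(3)[OF T])
  show "continuous_on {0..T} (\<lambda>t. c *\<^sub>R u t)" by (intro continuous_intros H1_continuous u)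
  show "(\<lambda>t. c *\<^sub>R wderiv T u t) \<in> sqint (leb T)" by (intro sqint_scaleR wderiv_sqint T u)
  fix t y assume t: "t \<in> {0..T}"
  have "c * (inner (u t) y - inner (u 0) y) = c * integral {0..t} (\<lambda>x. inner (wderiv T u x) y)"
    using weak_deriv_functional[OF T H1_continuous[OF u] H1_weak_deriv[OF u] bounded_linear_inner_left[of y] t] by simp
  then show "inner (c *\<^sub>R u t) y - inner (c *\<^sub>R u 0) y = integral {0..t} (\<lambda>x. inner (c *\<^sub>R wderiv T u x) y)"
    by (simp add: right_diff_distrib)
qed

lemma L2_pairing_le:
  fixes f :: "real \<Rightarrow> 'b::real_normed_vector \<Rightarrow>\<^sub>L real"
  assumes f: "f \<in> sqint (leb T)" and g: "g \<in> sqint (leb T)"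
  shows "\<bar>LINT t|leb T. blinfun_apply (f t) (g t)\<bar> \<le> L2_norm T f * L2_norm T g"
proof -
  note i = sqint_blinfun_integrable[OF complete_measure_leb f g]
  have "\<bar>LINT t|leb T. blinfun_apply (f t) (g t)\<bar> \<le> (LINT t|leb T. \<bar>blinfun_apply (f t) (g t)\<bar>)"
    by (rule integral_abs_bound)
  also have "\<dots> \<le> (LINT t|leb T. norm (f t) * norm (g t))"
  proof (rule integral_mono)
    show "\<bar>blinfun_apply (f t) (g t)\<bar> \<le> norm (f t) * norm (g t)" for t
      using norm_blinfun[of "f t" "g t"] by simp
  qed (use i sqint_norm_mult_integrable[OF complete_measure_leb f g] in auto)
  also have "\<dots> \<le> L2_norm T f * L2_norm T g"
    unfolding L2_norm_def by (rule sqint_Cauchy_Schwarz[OF complete_measure_leb f g])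
  finally show ?thesis .
qed

lemma L2_inner_le:
  fixes f g :: "real \<Rightarrow> 'b::real_inner"
  assumes f: "f \<in> sqint (leb T)" and g: "g \<in> sqint (leb T)"
  shows "\<bar>LINT t|leb T. inner (f t) (g t)\<bar> \<le> L2_norm T f * L2_norm T g"
proof -
  note i = sqint_inner_integrable[OF complete_measure_leb f g]
  have "\<bar>LINT t|leb T. inner (f t) (g t)\<bar> \<le> (LINT t|leb T. \<bar>inner (f t) (g t)\<bar>)"
    by (rule integral_abs_bound)
  also have "\<dots> \<le> (LINT t|leb T. norm (f t) * norm (g t))"
    using i sqint_norm_mult_integrable[OF complete_measure_leb f g]
    by (intro integral_mono) (auto simp: Cauchy_Schwarz_ineq2)
  also have "\<dots> \<le> L2_norm T f * L2_norm T g"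
    unfolding L2_norm_def by (rule sqint_Cauchy_Schwarz[OF complete_measure_leb f g])
  finally show ?thesis .
qed

lemma weakly_converges_L2_pairing:
  fixes f :: "real \<Rightarrow> 'b::{real_inner,complete_space} \<Rightarrow>\<^sub>L real"
  assumes f: "f \<in> sqint (leb T)" and w: "weakly_converges (Lp 2 T) (L2_norm T) v u"
  shows "(\<lambda>m. LINT t|leb T. blinfun_apply (f t) (v m t)) \<longlonglongrightarrow> (LINT t|leb T. blinfun_apply (f t) (u t))"
proof -
  note i = sqint_blinfun_integrable[OF complete_measure_leb f]
  have "bounded_functional (Lp 2 T) (L2_norm T) (\<lambda>g. LINT t|leb T. blinfun_apply (f t) (g t))"
    unfolding bounded_functional_def Lp2_eq_sqint
    using L2_pairing_le[OF f] i by (intro conjI ballI allI exI[of _ "L2_norm T f"]) (auto simp: blinfun.add_right blinfun.scaleR_right)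
  then show ?thesis using w unfolding weakly_converges_def by blast
qed

text \<open>\<open>wderiv\<close> picks one representative per function, so it is linear only almost
  everywhere; the pairing is a genuine bounded functional because integrals ignore null
  sets.\<close>

lemma weakly_converges_H1_pairing:
  fixes f :: "real \<Rightarrow> 'b::{real_inner,complete_space} \<Rightarrow>\<^sub>L real"
  assumes T: "T > 0" and f: "f \<in> sqint (leb T)" and w: "weakly_converges (H1 T) (H1_norm T) v u"
  shows "(\<lambda>m. LINT t|leb T. blinfun_apply (f t) (wderiv T (v m) t)) \<longlonglongrightarrow>
    (LINT t|leb T. blinfun_apply (f t) (wderiv T u t))"
proof -
  note i = sqint_blinfun_integrable[OF complete_measure_leb f]
  define F where "F g = (LINT t|leb T. blinfun_apply (f t) (wderiv T g t))" for g
  have cong: "(LINT t|leb T. blinfun_apply (f t) (a t)) = (LINT t|leb T. blinfun_apply (f t) (b t))"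
    if "a \<in> sqint (leb T)" "b \<in> sqint (leb T)" "AE t in leb T. a t = b t" for a b
    using that i by (intro integral_cong_AE borel_measurable_integrable) auto
  have "bounded_functional (H1 T) (H1_norm T) F"
    unfolding bounded_functional_def
  proof (intro conjI ballI allI exI)
    fix a b :: "real \<Rightarrow> 'b" assume a: "a \<in> H1 T" and b: "b \<in> H1 T"
    note wd = wderiv_sqint[OF T a] wderiv_sqint[OF T b]
    note ab = sqint_add[OF complete_measure_leb wd]
    have eq: "AE t in leb T. wderiv T a t + wderiv T b t = wderiv T (\<lambda>t. a t + b t) t"
      using H1_wderiv_add[OF T a b] by eventually_elim simp
    have "F (\<lambda>t. a t + b t) = (LINT t|leb T. blinfun_apply (f t) (wderiv T a t + wderiv T b t))"
      unfolding F_def by (rule cong[symmetric, OF ab sqint_cong_AE[OF complete_measure_leb ab eq] eq])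
    then show "F (\<lambda>t. a t + b t) = F a + F b"
      using i[OF wd(1)] i[OF wd(2)] by (simp add: F_def blinfun.add_right)
  next
    fix c and a :: "real \<Rightarrow> 'b" assume a: "a \<in> H1 T"
    note ca = sqint_scaleR[OF wderiv_sqint[OF T a], of c]
    have eq: "AE t in leb T. c *\<^sub>R wderiv T a t = wderiv T (\<lambda>t. c *\<^sub>R a t) t"
      using H1_wderiv_scaleR[OF T a, of c] by eventually_elim simp
    have "F (\<lambda>t. c *\<^sub>R a t) = (LINT t|leb T. blinfun_apply (f t) (c *\<^sub>R wderiv T a t))"
      unfolding F_def by (rule cong[symmetric, OF ca sqint_cong_AE[OF complete_measure_leb ca eq] eq])
    then show "F (\<lambda>t. c *\<^sub>R a t) = c * F a" by (simp add: F_def blinfun.scaleR_right)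
  next
    fix a :: "real \<Rightarrow> 'b" assume a: "a \<in> H1 T"
    have "\<bar>F a\<bar> \<le> L2_norm T f * L2_norm T (wderiv T a)"
      unfolding F_def by (rule L2_pairing_le[OF f wderiv_sqint[OF T a]])
    also have "\<dots> \<le> L2_norm T f * H1_norm T a"
      by (intro mult_left_mono L2_norm_le_H1_norm L2_norm_nonneg)
    finally show "\<bar>F a\<bar> \<le> L2_norm T f * H1_norm T a" .
  qed
  then show ?thesis using w unfolding weakly_converges_def F_def by blast
qed

section \<open>Passage to the limit\<close>

context rate_independent
begin

lemma l_sqint: "l \<in> sqint (leb T)"
  using l_H1 by (simp add: H1_def Lp2_eq_sqint)

text \<open>The integrated viscous inequality with the gradient of \<open>U\<close> moved to the
  side of \<open>R\<close>: this sum is what the recovery condition controls, so only terms linear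
  in the sequences remain on the left, apart from a product with the factor
  \<open>\<epsilon>\<close>.\<close>

lemma viscous_dissipation_power_lower_bound:
  assumes \<epsilon>: "\<epsilon> > 0" and sol: "evolution_solution T U B y0 q0 (viscous_dissipation \<epsilon> R) l q"
    and v: "v \<in> L2_in T D"
  shows "ereal ((LINT t|leb T. blinfun_apply (l t) (v t)) - \<epsilon> * (LINT t|leb T. inner (wderiv T q t) (v t)))
    \<le> dissipation_power T U B y0 R q v"
proof -
  have qH: "q \<in> H1 T" using sol by (simp add: evolution_solution_def)
  note qc = H1_continuous[OF qH]
  have vs: "v \<in> sqint (leb T)" and vD: "AE t in leb T. v t \<in> D" using v by (auto simp: L2_in_def Lp2_eq_sqint)
  note M = complete_measure_leb
  note il = sqint_blinfun_integrable[OF M l_sqint vs]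
  note iU = sqint_blinfun_integrable[OF M sqint_continuous[OF fderiv_U_continuous[OF qc]] vs]
  note ii = sqint_inner_integrable[OF M wderiv_sqint[OF T qH] vs]
  define h where "h t = blinfun_apply (l t) (v t) - blinfun_apply (fderiv U (q t)) (v t) - \<epsilon> * inner (wderiv T q t) (v t)" for t
  have hi: "integrable (leb T) h" unfolding h_def using il iU ii by auto
  have "AE t in leb T. ennreal (h t) \<le> R (hist q t) (v t)"
    using AE_good_times[OF \<epsilon> sol] vD
  proof eventually_elim
    case (elim t)
    then have "h t \<le> r (hist q t) (v t)"
      by (auto simp: good_times_def h_def force_def blinfun.diff_left)
    then show ?case using R_eq[OF elim(2), of "hist q t"] by (metis ennreal_leI)
  qed
  then have "(\<integral>\<^sup>+t. ennreal (h t) \<partial>leb T) \<le> (\<integral>\<^sup>+t. R (hist q t) (v t) \<partial>leb T)" by (rule nn_integral_mono_AE)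
  then have "ereal (LINT t|leb T. h t) \<le> enn2ereal (\<integral>\<^sup>+t. R (hist q t) (v t) \<partial>leb T)"
    using ereal_integral_le_nn_integral[OF hi] by (meson less_eq_ennreal.rep_eq order_trans)
  then have "ereal (LINT t|leb T. h t) + ereal (LINT t|leb T. blinfun_apply (fderiv U (q t)) (v t))
      \<le> dissipation_power T U B y0 R q v"
    unfolding dissipation_power_def by (rule add_right_mono)
  moreover have "(LINT t|leb T. h t) = (LINT t|leb T. blinfun_apply (l t) (v t))
      - (LINT t|leb T. blinfun_apply (fderiv U (q t)) (v t)) - \<epsilon> * (LINT t|leb T. inner (wderiv T q t) (v t))"
    unfolding h_def using il iU ii by simp
  ultimately show ?thesis by simp
qed

text \<open>At the rate itself the viscous relation is an identity. The chain rule turns the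
  gradient term into an energy difference, and the viscous term is dropped by its sign.\<close>

lemma viscous_dissipation_upper_bound:
  assumes \<epsilon>: "\<epsilon> > 0" and sol: "evolution_solution T U B y0 q0 (viscous_dissipation \<epsilon> R) l q"
  obtains a where "(\<integral>\<^sup>+t. R (hist q t) (wderiv T q t) \<partial>leb T) = ennreal a" "0 \<le> a"
    "a \<le> (LINT t|leb T. blinfun_apply (l t) (wderiv T q t)) - (U (q T) - U q0)"
proof -
  have qH: "q \<in> H1 T" "q 0 = q0" using sol by (auto simp: evolution_solution_def)
  note qc = H1_continuous[OF qH(1)] and M = complete_measure_leb
  define v where "v = wderiv T q"
  have vs: "v \<in> sqint (leb T)" unfolding v_def by (rule wderiv_sqint[OF T qH(1)])
  note il = sqint_blinfun_integrable[OF M l_sqint vs]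
  note iU = sqint_blinfun_integrable[OF M sqint_continuous[OF fderiv_U_continuous[OF qc]] vs]
  note ii = sqint_inner_integrable[OF M vs vs]
  define h where "h t = blinfun_apply (l t) (v t) - blinfun_apply (fderiv U (q t)) (v t) - \<epsilon> * inner (v t) (v t)" for t
  have hi: "integrable (leb T) h" unfolding h_def using il iU ii by auto
  have eq: "AE t in leb T. R (hist q t) (v t) = ennreal (h t) \<and> 0 \<le> h t"
    using AE_good_times[OF \<epsilon> sol]
  proof eventually_elim
    case (elim t)
    then have "v t \<in> D" "h t = r (hist q t) (v t)"
      by (auto simp: good_times_def h_def force_def blinfun.diff_left v_def)
    then show ?case using R_eq[of "v t" "hist q t"] by simp
  qed
  have "(\<integral>\<^sup>+t. R (hist q t) (v t) \<partial>leb T) = (\<integral>\<^sup>+t. ennreal (h t) \<partial>leb T)"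
    using eq by (intro nn_integral_cong_AE) auto
  also have "\<dots> = ennreal (LINT t|leb T. h t)"
    using eq by (intro nn_integral_eq_integral hi) auto
  finally have 1: "(\<integral>\<^sup>+t. R (hist q t) (wderiv T q t) \<partial>leb T) = ennreal (LINT t|leb T. h t)"
    by (simp add: v_def)
  have 2: "0 \<le> (LINT t|leb T. h t)" using eq by (intro integral_nonneg_AE) auto
  have "(LINT t|leb T. h t) = (LINT t|leb T. blinfun_apply (l t) (v t))
      - (LINT t|leb T. blinfun_apply (fderiv U (q t)) (v t)) - \<epsilon> * (LINT t|leb T. inner (v t) (v t))"
    unfolding h_def using il iU ii by simp
  moreover have "(LINT t|leb T. blinfun_apply (fderiv U (q t)) (v t)) = U (q T) - U q0"
    using chain_rule[OF T U qc H1_weak_deriv[OF qH(1)]] leb_integral[OF iU] by (simp add: v_def qH(2))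
  moreover have "0 \<le> \<epsilon> * (LINT t|leb T. inner (v t) (v t))" using \<epsilon> by (simp add: integral_nonneg_AE)
  ultimately have "(LINT t|leb T. h t) \<le> (LINT t|leb T. blinfun_apply (l t) (wderiv T q t)) - (U (q T) - U q0)"
    by (simp add: v_def)
  with 1 2 show ?thesis by (rule that)
qed

lemma r_history_continuous:
  assumes \<zeta>: "continuous_on {0..T} \<zeta>" and v: "v \<in> D"
  shows "continuous_on {0..T} (\<lambda>t. r (\<zeta> t) v)"
proof -
  have "(L * norm v)-lipschitz_on UNIV (\<lambda>\<zeta>. r \<zeta> v)"
  proof (rule lipschitz_onI)
    show "dist (r \<zeta>1 v) (r \<zeta>2 v) \<le> L * norm v * dist \<zeta>1 \<zeta>2" for \<zeta>1 \<zeta>2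
      using r_le_of_history[OF v, of \<zeta>1 \<zeta>2] r_le_of_history[OF v, of \<zeta>2 \<zeta>1]
      by (simp add: dist_norm dist_real_def norm_minus_commute algebra_simps abs_le_iff)
  qed (use L in simp)
  from lipschitz_on_continuous_on[OF this] show ?thesis
    by (rule continuous_on_compose2[OF _ \<zeta>]) simp
qed

text \<open>
  Testing with \<open>v\<close> scaled by the negative part of \<open>r - force\<close> turns the integrated inequality into
  a pointwise one at every time, so the exceptional set does not depend on \<open>v\<close>.
\<close>

lemma stability_pointwise:
  assumes u: "u \<in> H1 T"
    and test: "\<And>v. v \<in> L2_in T D \<Longrightarrow>
      ereal (LINT t|leb T. blinfun_apply (l t) (v t)) \<le> dissipation_power T U B y0 R u v"
    and v: "v \<in> D" and t: "t \<in> {0..T}"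
  shows "blinfun_apply (force u t) v \<le> r (hist u t) v"
proof -
  note uc = H1_continuous[OF u]
  define h where "h t = r (hist u t) v - blinfun_apply (force u t) v" for t
  define c where "c t = max 0 (- h t)" for t
  have rc: "continuous_on {0..T} (\<lambda>t. r (hist u t) v)"
    by (rule r_history_continuous[OF hist_continuous[OF uc H1_weak_deriv[OF u]] v])
  have hc: "continuous_on {0..T} h"
    unfolding h_def by (intro continuous_intros rc force_continuous uc)
  have cc: "continuous_on {0..T} c" unfolding c_def by (intro continuous_intros hc)
  have c0: "c t \<ge> 0" for t by (simp add: c_def)
  have sq: "(\<lambda>t. c t *\<^sub>R v) \<in> sqint (leb T)" by (intro sqint_continuous continuous_intros cc)
  then have "(\<lambda>t. c t *\<^sub>R v) \<in> L2_in T D"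
    using D_scale[OF c0 v] by (simp add: L2_in_def Lp2_eq_sqint)
  note tst = test[OF this]
  have i: "integrable (leb T) (\<lambda>t. c t * r (hist u t) v)" "integrable (leb T) (\<lambda>t. c t * blinfun_apply (l t) v)"
    "integrable (leb T) (\<lambda>t. c t * blinfun_apply (fderiv U (u t)) v)"
    by (intro continuous_imp_integrable_real continuous_intros cc rc l_continuous fderiv_U_continuous uc)+
  have "(\<integral>\<^sup>+t. R (hist u t) (c t *\<^sub>R v) \<partial>leb T) = (\<integral>\<^sup>+t. ennreal (c t * r (hist u t) v) \<partial>leb T)"
    using R_scale[OF c0] R_eq[OF v] c0 by (intro nn_integral_cong) (metis enn2real_nonneg ennreal_mult)
  also have "\<dots> = ennreal (LINT t|leb T. c t * r (hist u t) v)"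
    using c0 by (intro nn_integral_eq_integral i) auto
  finally have "enn2ereal (\<integral>\<^sup>+t. R (hist u t) (c t *\<^sub>R v) \<partial>leb T) = ereal (LINT t|leb T. c t * r (hist u t) v)"
    using c0 by (simp add: enn2ereal_ennreal integral_nonneg_AE)
  with tst have "(LINT t|leb T. c t * blinfun_apply (l t) v) \<le>
      (LINT t|leb T. c t * r (hist u t) v) + (LINT t|leb T. c t * blinfun_apply (fderiv U (u t)) v)"
    by (simp add: dissipation_power_def blinfun.scaleR_right)
  then have "0 \<le> (LINT t|leb T. c t * r (hist u t) v + c t * blinfun_apply (fderiv U (u t)) v - c t * blinfun_apply (l t) v)"
    using i by simp
  \<comment> \<open>Either \<open>c t = 0\<close> or \<open>c t = - h t\<close>, so
    \<open>c t * h t\<close> is \<open>- (c t)^2\<close>, and the nonnegative integral forces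
    \<open>c\<close> to vanish.\<close>
  also have "(\<lambda>t. c t * r (hist u t) v + c t * blinfun_apply (fderiv U (u t)) v - c t * blinfun_apply (l t) v) = (\<lambda>t. - (c t)\<^sup>2)"
  proof
    fix t
    have "c t * r (hist u t) v + c t * blinfun_apply (fderiv U (u t)) v - c t * blinfun_apply (l t) v = c t * h t"
      by (simp add: h_def force_def blinfun.diff_left algebra_simps)
    also have "\<dots> = - (c t)\<^sup>2" by (auto simp: c_def max_def power2_eq_square)
    finally show "c t * r (hist u t) v + c t * blinfun_apply (fderiv U (u t)) v - c t * blinfun_apply (l t) v = - (c t)\<^sup>2" .
  qed
  finally have "(LINT t|leb T. (c t)\<^sup>2) \<le> 0" by simp
  moreover have ci: "continuous_on {0..T} (\<lambda>t. (c t)\<^sup>2)" by (intro continuous_intros cc)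
  ultimately have "integral {0..T} (\<lambda>t. (c t)\<^sup>2) \<le> 0"
    using leb_integral[OF continuous_imp_integrable_real[OF ci]] by simp
  moreover have "0 \<le> integral {0..T} (\<lambda>t. (c t)\<^sup>2)"
    by (intro Henstock_Kurzweil_Integration.integral_nonneg integrable_continuous_interval ci) simp
  ultimately have "integral {0..T} (\<lambda>t. (c t)\<^sup>2) = 0" by simp
  then have "(c t)\<^sup>2 = 0"
    using integral_eq_0_iff[OF ci T] t by simp
  then show ?thesis by (simp add: c_def h_def max_def split: if_splits)
qed

text \<open>
  The measurability hypothesis on \<open>R\<close> only covers functions with values in \<open>D\<close>. Since \<open>D\<close> is closed,
  the set of times at which the derivative lies in \<open>D\<close> is measurable, and \<open>R\<close> is infinite elsewhere.
\<close>

lemma dissipation_measurable: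
  assumes D: "closed D" and u: "u \<in> H1 T"
  shows "(\<lambda>t. R (hist u t) (wderiv T u t)) \<in> borel_measurable (leb T)"
proof -
  let ?g = "wderiv T u"
  have g: "strongly_measurable (leb T) ?g" by (rule sqint_strongly_measurable[OF wderiv_sqint[OF T u]])
  define A where "A = {t \<in> space (leb T). infdist (?g t) D = 0}"
  have D_iff_A: "?g t \<in> D \<longleftrightarrow> t \<in> A" if "t \<in> {0..T}" for t
    using in_closed_iff_infdist_zero[OF D, of "?g t"] D_zero that by (auto simp: A_def)
  have m: "(\<lambda>t. infdist (?g t) D) \<in> borel_measurable (leb T)"
    by (intro strongly_measurable_borel[OF complete_measure_leb] strongly_measurable_compose[OF g] continuous_intros)
  have "(\<lambda>t. infdist (?g t) D) -` {0} \<inter> space (leb T) \<in> sets (leb T)"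
    by (rule measurable_sets[OF m]) simp
  also have "(\<lambda>t. infdist (?g t) D) -` {0} \<inter> space (leb T) = A" by (auto simp: A_def)
  finally have A: "A \<in> sets (leb T)" .
  have "strongly_measurable (leb T) (\<lambda>t. indicat_real A t *\<^sub>R ?g t)"
    using A by (intro strongly_measurable_scaleR strongly_measurable_real borel_measurable_indicator g)
  moreover have "\<forall>t\<in>{0..T}. indicat_real A t *\<^sub>R ?g t \<in> D"
    using D_iff_A D_zero by (simp add: indicator_def)
  moreover have "strongly_measurable (leb T) (hist u)"
    by (intro strongly_measurable_continuous_on hist_continuous[OF H1_continuous[OF u] H1_weak_deriv[OF u]]) simp
  ultimately have m: "(\<lambda>t. R (hist u t) (indicat_real A t *\<^sub>R ?g t)) \<in> borel_measurable (leb T)"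
    using R_dissipation unfolding admissible_dissipation_def by blast
  have "(\<lambda>t. if t \<in> A then R (hist u t) (indicat_real A t *\<^sub>R ?g t) else \<infinity>) \<in> borel_measurable (leb T)"
    using A by (intro measurable_If_set m) auto
  then show ?thesis
  proof (rule measurable_cong[THEN iffD1, rotated])
    fix t assume "t \<in> space (leb T)"
    then show "(if t \<in> A then R (hist u t) (indicat_real A t *\<^sub>R ?g t) else \<infinity>) = R (hist u t) (?g t)"
      using D_iff_A[of t] D_iff[of "?g t" "hist u t"] by (auto simp: less_top[symmetric])
  qed
qed

text \<open>Finite dissipation puts the rate in \<open>D\<close> almost everywhere. There stability
  bounds the power of the force by \<open>r\<close>, while \<open>diss\<close> is the opposite
  inequality in integrated form, so both agree almost everywhere. The identity at the rate,
  subtracted from stability, is membership in the subdifferential.\<close>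

lemma evolution_solutionI:
  assumes D: "closed D" and u: "u \<in> H1 T" "u 0 = q0"
    and stab: "\<And>v t. v \<in> D \<Longrightarrow> t \<in> {0..T} \<Longrightarrow> blinfun_apply (force u t) v \<le> r (hist u t) v"
    and \<beta>: "\<beta> = (LINT t|leb T. blinfun_apply (force u t) (wderiv T u t))" "0 \<le> \<beta>"
    and diss: "(\<integral>\<^sup>+t. R (hist u t) (wderiv T u t) \<partial>leb T) \<le> ennreal \<beta>"
  shows "evolution_solution T U B y0 q0 R l u"
proof -
  let ?g = "wderiv T u"
  note m = dissipation_measurable[OF D u(1)]
  have "(\<integral>\<^sup>+t. R (hist u t) (?g t) \<partial>leb T) \<noteq> \<infinity>" using diss by (auto simp: top_unique)
  then have "AE t in leb T. R (hist u t) (?g t) \<noteq> \<infinity>" by (rule nn_integral_PInf_AE[OF m])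
  then have gD: "AE t in leb T. ?g t \<in> D"
  proof eventually_elim
    case (elim t)
    then show ?case using D_iff[of "?g t" "hist u t"] by (simp add: less_top)
  qed
  have fi: "integrable (leb T) (\<lambda>t. blinfun_apply (force u t) (?g t))"
    by (intro sqint_blinfun_integrable complete_measure_leb sqint_continuous force_continuous
        H1_continuous u wderiv_sqint T)
  have rm: "(\<lambda>t. r (hist u t) (?g t)) \<in> borel_measurable (leb T)" using m by simp
  have nn: "(\<integral>\<^sup>+t. ennreal (r (hist u t) (?g t)) \<partial>leb T) \<le> ennreal \<beta>"
  proof -
    have "(\<integral>\<^sup>+t. ennreal (r (hist u t) (?g t)) \<partial>leb T) = (\<integral>\<^sup>+t. R (hist u t) (?g t) \<partial>leb T)"
    proof (rule nn_integral_cong_AE)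
      show "AE t in leb T. ennreal (r (hist u t) (?g t)) = R (hist u t) (?g t)"
        using gD by eventually_elim (rule R_eq[symmetric])
    qed
    then show ?thesis using diss by simp
  qed
  have ri: "integrable (leb T) (\<lambda>t. r (hist u t) (?g t))"
    using rm nn by (intro integrableI_nonneg) (auto simp: top_unique less_top[symmetric])
  have "ennreal (LINT t|leb T. r (hist u t) (?g t)) \<le> ennreal \<beta>"
    using nn by (subst (asm) nn_integral_eq_integral[OF ri]) auto
  then have le: "(LINT t|leb T. r (hist u t) (?g t)) \<le> \<beta>" using \<beta>(2) by (simp add: ennreal_le_iff)
  have ge: "AE t in leb T. 0 \<le> r (hist u t) (?g t) - blinfun_apply (force u t) (?g t)"
    using gD AE_space by eventually_elim (use stab in auto)
  have "0 \<le> (LINT t|leb T. r (hist u t) (?g t) - blinfun_apply (force u t) (?g t))"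
    by (rule integral_nonneg_AE[OF ge])
  then have "(LINT t|leb T. r (hist u t) (?g t) - blinfun_apply (force u t) (?g t)) = 0"
    using le ri fi \<beta>(1) by simp
  then have "AE t in leb T. r (hist u t) (?g t) - blinfun_apply (force u t) (?g t) = 0"
    using integral_nonneg_eq_0_iff_AE[OF Bochner_Integration.integrable_diff[OF ri fi] ge] by simp
  then have "AE t in leb T. - fderiv (energy U l t) (u t) \<in> subdiff (R (hist u t)) (?g t)"
    using gD AE_space
  proof eventually_elim
    case (elim t)
    have f: "- fderiv (energy U l t) (u t) = force u t"
      by (simp add: fderiv_energy[OF C2_function_differentiable[OF U]] force_def)
    have fin: "R (hist u t) (?g t) < \<infinity>" using elim(2) D_iff by blast
    have "enn2ereal (R (hist u t) (?g t)) + ereal (blinfun_apply (force u t) (v - ?g t)) \<le> enn2ereal (R (hist u t) v)" for v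
    proof (cases "v \<in> D")
      case True
      then have "enn2ereal (R (hist u t) v) = ereal (r (hist u t) v)" using D_iff enn2ereal_finite by blast
      moreover have "enn2ereal (R (hist u t) (?g t)) = ereal (r (hist u t) (?g t))"
        by (rule enn2ereal_finite[OF fin])
      ultimately show ?thesis
        using stab[OF True, of t] elim by (simp add: blinfun.diff_right)
    next
      case False
      then have "R (hist u t) v = top" using D_iff[of v "hist u t"] by (simp add: less_top[symmetric])
      then show ?thesis by (simp add: top_ennreal.rep_eq)
    qed
    then show ?case unfolding f subdiff_def using fin by blast
  qed
  then show ?thesis using u by (simp add: evolution_solution_def)
qed

theorem evolution_solution_exists:
  assumes visc: "viscous_solvability T U B y0 q0 R"
    and conv: "convergence_condition T U B y0 q0 R D"
  shows "\<exists>q. evolution_solution T U B y0 q0 R l q"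
proof -
  obtain e0 where e0: "e0 > 0" and solv: "\<And>\<epsilon>. 0 < \<epsilon> \<Longrightarrow> \<epsilon> < e0 \<Longrightarrow>
      \<exists>q. evolution_solution T U B y0 q0 (viscous_dissipation \<epsilon> R) l q"
    using visc l_sqint unfolding viscous_solvability_def Lp2_eq_sqint by blast
  \<comment> \<open>The denominator starts at 2, which keeps \<open>\<epsilon> m\<close> strictly
    below \<open>e0\<close>.\<close>
  define \<epsilon> where "\<epsilon> m = e0 / real (Suc (Suc m))" for m
  have \<epsilon>_pos: "\<epsilon> m > 0" and \<epsilon>_lt: "\<epsilon> m < e0" for m
    using e0 by (auto simp: \<epsilon>_def divide_less_eq)
  have "\<epsilon> \<longlonglongrightarrow> 0"
    unfolding \<epsilon>_def by (intro LIMSEQ_Suc[of "\<lambda>m. e0 / real (Suc m)"] LIMSEQ_Suc[of "\<lambda>m. e0 / real m"] lim_const_over_n)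
  have "\<forall>m. \<exists>q. evolution_solution T U B y0 q0 (viscous_dissipation (\<epsilon> m) R) l q"
    using solv \<epsilon>_pos \<epsilon>_lt by blast
  then obtain q where q: "\<And>m. evolution_solution T U B y0 q0 (viscous_dissipation (\<epsilon> m) R) l (q m)"
    by metis
  have qH: "q m \<in> H1 T" "q m 0 = q0" for m using q by (auto simp: evolution_solution_def)
  obtain C where C: "\<And>m. L2_norm T (wderiv T (q m)) \<le> C"
    using viscous_estimate q \<epsilon>_pos by metis
  obtain \<rho> u where \<rho>: "strict_mono (\<rho> :: nat \<Rightarrow> nat)" and u: "u \<in> H1 T" "u 0 = q0"
    and wc: "weakly_converges (H1 T) (H1_norm T) (\<lambda>m. q (\<rho> m)) u"
    by (rule H1_weakly_convergent_subsequence[OF T qH C])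
  define y where "y m = q (\<rho> m)" for m
  define e where "e m = \<epsilon> (\<rho> m)" for m
  have e: "e m > 0" "e \<longlonglongrightarrow> 0" for m
    using \<epsilon>_pos LIMSEQ_subseq_LIMSEQ[OF \<open>\<epsilon> \<longlonglongrightarrow> 0\<close> \<rho>] by (auto simp: e_def[abs_def] o_def)
  have sol: "evolution_solution T U B y0 q0 (viscous_dissipation (e m) R) l (y m)" for m
    using q by (simp add: y_def e_def)
  have yH: "y m \<in> H1 T" "y m 0 = q0" for m using qH by (auto simp: y_def)
  have wy: "weakly_converges (H1 T) (H1_norm T) y u" using wc by (simp add: y_def[abs_def])
  have "AE t in leb T. wderiv T (y m) t \<in> D" for m
    using AE_good_times[OF e(1) sol[of m]] by eventually_elim (simp add: good_times_def)
  with conv wy yH(2) have closed: "closed D"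
    and C1: "liminf (\<lambda>m. \<integral>\<^sup>+t. R (hist (y m) t) (wderiv T (y m) t) \<partial>leb T) \<ge> (\<integral>\<^sup>+t. R (hist u t) (wderiv T u t) \<partial>leb T)"
    and C2: "\<And>v. v \<in> L2_in T D \<Longrightarrow> \<exists>vm. (\<forall>m. vm m \<in> L2_in T D) \<and> weakly_converges (Lp 2 T) (L2_norm T) vm v \<and>
           limsup (\<lambda>m. dissipation_power T U B y0 R (y m) (vm m)) \<le> dissipation_power T U B y0 R u v"
    unfolding convergence_condition_def by blast+
  have test: "ereal (LINT t|leb T. blinfun_apply (l t) (v t)) \<le> dissipation_power T U B y0 R u v"
    if v: "v \<in> L2_in T D" for v
  proof -
    obtain vm where vm: "\<And>m. vm m \<in> L2_in T D" "weakly_converges (Lp 2 T) (L2_norm T) vm v"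
      "limsup (\<lambda>m. dissipation_power T U B y0 R (y m) (vm m)) \<le> dissipation_power T U B y0 R u v"
      using C2[OF v] by blast
    obtain K where K: "\<And>m. L2_norm T (vm m) \<le> K" using L2_weakly_converges_bounded[OF vm(2)] by blast
    let ?a = "\<lambda>m. (LINT t|leb T. blinfun_apply (l t) (vm m t)) - e m * (LINT t|leb T. inner (wderiv T (y m) t) (vm m t))"
    \<comment> \<open>The rates are bounded by \<open>C\<close> independently of the viscosity and
      the recovery functions by \<open>K\<close> as a weakly convergent sequence, so the viscous
      term is of order \<open>e m\<close>.\<close>
    have "(\<lambda>m. e m * (LINT t|leb T. inner (wderiv T (y m) t) (vm m t))) \<longlonglongrightarrow> 0"
    proof (rule Lim_null_comparison)
      show "\<forall>\<^sub>F m in sequentially. norm (e m * (LINT t|leb T. inner (wderiv T (y m) t) (vm m t))) \<le> e m * (C * K)"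
      proof (intro always_eventually allI)
        fix m
        have vs: "vm m \<in> sqint (leb T)" using vm(1)[of m] by (simp add: L2_in_def Lp2_eq_sqint)
        have "\<bar>LINT t|leb T. inner (wderiv T (y m) t) (vm m t)\<bar> \<le> L2_norm T (wderiv T (y m)) * L2_norm T (vm m)"
          by (rule L2_inner_le[OF wderiv_sqint[OF T yH(1)] vs])
        also have "\<dots> \<le> C * K"
          using C[of "\<rho> m"] K[of m] order_trans[OF L2_norm_nonneg C] by (intro mult_mono) (auto simp: y_def L2_norm_nonneg)
        finally show "norm (e m * (LINT t|leb T. inner (wderiv T (y m) t) (vm m t))) \<le> e m * (C * K)"
          using e(1)[of m] by (simp add: abs_mult)
      qed
      show "(\<lambda>m. e m * (C * K)) \<longlonglongrightarrow> 0" using tendsto_mult_left_zero[OF e(2)] by simp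
    qed
    then have "?a \<longlonglongrightarrow> (LINT t|leb T. blinfun_apply (l t) (v t)) - 0"
      by (intro tendsto_diff weakly_converges_L2_pairing[OF l_sqint vm(2)])
    then have "(\<lambda>m. ereal (?a m)) \<longlonglongrightarrow> ereal (LINT t|leb T. blinfun_apply (l t) (v t))" by simp
    then have "ereal (LINT t|leb T. blinfun_apply (l t) (v t)) = limsup (\<lambda>m. ereal (?a m))"
      by (intro lim_imp_Limsup[symmetric]) auto
    also have "\<dots> \<le> limsup (\<lambda>m. dissipation_power T U B y0 R (y m) (vm m))"
      by (intro Limsup_mono always_eventually allI viscous_dissipation_power_lower_bound[OF e(1) sol vm(1)])
    finally show ?thesis using vm(3) by (rule order_trans)
  qed
  note stab = stability_pointwise[OF u(1) test]
  have "\<exists>a. (\<integral>\<^sup>+t. R (hist (y m) t) (wderiv T (y m) t) \<partial>leb T) = ennreal a \<and> 0 \<le> a \<and>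
      a \<le> (LINT t|leb T. blinfun_apply (l t) (wderiv T (y m) t)) - (U (y m T) - U q0)" for m
    using viscous_dissipation_upper_bound[OF e(1) sol[of m]] by blast
  then obtain a where a: "\<And>m. (\<integral>\<^sup>+t. R (hist (y m) t) (wderiv T (y m) t) \<partial>leb T) = ennreal (a m)" "\<And>m. 0 \<le> a m"
    "\<And>m. a m \<le> (LINT t|leb T. blinfun_apply (l t) (wderiv T (y m) t)) - (U (y m T) - U q0)"
    by metis
  let ?\<xi> = "fderiv U (u T)"
  \<comment> \<open>The energy at the end point is replaced by its tangent at \<open>u T\<close>.
    The pairing of \<open>?\<xi>\<close> with the end point is an integral against the rate, so
    \<open>b\<close> is affine in the rate and converges under weak convergence.\<close>
  define b where "b m = (LINT t|leb T. blinfun_apply (l t) (wderiv T (y m) t)) - (LINT t|leb T. blinfun_apply ?\<xi> (wderiv T (y m) t))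
      + (LINT t|leb T. blinfun_apply ?\<xi> (wderiv T u t)) - (U (u T) - U q0)" for m
  define \<beta> where "\<beta> = (LINT t|leb T. blinfun_apply (l t) (wderiv T u t)) - (U (u T) - U q0)"
  have const: "(\<lambda>t. ?\<xi>) \<in> sqint (leb T)" by (intro sqint_continuous continuous_intros)
  have end_value: "blinfun_apply ?\<xi> (z T) - blinfun_apply ?\<xi> q0 = (LINT t|leb T. blinfun_apply ?\<xi> (wderiv T z t))"
    if z: "z \<in> H1 T" "z 0 = q0" for z
    using weak_deriv_functional[OF T H1_continuous[OF z(1)] H1_weak_deriv[OF z(1)] blinfun.bounded_linear_right, of T ?\<xi>]
      leb_integral[OF sqint_blinfun_integrable[OF complete_measure_leb const wderiv_sqint[OF T z(1)]]] T z(2) by simp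
  have ab: "a m \<le> b m" for m
  proof -
    have "U (u T) + blinfun_apply ?\<xi> (y m T - u T) + \<alpha> / 2 * (norm (y m T - u T))\<^sup>2 \<le> U (y m T)"
      by (rule strongly_convex_first_order[OF C2_function_differentiable[OF U] convex_U])
    moreover have "0 \<le> \<alpha> / 2 * (norm (y m T - u T))\<^sup>2" using \<alpha> by simp
    moreover have "blinfun_apply ?\<xi> (y m T - u T) =
        (LINT t|leb T. blinfun_apply ?\<xi> (wderiv T (y m) t)) - (LINT t|leb T. blinfun_apply ?\<xi> (wderiv T u t))"
      using end_value[OF yH(1) yH(2), of m] end_value[OF u] unfolding blinfun.diff_right by linarith
    ultimately show ?thesis using a(3)[of m] unfolding b_def by linarith
  qed
  have "b \<longlonglongrightarrow> (LINT t|leb T. blinfun_apply (l t) (wderiv T u t)) - (LINT t|leb T. blinfun_apply ?\<xi> (wderiv T u t))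
      + (LINT t|leb T. blinfun_apply ?\<xi> (wderiv T u t)) - (U (u T) - U q0)"
    unfolding b_def by (intro tendsto_intros weakly_converges_H1_pairing[OF T _ wy] l_sqint const)
  then have b_lim: "b \<longlonglongrightarrow> \<beta>" by (simp add: \<beta>_def)
  have "0 \<le> b m" for m using a(2)[of m] ab[of m] by linarith
  \<comment> \<open>The sign matters because \<open>ennreal \<beta>\<close> would otherwise be 0,
    and the bound on the dissipation would no longer bound it by \<open>\<beta>\<close>.\<close>
  then have \<beta>0: "0 \<le> \<beta>" using b_lim by (intro LIMSEQ_le_const) auto
  have diss: "(\<integral>\<^sup>+t. R (hist u t) (wderiv T u t) \<partial>leb T) \<le> ennreal \<beta>"
  proof -
    have "(\<integral>\<^sup>+t. R (hist u t) (wderiv T u t) \<partial>leb T) \<le> liminf (\<lambda>m. ennreal (a m))"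
      using C1 by (simp add: a(1))
    also have "\<dots> \<le> liminf (\<lambda>m. ennreal (b m))"
      by (intro Liminf_mono always_eventually allI ennreal_leI ab)
    also have "\<dots> = ennreal \<beta>"
      using b_lim by (intro lim_imp_Liminf tendsto_ennrealI) auto
    finally show ?thesis .
  qed
  have \<beta>_eq: "\<beta> = (LINT t|leb T. blinfun_apply (force u t) (wderiv T u t))"
  proof -
    note i = sqint_blinfun_integrable[OF complete_measure_leb _ wderiv_sqint[OF T u(1)]]
    note iU = i[OF sqint_continuous[OF fderiv_U_continuous[OF H1_continuous[OF u(1)]]]]
    have "U (u T) - U q0 = (LINT t|leb T. blinfun_apply (fderiv U (u t)) (wderiv T u t))"
      using chain_rule[OF T U H1_continuous[OF u(1)] H1_weak_deriv[OF u(1)]] leb_integral[OF iU] u(2) by simp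
    then show ?thesis
      using i[OF l_sqint] iU by (simp add: \<beta>_def force_def blinfun.diff_left)
  qed
  have "evolution_solution T U B y0 q0 R l u"
    by (rule evolution_solutionI[OF closed u stab \<beta>_eq \<beta>0 diss])
  then show ?thesis by blast
qed

end

theorem theorem4p4:
  fixes T :: real
    and q0 :: "'y::{real_inner, complete_space}"
    and y0 :: "'x::banach"
    and U :: "'y \<Rightarrow> real"
    and B :: "real \<Rightarrow> 'y \<Rightarrow> 'x"
    and R :: "'x \<Rightarrow> 'y \<Rightarrow> ennreal"
    and D :: "'y set"
    and l :: "real \<Rightarrow> 'y \<Rightarrow>\<^sub>L real"
  assumes "T > 0"
    and "admissible_energy U"
    and "admissible_kernel T B"
    and "admissible_dissipation T R D"
    and "viscous_solvability T U B y0 q0 R"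
    and "convergence_condition T U B y0 q0 R D"
    and "l \<in> H1 T \<inter> compatible_loads T U R q0 y0"
  shows "\<exists>q. evolution_solution T U B y0 q0 R l q"
proof -
  obtain \<alpha> where \<alpha>: "C2_function U" "\<alpha> > 0" "\<forall>y1 y2. \<forall>\<theta>\<in>{0..1}.
        (1 - \<theta>) * U y1 + \<theta> * U y2 \<ge>
          U ((1 - \<theta>) *\<^sub>R y1 + \<theta> *\<^sub>R y2) + \<alpha> / 2 * \<theta> * (1 - \<theta>) * (norm (y2 - y1))\<^sup>2"
    using assms(2) unfolding admissible_energy_def by blast
  obtain \<Lambda> where \<Lambda>: "\<And>t. t \<in> {0..T} \<Longrightarrow> \<Lambda>-lipschitz_on UNIV (B t)" "\<And>y. continuous_on {0..T} (\<lambda>t. B t y)"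
    using admissible_kernel_lipschitz[OF assms(1,3)] by blast
  obtain L where L: "L \<ge> 0" "\<forall>\<zeta>1 \<zeta>2. \<forall>\<eta>1\<in>D. \<forall>\<eta>2\<in>D.
          enn2real (R \<zeta>1 \<eta>2) - enn2real (R \<zeta>1 \<eta>1) + enn2real (R \<zeta>2 \<eta>1) - enn2real (R \<zeta>2 \<eta>2)
            \<le> L * norm (\<zeta>1 - \<zeta>2) * norm (\<eta>1 - \<eta>2)"
    using assms(4) unfolding admissible_dissipation_def by blast
  interpret rate_independent T q0 y0 U B R D l \<alpha> \<Lambda> L
    using assms \<alpha> \<Lambda> L by unfold_locales auto
  show ?thesis by (rule evolution_solution_exists[OF assms(5,6)])
qed

end
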